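(* Let $V$ be a unitary operator on $\mathscr{H}_1$, $X_\mu=\Gamma(V^{-1})P_\mu\Gamma(V)$, and $\theta$ a real $d\times d$ matrix skew-symmetric with respect to the Lorentzian scalar product. Let $\xi\in\mathcal{V}$ with $\|\xi\|_{\mathcal{V}}=1$ and let the unitary operator $\widetilde V_{X,\xi}=\bigoplus_{n=0}^\infty\widetilde V^{(n)}_{X,\xi}:\mathscr{H}\to\mathcal{V}\otimes\mathscr{H}$ be given by unitary equivalence to $V_{P,\xi}$ as $$\widetilde V_{X,\xi}=(1_{\mathcal{V}}\otimes\Gamma(V^{-1}))\,V_{P,\xi}\,\Gamma(V).$$ Then $\widetilde V_{X,\xi}$ is (by its adjoint action $A\mapsto\widetilde V_{X,\xi}A\widetilde V_{X,\xi}^*$) an isomorphism of the $*$-algebra generated by the deformed fields $\phi_{\theta,X}(f)$, $f\in\mathscr{S}(\mathbb{R}^d)$, onto the unitarily equivalent $*$-algebra of the unitarily transformed fields on the Moyal–Weyl space, generated by $$(1_{\mathcal{V}}\otimes\Gamma(V^{-1}))\,\phi_{\otimes,P}(Vf)\,(1_{\mathcal{V}}\otimes\Gamma(V)) .$$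
   Context: Let $d\ge 2$, $m>0$, and use the Minkowski product $xy=x_0y_0-\sum_{j=1}^{d-1}x_jy_j$ on $\mathbb{R}^d$. Put $\omega_{\mathbf p}=\sqrt{\mathbf p^2+m^2}$, $d\mu(\mathbf p)=(2\omega_{\mathbf p})^{-1}d^{d-1}\mathbf p$, $\mathscr{H}_1=L^2(\mathbb{R}^{d-1},d\mu)$, and let $\mathscr{H}=\bigoplus_n\mathscr{H}_n$ be the Boson Fock space over $\mathscr{H}_1$. $P_\mu$ is the second quantization of multiplication by $p_\mu$, $p=(\omega_{\mathbf p},\mathbf p)$, $\Gamma(V)=\bigoplus_{k\ge0}V^{\otimes k}$, $V_X(p)=e^{ip_\mu X^\mu}$. The free field is $\phi(f)=a(\overline{f^-})+a^*(f^+)$ with $f^\pm(\mathbf p)=\int dx\,f(x)e^{\pm ipx}$, $p=(\omega_{\mathbf p},\mathbf p)$; $a^*(h)=\int d\mu(\mathbf p)h(\mathbf p)a^*(\mathbf p)$, $a(h)=\int d\mu(\mathbf p)\overline{h(\mathbf p)}a(\mathbf p)$. The deformed field is the oscillatory integral $$\phi_{\theta,X}(f)\Psi=(2\pi)^{-d}\lim_{\epsilon\to0}\iint dx\,dy\,e^{-ixy}\chi(\epsilon x,\epsilon y)\,V_X(\theta x)\phi(f) V_X(-\theta x)\,V_X(y)\Psi,$$ $\chi\in\mathscr{S}(\mathbb{R}^d\times\mathbb{R}^d)$, $\chi(0,0)=1$, for $\Psi\in\Gamma(V^{-1})\bigotimes_{i=1}^k\Delta(P)$ (symmetric part understood), with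 $\Delta(P)=\{f\in\mathscr{H}_1:|(\mathbf p^2)^rf(\mathbf p)|\le c_r(f)<\infty,\ r=0,1,2,\dots\}$, extended by continuity to finite particle vectors. Moyal–Weyl space: $\mathcal{V}$ is the representation (Hilbert) space of the $*$-algebra generated by self-adjoint operators $\hat x_\mu$ with $[\hat x_\mu,\hat x_\nu]=-2i\theta_{\mu\nu}$ (in Weyl form). The operator $V_{P,\xi}=\bigoplus_nV^{(n)}_{P,\xi}:\mathscr{H}\to\mathcal{V}\otimes\mathscr{H}$ is $$(V^{(n)}_{P,\xi}\Psi_n)(\mathbf p_1,\dots,\mathbf p_n)=\Psi_n(\mathbf p_1,\dots,\mathbf p_n)\,e^{i\sum_{k=1}^np_k\hat x}\xi,\qquad\Psi_n\in\mathscr{H}_n,$$ with $p_k=(\omega_{\mathbf p_k},\mathbf p_k)$; it is unitary onto its range, and operators on $\mathcal{V}\otimes\mathscr{H}$ in the statement are understood on the range of $\widetilde V_{X,\xi}$. The free fields on the Moyal–Weyl space are, in the sense of distributions, obtained from $a_{\otimes,P}(\mathbf p)=e^{-ip\hat x}\otimes a(\mathbf p)$ and its adjoint $a^*_{\otimes,P}(\mathbf p)=e^{ip\hat x}\otimes a^*(\mathbf p)$: $$\phi_{\otimes,P}(f)=\int d\mu(\mathbf p)\,\bigl(f^-(\mathbf p)\,a_{\otimes,P}(\mathbf p)+f^+(\mathbf p)\,a_{\otimes,P}^*(\mathbf p)\bigr),$$ and $\phi_{\otimes,P}(Vf)$ is the same expression with $f^+$ replaced by $Vf^+$ and $f^-$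 replaced by $\overline{V\,\overline{f^-}}$, matching $\phi(Vf):=\Gamma(V)\phi(f)\Gamma(V^{-1})$. *)

theory Defs
  imports "HOL-Analysis.Analysis"
begin

section \<open>Complex Hilbert spaces\<close>

class cvector = ab_group_add +
  fixes cscale :: "complex \<Rightarrow> 'a \<Rightarrow> 'a" (infixr "*\<^sub>C" 75)
  assumes cscale_add_right: "c *\<^sub>C (x + y) = c *\<^sub>C x + c *\<^sub>C y"
    and cscale_add_left: "(c + d) *\<^sub>C x = c *\<^sub>C x + d *\<^sub>C x"
    and cscale_cscale: "c *\<^sub>C (d *\<^sub>C x) = (c * d) *\<^sub>C x"
    and cscale_one: "1 *\<^sub>C x = x"

text \<open>The inner product is antilinear in its first argument.\<close>

class chilbert = cvector + banach +
  fixes cinner :: "'a \<Rightarrow> 'a \<Rightarrow> complex"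
  assumes scaleR_cscale: "r *\<^sub>R x = complex_of_real r *\<^sub>C x"
    and cinner_commute: "cinner x y = cnj (cinner y x)"
    and cinner_add_right: "cinner x (y + z) = cinner x y + cinner x z"
    and cinner_cscale_right: "cinner x (c *\<^sub>C y) = c * cinner x y"
    and cinner_norm: "cinner x x = complex_of_real ((norm x)\<^sup>2)"

instantiation complex :: chilbert
begin

definition cscale_complex :: "complex \<Rightarrow> complex \<Rightarrow> complex"
  where "cscale_complex c x = c * x"

definition cinner_complex :: "complex \<Rightarrow> complex \<Rightarrow> complex"
  where "cinner_complex x y = cnj x * y"

instance
  by standard
    (auto simp: cscale_complex_def cinner_complex_def algebra_simps scaleR_conv_of_real
      complex_norm_square[symmetric])

end

text \<open>
  Function spaces depend on the mass, which is a term, so Hilbert spaces are carriers with an inner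
  product inside a type of vectors.
\<close>

record 'a hilb =
  hcarrier :: "'a set"
  hip :: "'a \<Rightarrow> 'a \<Rightarrow> complex"

definition whole :: "'v::chilbert hilb"
  where "whole = \<lparr>hcarrier = UNIV, hip = cinner\<rparr>"

definition hnorm :: "'a hilb \<Rightarrow> 'a \<Rightarrow> real"
  where "hnorm H u = sqrt (Re (hip H u u))"

definition linear_on :: "'a::cvector set \<Rightarrow> ('a \<Rightarrow> 'b::cvector) \<Rightarrow> bool"
  where "linear_on S T \<longleftrightarrow>
    (\<forall>u\<in>S. \<forall>v\<in>S. T (u + v) = T u + T v) \<and> (\<forall>c. \<forall>u\<in>S. T (c *\<^sub>C u) = c *\<^sub>C T u)"

definition cspan :: "'a::cvector set \<Rightarrow> 'a set"
  where "cspan S = {\<Sum>a\<in>F. c a *\<^sub>C a | F c. finite F \<and> F \<subseteq> S}"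

definition unitary_op :: "'a::cvector hilb \<Rightarrow> 'b::cvector hilb \<Rightarrow> ('a \<Rightarrow> 'b) \<Rightarrow> bool"
  where "unitary_op H K U \<longleftrightarrow>
    bij_betw U (hcarrier H) (hcarrier K) \<and> linear_on (hcarrier H) U \<and>
    (\<forall>u\<in>hcarrier H. \<forall>v\<in>hcarrier H. hip K (U u) (U v) = hip H u v)"

definition bounded_op :: "'a::cvector hilb \<Rightarrow> 'b::cvector hilb \<Rightarrow> ('a \<Rightarrow> 'b) \<Rightarrow> bool"
  where "bounded_op H K T \<longleftrightarrow>
    T \<in> hcarrier H \<rightarrow>\<^sub>E hcarrier K \<and> linear_on (hcarrier H) T \<and>
    (\<exists>C. \<forall>u\<in>hcarrier H. hnorm K (T u) \<le> C * hnorm H u)"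

definition adjoint_op :: "'a hilb \<Rightarrow> 'b hilb \<Rightarrow> ('a \<Rightarrow> 'b) \<Rightarrow> 'b \<Rightarrow> 'a"
  where "adjoint_op H K T w =
    (THE u. u \<in> hcarrier H \<and> (\<forall>v\<in>hcarrier H. hip H v u = hip K (T v) w))"

text \<open>Unbounded operators are given by their graphs.\<close>

definition self_adjoint :: "'a::cvector hilb \<Rightarrow> ('a \<times> 'a) set \<Rightarrow> bool"
  where "self_adjoint H A \<longleftrightarrow>
    A \<subseteq> hcarrier H \<times> hcarrier H \<and>
    (\<forall>u\<in>hcarrier H. \<forall>e>0. \<exists>v\<in>Domain A. hnorm H (u - v) < e) \<and>
    (\<forall>v\<in>hcarrier H. \<forall>w\<in>hcarrier H.
      (v, w) \<in> A \<longleftrightarrow> (\<forall>(u, u')\<in>A. hip H u' v = hip H u w))"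

definition graph_closure :: "'a::cvector hilb \<Rightarrow> ('a \<times> 'a) set \<Rightarrow> ('a \<times> 'a) set"
  where "graph_closure H A =
    {(u, w). u \<in> hcarrier H \<and> w \<in> hcarrier H \<and>
      (\<exists>s. (\<forall>n. s n \<in> A) \<and> (\<lambda>n. hnorm H (fst (s n) - u)) \<longlonglongrightarrow> 0 \<and>
           (\<lambda>n. hnorm H (snd (s n) - w)) \<longlonglongrightarrow> 0)}"

text \<open>The combination of the operators \<open>A \<mu>\<close>, on the intersection of their domains.\<close>

definition lin_comb :: "('i::finite \<Rightarrow> real) \<Rightarrow> ('i \<Rightarrow> ('a::cvector \<times> 'a) set) \<Rightarrow> ('a \<times> 'a) set"
  where "lin_comb c A =
    {(u, \<Sum>\<mu>\<in>UNIV. complex_of_real (c \<mu>) *\<^sub>C w \<mu>) | u w. \<forall>\<mu>. (u, w \<mu>) \<in> A \<mu>}"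

definition unitary_group :: "'a::cvector hilb \<Rightarrow> (real \<Rightarrow> 'a \<Rightarrow> 'a) \<Rightarrow> bool"
  where "unitary_group H U \<longleftrightarrow>
    (\<forall>t. unitary_op H H (U t)) \<and>
    (\<forall>s t. \<forall>u\<in>hcarrier H. U (s + t) u = U s (U t u)) \<and>
    (\<forall>u\<in>hcarrier H. ((\<lambda>t. hnorm H (U t u - u)) \<longlongrightarrow> 0) (at 0))"

definition generator :: "'a::cvector hilb \<Rightarrow> (real \<Rightarrow> 'a \<Rightarrow> 'a) \<Rightarrow> ('a \<times> 'a) set"
  where "generator H U =
    {(u, w). u \<in> hcarrier H \<and> w \<in> hcarrier H \<and>
      ((\<lambda>t. hnorm H ((1 / (\<i> * complex_of_real t)) *\<^sub>C (U t u - u) - w)) \<longlongrightarrow> 0) (at 0)}"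

text \<open>
  \<open>U t = exp (i t A)\<close> for self-adjoint \<open>A\<close>, by Stone's theorem: \<open>U\<close> is the strongly continuous
  unitary group with generator \<open>A\<close>.
\<close>

definition exp_group :: "'a::cvector hilb \<Rightarrow> ('a \<times> 'a) set \<Rightarrow> (real \<Rightarrow> 'a \<Rightarrow> 'a) \<Rightarrow> bool"
  where "exp_group H A U \<longleftrightarrow> unitary_group H U \<and> generator H U = A"

definition expi :: "'a::cvector hilb \<Rightarrow> ('a \<times> 'a) set \<Rightarrow> 'a \<Rightarrow> 'a"
  where "expi H A = (THE T. \<exists>U. exp_group H A U \<and> T = restrict (U 1) (hcarrier H))"


section \<open>Star algebras of operators on an invariant domain\<close>

text \<open>
  The elements are linear maps of a domain \<open>D\<close> into itself; the star operation is the Hilbert space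
  adjoint restricted to \<open>D\<close>.
\<close>

definition is_adj :: "'a hilb \<Rightarrow> 'a set \<Rightarrow> ('a \<Rightarrow> 'a) \<Rightarrow> ('a \<Rightarrow> 'a) \<Rightarrow> bool"
  where "is_adj H D A B \<longleftrightarrow>
    B \<in> D \<rightarrow>\<^sub>E D \<and> (\<forall>u\<in>D. \<forall>v\<in>D. hip H (A u) v = hip H u (B v))"

inductive_set star_alg :: "'a::cvector hilb \<Rightarrow> 'a set \<Rightarrow> ('a \<Rightarrow> 'a) set \<Rightarrow> ('a \<Rightarrow> 'a) set"
  for H D G where
  gen: "A \<in> G \<Longrightarrow> A \<in> star_alg H D G"
| one: "(\<lambda>u\<in>D. u) \<in> star_alg H D G"
| add: "A \<in> star_alg H D G \<Longrightarrow> B \<in> star_alg H D G \<Longrightarrow> (\<lambda>u\<in>D. A u + B u) \<in> star_alg H D G"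
| scale: "A \<in> star_alg H D G \<Longrightarrow> (\<lambda>u\<in>D. c *\<^sub>C A u) \<in> star_alg H D G"
| mult: "A \<in> star_alg H D G \<Longrightarrow> B \<in> star_alg H D G \<Longrightarrow> compose D A B \<in> star_alg H D G"
| adj: "A \<in> star_alg H D G \<Longrightarrow> is_adj H D A B \<Longrightarrow> B \<in> star_alg H D G"

definition is_star_algebra :: "'a::cvector hilb \<Rightarrow> 'a set \<Rightarrow> ('a \<Rightarrow> 'a) set \<Rightarrow> bool"
  where "is_star_algebra H D \<A> \<longleftrightarrow>
    \<A> \<subseteq> {A. A \<in> D \<rightarrow>\<^sub>E D \<and> linear_on D A} \<and>
    (\<lambda>u\<in>D. u) \<in> \<A> \<and>
    (\<forall>A\<in>\<A>. \<forall>B\<in>\<A>. (\<lambda>u\<in>D. A u + B u) \<in> \<A> \<and> compose D A B \<in> \<A>) \<and>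
    (\<forall>c. \<forall>A\<in>\<A>. (\<lambda>u\<in>D. c *\<^sub>C A u) \<in> \<A>) \<and>
    (\<forall>A\<in>\<A>. \<exists>!B. is_adj H D A B) \<and>
    (\<forall>A\<in>\<A>. \<forall>B. is_adj H D A B \<longrightarrow> B \<in> \<A>)"

definition star_iso :: "'a::cvector hilb \<Rightarrow> 'a set \<Rightarrow> ('a \<Rightarrow> 'a) set \<Rightarrow>
    'b::cvector hilb \<Rightarrow> 'b set \<Rightarrow> ('b \<Rightarrow> 'b) set \<Rightarrow> (('a \<Rightarrow> 'a) \<Rightarrow> ('b \<Rightarrow> 'b)) \<Rightarrow> bool"
  where "star_iso H D \<A> K E \<B> \<alpha> \<longleftrightarrow>
    is_star_algebra H D \<A> \<and> is_star_algebra K E \<B> \<and>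
    bij_betw \<alpha> \<A> \<B> \<and>
    \<alpha> (\<lambda>u\<in>D. u) = (\<lambda>w\<in>E. w) \<and>
    (\<forall>A\<in>\<A>. \<forall>B\<in>\<A>. \<alpha> (\<lambda>u\<in>D. A u + B u) = (\<lambda>w\<in>E. \<alpha> A w + \<alpha> B w)) \<and>
    (\<forall>c. \<forall>A\<in>\<A>. \<alpha> (\<lambda>u\<in>D. c *\<^sub>C A u) = (\<lambda>w\<in>E. c *\<^sub>C \<alpha> A w)) \<and>
    (\<forall>A\<in>\<A>. \<forall>B\<in>\<A>. \<alpha> (compose D A B) = compose E (\<alpha> A) (\<alpha> B)) \<and>
    (\<forall>A\<in>\<A>. \<forall>B\<in>\<A>. is_adj H D A B \<longrightarrow> is_adj K E (\<alpha> A) (\<alpha> B))"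


section \<open>Square-integrable functions up to null sets\<close>

text \<open>
  The direct sum over \<open>n\<close> of the product measures on \<open>n\<close>-tuples, with tuples written as lists.
\<close>

definition list_measure :: "'a measure \<Rightarrow> 'a list measure"
  where "list_measure M = measure_of (lists (space M))
    {A. A \<subseteq> lists (space M) \<and>
      (\<forall>n. {x \<in> space (\<Pi>\<^sub>M i\<in>{..<n}. M). map x [0..<n] \<in> A} \<in> sets (\<Pi>\<^sub>M i\<in>{..<n}. M))}
    (\<lambda>A. \<Sum>n. emeasure (\<Pi>\<^sub>M i\<in>{..<n}. M) {x \<in> space (\<Pi>\<^sub>M i\<in>{..<n}. M). map x [0..<n] \<in> A})"

text \<open>
  A reference measure on momentum space and on lists of momenta. It only serves to identify functions
  that agree almost everywhere, and has the same null sets as the mass shell measure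
  \<open>mu m\<close> (respectively \<open>list_measure (mu m)\<close>) defined below, for every \<open>m > 0\<close>.
\<close>

class vol =
  fixes vol :: "'a measure"

instantiation vec :: (euclidean_space, finite) vol
begin
definition vol_vec :: "('a, 'b) vec measure" where "vol_vec = lborel"
instance ..
end

instantiation list :: (vol) vol
begin
definition vol_list :: "'a list measure" where "vol_list = list_measure vol"
instance ..
end

quotient_type (overloaded) ('a, 'v) aefun = "'a::vol \<Rightarrow> 'v" /
  "\<lambda>f g. AE x in (vol :: 'a measure). f x = g x"
  morphisms rep_aefun mk
proof (rule equivpI)
  show "reflp (\<lambda>f g. AE x in (vol :: 'a measure). (f x :: 'v) = g x)"
    by (simp add: reflp_def)
  show "symp (\<lambda>f g. AE x in (vol :: 'a measure). (f x :: 'v) = g x)"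
    by (simp add: symp_def eq_commute)
  show "transp (\<lambda>f g. AE x in (vol :: 'a measure). (f x :: 'v) = g x)"
  proof (rule transpI)
    fix f g h :: "'a \<Rightarrow> 'v"
    assume "AE x in vol. f x = g x" and "AE x in vol. g x = h x"
    then show "AE x in vol. f x = h x" by eventually_elim simp
  qed
qed

instantiation aefun :: (vol, cvector) cvector
begin

lift_definition zero_aefun :: "('a, 'b) aefun" is "\<lambda>_. 0" .

lift_definition plus_aefun :: "('a, 'b) aefun \<Rightarrow> ('a, 'b) aefun \<Rightarrow> ('a, 'b) aefun"
  is "\<lambda>f g x. f x + g x"
  by (erule (1) eventually_elim2) simp

lift_definition minus_aefun :: "('a, 'b) aefun \<Rightarrow> ('a, 'b) aefun \<Rightarrow> ('a, 'b) aefun"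
  is "\<lambda>f g x. f x - g x"
  by (erule (1) eventually_elim2) simp

lift_definition uminus_aefun :: "('a, 'b) aefun \<Rightarrow> ('a, 'b) aefun"
  is "\<lambda>f x. - f x"
  by (erule eventually_mono) simp

lift_definition cscale_aefun :: "complex \<Rightarrow> ('a, 'b) aefun \<Rightarrow> ('a, 'b) aefun"
  is "\<lambda>c f x. c *\<^sub>C f x"
  by (erule eventually_mono) simp

instance
  by standard
    (transfer; simp add: algebra_simps cscale_add_right cscale_add_left cscale_cscale cscale_one)+

end

text \<open>
  Strong (Bochner) measurability; it agrees with Borel measurability when \<open>'v\<close> is separable.
\<close>

definition strongly_measurable :: "'a measure \<Rightarrow> ('a \<Rightarrow> 'v::chilbert) \<Rightarrow> bool"
  where "strongly_measurable M f \<longleftrightarrow>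
    f \<in> borel_measurable M \<and> (\<exists>C. countable C \<and> (\<forall>x\<in>space M. f x \<in> closure C))"

text \<open>
  A measurable representative; an arbitrary one need not be Borel measurable, and the Lebesgue
  integral of a non-measurable function is \<open>0\<close>.
\<close>

definition repr :: "('a::vol, 'v::chilbert) aefun \<Rightarrow> 'a \<Rightarrow> 'v"
  where "repr \<Psi> = (SOME f. strongly_measurable vol f \<and> mk f = \<Psi>)"

definition square_integrable :: "'a::vol measure \<Rightarrow> ('a \<Rightarrow> 'v::chilbert) \<Rightarrow> bool"
  where "square_integrable M f \<longleftrightarrow>
    strongly_measurable vol f \<and> (\<integral>\<^sup>+ x. ennreal ((norm (f x))\<^sup>2) \<partial>M) < \<infinity>"

definition L2 :: "'a::vol measure \<Rightarrow> ('a, 'v::chilbert) aefun hilb"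
  where "L2 M = \<lparr>
    hcarrier = {mk f | f. square_integrable M f},
    hip = (\<lambda>\<Psi> \<Phi>. \<integral>x. cinner (repr \<Psi> x) (repr \<Phi> x) \<partial>M)\<rparr>"

definition aconj :: "('a::vol, complex) aefun \<Rightarrow> ('a, complex) aefun"
  where "aconj h = mk (\<lambda>x. cnj (repr h x))"

text \<open>Weak integral of a Hilbert space valued function.\<close>

definition weak_integral :: "'a measure \<Rightarrow> ('a \<Rightarrow> 'v::chilbert) \<Rightarrow> 'v"
  where "weak_integral M g = (THE w. \<forall>v. cinner v w = (\<integral>x. cinner v (g x) \<partial>M))"


section \<open>Minkowski space\<close>

text \<open>
  Space has dimension \<open>d - 1 = CARD('s)\<close> and space-time vectors are indexed by \<open>'s option\<close>, with
  \<open>None\<close> the time index; so \<open>d \<ge> 2\<close>.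
\<close>

type_synonym 's spacetime = "real ^ ('s option)"

definition eta :: "'s option \<Rightarrow> real"
  where "eta \<mu> = (case \<mu> of None \<Rightarrow> 1 | Some j \<Rightarrow> - 1)"

definition mink :: "'s::finite spacetime \<Rightarrow> 's spacetime \<Rightarrow> real"
  where "mink x y = x $ None * y $ None - (\<Sum>j\<in>UNIV. x $ Some j * y $ Some j)"

definition lorentz_skew :: "real ^ ('s::finite option) ^ ('s option) \<Rightarrow> bool"
  where "lorentz_skew \<theta> \<longleftrightarrow> (\<forall>x y. mink x (\<theta> *v y) = - mink (\<theta> *v x) y)"

definition omega :: "real \<Rightarrow> real ^ 's::finite \<Rightarrow> real"
  where "omega m p = sqrt ((norm p)\<^sup>2 + m\<^sup>2)"

definition onshell :: "real \<Rightarrow> real ^ 's::finite \<Rightarrow> 's spacetime"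
  where "onshell m p = (\<chi> \<mu>. case \<mu> of None \<Rightarrow> omega m p | Some j \<Rightarrow> p $ j)"

definition total_momentum :: "real \<Rightarrow> (real ^ 's::finite) list \<Rightarrow> 's spacetime"
  where "total_momentum m ps = (\<Sum>p\<leftarrow>ps. onshell m p)"

definition mu :: "real \<Rightarrow> (real ^ 's::finite) measure"
  where "mu m = density lborel (\<lambda>p. ennreal (1 / (2 * omega m p)))"

text \<open>
  \<open>D bs\<close> is the iterated partial derivative of \<open>f\<close> in the directions \<open>bs\<close>.
\<close>

definition schwartz :: "('a::euclidean_space \<Rightarrow> complex) \<Rightarrow> bool"
  where "schwartz f \<longleftrightarrow>
    (\<exists>D. D [] = f \<and>
      (\<forall>bs\<in>lists Basis. \<forall>x.
        (D bs has_derivative (\<lambda>h. \<Sum>b\<in>Basis. (h \<bullet> b) *\<^sub>R D (b # bs) x)) (at x)) \<and>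
      (\<forall>bs\<in>lists Basis. \<forall>N. \<exists>C. \<forall>x. (1 + norm x) ^ N * norm (D bs x) \<le> C))"


section \<open>Fock space\<close>

definition one_particle :: "real \<Rightarrow> (real ^ 's::finite, complex) aefun hilb"
  where "one_particle m = L2 (mu m)"

text \<open>
  The full Fock space is the direct sum over \<open>n\<close> of the square-integrable functions of \<open>n\<close> momenta,
  and the Boson Fock space its symmetric part. For \<open>'v = complex\<close> this is the usual Fock space
  \<open>\<H>\<close>; for a Hilbert space \<open>'v\<close>, \<open>fock m\<close> is the Hilbert tensor product of
  \<open>'v\<close> with \<open>\<H>\<close>, realised as \<open>'v\<close>-valued symmetric functions.
\<close>

definition full_fock :: "real \<Rightarrow> ((real ^ 's::finite) list, 'v::chilbert) aefun hilb"
  where "full_fock m = L2 (list_measure (mu m))"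

definition fock :: "real \<Rightarrow> ((real ^ 's::finite) list, 'v::chilbert) aefun hilb"
  where "fock m = \<lparr>
    hcarrier = {mk f | f. square_integrable (list_measure (mu m)) f \<and>
                          (\<forall>ps qs. mset ps = mset qs \<longrightarrow> f ps = f qs)},
    hip = hip (full_fock m)\<rparr>"

definition particles_le :: "nat \<Rightarrow> ((real ^ 's::finite) list, 'v::chilbert) aefun \<Rightarrow> bool"
  where "particles_le N \<Psi> \<longleftrightarrow>
    (AE ps in vol. N < length ps \<longrightarrow> repr \<Psi> ps = 0)"

definition finite_particle :: "real \<Rightarrow> ((real ^ 's::finite) list, 'v::chilbert) aefun set"
  where "finite_particle m = {\<Psi> \<in> hcarrier (fock m). \<exists>N. particles_le N \<Psi>}"

definition tensor :: "(real ^ 's::finite, complex) aefun list \<Rightarrow> ((real ^ 's) list, complex) aefun"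
  where "tensor fs = mk (\<lambda>ps. if length ps = length fs
    then \<Prod>i<length fs. repr (fs ! i) (ps ! i) else 0)"

text \<open>\<open>\<Gamma>(V)\<close> is the direct sum of the tensor powers of \<open>V\<close>; it leaves the symmetric part invariant.\<close>

definition Gam :: "real \<Rightarrow> ((real ^ 's::finite, complex) aefun \<Rightarrow> (real ^ 's, complex) aefun) \<Rightarrow>
    ((real ^ 's) list, complex) aefun \<Rightarrow> ((real ^ 's) list, complex) aefun"
  where "Gam m V = (THE T. bounded_op (full_fock m) (full_fock m) T \<and>
    (\<forall>fs. set fs \<subseteq> hcarrier (one_particle m) \<longrightarrow> T (tensor fs) = tensor (map V fs)))"

definition inv_op :: "real \<Rightarrow> ((real ^ 's::finite, complex) aefun \<Rightarrow> (real ^ 's, complex) aefun) \<Rightarrow>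
    (real ^ 's, complex) aefun \<Rightarrow> (real ^ 's, complex) aefun"
  where "inv_op m V = inv_into (hcarrier (one_particle m)) V"

definition vtensor :: "'v::chilbert \<Rightarrow> ((real ^ 's::finite) list, complex) aefun \<Rightarrow>
    ((real ^ 's) list, 'v) aefun"
  where "vtensor v \<Psi> = mk (\<lambda>ps. repr \<Psi> ps *\<^sub>C v)"

text \<open>The operator \<open>1 \<otimes> A\<close>.\<close>

definition amplify :: "real \<Rightarrow>
    (((real ^ 's::finite) list, complex) aefun \<Rightarrow> ((real ^ 's) list, complex) aefun) \<Rightarrow>
    ((real ^ 's) list, 'v::chilbert) aefun \<Rightarrow> ((real ^ 's) list, 'v) aefun"
  where "amplify m A = (THE T. bounded_op (fock m) (fock m) T \<and>
    (\<forall>v. \<forall>\<Psi>\<in>hcarrier (fock m). T (vtensor v \<Psi>) = vtensor v (A \<Psi>)))"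

text \<open>
  The operator \<open>P\<^sub>\<mu>\<close> is built from the component \<open>\<mu>\<close> of \<open>(\<omega>, p)\<close>, the metric signs being supplied
  by the Minkowski product in \<open>x\<^sub>\<mu> X\<^sup>\<mu>\<close>.
\<close>

definition mom_P :: "real \<Rightarrow> 's::finite option \<Rightarrow>
    (((real ^ 's) list, complex) aefun \<times> ((real ^ 's) list, complex) aefun) set"
  where "mom_P m \<mu> = {(\<Psi>, \<Phi>). \<Psi> \<in> hcarrier (fock m) \<and> \<Phi> \<in> hcarrier (fock m) \<and>
    \<Phi> = mk (\<lambda>ps. complex_of_real (total_momentum m ps $ \<mu>) * repr \<Psi> ps)}"

definition coord_X :: "real \<Rightarrow> ((real ^ 's::finite, complex) aefun \<Rightarrow> (real ^ 's, complex) aefun) \<Rightarrow>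
    's option \<Rightarrow> (((real ^ 's) list, complex) aefun \<times> ((real ^ 's) list, complex) aefun) set"
  where "coord_X m V \<mu> = {(\<Psi>, Gam m (inv_op m V) \<Phi>) | \<Psi> \<Phi>.
    \<Psi> \<in> hcarrier (fock m) \<and> (Gam m V \<Psi>, \<Phi>) \<in> mom_P m \<mu>}"

text \<open>\<open>exp (i x\<^sub>\<mu> A\<^sup>\<mu>)\<close>, the index being raised with the metric.\<close>

definition translation :: "'a::cvector hilb \<Rightarrow> ('s::finite option \<Rightarrow> ('a \<times> 'a) set) \<Rightarrow>
    's spacetime \<Rightarrow> 'a \<Rightarrow> 'a"
  where "translation H A x = expi H (graph_closure H (lin_comb (\<lambda>\<mu>. eta \<mu> * x $ \<mu>) A))"


section \<open>The free and the deformed field\<close>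

definition ann :: "real \<Rightarrow> (real ^ 's::finite, complex) aefun \<Rightarrow>
    ((real ^ 's) list, complex) aefun \<Rightarrow> ((real ^ 's) list, complex) aefun"
  where "ann m h \<Psi> = mk (\<lambda>ps. complex_of_real (sqrt (real (length ps + 1))) *
    (\<integral>p. cnj (repr h p) * repr \<Psi> (p # ps) \<partial>mu m))"

definition crea :: "(real ^ 's::finite, complex) aefun \<Rightarrow>
    ((real ^ 's) list, complex) aefun \<Rightarrow> ((real ^ 's) list, complex) aefun"
  where "crea h \<Psi> = mk (\<lambda>ps. complex_of_real (1 / sqrt (real (length ps))) *
    (\<Sum>k<length ps. repr h (ps ! k) * repr \<Psi> (take k ps @ drop (Suc k) ps)))"

definition f_plus :: "real \<Rightarrow> ('s::finite spacetime \<Rightarrow> complex) \<Rightarrow> (real ^ 's, complex) aefun"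
  where "f_plus m f = mk (\<lambda>p. \<integral>x. f x * exp (\<i> * complex_of_real (mink (onshell m p) x)) \<partial>lborel)"

definition f_minus :: "real \<Rightarrow> ('s::finite spacetime \<Rightarrow> complex) \<Rightarrow> (real ^ 's, complex) aefun"
  where "f_minus m f = mk (\<lambda>p. \<integral>x. f x * exp (- \<i> * complex_of_real (mink (onshell m p) x)) \<partial>lborel)"

definition free_field :: "real \<Rightarrow> ('s::finite spacetime \<Rightarrow> complex) \<Rightarrow>
    ((real ^ 's) list, complex) aefun \<Rightarrow> ((real ^ 's) list, complex) aefun"
  where "free_field m f \<Psi> = ann m (aconj (f_minus m f)) \<Psi> + crea (f_plus m f) \<Psi>"

definition Delta_P :: "real \<Rightarrow> (real ^ 's::finite, complex) aefun set"
  where "Delta_P m = {h \<in> hcarrier (one_particle m).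
    \<forall>r. \<exists>c::real. AE p in vol. norm (complex_of_real (((norm p)\<^sup>2) ^ r) * repr h p) \<le> c}"

definition core_domain :: "real \<Rightarrow> ((real ^ 's::finite, complex) aefun \<Rightarrow> (real ^ 's, complex) aefun) \<Rightarrow>
    ((real ^ 's) list, complex) aefun set"
  where "core_domain m V =
    Gam m (inv_op m V) ` (cspan {tensor fs | fs. set fs \<subseteq> Delta_P m} \<inter> hcarrier (fock m))"

text \<open>
  The regularised integral, as a weak integral in \<open>H\<close>. Here \<open>U x\<close> stands for \<open>exp (i x\<^sub>\<mu> X\<^sup>\<mu>)\<close>.
\<close>

definition warped :: "'a::cvector hilb \<Rightarrow> ('s::finite spacetime \<Rightarrow> 'a \<Rightarrow> 'a) \<Rightarrow>
    real ^ ('s option) ^ ('s option) \<Rightarrow> ('s spacetime \<times> 's spacetime \<Rightarrow> complex) \<Rightarrow>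
    ('a \<Rightarrow> 'a) \<Rightarrow> real \<Rightarrow> 'a \<Rightarrow> 'a"
  where "warped H U \<theta> \<rho> A \<epsilon> \<Psi> = (THE \<Phi>. \<Phi> \<in> hcarrier H \<and>
    (\<forall>\<eta>\<in>hcarrier H. hip H \<eta> \<Phi> = complex_of_real (1 / (2 * pi) ^ CARD('s option)) *
      (\<integral>z. (case z of (x, y) \<Rightarrow>
        exp (- \<i> * complex_of_real (mink x y)) * \<rho> (\<epsilon> *\<^sub>R x, \<epsilon> *\<^sub>R y) *
        hip H \<eta> (U (\<theta> *v x) (A (U (- (\<theta> *v x)) (U y \<Psi>))))) \<partial>lborel)))"

text \<open>
  The limit on the core, extended to all finite particle vectors by continuity on the vectors of
  bounded particle number.
\<close>

definition deformed_field :: "real \<Rightarrow>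
    ((real ^ 's::finite, complex) aefun \<Rightarrow> (real ^ 's, complex) aefun) \<Rightarrow>
    real ^ ('s option) ^ ('s option) \<Rightarrow> ('s spacetime \<times> 's spacetime \<Rightarrow> complex) \<Rightarrow>
    ('s spacetime \<Rightarrow> complex) \<Rightarrow>
    ((real ^ 's) list, complex) aefun \<Rightarrow> ((real ^ 's) list, complex) aefun"
  where "deformed_field m V \<theta> \<rho> f = (THE T.
    T \<in> finite_particle m \<rightarrow>\<^sub>E finite_particle m \<and> linear_on (finite_particle m) T \<and>
    (\<forall>N. \<exists>C. \<forall>\<Psi>\<in>finite_particle m. particles_le N \<Psi> \<longrightarrow>
      hnorm (fock m) (T \<Psi>) \<le> C * hnorm (fock m) \<Psi>) \<and>
    (\<forall>\<Psi>\<in>core_domain m V.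
      ((\<lambda>\<epsilon>. hnorm (fock m) (warped (fock m) (translation (fock m) (coord_X m V)) \<theta> \<rho>
         (free_field m f) \<epsilon> \<Psi> - T \<Psi>)) \<longlongrightarrow> 0) (at_right 0)))"


section \<open>Moyal--Weyl space\<close>

text \<open>\<open>\<theta>\<^sub>\<mu>\<^sub>\<nu>\<close> is the matrix of the endomorphism \<open>\<theta>\<close> with its first index lowered.\<close>

definition lower :: "real ^ ('s::finite option) ^ ('s option) \<Rightarrow> 's option \<Rightarrow> 's option \<Rightarrow> real"
  where "lower \<theta> \<mu> \<nu> = eta \<mu> * \<theta> $ \<mu> $ \<nu>"

text \<open>
  Self-adjoint operators \<open>xh \<mu>\<close> with commutators \<open>-2 i \<theta>\<^sub>\<mu>\<^sub>\<nu>\<close> in Weyl form: \<open>W p\<close> is the exponential of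
  \<open>i p\<^sup>\<mu> xh\<^sub>\<mu>\<close>, and the phase is \<open>exp (1/2 [i p\<^sup>\<mu> xh\<^sub>\<mu>, i q\<^sup>\<nu> xh\<^sub>\<nu>])\<close>.
\<close>

definition moyal_weyl :: "real ^ ('s::finite option) ^ ('s option) \<Rightarrow>
    ('s option \<Rightarrow> ('v::chilbert \<times> 'v) set) \<Rightarrow> ('s spacetime \<Rightarrow> 'v \<Rightarrow> 'v) \<Rightarrow> bool"
  where "moyal_weyl \<theta> xh W \<longleftrightarrow>
    (\<forall>\<mu>. self_adjoint whole (xh \<mu>)) \<and>
    (\<forall>p. exp_group whole (graph_closure whole (lin_comb (\<lambda>\<mu>. p $ \<mu>) xh)) (\<lambda>t. W (t *\<^sub>R p))) \<and>
    (\<forall>p q v. W p (W q v) =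
      exp (- (1/2) * (\<Sum>\<mu>\<in>UNIV. \<Sum>\<nu>\<in>UNIV. complex_of_real (p $ \<mu> * q $ \<nu>) *
        (- 2 * \<i> * complex_of_real (lower \<theta> \<mu> \<nu>)))) *\<^sub>C W (p + q) v)"

definition V_P :: "real \<Rightarrow> ('s::finite spacetime \<Rightarrow> 'v::chilbert \<Rightarrow> 'v) \<Rightarrow> 'v \<Rightarrow>
    ((real ^ 's) list, complex) aefun \<Rightarrow> ((real ^ 's) list, 'v) aefun"
  where "V_P m W \<xi> \<Psi> = mk (\<lambda>ps. repr \<Psi> ps *\<^sub>C W (total_momentum m ps) \<xi>)"

definition Vtilde :: "real \<Rightarrow> ((real ^ 's::finite, complex) aefun \<Rightarrow> (real ^ 's, complex) aefun) \<Rightarrow>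
    ('s spacetime \<Rightarrow> 'v::chilbert \<Rightarrow> 'v) \<Rightarrow> 'v \<Rightarrow>
    ((real ^ 's) list, complex) aefun \<Rightarrow> ((real ^ 's) list, 'v) aefun"
  where "Vtilde m V W \<xi> \<Psi> = amplify m (Gam m (inv_op m V)) (V_P m W \<xi> (Gam m V \<Psi>))"

text \<open>
  The smeared operators \<open>\<integral> d\<mu>(p) g(p) exp(-i p xh) \<otimes> a(p)\<close> and
  \<open>\<integral> d\<mu>(p) h(p) exp(i p xh) \<otimes> a\<^sup>*(p)\<close>; both are linear in the smearing function.
\<close>

definition ann_mw :: "real \<Rightarrow> ('s::finite spacetime \<Rightarrow> 'v::chilbert \<Rightarrow> 'v) \<Rightarrow>
    (real ^ 's, complex) aefun \<Rightarrow> ((real ^ 's) list, 'v) aefun \<Rightarrow> ((real ^ 's) list, 'v) aefun"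
  where "ann_mw m W g \<Psi> = mk (\<lambda>ps. complex_of_real (sqrt (real (length ps + 1))) *\<^sub>C
    weak_integral (mu m) (\<lambda>p. repr g p *\<^sub>C W (- onshell m p) (repr \<Psi> (p # ps))))"

definition crea_mw :: "real \<Rightarrow> ('s::finite spacetime \<Rightarrow> 'v::chilbert \<Rightarrow> 'v) \<Rightarrow>
    (real ^ 's, complex) aefun \<Rightarrow> ((real ^ 's) list, 'v) aefun \<Rightarrow> ((real ^ 's) list, 'v) aefun"
  where "crea_mw m W h \<Psi> = mk (\<lambda>ps. complex_of_real (1 / sqrt (real (length ps))) *\<^sub>C
    (\<Sum>k<length ps. repr h (ps ! k) *\<^sub>C
      W (onshell m (ps ! k)) (repr \<Psi> (take k ps @ drop (Suc k) ps))))"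

text \<open>\<open>field_mw m W V f\<close> is \<open>\<phi>\<^bsub>\<otimes>,P\<^esub>(V f)\<close>.\<close>

definition field_mw :: "real \<Rightarrow> ('s::finite spacetime \<Rightarrow> 'v::chilbert \<Rightarrow> 'v) \<Rightarrow>
    ((real ^ 's, complex) aefun \<Rightarrow> (real ^ 's, complex) aefun) \<Rightarrow> ('s spacetime \<Rightarrow> complex) \<Rightarrow>
    ((real ^ 's) list, 'v) aefun \<Rightarrow> ((real ^ 's) list, 'v) aefun"
  where "field_mw m W V f \<Psi> =
    ann_mw m W (aconj (V (aconj (f_minus m f)))) \<Psi> + crea_mw m W (V (f_plus m f)) \<Psi>"

definition transformed_field :: "real \<Rightarrow> ('s::finite spacetime \<Rightarrow> 'v::chilbert \<Rightarrow> 'v) \<Rightarrow>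
    ((real ^ 's, complex) aefun \<Rightarrow> (real ^ 's, complex) aefun) \<Rightarrow> ('s spacetime \<Rightarrow> complex) \<Rightarrow>
    ((real ^ 's) list, 'v) aefun \<Rightarrow> ((real ^ 's) list, 'v) aefun"
  where "transformed_field m W V f \<Psi> =
    amplify m (Gam m (inv_op m V)) (field_mw m W V f (amplify m (Gam m V) \<Psi>))"

text \<open>The image under \<open>Vtilde\<close> of the domain of the deformed fields.\<close>

definition mw_domain :: "real \<Rightarrow> ((real ^ 's::finite, complex) aefun \<Rightarrow> (real ^ 's, complex) aefun) \<Rightarrow>
    ('s spacetime \<Rightarrow> 'v::chilbert \<Rightarrow> 'v) \<Rightarrow> 'v \<Rightarrow> ((real ^ 's) list, 'v) aefun set"
  where "mw_domain m V W \<xi> = Vtilde m V W \<xi> ` finite_particle m"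

end

(*
  Conjugated by \<open>\<Gamma>(V)\<close>, the translations become multiplication by phases of the total momentum, so the
  regularised oscillatory integral is the free field with an additional kernel in the momentum of the
  created (or annihilated) particle and the total momentum of the others. Integration by parts gives a
  bound on these kernels uniform in the regularisation, Fourier inversion at the origin their limit
  \<open>exp (i p \<theta> q)\<close>, and dominated convergence the limit of the operators. The same phase is what the
  Weyl relations produce when \<open>exp (i p x)\<close> acts on \<open>exp (i q x) \<xi>\<close>; so the deformed field and the
  field on the Moyal--Weyl space are intertwined, and conjugation by the isometry carries one star
  algebra to the other.
*)
theory Submission
  imports Defs "HOL-Probability.Characteristic_Functions"
begin

text \<open>Most operators in the statement (\<open>Gam\<close>, \<open>amplify\<close>,
  \<open>expi\<close>, \<open>warped\<close>, \<open>deformed_field\<close>,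
  \<open>weak_integral\<close>, \<open>adjoint_op\<close>) are definite descriptions, so each calls
  for an explicit candidate and a uniqueness argument. For \<open>Gam\<close> and
  \<open>amplify\<close> both come from total families with equal Gram matrices; for exponentials
  the group is exhibited as multiplication by phases and identified by its generator. The fields are
  unbounded, but on at most \<open>N\<close> particles they are bounded by a multiple of
  \<open>sqrt (N + 1)\<close>; continuity and density arguments therefore run at fixed
  \<open>N\<close>. Symmetric vectors are produced from the vacuum by creation operators
  (\<open>cvec\<close>), which keeps them in the span of tensors that defines the core. Annihilating
  \<open>p\<close> leads to the kernel with arguments \<open>-p\<close> and \<open>p + q\<close>.
  Its limit is the conjugate of the creation kernel because skewness makes the term quadratic in
  \<open>p\<close> vanish; hence the fields for \<open>f\<close> and for its conjugate are mutually
  adjoint on the domain, and every generator has a star. The isometry need not be onto, so it is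
  handled as a unitary onto its range, where its adjoint is its inverse.\<close>

type_synonym ('s, 'v) fk = "((real ^ 's) list, 'v) aefun"
type_synonym 's wf = "(real ^ 's, complex) aefun"
type_synonym en = ennreal

abbreviation (input) en :: "real => ennreal" where "en == ennreal"
abbreviation (input) cor :: "real => complex" where "cor == complex_of_real"
abbreviation (input) "hcar == hcarrier"
abbreviation (input) "sqint == square_integrable"
abbreviation (input) "smeas == strongly_measurable"
abbreviation (input) "bm == borel_measurable"
abbreviation (input) "nni == nn_integral"
abbreviation (input) "itg == lebesgue_integral"
abbreviation (input) pairm (infixr "><" 80) where "M >< N == pair_measure M N"
abbreviation (input) lims :: "(nat => 'a::topological_space) => 'a => bool" (infixr "---->" 60)
  where "f ----> l == f \<longlonglongrightarrow> l"
abbreviation (input) limf (infixr "--->" 60) where "f ---> l == f \<longlongrightarrow> l"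
abbreviation (input) cscl (infixr "*c" 75) where "c *c x == c *\<^sub>C x"

section \<open>Inner product spaces\<close>

lemma cscale_zero_left [simp]: "0 *c (x::'a::cvector) = 0" using cscale_add_left[of 0 0 x] by simp

lemma cscale_zero_right [simp]: "c *c (0::'a::cvector) = 0" using cscale_add_right[of c 0 "0::'a"] by simp

lemma cscale_minus_left: "(- c) *c (x::'a::cvector) = - (c *c x)" using cscale_add_left[of c "- c" x] by (simp add: eq_neg_iff_add_eq_0 add.commute)

lemma cscale_minus_right: "c *c (- x) = - (c *c (x::'a::cvector))" using cscale_add_right[of c x "- x"] by (simp add: eq_neg_iff_add_eq_0 add.commute)

lemma cscale_diff_right: "c *c (x - y) = c *c (x::'a::cvector) - c *c y" using cscale_add_right[of c x "- y"] by (simp add: cscale_minus_right)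

lemma cscale_sum_right: "c *c (\<Sum>i\<in>I. f i :: 'a::cvector) = (\<Sum>i\<in>I. c *c f i)" by (induction I rule: infinite_finite_induct) (auto simp: cscale_add_right)

lemma minus_eq_cscale: "u - (v::'a::cvector) = u + (- 1) *c v" by (simp add: cscale_minus_left cscale_one)

lemma cscale_complex [simp]: "c *c (z::complex) = c * z" by (simp add: cscale_complex_def)

lemma cinner_complex [simp]: "cinner (y::complex) z = cnj y * z" by (simp add: cinner_complex_def)

definition csubspace :: "'a::cvector set => bool" where "csubspace S \<longleftrightarrow> 0 : S \<and> (\<forall>u\<in>S. \<forall>v\<in>S. u + v : S) \<and> (\<forall>c. \<forall>u\<in>S. c *c u : S)"

lemma csubspace_diff: "csubspace S ==> u : S ==> v : S ==> u - v : S" by (simp add: csubspace_def minus_eq_cscale)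

lemma csubspace_sum: "csubspace S ==> (!!i. i : I ==> f i : S) ==> (\<Sum>i\<in>I. f i) : S" by (induction I rule: infinite_finite_induct) (auto simp: csubspace_def)

lemma cspanE: assumes "u : cspan S" obtains F c where "finite F" "F <= S" "u = (\<Sum>a\<in>F. c a *c a)" using assms by (auto simp: cspan_def)

lemma csubspace_cspan: "csubspace (cspan S)" proof -
 have "0 : cspan S" unfolding cspan_def by (rule CollectI, rule exI[of _ "{}"]) auto
 moreover have "u + v : cspan S" if uv: "u : cspan S" "v : cspan S" for u v proof -
  obtain F c where F: "finite F" "F <= S" "u = (\<Sum>a\<in>F. c a *c a)" using uv(1) by (rule cspanE)
  obtain G d where G: "finite G" "G <= S" "v = (\<Sum>a\<in>G. d a *c a)" using uv(2) by (rule cspanE)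
  have "u = (\<Sum>a\<in>F \<union> G. (if a : F then c a else 0) *c a)" unfolding F(3) using F(1) G(1) by (intro sum.mono_neutral_cong_left) auto
  moreover have "v = (\<Sum>a\<in>F \<union> G. (if a : G then d a else 0) *c a)" unfolding G(3) using F(1) G(1) by (intro sum.mono_neutral_cong_left) auto
  ultimately have "u + v = (\<Sum>a\<in>F \<union> G. ((if a : F then c a else 0) + (if a : G then d a else 0)) *c a)" by (simp add: sum.distrib cscale_add_left)
  then show ?thesis unfolding cspan_def using F G by (intro CollectI exI[of _ "F \<union> G"] exI[of _ "%a. (if a : F then c a else 0) + (if a : G then d a else 0)"]) auto
 qed
 moreover have "k *c u : cspan S" if uv: "u : cspan S" for u k proof -
  obtain F c where F: "finite F" "F <= S" "u = (\<Sum>a\<in>F. c a *c a)" using uv(1) by (rule cspanE)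
  then have "k *c u = (\<Sum>a\<in>F. (k * c a) *c a)" by (simp add: cscale_sum_right cscale_cscale)
  then show ?thesis unfolding cspan_def using F by (intro CollectI exI[of _ F] exI[of _ "%a. k * c a"]) auto
 qed
 ultimately show ?thesis by (auto simp: csubspace_def)
qed

lemma cspan_base: "s : S ==> s : cspan S" unfolding cspan_def by (intro CollectI exI[of _ "{s}"] exI[of _ "%_. 1"]) (auto simp: cscale_one)

lemma cspan_least: "csubspace C ==> S <= C ==> cspan S <= C" unfolding cspan_def by (auto intro!: csubspace_sum) (auto simp: csubspace_def subset_iff)

lemma linear_onD: assumes "linear_on S T" shows "u : S ==> v : S ==> T (u + v) = T u + T v" and "u : S ==> T (c *c u) = c *c T u" using assms by (auto simp: linear_on_def)

lemma linear_on_zero: "linear_on S T ==> u : S ==> T 0 = 0" using linear_onD(2)[of S T u 0] by simp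

lemma linear_on_diff: "csubspace S ==> linear_on S T ==> u : S ==> v : S ==> T (u - v) = T u - T v" by (simp add: minus_eq_cscale[of u v] minus_eq_cscale[of "T u"] linear_onD csubspace_def)

lemma linear_on_sum: assumes "csubspace S" "linear_on S T" "!!i. i : I ==> f i : S" shows "T (\<Sum>i\<in>I. f i) = (\<Sum>i\<in>I. T (f i))" using assms(3) proof (induction I rule: infinite_finite_induct)
 case (insert i I)
 then have "(\<Sum>i\<in>I. f i) : S" using csubspace_sum[OF assms(1), of I f] by auto
 with insert show ?case by (simp add: linear_onD(1)[OF assms(2)])
qed (use assms linear_on_zero in "auto simp: csubspace_def")

lemma linear_on_eq_on_cspan: assumes T: "csubspace C" "S <= C" "linear_on C T" "linear_on C T'" and eq: "!!s. s : S ==> T s = T' s" and u: "u : cspan S" shows "T u = T' u" proof -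
 have "csubspace {u : C. T u = T' u}" using T linear_on_zero[OF T(3), of 0] linear_on_zero[OF T(4), of 0] unfolding csubspace_def by (auto simp: linear_onD[OF T(3)] linear_onD[OF T(4)])
 then show ?thesis using cspan_least[of "{u : C. T u = T' u}" S] eq T(2) u by auto
qed

text \<open>The ambient type has only a linear structure, so completeness is stated through
  \<open>hnorm\<close> and sequences instead of a topology of the type. Only the real part of
  \<open>hip H u u\<close> is constrained, since \<open>hip_commute\<close> already makes this
  number real.\<close>

locale hspace = fixes H :: "'a::cvector hilb" assumes carrier: "csubspace (hcar H)" and hip_commute: "u : hcar H ==> v : hcar H ==> hip H u v = cnj (hip H v u)" and hip_add_right: "u : hcar H ==> v : hcar H ==> w : hcar H ==>
   hip H u (v + w) = hip H u v + hip H u w" and hip_scale_right: "u : hcar H ==> v : hcar H ==> hip H u (c *c v) = c * hip H u v" and hip_nonneg: "u : hcar H ==> 0 <= Re (hip H u u)"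
  and hip_definite: "u : hcar H ==> Re (hip H u u) = 0 ==> u = 0" and complete: "(!!n::nat. s n : hcar H) ==> (!!e. e > 0 ==> \<exists>M. \<forall>m\<ge>M. \<forall>n\<ge>M. hnorm H (s m - s n) < e) ==>
   \<exists>l\<in>hcar H. (%n. hnorm H (s n - l)) ----> 0"
begin

lemma zero [simp]: "0 : hcar H" and add [simp]: "u : hcar H ==> v : hcar H ==> u + v : hcar H" and scale [simp]: "u : hcar H ==> c *c u : hcar H" and diff [simp]: "u : hcar H ==> v : hcar H ==> u - v : hcar H"
 using carrier csubspace_diff[OF carrier] by (auto simp: csubspace_def)

lemma hip_add_left: assumes "u : hcar H" "v : hcar H" "w : hcar H" shows "hip H (u + v) w = hip H u w + hip H v w" using assms by (simp add: hip_commute[of "u + v" w] hip_commute[of u w] hip_commute[of v w] hip_add_right)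

lemma hip_scale_left: assumes "u : hcar H" "v : hcar H" shows "hip H (c *c u) v = cnj c * hip H u v" using assms by (simp add: hip_commute[of "c *c u" v] hip_commute[of u v] hip_scale_right)

lemma hip_diff_right: "u : hcar H ==> v : hcar H ==> w : hcar H ==> hip H u (v - w) = hip H u v - hip H u w" by (simp add: minus_eq_cscale[of v w] hip_add_right hip_scale_right)

lemma hip_diff_left: "u : hcar H ==> v : hcar H ==> w : hcar H ==> hip H (u - v) w = hip H u w - hip H v w" by (simp add: minus_eq_cscale[of u v] hip_add_left hip_scale_left)

lemma hip_zero_right [simp]: "u : hcar H ==> hip H u 0 = 0" using hip_scale_right[of u u 0] by simp

lemma hip_zero_left [simp]: "u : hcar H ==> hip H 0 u = 0" using hip_scale_left[of u u 0] by simp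

lemma hip_sum_right: assumes "u : hcar H" "!!i. i : I ==> f i : hcar H" shows "hip H u (\<Sum>i\<in>I. f i) = (\<Sum>i\<in>I. hip H u (f i))" using assms(2) proof (induction I rule: infinite_finite_induct)
 case (insert i I)
 then have "(\<Sum>i\<in>I. f i) : hcar H" by (intro csubspace_sum carrier) auto
 with insert assms(1) show ?case by (simp add: hip_add_right)
qed (use assms in auto)

lemma hip_sum_left: assumes "u : hcar H" "!!i. i : I ==> f i : hcar H" shows "hip H (\<Sum>i\<in>I. f i) u = (\<Sum>i\<in>I. hip H (f i) u)" proof -
 have "(\<Sum>i\<in>I. f i) : hcar H" using assms by (intro csubspace_sum carrier) auto
 then have "hip H (\<Sum>i\<in>I. f i) u = cnj (\<Sum>i\<in>I. hip H u (f i))" using assms hip_commute[of "\<Sum>i\<in>I. f i" u] by (simp add: hip_sum_right)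
 also have "... = (\<Sum>i\<in>I. hip H (f i) u)" using assms by (auto intro!: sum.cong hip_commute[symmetric])
 finally show ?thesis .
qed

lemma hip_self: "u : hcar H ==> hip H u u = cor ((hnorm H u)^2)" using hip_commute[of u u] hip_nonneg[of u] by (simp add: hnorm_def complex_eq_iff)

lemma hnorm_nonneg [simp]: "u : hcar H ==> 0 <= hnorm H u" using hip_nonneg[of u] by (simp add: hnorm_def)

lemma hnorm_eq_0: "u : hcar H ==> hnorm H u = 0 \<longleftrightarrow> u = 0" using hip_definite[of u] by (auto simp: hnorm_def)

lemma hnorm_zero [simp]: "hnorm H 0 = 0" by (simp add: hnorm_eq_0)

lemma hnorm_scale: "u : hcar H ==> hnorm H (c *c u) = cmod c * hnorm H u" proof -
 assume u: "u : hcar H"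
 have "cor ((hnorm H (c *c u))^2) = cor ((cmod c * hnorm H u)^2)" using u hip_self[of "c *c u"] hip_self[of u] complex_norm_square[of c] by (simp add: hip_scale_left hip_scale_right power_mult_distrib mult_ac)
 then have "(hnorm H (c *c u))^2 = (cmod c * hnorm H u)^2" using of_real_eq_iff by blast
 then show ?thesis using u by (auto intro!: power2_eq_imp_eq)
qed

lemma hnorm_minus_commute: "u : hcar H ==> v : hcar H ==> hnorm H (u - v) = hnorm H (v - u)" using hnorm_scale[of "u - v" "-1"] by (simp add: cscale_minus_left cscale_one)

lemma hnorm_diff_sq: assumes "u : hcar H" "v : hcar H" shows "(hnorm H (u - v))^2 = (hnorm H u)^2 + (hnorm H v)^2 - 2 * Re (hip H u v)" proof -
 have "cor ((hnorm H (u - v))^2) = hip H u u + hip H v v - (hip H u v + cnj (hip H u v))" using assms hip_commute[of v u] hip_self[of "u - v"] by (simp add: hip_diff_left hip_diff_right algebra_simps)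
 also have "... = cor ((hnorm H u)^2 + (hnorm H v)^2 - 2 * Re (hip H u v))" using assms by (simp only: hip_self complex_add_cnj of_real_add of_real_diff)
 finally show ?thesis using of_real_eq_iff by blast
qed

lemma hnorm_add_sq: assumes "u : hcar H" "v : hcar H" shows "(hnorm H (u + v))^2 = (hnorm H u)^2 + (hnorm H v)^2 + 2 * Re (hip H u v)"
 using hnorm_diff_sq[of u "(-1) *c v"] assms hnorm_scale[of v "-1"] hip_scale_right[of u v "-1"] scale[of v "-1"] by (simp add: cscale_minus_left cscale_one)

lemma Cauchy_Schwarz: assumes u: "u : hcar H" and v: "v : hcar H" shows "cmod (hip H u v) <= hnorm H u * hnorm H v" proof (cases "u = 0")
 case True then show ?thesis using v by simp
next
 case False
 define a where "a = (hnorm H u)^2"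
 have a: "a > 0" unfolding a_def using False hnorm_eq_0[OF u] by simp
 \<comment> \<open>With this coefficient \<open>c *c u\<close> is the orthogonal projection of
   \<open>v\<close> on \<open>u\<close>; the inequality is the nonnegativity of the squared norm of
   the remainder.\<close>
 define c where "c = hip H u v / a"
 have "hip H (c *c u) v = cnj c * hip H u v" using u v by (simp add: hip_scale_left)
 also have "... = cor ((cmod (hip H u v))^2 / a)" unfolding c_def using complex_norm_square[of "hip H u v"] by (simp add: mult_ac)
 finally have 1: "Re (hip H (c *c u) v) = (cmod (hip H u v))^2 / a" by simp
 have 2: "(hnorm H (c *c u))^2 = (cmod (hip H u v))^2 / a" using a u by (simp add: hnorm_scale c_def norm_divide power_mult_distrib power_divide) (simp add: a_def power2_eq_square)
 have "0 <= (hnorm H (c *c u - v))^2" by simp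
 also have "... = (hnorm H v)^2 - (cmod (hip H u v))^2 / a" using u v 1 2 by (simp add: hnorm_diff_sq)
 finally have "(cmod (hip H u v))^2 <= (hnorm H u * hnorm H v)^2" using a by (simp add: field_simps a_def power_mult_distrib)
 then show ?thesis using u v by (auto intro: power2_le_imp_le)
qed

lemma hnorm_triangle: assumes u: "u : hcar H" and v: "v : hcar H" shows "hnorm H (u + v) <= hnorm H u + hnorm H v" proof (rule power2_le_imp_le)
 have "Re (hip H u v) <= hnorm H u * hnorm H v" using Cauchy_Schwarz[OF u v] complex_Re_le_cmod order_trans by blast
 then show "(hnorm H (u + v))^2 <= (hnorm H u + hnorm H v)^2" using u v by (simp add: hnorm_add_sq power2_sum)
qed (use u v in auto)

lemma hnorm_triangle_diff: assumes "u : hcar H" "v : hcar H" "w : hcar H" shows "hnorm H (u - w) <= hnorm H (u - v) + hnorm H (v - w)" using hnorm_triangle[of "u - v" "v - w"] assms by simp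

lemma tendsto_hip: assumes "!!x. u x : hcar H" "!!x. v x : hcar H" and a: "a : hcar H" and b: "b : hcar H" and u: "((%x. hnorm H (u x - a)) ---> 0) F" and v: "((%x. hnorm H (v x - b)) ---> 0) F"
 shows "((%x. hip H (u x) (v x)) ---> hip H a b) F" proof (rule Lim_null[THEN iffD2], rule Lim_null_comparison)
 have "hip H (u x) (v x) - hip H a b = hip H (u x - a) (v x - b) + hip H (u x - a) b + hip H a (v x - b)" for x using assms by (simp add: hip_diff_left hip_diff_right algebra_simps)
 moreover have "cmod (hip H (u x - a) (v x - b) + hip H (u x - a) b + hip H a (v x - b)) <= hnorm H (u x - a) * hnorm H (v x - b) + hnorm H (u x - a) * hnorm H b + hnorm H a * hnorm H (v x - b)" for x
  using assms by (intro norm_triangle_mono Cauchy_Schwarz) auto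
 ultimately show "\<forall>\<^sub>F x in F. cmod (hip H (u x) (v x) - hip H a b) <= hnorm H (u x - a) * hnorm H (v x - b) + hnorm H (u x - a) * hnorm H b + hnorm H a * hnorm H (v x - b)" by simp
 show "((%x. hnorm H (u x - a) * hnorm H (v x - b) + hnorm H (u x - a) * hnorm H b + hnorm H a * hnorm H (v x - b)) ---> 0) F" using tendsto_add[OF tendsto_add[OF tendsto_mult[OF u v] tendsto_mult_right[OF u, of "hnorm H b"]]
   tendsto_mult_left[OF v, of "hnorm H a"]] by simp
qed

lemma tendsto_hnorm: assumes "!!x. u x : hcar H" "a : hcar H" "((%x. hnorm H (u x - a)) ---> 0) F" shows "((%x. hnorm H (u x)) ---> hnorm H a) F" unfolding hnorm_def by (intro tendsto_real_sqrt tendsto_Re tendsto_hip assms)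

lemma hlimit_unique: assumes "!!x. u x : hcar H" "a : hcar H" "b : hcar H" "F ~= bot" and "((%x. hnorm H (u x - a)) ---> 0) F" "((%x. hnorm H (u x - b)) ---> 0) F" shows "a = b" proof -
 have "((%x. hnorm H (u x - a) + hnorm H (u x - b)) ---> 0) F" using tendsto_add[OF assms(5,6)] by simp
 moreover have "hnorm H (a - b) <= hnorm H (u x - a) + hnorm H (u x - b)" for x using hnorm_triangle_diff[of a "u x" b] assms hnorm_minus_commute[of a "u x"] by simp
 ultimately have "hnorm H (a - b) <= 0" using assms(4) tendsto_lowerbound by (metis (no_types, lifting) always_eventually)
 then have "hnorm H (a - b) = 0" by (intro antisym) (use assms in auto)
 then show ?thesis using hnorm_eq_0[of "a - b"] assms by simp
qed

lemma hip_eqI: assumes "u : hcar H" "v : hcar H" "!!w. w : hcar H ==> hip H w u = hip H w v" shows "u = v" proof -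
 have "hip H (u - v) (u - v) = 0" using assms by (simp add: hip_diff_right)
 then show ?thesis using hip_definite[of "u - v"] assms by simp
qed

section \<open>Total sets and the projection theorem\<close>

lemma parallelogram: assumes "u : hcar H" "v : hcar H" shows "(hnorm H (u - v))^2 = 2 * (hnorm H u)^2 + 2 * (hnorm H v)^2 - (hnorm H (u + v))^2" using assms by (simp add: hnorm_add_sq hnorm_diff_sq)

text \<open>Totality is expressed by a trivial orthogonal complement because this is what the
  separation arguments for tensors deliver; density of the span is extracted from it by
  \<open>total_dense\<close>.\<close>

definition total :: "'a set => bool" where "total S \<longleftrightarrow> S <= hcar H \<and> (\<forall>u\<in>hcar H. (\<forall>s\<in>S. hip H s u = 0) --> u = 0)"

text \<open>Otherwise subtracting the projection of \<open>x\<close> on \<open>v\<close> would lower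
  the squared norm of \<open>x\<close> by \<open>|<v, x>|^2 / |v|^2\<close>, against
  minimality.\<close>

lemma minimizing_orthogonal: assumes S: "csubspace S" "S <= hcar H" and x: "x : hcar H" and min: "!!v. v : S ==> hnorm H x <= hnorm H (x - v)" and v: "v : S" shows "hip H v x = 0" proof (cases "v = 0")
 case False
 have vH: "v : hcar H" using v S by auto
 have pos: "(hnorm H v)^2 > 0" using False hnorm_eq_0[OF vH] by simp
 define c where "c = hip H v x / cor ((hnorm H v)^2)"
 have cv: "c *c v : S" using S v by (auto simp: csubspace_def)
 have "(hnorm H x)^2 <= (hnorm H (x - c *c v))^2" using min[OF cv] x by (simp add: power_mono)
 also have "... = (hnorm H x)^2 + (hnorm H (c *c v))^2 - 2 * Re (hip H x (c *c v))" using x vH by (simp add: hnorm_diff_sq)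
 also have "hip H x (c *c v) = cor ((cmod (hip H v x))^2 / (hnorm H v)^2)" using x vH hip_commute[of x v] complex_norm_square[of "hip H v x"] by (simp add: hip_scale_right c_def)
 also have "(hnorm H (c *c v))^2 = (cmod (hip H v x))^2 / (hnorm H v)^2" using vH pos by (simp add: hnorm_scale c_def norm_divide power_mult_distrib power_divide) (simp add: power2_eq_square norm_mult)
 finally have "(cmod (hip H v x))^2 / (hnorm H v)^2 <= 0" by simp
 then show ?thesis using pos by (simp add: divide_le_0_iff)
qed (use x in auto)

text \<open>A minimizing sequence in the span converges, by the parallelogram law, to some
  \<open>l\<close>; minimality makes \<open>u - l\<close> orthogonal to \<open>S\<close>, so
  totality gives \<open>u = l\<close>.\<close>

lemma total_dense: assumes tot: "total S" and u: "u : hcar H" shows "\<exists>s. (\<forall>n::nat. s n : cspan S) \<and> (%n. hnorm H (s n - u)) ----> 0" proof -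
 let ?L = "cspan S"
 have L: "csubspace ?L" by (rule csubspace_cspan)
 have LH: "?L <= hcar H" using tot carrier by (intro cspan_least) (auto simp: total_def)
 define d where "d = (INF v\<in>?L. hnorm H (u - v))"
 have ne: "?L ~= {}" using L by (auto simp: csubspace_def)
 have bdd: "bdd_below ((%v. hnorm H (u - v)) ` ?L)" by (rule bdd_belowI2[of _ 0]) (use LH u in auto)
 have d_le: "d <= hnorm H (u - v)" if "v : ?L" for v unfolding d_def using bdd that by (rule cINF_lower)
 have d0: "0 <= d" unfolding d_def using ne LH u by (intro cINF_greatest) auto
 have "\<exists>v\<in>?L. hnorm H (u - v) < d + 1 / real (Suc n)" for n using cINF_less_iff[OF ne bdd, of "d + 1 / real (Suc n)"] by (simp add: d_def)
 then obtain s where s: "!!n. s n : ?L" "!!n. hnorm H (u - s n) < d + 1 / real (Suc n)" by metis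
 have sH: "s n : hcar H" for n using s LH by auto
 have est: "(hnorm H (s m - s n))^2 <= (4 * d + 2) * (1 / real (Suc m)) + (4 * d + 2) * (1 / real (Suc n))" for m n proof -
  \<comment> \<open>The midpoint lies in the span, hence at distance at least \<open>d\<close> from
    \<open>u\<close>; in the parallelogram identity only the excess of the two distances over
    \<open>d\<close> remains.\<close>
  have half: "(1/2) *c (s m + s n) : ?L" using L s by (auto simp: csubspace_def)
  have "(u - s m) + (u - s n) = 2 *c (u - (1/2) *c (s m + s n))" using cscale_add_left[of 1 1 u] by (simp add: cscale_diff_right cscale_cscale cscale_one algebra_simps)
  then have "hnorm H ((u - s m) + (u - s n)) = 2 * hnorm H (u - (1/2) *c (s m + s n))" using half LH u by (simp add: hnorm_scale subset_iff)
  with d_le[OF half] d0 have 1: "(2 * d)^2 <= (hnorm H ((u - s m) + (u - s n)))^2" by (simp add: power_mono)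
  have sq: "(hnorm H (u - s k))^2 <= d\<^sup>2 + (2 * d + 1) * (1 / real (Suc k))" for k proof -
   have "(hnorm H (u - s k))^2 <= (d + 1 / real (Suc k))^2" using s(2)[of k] u sH by (intro power_mono) auto
   also have "... = d\<^sup>2 + 2 * d * (1 / real (Suc k)) + (1 / real (Suc k)) * (1 / real (Suc k))" by (simp add: power2_sum power2_eq_square algebra_simps)
   also have "(1 / real (Suc k)) * (1 / real (Suc k)) <= 1 * (1 / real (Suc k))" by (intro mult_right_mono) auto
   finally show ?thesis by (simp add: algebra_simps)
  qed
  have "(hnorm H (s m - s n))^2 = (hnorm H ((u - s n) - (u - s m)))^2" by simp
  also have "... = 2 * (hnorm H (u - s n))^2 + 2 * (hnorm H (u - s m))^2 - (hnorm H ((u - s n) + (u - s m)))^2" using u sH by (intro parallelogram) auto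
  also have "... <= 2 * (d\<^sup>2 + (2 * d + 1) * (1 / real (Suc n))) + 2 * (d\<^sup>2 + (2 * d + 1) * (1 / real (Suc m))) - (2 * d)^2" using 1 sq[of n] sq[of m] unfolding add.commute[of "u - s m"]
   by (intro diff_mono add_mono mult_left_mono) (simp_all only: zero_le_numeral)
  finally show ?thesis by (simp add: power2_eq_square algebra_simps)
 qed
 have lim0: "(%n. (4 * d + 2) * (1 / real (Suc n))) ----> 0" using tendsto_mult_right_zero[OF LIMSEQ_inverse_real_of_nat, of "4 * d + 2"] by (simp add: inverse_eq_divide)
 have "\<exists>M. \<forall>m\<ge>M. \<forall>n\<ge>M. hnorm H (s m - s n) < e" if e: "e > 0" for e proof -
  have "e\<^sup>2 / 2 > 0" using e by simp
  then obtain M where M: "!!n. n \<ge> M ==> (4 * d + 2) * (1 / real (Suc n)) < e\<^sup>2 / 2" using order_tendstoD(2)[OF lim0] unfolding eventually_sequentially by blast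
  have "hnorm H (s m - s n) < e" if "m \<ge> M" "n \<ge> M" for m n proof (rule power2_less_imp_less)
   show "(hnorm H (s m - s n))^2 < e\<^sup>2" using est[of m n] M[OF that(1)] M[OF that(2)] by linarith
  qed (use e in auto)
  then show ?thesis by blast
 qed
 from complete[OF sH this] obtain l where l: "l : hcar H" "(%n. hnorm H (s n - l)) ----> 0" by blast
 \<comment> \<open>The limit \<open>l\<close> is not known to lie in the span, but each
   \<open>s n + v\<close> does, so the lower bound \<open>d\<close> passes to the norm of
   \<open>u - l - v\<close>.\<close>
 have lim: "(%n. hnorm H (u - (s n + v))) ----> hnorm H (u - l - v)" if "v : hcar H" for v using l sH u that hnorm_minus_commute[OF l(1) sH] by (intro tendsto_hnorm) auto
 have "(%n. hnorm H (u - (s n + 0))) ----> hnorm H (u - l - 0)" by (intro lim) auto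
 then have lim': "(%n. hnorm H (u - s n)) ----> hnorm H (u - l)" by simp
 have "(%n. d + 1 / real (Suc n)) ----> d + 0" using LIMSEQ_inverse_real_of_nat by (intro tendsto_add tendsto_const) (simp add: inverse_eq_divide)
 then have "hnorm H (u - l) <= d" unfolding add_0_right by (rule LIMSEQ_le[OF lim']) (use s(2) in "auto intro: less_imp_le")
 moreover have "d <= hnorm H (u - l - v)" if v: "v : ?L" for v proof -
  have "d <= hnorm H (u - (s n + v))" for n using d_le[of "s n + v"] s(1)[of n] v L by (auto simp: csubspace_def)
  then show ?thesis using LIMSEQ_le_const[OF lim[of v]] v LH by blast
 qed
 ultimately have min: "hnorm H (u - l) <= hnorm H (u - l - v)" if "v : ?L" for v using that by (meson order_trans)
 have "hip H v (u - l) = 0" if "v : ?L" for v by (rule minimizing_orthogonal[OF L LH _ min that]) (use u l in auto)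
 then have "u - l = 0" using tot diff[OF u l(1)] cspan_base unfolding total_def by blast
 then show ?thesis using s l by auto
qed

end

section \<open>Bounded operators and isometries determined on total sets\<close>

lemma bounded_opD: assumes "bounded_op H K T" shows "T : hcar H \<rightarrow>\<^sub>E hcar K" "linear_on (hcar H) T"
  "u : hcar H ==> T u : hcar K" using assms by (auto simp: bounded_op_def)

lemma bounded_opE: assumes "bounded_op H K T" "hspace H" obtains C where "C \<ge> 0" "!!u. u : hcar H ==> hnorm K (T u) <= C * hnorm H u" proof -
 obtain C where C: "!!u. u : hcar H ==> hnorm K (T u) <= C * hnorm H u" using assms by (auto simp: bounded_op_def)
 have "hnorm K (T u) <= max C 0 * hnorm H u" if "u : hcar H" for u using C[OF that] hspace.hnorm_nonneg[OF assms(2) that] by (meson max.cobounded1 mult_right_mono order_trans)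
 then show thesis by (intro that[of "max C 0"]) auto
qed

lemma bounded_op_tendsto: assumes T: "bounded_op H K T" and H: "hspace H" and K: "hspace K" and "!!x. u x : hcar H" "a : hcar H" "((%x. hnorm H (u x - a)) ---> 0) F" shows "((%x. hnorm K (T (u x) - T a)) ---> 0) F" proof -
 obtain C where C: "!!u. u : hcar H ==> hnorm K (T u) <= C * hnorm H u" using bounded_opE[OF T H] by blast
 have "hnorm K (T (u x) - T a) <= C * hnorm H (u x - a)" for x using C[of "u x - a"] assms(4)[of x] assms(5) linear_on_diff[OF hspace.carrier[OF H] bounded_opD(2)[OF T]] by (simp add: hspace.diff[OF H])
 moreover have "0 <= hnorm K (T (u x) - T a)" for x using bounded_opD(3)[OF T assms(4)] bounded_opD(3)[OF T assms(5)] by (intro hspace.hnorm_nonneg[OF K] hspace.diff[OF K])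
 ultimately show ?thesis using tendsto_mult_right_zero[OF assms(6), of C] by (intro Lim_null_comparison[OF _ tendsto_mult_right_zero[OF assms(6), of C]]) auto
qed

text \<open>Uniqueness for definite descriptions of bounded operators. Equality as functions is
  available because \<open>bounded_op\<close> also fixes the values off the carrier.\<close>

lemma bounded_op_eqI: assumes T: "bounded_op H K T" and T': "bounded_op H K T'" and H: "hspace H" and K: "hspace K" and S: "hspace.total H S" and eq: "!!s. s : S ==> T s = T' s" shows "T = T'" proof (rule extensionalityI)
 show "T : extensional (hcar H)" "T' : extensional (hcar H)" using bounded_opD(1)[OF T] bounded_opD(1)[OF T'] by (auto simp: PiE_def)
 fix u assume u: "u : hcar H"
 obtain s where s: "!!n::nat. s n : cspan S" "(%n. hnorm H (s n - u)) ----> 0" using hspace.total_dense[OF H S u] by blast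
 have SH: "S <= hcar H" using S by (simp add: hspace.total_def[OF H])
 have sH: "s n : hcar H" for n using s(1) cspan_least[OF hspace.carrier[OF H] SH] by auto
 have eq: "T (s n) = T' (s n)" for n using linear_on_eq_on_cspan[OF hspace.carrier[OF H] SH bounded_opD(2)[OF T] bounded_opD(2)[OF T'] eq s(1)] .
 have "(%n. hnorm K (T (s n) - T u)) ----> 0" "(%n. hnorm K (T (s n) - T' u)) ----> 0" using bounded_op_tendsto[OF T H K sH u s(2)] bounded_op_tendsto[OF T' H K sH u s(2)] by (auto simp: eq)
 then show "T u = T' u" using sH u bounded_opD(3)[OF T] bounded_opD(3)[OF T'] by (intro hspace.hlimit_unique[OF K]) auto
qed

text \<open>The image of \<open>u\<close> is the vector \<open>w\<close> with \<open>\<langle>t i, w\<rangle> = \<langle>s i, u\<rangle>\<close> for all \<open>i\<close>, which is unique as the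
 \<open>t i\<close> are total.\<close>

lemma isometry_extension_vector: assumes H: "hspace H" and K: "hspace K" and s: "hspace.total H (s ` I)" and t: "t ` I <= hcar K" and gram: "!!i j. i : I ==> j : I ==> hip K (t i) (t j) = hip H (s i) (s j)" and u: "u : hcar H"
 shows "\<exists>w\<in>hcar K. (\<forall>i\<in>I. hip K (t i) w = hip H (s i) u) \<and> hnorm K w = hnorm H u" proof -
 interpret H: hspace H by fact
 interpret K: hspace K by fact
 have sH: "s i : hcar H" if "i : I" for i using s that by (auto simp: H.total_def)
 have tK: "t i : hcar K" if "i : I" for i using t that by auto
 obtain x where x: "!!n::nat. x n : cspan (s ` I)" "(%n. hnorm H (x n - u)) ----> 0" using H.total_dense[OF s u] by blast
 \<comment> \<open>\<open>R a b\<close> relates a combination of the \<open>s i\<close> to the same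
   combination of the \<open>t i\<close>. The clause over all \<open>a'\<close> and
   \<open>b'\<close> gives equal inner products for any two related pairs, without showing that
   \<open>b\<close> depends only on \<open>a\<close>; so \<open>y\<close> inherits the Cauchy
   property from \<open>x\<close>.\<close>
 define R where "R a b \<longleftrightarrow> a : hcar H \<and> b : hcar K \<and> (\<forall>i\<in>I. hip K (t i) b = hip H (s i) a) \<and>
  b : cspan (t ` I) \<and> (\<forall>a' b'. a' : hcar H --> b' : hcar K --> (\<forall>i\<in>I. hip K (t i) b' = hip H (s i) a') --> hip K b b' = hip H a a')" for a b
 have "\<exists>b. R a b" if a: "a : cspan (s ` I)" for a proof -
  obtain F c where F: "finite F" "F <= s ` I" "a = (\<Sum>v\<in>F. c v *c v)" using a by (rule cspanE)
  obtain J where J: "!!v. v : F ==> J v : I \<and> v = s (J v)" using F(2) unfolding subset_iff image_iff by metis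
  define b where "b = (\<Sum>v\<in>F. c v *c t (J v))"
  have cv: "c v *c v : hcar H" "c v *c t (J v) : hcar K" if "v : F" for v using J[OF that] sH[of "J v"] tK[of "J v"] by auto
  have aH: "a : hcar H" "b : hcar K" unfolding F(3) b_def using cv by (auto intro!: csubspace_sum H.carrier K.carrier)
  have 1: "hip K (t i) b = hip H (s i) a" if i: "i : I" for i proof -
   have "hip K (t i) b = (\<Sum>v\<in>F. c v * hip K (t i) (t (J v)))" unfolding b_def using cv J tK i by (subst K.hip_sum_right) (auto simp: K.hip_scale_right)
   also have "... = (\<Sum>v\<in>F. c v * hip H (s i) v)" using J i by (intro sum.cong) (auto simp: gram)
   also have "... = hip H (s i) a" unfolding F(3) using cv J sH i by (subst H.hip_sum_right) (auto simp: H.hip_scale_right intro!: sum.cong, metis H.hip_scale_right)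
   finally show ?thesis .
  qed
  have 2: "hip K b b' = hip H a a'" if "a' : hcar H" "b' : hcar K" "\<forall>i\<in>I. hip K (t i) b' = hip H (s i) a'" for a' b' proof -
   have "hip K b b' = (\<Sum>v\<in>F. cnj (c v) * hip K (t (J v)) b')" unfolding b_def using cv J tK that by (subst K.hip_sum_left) (auto simp: K.hip_scale_left)
   also have "... = (\<Sum>v\<in>F. cnj (c v) * hip H v a')" using J that by (intro sum.cong) auto
   also have "... = hip H a a'" unfolding F(3) using cv J sH that by (subst H.hip_sum_left) (auto simp: H.hip_scale_left intro!: sum.cong, metis H.hip_scale_left)
   finally show ?thesis .
  qed
  have 3: "b : cspan (t ` I)" unfolding b_def using J csubspace_cspan[of "t ` I"] by (intro csubspace_sum) (auto simp: csubspace_def cspan_base)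
  show ?thesis unfolding R_def using aH 1 2 3 by blast
 qed
 then have "\<forall>n. \<exists>b. R (x n) b" using x(1) by blast
 then obtain y where y: "!!n. R (x n) (y n)" by metis
 have xH: "x n : hcar H" and yK: "y n : hcar K" for n using y by (auto simp: R_def)
 have yip: "hip K (y m) (y n) = hip H (x m) (x n)" for m n using y[of m] y[of n] unfolding R_def by blast
 have ynorm: "hnorm K (y m - y n) = hnorm H (x m - x n)" for m n unfolding hnorm_def using xH yK by (simp add: K.hip_diff_left K.hip_diff_right H.hip_diff_left H.hip_diff_right yip)
 have "\<exists>M. \<forall>m\<ge>M. \<forall>n\<ge>M. hnorm K (y m - y n) < e" if "e > 0" for e proof -
  have "e / 2 > 0" using that by simp
  then obtain M where M: "!!n. n \<ge> M ==> hnorm H (x n - u) < e / 2" using order_tendstoD(2)[OF x(2)] unfolding eventually_sequentially by blast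
  have "hnorm K (y m - y n) < e" if "m \<ge> M" "n \<ge> M" for m n using H.hnorm_triangle_diff[of "x m" u "x n"] M[OF that(1)] M[OF that(2)] xH u H.hnorm_minus_commute[of u "x n"] by (simp add: ynorm)
  then show ?thesis by blast
 qed
 from K.complete[OF yK this] obtain w where w: "w : hcar K" "(%n. hnorm K (y n - w)) ----> 0" by blast
 have "hip K (t i) w = hip H (s i) u" if i: "i : I" for i proof (rule LIMSEQ_unique)
  show "(%n. hip K (t i) (y n)) ----> hip K (t i) w" using w yK tK i by (intro K.tendsto_hip) auto
  have "(%n. hip H (s i) (x n)) ----> hip H (s i) u" using x xH sH i u by (intro H.tendsto_hip) auto
  moreover have "hip K (t i) (y n) = hip H (s i) (x n)" for n using y[of n] i by (auto simp: R_def)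
  ultimately show "(%n. hip K (t i) (y n)) ----> hip H (s i) u" by simp
 qed
 moreover have "hnorm K w = hnorm H u" proof (rule LIMSEQ_unique)
  show "(%n. hnorm K (y n)) ----> hnorm K w" using w yK by (intro K.tendsto_hnorm) auto
  have "(%n. hnorm H (x n)) ----> hnorm H u" using x xH u by (intro H.tendsto_hnorm) auto
  then show "(%n. hnorm K (y n)) ----> hnorm H u" by (simp add: hnorm_def yip)
 qed
 ultimately show ?thesis using w by blast
qed

text \<open>A vector is determined by its pairings with a total family. This yields linearity and
  injectivity, and the preceding lemma with the roles of \<open>s\<close> and \<open>t\<close>
  exchanged yields surjectivity. \<open>Gam\<close> and \<open>amplify\<close> are both obtained in
  this way.\<close>

lemma isometry_extension: assumes H: "hspace H" and K: "hspace K" and s: "hspace.total H (s ` I)" and t: "hspace.total K (t ` I)" and gram: "!!i j. i : I ==> j : I ==> hip K (t i) (t j) = hip H (s i) (s j)"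
 obtains T where "bounded_op H K T" "!!i. i : I ==> T (s i) = t i" "unitary_op H K T"
  "!!T'. bounded_op H K T' ==> (!!i. i : I ==> T' (s i) = t i) ==> T' = T" proof -
 interpret H: hspace H by fact
 interpret K: hspace K by fact
 have sH: "s i : hcar H" if "i : I" for i using s that by (auto simp: H.total_def)
 have tK: "t i : hcar K" if "i : I" for i using t that by (auto simp: K.total_def)
 have sI: "s ` I <= hcar H" and tI: "t ` I <= hcar K" using sH tK by auto
 have uniq: "w = w'" if "w : hcar K" "w' : hcar K" "\<forall>i\<in>I. hip K (t i) w = hip K (t i) w'" for w w' proof -
  have "w - w' = 0" using t that tK K.diff[OF that(1,2)] unfolding K.total_def by (auto simp: K.hip_diff_right simp del: K.diff)
  then show ?thesis by simp
 qed
 have uniq': "u = u'" if "u : hcar H" "u' : hcar H" "\<forall>i\<in>I. hip H (s i) u = hip H (s i) u'" for u u' proof -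
  have "u - u' = 0" using s that sH H.diff[OF that(1,2)] unfolding H.total_def by (auto simp: H.hip_diff_right simp del: H.diff)
  then show ?thesis by simp
 qed
 obtain T0 where T0: "!!u. u : hcar H ==> T0 u : hcar K \<and> (\<forall>i\<in>I. hip K (t i) (T0 u) = hip H (s i) u) \<and> hnorm K (T0 u) = hnorm H u" using isometry_extension_vector[OF H K s tI gram] by metis
 define T where "T = restrict T0 (hcar H)"
 have TK: "T u : hcar K" and Tt: "!!i. i : I ==> hip K (t i) (T u) = hip H (s i) u" and Tn: "hnorm K (T u) = hnorm H u" if "u : hcar H" for u using T0[OF that] that by (auto simp: T_def)
 have lin: "linear_on (hcar H) T" unfolding linear_on_def by (auto intro!: uniq TK simp: Tt K.hip_add_right H.hip_add_right K.hip_scale_right H.hip_scale_right TK tK sH)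
 have bnd: "bounded_op H K T" unfolding bounded_op_def using TK Tn lin by (auto simp: T_def intro!: exI[of _ 1])
 have Ts: "T (s i) = t i" if "i : I" for i using that by (intro uniq TK sH tK) (auto simp: Tt sH gram)
 have iso: "hip K (T u) (T v) = hip H u v" if uv: "u : hcar H" "v : hcar H" for u v proof -
  \<comment> \<open>Polarisation: norms of sums give the real part, and replacing \<open>v\<close>
    by \<open>\<i> *c v\<close> gives the imaginary part.\<close>
  have re: "Re (hip K (T u) (T v)) = Re (hip H u v)" if "u : hcar H" "v : hcar H" for u v proof -
   have "T (u + v) = T u + T v" using lin that by (simp add: linear_on_def)
   then have "(hnorm K (T u + T v))^2 = (hnorm H (u + v))^2" using that Tn[of "u + v"] by simp
   then show ?thesis using that by (simp add: K.hnorm_add_sq H.hnorm_add_sq TK Tn)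
  qed
  have "T (\<i> *c v) = \<i> *c T v" using lin uv by (simp add: linear_on_def)
  then have "Im (hip K (T u) (T v)) = Im (hip H u v)" using re[of u "\<i> *c v"] uv by (simp add: K.hip_scale_right H.hip_scale_right TK)
  with re[OF uv] show ?thesis by (simp add: complex_eq_iff)
 qed
 have "inj_on T (hcar H)" by (rule inj_onI) (metis Tt uniq')
 moreover have "\<exists>u\<in>hcar H. T u = w" if w: "w : hcar K" for w proof -
  obtain u where "u : hcar H" "\<forall>i\<in>I. hip H (s i) u = hip K (t i) w" using isometry_extension_vector[OF K H t sI gram[symmetric] w] by blast
  then show ?thesis using w by (intro bexI[of _ u] uniq) (auto simp: Tt TK)
 qed
 ultimately have "bij_betw T (hcar H) (hcar K)" unfolding bij_betw_def using TK by (auto simp: image_iff)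
 then have "unitary_op H K T" unfolding unitary_op_def using lin iso by auto
 moreover have "T' = T" if "bounded_op H K T'" "!!i. i : I ==> T' (s i) = t i" for T' by (rule bounded_op_eqI[OF that(1) bnd H K s]) (auto simp: that Ts)
 ultimately show thesis using bnd Ts that by blast
qed

section \<open>Square-integrable functions\<close>

lemma cinner_cscale_left: "cinner (c *c x) y = cnj c * cinner x (y::'v::chilbert)" by (simp add: cinner_commute[of "c *c x"] cinner_commute[of x] cinner_cscale_right)

lemma norm_cscale: "norm (c *c (x::'v::chilbert)) = cmod c * norm x" proof -
 have "cor ((norm (c *c x))^2) = cor ((cmod c * norm x)^2)" using complex_norm_square[of c] cinner_norm[of "c *c x"] cinner_norm[of x] by (simp add: cinner_cscale_left cinner_cscale_right power_mult_distrib mult_ac)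
 then have "(norm (c *c x))^2 = (cmod c * norm x)^2" using of_real_eq_iff by blast
 then show ?thesis by (auto intro!: power2_eq_imp_eq)
qed

interpretation whole: hspace "whole :: 'v::chilbert hilb" rewrites whole_carrier [simp]: "hcar (whole :: 'v hilb) = UNIV" and whole_hip [simp]: "hip (whole :: 'v hilb) = cinner"
  and whole_norm [simp]: "hnorm (whole :: 'v hilb) = norm" proof -
 have n: "hnorm (whole :: 'v hilb) = norm" by (rule ext) (simp add: hnorm_def whole_def cinner_norm)
 show "hspace (whole :: 'v hilb)" proof
  fix s :: "nat => 'v"
  assume "!!e. e > 0 ==> \<exists>M. \<forall>m\<ge>M. \<forall>n\<ge>M. hnorm whole (s m - s n) < e"
  then have "Cauchy s" by (simp add: Cauchy_def dist_norm n)
  then obtain l where "s ----> l" by (auto simp: Cauchy_convergent_iff convergent_def)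
  then show "\<exists>l\<in>hcar whole. (%n. hnorm whole (s n - l)) ----> 0" unfolding n by (auto simp: whole_def tendsto_norm_zero_iff LIM_zero_iff)
 next
  show "hip (whole :: 'v hilb) u v = cnj (hip whole v u)" for u v unfolding whole_def by (simp only: hilb.select_convs) (rule cinner_commute)
 qed (auto simp: whole_def csubspace_def cinner_add_right cinner_cscale_right cinner_norm)
qed (auto simp: whole_def hnorm_def cinner_norm)

lemma cinner_Cauchy_Schwarz: "cmod (cinner x y) <= norm x * norm (y::'v::chilbert)" using whole.Cauchy_Schwarz by simp

lemma tendsto_cinner: assumes "(f ---> a) F" "(g ---> (b::'v::chilbert)) F" shows "((%x. cinner (f x) (g x)) ---> cinner a b) F" using whole.tendsto_hip[of f g a b F] assms by (simp add: tendsto_norm_zero_iff LIM_zero_iff)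

lemma cscale_scaleR: "c *c (r *\<^sub>R x) = r *\<^sub>R (c *c (x::'v::chilbert))" by (simp add: scaleR_cscale cscale_cscale mult.commute)

lemma tendsto_cscale: assumes "(c ---> a) F" "(g ---> (b::'v::chilbert)) F" shows "((%x. c x *c g x) ---> a *c b) F" proof -
 have "bounded_bilinear (%c (x::'v). c *c x)" proof
  show "\<exists>K. \<forall>c (x::'v). norm (c *c x) <= norm c * norm x * K" by (intro exI[of _ 1]) (simp add: norm_cscale)
  show "(r *\<^sub>R c) *c x = r *\<^sub>R (c *c x)" for r c and x :: 'v by (simp add: scaleR_cscale cscale_cscale scaleR_conv_of_real)
 qed (simp_all add: cscale_add_left cscale_add_right cscale_scaleR)
 from bounded_bilinear.tendsto[OF this assms] show ?thesis .
qed

lemma cinner_ext: assumes "!!v. cinner v x = cinner v (y::'v::chilbert)" shows "x = y" using whole.hip_eqI[of x y] assms by simp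

subsection \<open>Strong measurability\<close>

text \<open>In nonseparable spaces the pair of two Borel functions need not be Borel into the
  product space, so continuous binary operations are not automatically measurable. Countable ranges
  make every function of the pair measurable, and \<open>smeas_continuous2\<close> passes to the
  limit.\<close>

lemma measurable_countable_range2: assumes s: "s : bm M" "countable (range s)" and t: "t : bm M" "countable (range t)" shows "(%x. h (s x :: 'v::metric_space) (t x :: 'w::metric_space)) : bm M" proof -
 have "(%x. (s x, t x)) : measurable M (count_space (range s \<times> range t))" proof (subst measurable_count_space_eq_countable)
  show "countable (range s \<times> range t)" using assms by auto
  have "(%x. (s x, t x)) -` {(a, b)} \<inter> space M : sets M" for a b proof -
   have "(%x. (s x, t x)) -` {(a, b)} \<inter> space M = (s -` {a} \<inter> space M) \<inter> (t -` {b} \<inter> space M)" by auto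
   also have "... : sets M" by (intro sets.Int measurable_sets[OF s(1)] measurable_sets[OF t(1)]) auto
   finally show ?thesis .
  qed
  then show "(%x. (s x, t x)) : space M \<rightarrow> range s \<times> range t \<and> (\<forall>a\<in>range s \<times> range t. (%x. (s x, t x)) -` {a} \<inter> space M : sets M)" by auto
 qed
 from measurable_compose[OF this, of "%(a, b). h a b" borel] show ?thesis by simp
qed

text \<open>The approximation takes the first point, in an enumeration of the countable set, within
  \<open>1 / Suc n\<close> of \<open>f x\<close>; a least index depends measurably on
  \<open>x\<close>.\<close>

lemma smeas_approx: fixes f :: "'a => 'v::chilbert" assumes "smeas M f" obtains s :: "nat => 'a => 'v" where "!!n. s n : bm M" "!!n. countable (range (s n))"
  "!!x. x : space M ==> (%n. s n x) ----> f x" proof (cases "space M = {}")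
 case True
 then show thesis by (intro that[of "%_ _. 0"]) (auto simp: measurable_def)
next
 case False
 obtain C where C: "countable C" "!!x. x : space M ==> f x : closure C" and f: "f : bm M" using assms by (auto simp: strongly_measurable_def)
 have ne: "C ~= {}" using False C(2) by fastforce
 define c where "c = from_nat_into C"
 define k where "k n x = (LEAST k. f x : ball (c k) (1 / Suc n))" for n x
 have ex: "\<exists>k. f x : ball (c k) (1 / Suc n)" if x: "x : space M" for n x proof -
  obtain y where "y : C" "dist y (f x) < 1 / Suc n" using C(2)[OF x] unfolding closure_approachable by (meson of_nat_0_less_iff zero_less_Suc zero_less_divide_1_iff)
  then show ?thesis using from_nat_into_surj[OF C(1), of y] by (auto simp: c_def)
 qed
 have k: "k n : measurable M (count_space UNIV)" for n unfolding k_def proof (rule measurable_Least)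
  fix i
  have "f -` ball (c i) (1 / Suc n) \<inter> space M : sets M" by (rule measurable_sets[OF f]) simp
  moreover have "f -` ball (c i) (1 / Suc n) \<inter> space M = {x : space M. f x : ball (c i) (1 / Suc n)}" by auto
  ultimately show "Measurable.pred M (%x. f x : ball (c i) (1 / Suc n))" by (simp only: pred_def)
 qed
 show thesis proof
  show "(%x. c (k n x)) : bm M" for n using measurable_compose[OF k, of c borel n] by simp
  show "countable (range (%x. c (k n x)))" for n by (rule countable_subset[of _ "range c"]) auto
  show "(%n. c (k n x)) ----> f x" if x: "x : space M" for x proof (rule metric_LIMSEQ_I)
   fix e :: real assume "e > 0"
   then obtain N where N: "1 / Suc N < e" using nat_approx_posE by blast
   have "dist (c (k n x)) (f x) < e" if "n \<ge> N" for n proof -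
    have "f x : ball (c (k n x)) (1 / Suc n)" unfolding k_def by (rule LeastI_ex) (rule ex[OF x])
    moreover have "1 / real (Suc n) <= 1 / real (Suc N)" using that by (intro divide_left_mono) auto
    ultimately show ?thesis using N by simp
   qed
   then show "\<exists>no. \<forall>n\<ge>no. dist (c (k n x)) (f x) < e" by blast
  qed
 qed
qed

lemma smeas_limit: assumes "!!n. s n : bm M" "!!n. countable (range (s n))" and "!!x. x : space M ==> (%n::nat. s n x) ----> (f x :: 'v::chilbert)" shows "smeas M f" unfolding strongly_measurable_def proof
 show "f : bm M" by (rule borel_measurable_LIMSEQ_metric[of s]) (use assms in auto)
 show "\<exists>C. countable C \<and> (\<forall>x\<in>space M. f x : closure C)" proof (intro exI conjI ballI)
  show "countable (\<Union>n. range (s n))" using assms by auto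
  show "f x : closure (\<Union>n. range (s n))" if "x : space M" for x using assms(3)[OF that] by (auto simp: closure_sequential intro!: exI[of _ "%n. s n x"])
 qed
qed

lemma smeas_continuous2: fixes f :: "'a => 'v::chilbert" and g :: "'a => 'w::chilbert" and h :: "'v => 'w => 'u::chilbert" assumes f: "smeas M f" and g: "smeas M g"
  and h: "!!u v a b. u ----> a ==> v ----> b ==> (%n. h (u n) (v n)) ----> h a b" shows "smeas M (%x. h (f x) (g x))" proof -
 obtain s where s: "!!n. s n : bm M" "!!n. countable (range (s n))"
  "!!x. x : space M ==> (%n. s n x) ----> f x" using smeas_approx[OF f] by blast
 obtain t where t: "!!n. t n : bm M" "!!n. countable (range (t n))"
  "!!x. x : space M ==> (%n. t n x) ----> g x" using smeas_approx[OF g] by blast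
 show ?thesis proof (rule smeas_limit)
  show "(%x. h (s n x) (t n x)) : bm M" for n by (rule measurable_countable_range2) (use s t in auto)
  have "range (%x. h (s n x) (t n x)) <= (%(a, b). h a b) ` (range (s n) \<times> range (t n))" for n by auto
  then show "countable (range (%x. h (s n x) (t n x)))" for n by (rule countable_subset) (use s(2) t(2) in auto)
  show "(%n. h (s n x) (t n x)) ----> h (f x) (g x)" if "x : space M" for x using s(3) t(3) that by (intro h) auto
 qed
qed

lemma smeas_separable:
 "smeas M (f :: 'a => 'v::{chilbert,second_countable_topology}) \<longleftrightarrow> f : bm M" proof -
 obtain D :: "'v set" where D: "countable D" "!!X. open X ==> X ~= {} ==> \<exists>d\<in>D. d : X" using countable_dense_exists by blast
 have "v : closure D" for v unfolding closure_approachable using D(2)[of "ball v _"] by (auto simp: dist_commute)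
 then show ?thesis using D(1) by (auto simp: strongly_measurable_def)
qed

lemma smeas_complex [simp]:
 "smeas M (f :: 'a => complex) \<longleftrightarrow> f : bm M" by (rule smeas_separable)

lemma smeas_borel: "smeas M f ==> f : bm M" by (simp add: strongly_measurable_def)

lemma smeas_const: "smeas M (%_. c)" unfolding strongly_measurable_def by (auto intro!: exI[of _ "{c}"])

lemma smeas_add:
 "smeas M f ==> smeas M g ==> smeas M (%x. f x + g x)" by (rule smeas_continuous2) (auto intro: tendsto_add)

lemma smeas_diff:
 "smeas M f ==> smeas M g ==> smeas M (%x. f x - g x)" by (rule smeas_continuous2) (auto intro: tendsto_diff)

lemma smeas_cscale:
 "c : bm M ==> smeas M g ==> smeas M (%x. c x *c g x)" by (rule smeas_continuous2[where h = "%c x. c *c x"]) (auto intro: tendsto_cscale)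

lemma borel_measurable_cinner:
 "smeas M f ==> smeas M g ==> (%x. cinner (f x) (g x)) : bm M" using smeas_continuous2[of M f g cinner] by (simp add: tendsto_cinner)

lemma smeas_compose: assumes f: "smeas N f" and g: "g : measurable M N" shows "smeas M (%x. f (g x))" using assms measurable_space[OF g] unfolding strongly_measurable_def by (auto intro: measurable_compose)

lemma smeas_LIMSEQ: assumes "!!n. smeas M (s n)" "!!x. x : space M ==> (%n::nat. s n x) ----> f x" shows "smeas M f" proof -
 have "\<forall>n. \<exists>C. countable C \<and> (\<forall>x\<in>space M. s n x : closure C)" using assms(1) by (auto simp: strongly_measurable_def)
 then obtain C where C: "!!n. countable (C n)" "!!n x. x : space M ==> s n x : closure (C n)" by metis
 have "f x : closure (\<Union>n. C n)" if x: "x : space M" for x proof -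
  have "s n x : closure (\<Union>n. C n)" for n using C(2)[OF x, of n] closure_mono[of "C n" "\<Union>n. C n"] by auto
  then have "f x : closure (closure (\<Union>n. C n))" using assms(2)[OF x] by (subst closure_sequential) (auto intro!: exI[of _ "%n. s n x"])
  then show ?thesis by simp
 qed
 moreover have "f : bm M" by (rule borel_measurable_LIMSEQ_metric[of s]) (use assms in "auto simp: smeas_borel")
 ultimately show ?thesis unfolding strongly_measurable_def using C(1) by (auto intro!: exI[of _ "\<Union>n. C n"])
qed

lemma smeas_sets_cong: fixes f :: "'a => 'v::chilbert" shows "sets M = sets N ==> smeas M f \<longleftrightarrow> smeas N f" using sets_eq_imp_space_eq[of M N] measurable_cong_sets[of M N "borel :: 'v measure" borel, OF _ refl]
 by (simp add: strongly_measurable_def)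

lemma borel_measurable_norm_sq:
 "smeas M f ==> (%x. (norm (f x))^2) : bm M" using smeas_borel[of M f] by measurable

subsection \<open>Functions up to null sets\<close>

lemma mk_eq_iff: "mk f = mk g \<longleftrightarrow> (AE x in (vol :: 'a::vol measure). f x = g x)" by (simp add: aefun.abs_eq_iff)

lemma mk_plus: "mk f + mk g = mk (%x. f x + g x)" by (simp add: plus_aefun.abs_eq)

lemma mk_scale: "c *c mk f = mk (%x. c *c f x)" by (simp add: cscale_aefun.abs_eq)

lemma mk_minus: "mk f - mk g = mk (%x. f x - g x)" by (simp add: minus_aefun.abs_eq)

lemma mk_zero: "0 = mk (%_. 0)" by (simp add: zero_aefun_def)

lemma mk_sum: "(\<Sum>i\<in>I. mk (f i)) = mk (%x. \<Sum>i\<in>I. f i x :: 'v::cvector)" by (induction I rule: infinite_finite_induct) (auto simp: mk_plus mk_zero)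

lemma repr_mk: fixes f :: "'a::vol => 'v::chilbert" assumes "smeas vol f" shows "smeas vol (repr (mk f))" "mk (repr (mk f)) = mk f"
  "AE x in (vol :: 'a measure). repr (mk f) x = f x" proof -
 have "smeas vol (repr (mk f)) \<and> mk (repr (mk f)) = mk f" unfolding repr_def by (rule someI[of _ f]) (use assms in simp)
 then show "smeas vol (repr (mk f))" "mk (repr (mk f)) = mk f" by auto
 then show "AE x in (vol :: 'a measure). repr (mk f) x = f x" by (simp add: mk_eq_iff)
qed

text \<open>The square-integrable functions that are constant on the classes of \<open>R\<close> and vanish on \<open>Z\<close>:
 with \<open>R\<close> the permutation of momenta this is the Fock space, and \<open>Z\<close> bounds the particle number.\<close>

definition inv_L2 :: "'a::vol measure => ('a => 'a => bool) => 'a set => ('a, 'v::chilbert) aefun hilb" where "inv_L2 M R Z = \<lparr>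
  hcarrier = {mk f | f. sqint M f \<and> (\<forall>x y. R x y --> f x = f y) \<and> (\<forall>x\<in>Z. f x = 0)}, hip = hip (L2 M)\<rparr>"

lemma L2_eq_inv_L2: "L2 M = inv_L2 M (=) {}" by (simp add: inv_L2_def L2_def)

lemma hip_inv_L2: "hip (inv_L2 M R Z) = hip (L2 M)" by (simp add: inv_L2_def)

lemma hnorm_inv_L2: "hnorm (inv_L2 M R Z) = hnorm (L2 M)" by (simp add: inv_L2_def hnorm_def fun_eq_iff)

lemma inv_L2_mono: "(!!x y. R' x y ==> R x y) ==> Z' <= Z ==> hcar (inv_L2 M R Z) <= hcar (inv_L2 M R' Z')" by (auto simp: inv_L2_def) blast

lemma inv_L2E: assumes "u : hcar (inv_L2 M R Z)" obtains f where "u = mk f" "sqint M f" "!!x y. R x y ==> f x = f y" "!!x. x : Z ==> f x = 0" using assms by (auto simp: inv_L2_def)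

lemma inv_L2I: assumes "sqint M f" "!!x y. R x y ==> f x = f y" "!!x. x : Z ==> f x = 0" shows "mk f : hcar (inv_L2 M R Z)" using assms by (auto simp: inv_L2_def)

lemma norm_add_sq_le: "(norm (a + b))^2 <= 2 * (norm a)^2 + 2 * (norm (b::'v::real_normed_vector))^2" proof -
 have "(norm (a + b))^2 <= (norm a + norm b)^2" by (intro power_mono norm_triangle_ineq) auto
 also have "... <= 2 * (norm a)^2 + 2 * (norm b)^2" using sum_squares_bound[of "norm a" "norm b"] by (simp add: power2_sum)
 finally show ?thesis .
qed

text \<open>Equality of classes refers to \<open>vol\<close>, norms and inner products to
  \<open>M\<close>. Equal measurable sets and equal null sets let almost-everywhere statements pass
  between the two.\<close>

locale vol_measure = fixes M :: "'a::vol measure" assumes sets_M: "sets M = sets vol" and null_M: "null_sets M = null_sets vol"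
begin

lemma space_M: "space M = space vol" using sets_M by (rule sets_eq_imp_space_eq)

lemma AE_vol_iff: "(AE x in vol. P x) \<longleftrightarrow> (AE x in M. P x)" by (simp add: eventually_ae_filter null_M space_M)

lemma mk_eq_iff_M: "mk f = mk g \<longleftrightarrow> (AE x in M. f x = g x)" by (simp add: mk_eq_iff AE_vol_iff)

lemma smeas_vol_iff: "smeas vol f \<longleftrightarrow> smeas M f" using smeas_sets_cong[OF sets_M] by blast

lemma repr_M: assumes "smeas M f" shows "smeas M (repr (mk f))" "mk (repr (mk f)) = mk f"
  "AE x in M. repr (mk f) x = f x" using repr_mk[of f] assms by (auto simp: smeas_vol_iff AE_vol_iff)

lemma sqint_iff:
 "sqint M f \<longleftrightarrow> smeas M f \<and> (nni M (%x. en ((norm (f x))^2))) < \<infinity>" by (simp add: square_integrable_def smeas_vol_iff)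

lemma sqint_strong: "sqint M f ==> smeas M f" by (simp add: sqint_iff)

lemma sqint_borel [measurable_dest]: "sqint M f ==> f : bm M" by (simp add: sqint_iff smeas_borel)

lemma sqint_norm_sq: "sqint M f ==> integrable M (%x. (norm (f x))^2)" by (rule integrableI_bounded) (auto simp: sqint_iff borel_measurable_norm_sq)

lemma sqint_cong_AE: assumes "sqint M f" "smeas M g" "AE x in M. f x = g x" shows "sqint M g" proof -
 have "(nni M (%x. en ((norm (g x))^2))) = (nni M (%x. en ((norm (f x))^2)))" by (rule nn_integral_cong_AE) (use assms(3) in eventually_elim, auto)
 then show ?thesis using assms by (auto simp: sqint_iff)
qed

lemma sqint_zero: "sqint M (%_. 0)" by (simp add: sqint_iff smeas_const)

lemma sqint_bounded: assumes g: "sqint M g" and f: "smeas M f" and le: "AE x in M. norm (f x) <= C * norm (g x)" shows "sqint M f" proof -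
 have "(nni M (%x. en ((norm (f x))^2))) <= (nni M (%x. en (C\<^sup>2) * en ((norm (g x))^2)))" proof (rule nn_integral_mono_AE, use le in eventually_elim)
  fix x assume "norm (f x) <= C * norm (g x)"
  then have "(norm (f x))^2 <= (C * norm (g x))^2" by (intro power_mono) auto
  then show "en ((norm (f x))^2) <= en (C\<^sup>2) * en ((norm (g x))^2)" by (simp add: power_mult_distrib flip: ennreal_mult)
 qed
 also have "... = en (C\<^sup>2) * (nni M (%x. en ((norm (g x))^2)))" using g borel_measurable_norm_sq[OF sqint_strong[OF g]] by (intro nn_integral_cmult) auto
 also have "... < \<infinity>" using g by (auto simp: sqint_iff ennreal_mult_less_top)
 finally show ?thesis using f by (simp add: sqint_iff)
qed

lemma sqint_add: assumes f: "sqint M f" and g: "sqint M g" shows "sqint M (%x. f x + g x)" proof -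
 have [measurable]: "f : bm M" "g : bm M" using f g by (auto simp: sqint_borel)
 have "(nni M (%x. en ((norm (f x + g x))^2))) <= (nni M (%x. 2 * en ((norm (f x))^2) + 2 * en ((norm (g x))^2)))" proof (rule nn_integral_mono)
  fix x
  have "en ((norm (f x + g x))^2) <= en (2 * (norm (f x))^2 + 2 * (norm (g x))^2)" by (intro ennreal_leI norm_add_sq_le)
  also have "... = 2 * en ((norm (f x))^2) + 2 * en ((norm (g x))^2)" by (simp add: ennreal_mult' ennreal_plus)
  finally show "en ((norm (f x + g x))^2) <= 2 * en ((norm (f x))^2) + 2 * en ((norm (g x))^2)" .
 qed
 also have "... = 2 * (nni M (%x. en ((norm (f x))^2))) + 2 * (nni M (%x. en ((norm (g x))^2)))" by (simp add: nn_integral_add nn_integral_cmult)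
 also have "... < \<infinity>" using f g by (auto simp: sqint_iff ennreal_mult_less_top)
 finally show ?thesis using f g by (simp add: sqint_iff smeas_add)
qed

lemma sqint_scale: "sqint M f ==> sqint M (%x. c *c f x)" by (rule sqint_bounded[where g = f and C = "cmod c"]) (auto simp: norm_cscale sqint_strong intro!: smeas_cscale)

lemma sqint_diff:
 "sqint M f ==> sqint M g ==> sqint M (%x. f x - g x)" using sqint_add[of f "%x. (-1) *c g x"] sqint_scale[of g "-1"] by (simp add: cscale_minus_left cscale_one)

lemma integrable_cinner: assumes f: "sqint M f" and g: "sqint M g" shows "integrable M (%x. cinner (f x) (g x))" proof (rule Bochner_Integration.integrable_bound)
 show "integrable M (%x. (norm (f x))^2 + (norm (g x))^2)" using f g by (intro Bochner_Integration.integrable_add sqint_norm_sq)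
 show "(%x. cinner (f x) (g x)) : bm M" using f g by (intro borel_measurable_cinner sqint_strong)
 have "cmod (cinner (f x) (g x)) <= (norm (f x))^2 + (norm (g x))^2" for x proof -
  have "cmod (cinner (f x) (g x)) <= norm (f x) * norm (g x)" by (rule cinner_Cauchy_Schwarz)
  also have "... <= (norm (f x))^2 + (norm (g x))^2" using sum_squares_bound[of "norm (f x)" "norm (g x)"] mult_nonneg_nonneg[OF norm_ge_zero[of "f x"] norm_ge_zero[of "g x"]] by linarith
  finally show ?thesis .
 qed
 then show "AE x in M. norm (cinner (f x) (g x)) <= norm ((norm (f x))^2 + (norm (g x))^2)" by simp
qed

lemma hip_mk: assumes "smeas M f" "smeas M g" shows "hip (L2 M) (mk f) (mk g) = (itg M (%x. cinner (f x) (g x)))" proof -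
 have "(itg M (%x. cinner (repr (mk f) x) (repr (mk g) x))) = (itg M (%x. cinner (f x) (g x)))" proof (rule integral_cong_AE)
  show "AE x in M. cinner (repr (mk f) x) (repr (mk g) x) = cinner (f x) (g x)" using repr_M(3)[OF assms(1)] repr_M(3)[OF assms(2)] by eventually_elim simp
 qed (intro borel_measurable_cinner repr_M assms)+
 then show ?thesis by (simp add: L2_def)
qed

lemma Re_hip_mk: assumes "sqint M f" shows "Re (hip (L2 M) (mk f) (mk f)) = (itg M (%x. (norm (f x))^2))" proof -
 have "hip (L2 M) (mk f) (mk f) = (itg M (%x. cor ((norm (f x))^2)))" using assms by (simp add: hip_mk sqint_strong cinner_norm)
 also have "... = cor (itg M (%x. (norm (f x))^2))" by (rule integral_complex_of_real)
 finally show ?thesis by simp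
qed

lemma hnorm_mk_nonneg: "sqint M f ==> 0 <= hnorm (L2 M) (mk f)" by (simp add: hnorm_def Re_hip_mk)

lemma hnorm_mk: assumes "sqint M f" shows "en ((hnorm (L2 M) (mk f))^2) = (nni M (%x. en ((norm (f x))^2)))" using sqint_norm_sq[OF assms] Re_hip_mk[OF assms] by (simp add: nn_integral_eq_integral hnorm_def)

lemma hnorm_mk_le: assumes "sqint M f" "(nni M (%x. en ((norm (f x))^2))) <= en (c\<^sup>2)" "0 <= c" shows "hnorm (L2 M) (mk f) <= c" proof (rule power2_le_imp_le)
 have "en ((hnorm (L2 M) (mk f))^2) <= en (c\<^sup>2)" unfolding hnorm_mk[OF assms(1)] by (rule assms(2))
 then show "(hnorm (L2 M) (mk f))^2 <= c\<^sup>2" by (subst (asm) ennreal_le_iff) auto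
qed (rule assms(3))

text \<open>Riesz-Fischer with a constraint: the limit must satisfy the \<open>R\<close>-invariance
  and the vanishing on \<open>Z\<close> at every point, because the carriers demand them exactly of
  some representative.\<close>

lemma L2_complete: fixes f :: "nat => 'a => 'v::chilbert" assumes f: "!!n. sqint M (f n)" and R: "!!n x y. R x y ==> f n x = f n y" and Z: "!!n x. x : Z ==> f n x = 0"
  and Cauchy: "!!e. e > 0 ==> \<exists>N. \<forall>m\<ge>N. \<forall>n\<ge>N. (nni M (%x. en ((norm (f m x - f n x))^2))) <= en e" obtains F where "sqint M F" "!!x y. R x y ==> F x = F y" "!!x. x : Z ==> F x = 0"
  "!!e. e > 0 ==> \<exists>N. \<forall>n\<ge>N. (nni M (%x. en ((norm (f n x - F x))^2))) <= en e" proof -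
 have fs: "smeas M (f n)" for n using f by (rule sqint_strong)
 \<comment> \<open>The rate \<open>(1/4)^k\<close> is for squared distances: weighted by
   \<open>2^k\<close> the differences still have a summable integral, and finiteness of
   \<open>g x\<close> bounds \<open>d k x\<close> by a geometric sequence of ratio
   \<open>1 / sqrt 2\<close>.\<close>
 have "\<exists>r. \<forall>k. (\<forall>n\<ge>r k. (nni M (%x. en ((norm (f (r k) x - f n x))^2))) <= en ((1/4)^k)) \<and> r k < r (Suc k)" proof (rule dependent_nat_choice)
  show "\<exists>r. \<forall>n\<ge>r. (nni M (%x. en ((norm (f r x - f n x))^2))) <= en ((1/4)^0)" using Cauchy[of 1] by auto
  fix r k
  obtain N where N: "!!m n. m \<ge> N ==> n \<ge> N ==> (nni M (%x. en ((norm (f m x - f n x))^2))) <= en ((1/4)^Suc k)" using Cauchy[of "(1/4)^Suc k"] by auto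
  show "\<exists>r'. (\<forall>n\<ge>r'. (nni M (%x. en ((norm (f r' x - f n x))^2))) <= en ((1/4)^Suc k)) \<and> r < r'" by (rule exI[of _ "max N (Suc r)"]) (auto intro!: N simp del: power_Suc)
 qed
 then obtain r where r: "!!k n. n \<ge> r k ==> (nni M (%x. en ((norm (f (r k) x - f n x))^2))) <= en ((1/4)^k)" and r_Suc: "!!k. r k < r (Suc k)" by blast
 have r_mono: "strict_mono r" using r_Suc by (simp add: strict_mono_Suc_iff)
 define d where "d k x = norm (f (r k) x - f (r (Suc k)) x)" for k x
 have d_meas [measurable]: "d k : bm M" for k unfolding d_def using smeas_borel[OF smeas_diff[OF fs fs]] by measurable
 define g where "g x = (\<Sum>k. en (2^k * (d k x)^2))" for x
 have g_meas [measurable]: "g : bm M" unfolding g_def by measurable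
 have "(nni M (%x. g x)) = (\<Sum>k. nni M (%x. en (2^k * (d k x)^2)) )" unfolding g_def by (rule nn_integral_suminf) measurable
 also have "... <= (\<Sum>k. en ((1/2)^k))" proof (rule suminf_le)
  fix k
  have "(nni M (%x. en (2^k * (d k x)^2))) = en (2^k) * (nni M (%x. en ((d k x)^2)))" by (simp add: ennreal_mult nn_integral_cmult)
  also have "... <= en (2^k) * en ((1/4)^k)" unfolding d_def using r[of k "r (Suc k)"] r_Suc[of k] by (intro mult_left_mono) auto
  also have "... = en ((1/2)^k)" by (simp flip: ennreal_mult power_mult_distrib)
  finally show "(nni M (%x. en (2^k * (d k x)^2))) <= en ((1/2)^k)" .
 qed auto
 also have "... = en (\<Sum>k. (1/2)^k)" by (intro suminf_ennreal2) (auto simp: summable_geometric)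
 also have "... < \<infinity>" by simp
 finally have g_fin: "AE x in M. g x ~= \<infinity>" by (intro nn_integral_PInf_AE) auto
 \<comment> \<open>\<open>g\<close> is built from the \<open>f n\<close> alone, so two points
   related by \<open>R\<close> are both inside or both outside \<open>E\<close>; setting the limit
   to zero off \<open>E\<close> therefore preserves the invariance.\<close>
 define E where "E = {x. g x ~= \<infinity>}"
 have conv: "convergent (%k. f (r k) x)" if xE: "x : E" for x proof -
  obtain c where c: "g x = en c" "c \<ge> 0" using xE by (cases "g x") (auto simp: E_def)
  have dk: "d k x <= sqrt c * (1 / sqrt 2)^k" for k proof -
   have "en (2^k * (d k x)^2) <= g x" unfolding g_def by (rule order_trans[OF _ sum_le_suminf[where I = "{k}"]]) auto
   then have "2^k * (d k x)^2 <= c" unfolding c(1) using c(2) by (subst (asm) ennreal_le_iff)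
   then have "(d k x)^2 <= c * (1/2)^k" by (simp add: field_simps power_divide)
   also have "... = (sqrt c * (1 / sqrt 2)^k)^2" using c by (simp add: power_mult_distrib power_divide flip: power_mult) (metis mult.commute power_mult real_sqrt_pow2 zero_le_numeral)
   finally show ?thesis using c by (auto intro: power2_le_imp_le)
  qed
  have "summable (%k. sqrt c * (1 / sqrt 2)^k)" by (intro summable_mult summable_geometric) auto
  then have "summable (%k. f (r (Suc k)) x - f (r k) x)" by (rule summable_comparison_test') (use dk in "auto simp: d_def norm_minus_commute")
  then have "convergent (%n. \<Sum>k<n. f (r (Suc k)) x - f (r k) x)" by (simp add: summable_iff_convergent)
  then have "convergent (%n. f (r n) x - f (r 0) x)" by (simp add: sum_lessThan_telescope[of "%k. f (r k) x"])
  then show ?thesis by (simp add: convergent_diff_const_right_iff)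
 qed
 define h where "h k x = (indicator E x :: complex) *c f (r k) x" for k x
 define F where "F x = (if x : E then lim (%k. f (r k) x) else 0)" for x
 have hF: "(%k. h k x) ----> F x" for x using conv[of x] by (auto simp: h_def F_def cscale_one convergent_LIMSEQ_iff)
 have E_sets: "{x : space M. x : E} : sets M" unfolding E_def by measurable
 have h_strong: "smeas M (h k)" for k proof -
  have "(%x. indicator E x :: complex) : bm M" using E_sets by (subst borel_measurable_indicator_iff) (simp add: Int_def conj_commute)
  then show ?thesis unfolding h_def by (intro smeas_cscale fs)
 qed
 have F_strong: "smeas M F" using h_strong hF by (rule smeas_LIMSEQ)
 have fF: "AE x in M. (%k. f (r k) x) ----> F x" using g_fin proof eventually_elim
  case (elim x)
  then show ?case using hF[of x] by (simp add: h_def E_def cscale_one)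
 qed
 have est: "\<exists>N. \<forall>n\<ge>N. (nni M (%x. en ((norm (f n x - F x))^2))) <= en e" if e: "e > 0" for e proof -
  obtain N where N: "!!m n. m \<ge> N ==> n \<ge> N ==> (nni M (%x. en ((norm (f m x - f n x))^2))) <= en e" using Cauchy[OF e] by blast
  have "(nni M (%x. en ((norm (f n x - F x))^2))) <= en e" if n: "n \<ge> N" for n proof -
   have "(nni M (%x. en ((norm (f n x - F x))^2))) = (nni M (%x. liminf (%k. en ((norm (f n x - f (r k) x))^2))))" proof (rule nn_integral_cong_AE, use fF in eventually_elim)
    fix x assume "(%k. f (r k) x) ----> F x"
    then have "(%k. en ((norm (f n x - f (r k) x))^2)) ----> en ((norm (f n x - F x))^2)" by (intro tendsto_ennrealI tendsto_intros)
    then show "en ((norm (f n x - F x))^2) = liminf (%k. en ((norm (f n x - f (r k) x))^2))" by (intro lim_imp_Liminf[symmetric]) auto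
   qed
   also have "... <= liminf (%k. nni M (%x. en ((norm (f n x - f (r k) x))^2)) )" using smeas_borel[OF smeas_diff[OF fs fs]] by (intro nn_integral_liminf) measurable
   also have "... <= liminf (%k. en e)" proof (rule Liminf_mono)
    have "r k \<ge> N" if "k \<ge> N" for k using seq_suble[OF r_mono, of k] that by linarith
    then show "\<forall>\<^sub>F k in sequentially. (nni M (%x. en ((norm (f n x - f (r k) x))^2))) <= en e" using N n by (auto simp: eventually_sequentially intro!: exI[of _ N])
   qed
   also have "... = en e" by (simp add: Liminf_const)
   finally show ?thesis .
  qed
  then show ?thesis by blast
 qed
 have "sqint M F" proof -
  obtain N where "(nni M (%x. en ((norm (f N x - F x))^2))) <= en 1" using est[of 1] by auto
  then have "(nni M (%x. en ((norm (f N x - F x))^2))) < \<infinity>" by (rule order_le_less_trans) simp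
  then have "sqint M (%x. f N x - F x)" by (simp add: sqint_iff smeas_diff fs F_strong)
  then have "sqint M (%x. f N x - (f N x - F x))" by (rule sqint_diff[OF f])
  then show ?thesis by simp
 qed
 moreover have "F x = F y" if xy: "R x y" for x y proof -
  have "f n x = f n y" for n using R[OF xy] .
  then show ?thesis by (simp add: F_def E_def g_def d_def)
 qed
 moreover have "F x = 0" if "x : Z" for x proof (rule LIMSEQ_unique[OF hF])
  show "(%k. h k x) ----> 0" using Z[OF that] by (simp add: h_def)
 qed
 ultimately show thesis using est that by blast
qed

text \<open>One proof serves \<open>L2\<close>, \<open>fock\<close>, \<open>fock_le\<close> and
  \<open>full_le\<close>, which differ only in the choice of \<open>R\<close> and
  \<open>Z\<close>.\<close>

lemma hspace_inv_L2: "hspace (inv_L2 M R Z :: ('a, 'v::chilbert) aefun hilb)" proof -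
 let ?H = "inv_L2 M R Z :: ('a, 'v) aefun hilb"
 note sq = sqint_strong
 have sub: "csubspace (hcar ?H)" unfolding csubspace_def proof (intro conjI ballI allI)
  show "0 : hcar ?H" unfolding mk_zero by (intro inv_L2I sqint_zero) auto
  fix u v assume "u : hcar ?H" "v : hcar ?H"
  then obtain f g where "u = mk f" "sqint M f" "!!x y. R x y ==> f x = f y" "!!x. x : Z ==> f x = 0"
   "v = mk g" "sqint M g" "!!x y. R x y ==> g x = g y" "!!x. x : Z ==> g x = 0" by (elim inv_L2E) blast
  then show "u + v : hcar ?H" by (simp add: mk_plus) (intro inv_L2I sqint_add; simp)
 next
  fix c u assume "u : hcar ?H"
  then obtain f where "u = mk f" "sqint M f" "!!x y. R x y ==> f x = f y" "!!x. x : Z ==> f x = 0" by (elim inv_L2E) blast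
  then show "c *c u : hcar ?H" by (simp add: mk_scale) (intro inv_L2I sqint_scale; simp)
 qed
 show ?thesis proof
  show "csubspace (hcar ?H)" by (rule sub)
  fix u v assume "u : hcar ?H" "v : hcar ?H"
  then obtain f g where f: "u = mk f" "sqint M f" and g: "v = mk g" "sqint M g" by (elim inv_L2E) blast
  have "(itg M (%x. cinner (f x) (g x))) = cnj (itg M (%x. cinner (g x) (f x)))" unfolding Bochner_Integration.integral_cnj[symmetric] by (intro Bochner_Integration.integral_cong refl cinner_commute)
  then show "hip ?H u v = cnj (hip ?H v u)" by (simp add: hip_inv_L2 f g hip_mk sq)
  show "hip ?H u (c *c v) = c * hip ?H u v" for c using f g by (simp add: hip_inv_L2 mk_scale hip_mk sq sqint_scale cinner_cscale_right)
 next
  fix u v w assume "u : hcar ?H" "v : hcar ?H" "w : hcar ?H"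
  then obtain f g h where "u = mk f" "sqint M f" "v = mk g" "sqint M g"
   "w = mk h" "sqint M h" by (elim inv_L2E) blast
  then show "hip ?H u (v + w) = hip ?H u v + hip ?H u w" by (simp add: hip_inv_L2 mk_plus hip_mk sq sqint_add cinner_add_right integrable_cinner)
 next
  fix u assume "u : hcar ?H"
  then obtain f where f: "u = mk f" "sqint M f" by (elim inv_L2E) blast
  have eq: "Re (hip ?H u u) = (itg M (%x. (norm (f x))^2))" using f by (simp add: hip_inv_L2 Re_hip_mk)
  show "0 <= Re (hip ?H u u)" unfolding eq by simp
  assume "Re (hip ?H u u) = 0"
  then have "AE x in M. (norm (f x))^2 = 0" unfolding eq using sqint_norm_sq[OF f(2)] by (subst (asm) integral_nonneg_eq_0_iff_AE) auto
  then show "u = 0" unfolding f(1) mk_zero mk_eq_iff_M by simp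
 next
  fix s :: "nat => ('a, 'v) aefun"
  assume s: "!!n. s n : hcar ?H" and C: "!!e. e > 0 ==> \<exists>N. \<forall>m\<ge>N. \<forall>n\<ge>N. hnorm ?H (s m - s n) < e"
  have "\<forall>n. \<exists>f. s n = mk f \<and> sqint M f \<and> (\<forall>x y. R x y --> f x = f y) \<and> (\<forall>x\<in>Z. f x = 0)" using s by (auto simp: inv_L2_def)
  then obtain f where f: "!!n. s n = mk (f n)" "!!n. sqint M (f n)"
   "!!n x y. R x y ==> f n x = f n y" "!!n x. x : Z ==> f n x = 0" by metis
  have nm: "(nni M (%x. en ((norm (f m x - g x))^2))) = en ((hnorm ?H (s m - mk g))^2)" if "sqint M g" for m g unfolding hnorm_inv_L2 f(1) mk_minus using f(2) that by (intro hnorm_mk[symmetric] sqint_diff)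
  have nonneg: "0 <= hnorm ?H (s m - mk g)" if "sqint M g" for m g unfolding f(1) hnorm_inv_L2 mk_minus using f(2) that by (intro hnorm_mk_nonneg sqint_diff)
  have "\<exists>N. \<forall>m\<ge>N. \<forall>n\<ge>N. (nni M (%x. en ((norm (f m x - f n x))^2))) <= en e" if e: "e > 0" for e proof -
   obtain N where N: "!!m n. m \<ge> N ==> n \<ge> N ==> hnorm ?H (s m - s n) < sqrt e" using C[of "sqrt e"] e by auto
   have "(nni M (%x. en ((norm (f m x - f n x))^2))) <= en e" if "m \<ge> N" "n \<ge> N" for m n proof -
    have "(hnorm ?H (s m - s n))^2 <= (sqrt e)^2" using N[OF that] nonneg[OF f(2), of m n] by (intro power_mono) (auto simp: f(1))
    then show ?thesis using e nm[OF f(2), of m n] by (simp add: f(1) ennreal_leI)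
   qed
   then show ?thesis by blast
  qed
  from L2_complete[OF f(2-4) this] obtain F where F: "sqint M F" "!!x y. R x y ==> F x = F y"
   "!!x. x : Z ==> F x = 0"
   "!!e. e > 0 ==> \<exists>N. \<forall>n\<ge>N. (nni M (%x. en ((norm (f n x - F x))^2))) <= en e" by blast
  have "(%n. hnorm ?H (s n - mk F)) ----> 0" proof (rule LIMSEQ_I)
   fix e :: real assume e: "e > 0"
   obtain N where N: "!!n. n \<ge> N ==> (nni M (%x. en ((norm (f n x - F x))^2))) <= en ((e / 2)^2)" using F(4)[of "(e / 2)^2"] e by auto
   have "norm (hnorm ?H (s n - mk F) - 0) < e" if "n \<ge> N" for n proof -
    have "(hnorm ?H (s n - mk F))^2 <= (e / 2)^2" using N[OF that] nm[OF F(1), of n] by simp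
    then have "hnorm ?H (s n - mk F) <= e / 2" by (rule power2_le_imp_le) (use e in simp)
    then show ?thesis using e nonneg[OF F(1), of n] by simp
   qed
   then show "\<exists>no. \<forall>n\<ge>no. norm (hnorm ?H (s n - mk F) - 0) < e" by blast
  qed
  then show "\<exists>l\<in>hcar ?H. (%n. hnorm ?H (s n - l)) ----> 0" using F by (intro bexI[of _ "mk F"] inv_L2I) auto
 qed
qed

lemma hspace_L2: "hspace (L2 M)" unfolding L2_eq_inv_L2 by (rule hspace_inv_L2)

lemma L2_carrier: "hcar (L2 M) = {mk f | f. sqint M f}" by (simp add: L2_def)

lemma L2_mk: "sqint M f ==> mk f : hcar (L2 M)" by (auto simp: L2_carrier)

lemma repr_L2: assumes "u : hcar (L2 M)" shows "sqint M (repr u)" "mk (repr u) = u" proof -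
 obtain f where f: "u = mk f" "sqint M f" using assms by (auto simp: L2_carrier)
 note r = repr_M[OF sqint_strong[OF f(2)]]
 show "mk (repr u) = u" using r(2) f by simp
 show "sqint M (repr u)" unfolding f(1) using sqint_cong_AE[OF f(2) r(1)] r(3) by (simp add: eq_commute)
qed

lemma hip_repr: "hip (L2 M) u v = (itg M (%x. cinner (repr u x) (repr v x)))" by (simp add: L2_def)

end

section \<open>Measures on lists\<close>

definition rem_nth :: "nat => 'a list => 'a list" where "rem_nth k ps = take k ps @ drop (Suc k) ps"

definition ins_nth :: "nat => 'a => 'a list => 'a list" where "ins_nth k p ps = take k ps @ p # drop k ps"

text \<open>These maps generate all permutations.\<close>

definition move_nth :: "nat => 'a list => 'a list" where "move_nth k qs = (case qs of [] => [] | q # qs' => ins_nth k q qs')"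

lemma rem_nth_simps [simp]: "rem_nth 0 (p # ps) = ps" "rem_nth (Suc k) (p # ps) = p # rem_nth k ps"
 "rem_nth k [] = []" by (auto simp: rem_nth_def)

lemma length_rem_nth: "k < length ps ==> length (rem_nth k ps) = length ps - 1" by (simp add: rem_nth_def)

lemma mset_rem_nth: "k < length ps ==> mset (rem_nth k ps) = mset ps - {#ps ! k#}" proof -
 assume "k < length ps"
 then have "mset ps = mset (take k ps @ ps ! k # drop (Suc k) ps)" by (simp add: id_take_nth_drop[symmetric])
 then show ?thesis by (simp add: rem_nth_def)
qed

lemma ins_nth_simps [simp]: "ins_nth 0 p ps = p # ps" "ins_nth (Suc k) p (q # ps) = q # ins_nth k p ps" by (auto simp: ins_nth_def)

lemma length_ins_nth [simp]: "length (ins_nth k p ps) = Suc (length ps)" by (simp add: ins_nth_def)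

lemma nth_ins_nth [simp]: "k <= length ps ==> ins_nth k p ps ! k = p" by (simp add: ins_nth_def nth_append min_def)

lemma rem_ins_nth [simp]: "k <= length ps ==> rem_nth k (ins_nth k p ps) = ps" by (simp add: ins_nth_def rem_nth_def min_def)

lemma mset_ins_nth [simp]: "mset (ins_nth k p ps) = add_mset p (mset ps)" proof -
 have "mset (take k ps) + mset (drop k ps) = mset ps" by (simp flip: mset_append)
 then show ?thesis by (simp add: ins_nth_def)
qed

lemma mset_move_nth [simp]: "mset (move_nth k qs) = mset qs" by (cases qs) (auto simp: move_nth_def)

lemma length_move_nth [simp]: "length (move_nth k qs) = length qs" by (cases qs) (auto simp: move_nth_def)

lemma move_nth_Nil [simp]: "move_nth k [] = []" by (simp add: move_nth_def)

lemma move_nth_Suc: "move_nth (Suc k) (q # r # qs) = r # move_nth k (q # qs)" "move_nth (Suc k) [q] = [q]" by (auto simp: move_nth_def ins_nth_def)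

lemma nth_move_nth: "k < length qs ==> move_nth k qs ! k = hd qs" and rem_move_nth: "k < length qs ==> rem_nth k (move_nth k qs) = tl qs" by (cases qs; simp add: move_nth_def)+

locale list_space = sigma_finite_measure M for M :: "'a measure" + assumes space_UNIV [simp]: "space M = UNIV"
begin

abbreviation L :: "'a list measure" where "L \<equiv> list_measure M"
abbreviation P :: "nat => (nat => 'a) measure" where "P n \<equiv> \<Pi>\<^sub>M i\<in>{..<n}. M"

interpretation product_sigma_finite "%_. M" by standard

lemma sigma_finite_P: "sigma_finite_measure (P n)" proof -
 interpret finite_product_sigma_finite "%_. M" "{..<n}" by standard simp
 show ?thesis by unfold_locales
qed

lemma list_measure_facts: shows space_L [simp]: "space L = UNIV" and sets_L_iff: "A : sets L \<longleftrightarrow> (\<forall>n. {x : space (P n). map x [0..<n] : A} : sets (P n))"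
  and emeasure_L: "A : sets L ==> emeasure L A = (\<Sum>n. emeasure (P n) {x : space (P n). map x [0..<n] : A})" proof -
 let ?S = "{A. A <= lists (space M) \<and> (\<forall>n. {x : space (P n). map x [0..<n] : A} : sets (P n))}"
 let ?m = "%A. \<Sum>n. emeasure (P n) {x : space (P n). map x [0..<n] : A}"
 have sa: "sigma_algebra (lists (space M)) ?S" unfolding sigma_algebra_iff2 proof (intro conjI ballI allI impI)
  show "?S <= Pow (lists (space M))" by auto
  show "{} : ?S" by auto
  fix s assume s: "s : ?S"
  have "{x : space (P n). map x [0..<n] : lists (space M) - s} = space (P n) - {x : space (P n). map x [0..<n] : s}" for n by auto
  with s show "lists (space M) - s : ?S" by auto
 next
  fix A :: "nat => 'a list set" assume A: "range A <= ?S"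
  have "{x : space (P n). map x [0..<n] : (\<Union>i. A i)} = (\<Union>i. {x : space (P n). map x [0..<n] : A i})" for n by auto
  with A show "(\<Union>i. A i) : ?S" by (auto intro!: sets.countable_UN)
 qed
 have pos: "positive ?S ?m" by (auto simp: positive_def)
 have ca: "countably_additive ?S ?m" proof (rule countably_additiveI)
  fix A :: "nat => 'a list set" assume A: "range A <= ?S" "disjoint_family A"
  have "(\<Sum>i. ?m (A i)) = (\<Sum>n. \<Sum>i. emeasure (P n) {x : space (P n). map x [0..<n] : A i})" using nn_integral_suminf[of "%i n. emeasure (P n) {x : space (P n). map x [0..<n] : A i}" "count_space UNIV"]
   by (simp add: nn_integral_count_space_nat)
  also have "... = ?m (\<Union>i. A i)" proof (intro suminf_cong)
   fix n
   have "(\<Sum>i. emeasure (P n) {x : space (P n). map x [0..<n] : A i}) = emeasure (P n) (\<Union>i. {x : space (P n). map x [0..<n] : A i})" proof (rule suminf_emeasure)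
    show "disjoint_family (%i. {x : space (P n). map x [0..<n] : A i})" using A(2) unfolding disjoint_family_on_def by blast
   qed (use A in auto)
   also have "(\<Union>i. {x : space (P n). map x [0..<n] : A i}) = {x : space (P n). map x [0..<n] : (\<Union>i. A i)}" by auto
   finally show "(\<Sum>i. emeasure (P n) {x : space (P n). map x [0..<n] : A i}) = emeasure (P n) {x : space (P n). map x [0..<n] : (\<Union>i. A i)}" .
  qed
  finally show "(\<Sum>i. ?m (A i)) = ?m (\<Union>i. A i)" .
 qed
 have sub: "?S <= Pow (lists (space M))" by auto
 have sets: "sets L = ?S" unfolding list_measure_def using sigma_algebra.sets_measure_of_eq[OF sa] by simp
 show "space L = UNIV" unfolding list_measure_def by (subst space_measure_of[OF sub]) simp
 show "A : sets L \<longleftrightarrow> (\<forall>n. {x : space (P n). map x [0..<n] : A} : sets (P n))" unfolding sets by auto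
 show "emeasure L A = ?m A" if "A : sets L" unfolding list_measure_def by (rule emeasure_measure_of_sigma[OF sa pos ca]) (use that sets in auto)
qed

lemma measurable_L_iff:
 "f : measurable L N \<longleftrightarrow> range f <= space N \<and> (\<forall>n. (%x. f (map x [0..<n])) : measurable (P n) N)" proof -
 have "f -` A \<inter> space L : sets L \<longleftrightarrow> (\<forall>n. (%x. f (map x [0..<n])) -` A \<inter> space (P n) : sets (P n))" for A unfolding sets_L_iff by (simp add: vimage_def Int_def conj_commute)
 then show ?thesis unfolding measurable_def by (auto simp: image_subset_iff Pi_iff)
qed

lemma measurable_list_of [measurable]: "(%x. map x [0..<n]) : measurable (P n) L" unfolding measurable_def by (auto simp: vimage_def Int_def conj_commute sets_L_iff)

lemma measurable_length_L [measurable]: "length : measurable L (count_space UNIV)" by (subst measurable_L_iff) auto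

lemma measurable_nth_L [measurable]: "(%ps. if j < length ps then ps ! j else a) : measurable L M" proof (subst measurable_L_iff, intro conjI allI)
 show "(%x. if j < length (map x [0..<n]) then map x [0..<n] ! j else a) : measurable (P n) M" for n by (cases "j < n") auto
qed simp

lemma map_case_nat: "map (\<lambda>i\<in>{..<Suc n}. case i of 0 => p | Suc j => x j) [0..<Suc n] = p # map x [0..<n]" by (rule nth_equalityI) (auto split: nat.split simp: nth_Cons simp del: upt_Suc)

text \<open>The list space is a disjoint sum over lengths, so the preimage is assembled from slices:
  on tails of length \<open>n\<close> the map factors through \<open>\<phi> n\<close> into the
  product of \<open>Suc n\<close> copies.\<close>

lemma measurable_Cons_L [measurable]: "(%z. fst z # snd z) : measurable (M >< L) L" proof (rule measurableI)
 fix A assume A: "A : sets L"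
 define \<phi> where "\<phi> n z = (\<lambda>i\<in>{..<Suc n}. case i of 0 => fst z | Suc j => (if j < length (snd z) then snd z ! j else undefined))" for n and z :: "'a \<times> 'a list"
 have [measurable]: "\<phi> n : measurable (M >< L) (P (Suc n))" for n unfolding \<phi>_def proof (rule measurable_restrict)
  fix i
  show "(%z. case i of 0 => fst z | Suc j => (if j < length (snd z) then snd z ! j else undefined)) : measurable (M >< L) M" by (cases i) (auto intro: measurable_compose[OF measurable_snd measurable_nth_L])
 qed
 have B: "{x : space (P (Suc n)). map x [0..<Suc n] : A} : sets (P (Suc n))" for n using A by (simp only: sets_L_iff)
 have map: "map (\<phi> n z) [0..<Suc n] = fst z # snd z" if "length (snd z) = n" for n z unfolding \<phi>_def map_case_nat using that by (auto intro!: nth_equalityI)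
 have "{z : space (M >< L). length (snd z) = n} \<inter> (\<phi> n -` {x : space (P (Suc n)). map x [0..<Suc n] : A} \<inter> space (M >< L)) : sets (M >< L)" for n proof (rule sets.Int)
  show "{z : space (M >< L). length (snd z) = n} : sets (M >< L)" by measurable
  show "\<phi> n -` {x : space (P (Suc n)). map x [0..<Suc n] : A} \<inter> space (M >< L) : sets (M >< L)" by (rule measurable_sets[OF _ B]) measurable
 qed
 then have "(\<Union>n. {z : space (M >< L). length (snd z) = n} \<inter> (\<phi> n -` {x : space (P (Suc n)). map x [0..<Suc n] : A} \<inter> space (M >< L))) : sets (M >< L)" by (intro sets.countable_UN) auto
 also have "(\<Union>n. {z : space (M >< L). length (snd z) = n} \<inter> (\<phi> n -` {x : space (P (Suc n)). map x [0..<Suc n] : A} \<inter> space (M >< L))) = (%z. fst z # snd z) -` A \<inter> space (M >< L)"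
 proof (rule set_eqI)
  fix z
  have "\<phi> n z : space (P (Suc n))" for n by (simp add: \<phi>_def space_PiM)
  then show "z : (\<Union>n. {z : space (M >< L). length (snd z) = n} \<inter> (\<phi> n -` {x : space (P (Suc n)). map x [0..<Suc n] : A} \<inter> space (M >< L))) \<longleftrightarrow>
    z : (%z. fst z # snd z) -` A \<inter> space (M >< L)" by (simp add: map[OF refl] space_pair_measure del: upt_Suc)
 qed
 finally show "(%z. fst z # snd z) -` A \<inter> space (M >< L) : sets (M >< L)" .
qed simp

lemma measurable_Cons_L' [measurable (raw)]:
 "f : measurable N M ==> g : measurable N L ==> (%x. f x # g x) : measurable N L" using measurable_compose[OF measurable_Pair measurable_Cons_L, of f N g] by simp

lemma measurable_hd_L [measurable]: "hd : measurable L M" proof -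
 have "(%x. hd (map x [0..<n])) : measurable (P n) M" for n by (cases n) (auto simp: hd_map simp del: upt_Suc)
 then show ?thesis by (subst measurable_L_iff) auto
qed

lemma measurable_tl_L [measurable]: "tl : measurable L L" proof -
 have "(%x. tl (map x [0..<n])) : measurable (P n) L" for n proof (cases n)
  case (Suc k)
  have "(%x. \<lambda>i\<in>{..<k}. x (Suc i)) : measurable (P n) (P k)" unfolding Suc by (intro measurable_restrict) auto
  from measurable_compose[OF this measurable_list_of] show ?thesis by (rule measurable_cong[THEN iffD1, rotated]) (auto simp: Suc map_tl[symmetric] intro!: nth_equalityI simp del: upt_Suc simp: nth_tl)
 qed simp
 then show ?thesis by (subst measurable_L_iff) auto
qed

lemma sets_Nil_L [measurable]: "{[]} : sets L" proof -
 have "{ps : space L. length ps = 0} : sets L" by measurable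
 then show ?thesis by simp
qed

lemma sets_not_Nil_L [measurable]: "- {[]} : sets L" using sets.compl_sets[OF sets_Nil_L] by (simp add: Compl_eq_Diff_UNIV)

text \<open>Takes the place of structural recursion for measurability: list indexing,
  \<open>rem_nth\<close>, \<open>move_nth\<close> and \<open>tfun\<close> are treated by induction
  through it.\<close>

lemma measurable_list_cases: assumes "f [] : space N" and f: "(%z. f (fst z # snd z)) : measurable (M >< L) N" shows "f : measurable L N" proof -
 have 1: "(%ps. f (hd ps # tl ps)) : measurable L N" using measurable_compose[OF measurable_Pair[OF measurable_hd_L measurable_tl_L] f] by simp
 have "(%ps. if ps = [] then f [] else f (hd ps # tl ps)) : measurable L N" proof (rule measurable_If[OF _ 1])
  show "(%_. f []) : measurable L N" using assms(1) by simp
 qed (simp add: sets_Nil_L)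
 then show ?thesis by (rule measurable_cong[THEN iffD1, rotated]) auto
qed

lemma measurable_nth [measurable]: "(%ps. ps ! k) : measurable L M" proof (induction k)
 case 0 show ?case by (rule measurable_list_cases) auto
next
 case (Suc k) show ?case by (rule measurable_list_cases) (auto intro: measurable_compose[OF measurable_snd Suc])
qed

lemma measurable_rem_nth [measurable]: "rem_nth k : measurable L L" proof (induction k)
 case 0 show ?case by (rule measurable_list_cases) auto
next
 case (Suc k)
 note [measurable] = this
 show ?case by (rule measurable_list_cases) auto
qed

lemma measurable_move_nth [measurable]: "move_nth k : measurable L L" proof (induction k)
 case 0
 have "move_nth 0 = (%qs :: 'a list. qs)" by (rule ext, case_tac qs) (auto simp: move_nth_def)
 then show ?case by simp
next
 case (Suc k)
 note [measurable] = this
 have "(%z. move_nth (Suc k) (fst z # snd z)) : measurable (M >< L) L" proof -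
  have "(%z. if snd z = [] then [fst z] else hd (snd z) # move_nth k (fst z # tl (snd z))) : measurable (M >< L) L" by measurable
  then show ?thesis by (rule measurable_cong[THEN iffD1, rotated]) (auto simp: move_nth_Suc neq_Nil_conv)
 qed
 then show ?case by (intro measurable_list_cases) auto
qed

lemma distr_case_nat:
 "distr (M >< P n) (P (Suc n)) (%z. \<lambda>i\<in>{..<Suc n}. case i of 0 => fst z | Suc j => snd z j) = P (Suc n)" (is "distr _ _ ?\<psi> = _") proof (rule PiM_eqI)
 interpret Pn: sigma_finite_measure "P n" by (rule sigma_finite_P)
 have [measurable]: "?\<psi> : measurable (M >< P n) (P (Suc n))" proof (rule measurable_restrict)
  fix i assume "i : {..<Suc n}"
  then show "(%z. case i of 0 => fst z | Suc j => snd z j) : measurable (M >< P n) M" by (cases i) auto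
 qed
 fix A assume A: "!!i. i : {..<Suc n} ==> A i : sets M"
 have "?\<psi> -` (Pi\<^sub>E {..<Suc n} A) \<inter> space (M >< P n) = A 0 \<times> Pi\<^sub>E {..<n} (%j. A (Suc j))" by (auto simp: space_pair_measure space_PiM PiE_iff extensional_def Ball_def All_less_Suc2)
 moreover have "Pi\<^sub>E {..<Suc n} A : sets (P (Suc n))" using A by (intro sets_PiM_I_finite) auto
 ultimately have "emeasure (distr (M >< P n) (P (Suc n)) ?\<psi>) (Pi\<^sub>E {..<Suc n} A) = emeasure (M >< P n) (A 0 \<times> Pi\<^sub>E {..<n} (%j. A (Suc j)))" by (subst emeasure_distr) auto
 also have "... = emeasure M (A 0) * emeasure (P n) (Pi\<^sub>E {..<n} (%j. A (Suc j)))" using A by (intro Pn.emeasure_pair_measure_Times) (auto intro!: sets_PiM_I_finite)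
 also have "... = emeasure M (A 0) * (\<Prod>j<n. emeasure M (A (Suc j)))" using A by (subst emeasure_PiM) auto
 also have "... = (\<Prod>i<Suc n. emeasure M (A i))" by (simp add: prod.lessThan_Suc_shift del: prod.lessThan_Suc)
 finally show "emeasure (distr (M >< P n) (P (Suc n)) ?\<psi>) (Pi\<^sub>E {..<Suc n} A) = (\<Prod>i<Suc n. emeasure M (A i))" .
qed auto

lemma emeasure_P_Suc: assumes A: "A : sets L" shows "emeasure (P (Suc n)) {x : space (P (Suc n)). map x [0..<Suc n] : A} = (nni M (%p. emeasure (P n) {x : space (P n). p # map x [0..<n] : A}))" proof -
 interpret Pn: sigma_finite_measure "P n" by (rule sigma_finite_P)
 define \<psi> where "\<psi> = (%z :: 'a \<times> (nat => 'a). \<lambda>i\<in>{..<Suc n}. case i of 0 => fst z | Suc j => snd z j)"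
 have \<psi> [measurable]: "\<psi> : measurable (M >< P n) (P (Suc n))" unfolding \<psi>_def proof (rule measurable_restrict)
  fix i assume "i : {..<Suc n}"
  then show "(%z. case i of 0 => fst z | Suc j => snd z j) : measurable (M >< P n) M" by (cases i) auto
 qed
 let ?B = "{x : space (P (Suc n)). map x [0..<Suc n] : A}"
 have B: "?B : sets (P (Suc n))" using A by (simp only: sets_L_iff)
 have "emeasure (P (Suc n)) ?B = emeasure (distr (M >< P n) (P (Suc n)) \<psi>) ?B" by (simp only: \<psi>_def distr_case_nat)
 also have "... = emeasure (M >< P n) (\<psi> -` ?B \<inter> space (M >< P n))" using B by (intro emeasure_distr) auto
 also have "... = (nni M (%p. emeasure (P n) (Pair p -` (\<psi> -` ?B \<inter> space (M >< P n)))))" by (intro Pn.emeasure_pair_measure_alt measurable_sets[OF \<psi> B])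
 also have "... = (nni M (%p. emeasure (P n) {x : space (P n). p # map x [0..<n] : A}))" proof (intro nn_integral_cong arg_cong[where f = "emeasure (P n)"])
  fix p
  have "\<psi> (p, x) : space (P (Suc n))" for x by (simp add: \<psi>_def space_PiM)
  moreover have "map (\<psi> (p, x)) [0..<Suc n] = p # map x [0..<n]" for x using map_case_nat[where n = n and p = p and x = x] by (simp only: \<psi>_def fst_conv snd_conv)
  ultimately show "Pair p -` (\<psi> -` ?B \<inter> space (M >< P n)) = {x : space (P n). p # map x [0..<n] : A}" by (auto simp: space_pair_measure simp del: upt_Suc)
 qed
 finally show ?thesis .
qed

lemma sets_Cons_vimage: "A : sets L ==> {ps. p # ps : A} : sets L" proof -
 assume A: "A : sets L"
 have "(%ps. p # ps) : measurable L L" by measurable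
 from measurable_sets[OF this A] show ?thesis by (simp add: vimage_def)
qed

text \<open>From here on values of the measure are computed by this recursion over the first entry
  instead of the sum over product measures.\<close>

lemma emeasure_L_Cons: assumes A: "A : sets L" shows "emeasure L A = indicator A [] + (nni M (%p. emeasure L {ps. p # ps : A}))" proof -
 let ?e = "%A n. emeasure (P n) {x : space (P n). map x [0..<n] : A}"
 have 0: "?e A 0 = indicator A []" by (simp add: PiM_empty indicator_def)
 have "emeasure L A = (\<Sum>n. ?e A n)" using A by (rule emeasure_L)
 also have "... = ?e A 0 + (\<Sum>n. ?e A (Suc n))" using suminf_offset[of "?e A" 1] by (simp add: add.commute)
 also have "(\<Sum>n. ?e A (Suc n)) = (\<Sum>n. nni M (%p. ?e {ps. p # ps : A} n) )" using emeasure_P_Suc[OF A] by (simp del: upt_Suc)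
 also have "... = (nni M (%p. (\<Sum>n. ?e {ps. p # ps : A} n)))" proof (rule nn_integral_suminf[symmetric])
  fix n
  interpret Pn: sigma_finite_measure "P n" by (rule sigma_finite_P)
  have "(%z. fst z # map (snd z) [0..<n]) : measurable (M >< P n) L" by measurable
  from Pn.measurable_emeasure_Pair[OF measurable_sets[OF this A]]
  show "(%p. ?e {ps. p # ps : A} n) : bm M" by (simp add: vimage_def space_pair_measure Int_def conj_commute)
 qed
 also have "... = (nni M (%p. emeasure L {ps. p # ps : A}))" using A by (intro nn_integral_cong emeasure_L[symmetric] sets_Cons_vimage)
 finally show ?thesis using 0 by simp
qed

lemma emeasure_L_Nil [simp]: "emeasure L {[]} = 1" by (subst emeasure_L_Cons) (auto simp: sets_Nil_L)

lemma sigma_finite_L: "sigma_finite_measure L" proof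
 obtain A :: "nat => 'a set" where A: "range A <= sets M" "(\<Union>i. A i) = space M" "!!i. emeasure M (A i) ~= \<infinity>" "incseq A" using sigma_finite_incseq by blast
 \<comment> \<open>Lists of length \<open>n\<close> with entries in \<open>A i\<close> have measure
   \<open>emeasure M (A i) ^ n\<close>. These are countably many sets, and since \<open>A\<close> is
   increasing every list lies in one of them.\<close>
 define B where "B n i = {ps. length ps = n \<and> set ps <= A i}" for n i
 have B: "B n i : sets L \<and> emeasure L (B n i) < \<infinity>" for n i proof (induction n)
  case 0
  have "B 0 i = {[]}" by (auto simp: B_def)
  then show ?case by (simp add: sets_Nil_L)
 next
  case (Suc n)
  have [measurable]: "A i : sets M" using A by auto
  have [measurable]: "B n i : sets L" using Suc by auto
  have eq: "B (Suc n) i = {ps : space L. ps ~= [] \<and> hd ps : A i \<and> tl ps : B n i}" by (auto simp: B_def length_Suc_conv neq_Nil_conv)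
  have meas: "B (Suc n) i : sets L" unfolding eq by measurable
  have "emeasure L (B (Suc n) i) = (nni M (%p. emeasure L {ps. p # ps : B (Suc n) i}))" using meas by (subst emeasure_L_Cons) (auto simp: B_def)
  also have "... = (nni M (%p. emeasure L (B n i) * indicator (A i) p))" by (intro nn_integral_cong) (auto simp: B_def indicator_def)
  also have "... = emeasure L (B n i) * emeasure M (A i)" by (simp add: nn_integral_cmult)
  also have "... < \<infinity>" using Suc A(3)[of i] by (auto simp: ennreal_mult_less_top top.not_eq_extremum)
  finally show ?case using meas by simp
 qed
 show "\<exists>C. countable C \<and> C <= sets L \<and> \<Union> C = space L \<and> (\<forall>a\<in>C. emeasure L a ~= \<infinity>)" proof (intro exI conjI ballI)
  show "countable (range (%(n, i). B n i))" by auto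
  show "range (%(n, i). B n i) <= sets L" using B by auto
  have "\<exists>i. set ps <= A i" for ps proof (induction ps)
   case (Cons p ps)
   then obtain i where i: "set ps <= A i" by blast
   obtain j where j: "p : A j" using A(2) by auto
   have "A i <= A (max i j)" "A j <= A (max i j)" using A(4) by (auto simp: incseq_def)
   then show ?case using i j by (auto intro!: exI[of _ "max i j"])
  qed simp
  then show "\<Union> (range (%(n, i). B n i)) = space L" by (auto simp: B_def)
  show "emeasure L a ~= \<infinity>" if "a : range (%(n, i). B n i)" for a using that B by (auto simp: less_top)
 qed
qed

sublocale L: sigma_finite_measure L by (rule sigma_finite_L)
sublocale PL: pair_sigma_finite M L ..

text \<open>Nonempty lists are the product of first entry and tail. The Fubini formulas for lists
  are this identity together with the atom \<open>[]\<close> of mass one.\<close>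

lemma density_eq_distr_Cons:
 "density L (%ps. en (indicator (- {[]}) ps)) = distr (M >< L) L (%z. fst z # snd z)" proof (rule measure_eqI)
 fix A assume "A : sets (density L (%ps. en (indicator (- {[]}) ps)))"
 then have A [measurable]: "A : sets L" by simp
 have "emeasure (density L (%ps. en (indicator (- {[]}) ps))) A = (nni L (%ps. indicator (A - {[]}) ps))" by (subst emeasure_density) (measurable, intro nn_integral_cong, auto simp: indicator_def)
 also have "... = emeasure L (A - {[]})" by simp
 also have "... = (nni M (%p. emeasure L {ps. p # ps : A}))" by (subst emeasure_L_Cons) auto
 also have "... = emeasure (M >< L) ((%z. fst z # snd z) -` A \<inter> space (M >< L))" using measurable_sets[OF measurable_Cons_L A] by (subst L.emeasure_pair_measure_alt)
   (auto intro!: nn_integral_cong arg_cong[where f = "emeasure L"] simp: space_pair_measure)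
 also have "... = emeasure (distr (M >< L) L (%z. fst z # snd z)) A" by (simp add: emeasure_distr)
 finally show "emeasure (density L (%ps. en (indicator (- {[]}) ps))) A = emeasure (distr (M >< L) L (%z. fst z # snd z)) A" .
qed simp

lemma nn_integral_L_pair: assumes f [measurable]: "f : bm L" shows "(nni L (%ps. f ps)) = f [] + (nni (M >< L) (%z. f (fst z # snd z)))" proof -
 have "(nni L (%ps. f ps)) = (nni L (%ps. f [] * indicator {[]} ps + en (indicator (- {[]}) ps) * f ps))" by (intro nn_integral_cong) (auto simp: indicator_def)
 also have "... = f [] + (nni L (%ps. en (indicator (- {[]}) ps) * f ps))" by (subst nn_integral_add) (auto simp: nn_integral_cmult)
 also have "(nni L (%ps. en (indicator (- {[]}) ps) * f ps)) = (nni (density L (%ps. en (indicator (- {[]}) ps))) (%ps. f ps))" by (subst nn_integral_density) auto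
 also have "... = (nni (M >< L) (%z. f (fst z # snd z)))" unfolding density_eq_distr_Cons by (subst nn_integral_distr) auto
 finally show ?thesis .
qed

lemma nn_integral_L: assumes f [measurable]: "f : bm L" shows "(nni L (%ps. f ps)) = f [] + (nni M (%p. nni L (%ps. f (p # ps))))" unfolding nn_integral_L_pair[OF f] by (subst L.nn_integral_fst[symmetric]) auto

lemma nn_integral_L_swap: assumes f [measurable]: "f : bm L" shows "(nni L (%ps. f ps)) = f [] + (nni L (%ps. nni M (%p. f (p # ps))))"
 unfolding nn_integral_L[OF f] by (subst PL.Fubini'[of "%p ps. f (p # ps)"]) (auto simp: split_beta')

lemma integral_L_pair: fixes f :: "'a list => 'b::{banach, second_countable_topology}" assumes f: "integrable L f" shows "integrable (M >< L) (%z. f (fst z # snd z))"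
  and "(itg L (%ps. f ps)) = f [] + (itg (M >< L) (%z. f (fst z # snd z)))" proof -
 have [measurable]: "f : bm L" using f by auto
 have 1: "integrable L (%ps. indicator (- {[]}) ps *\<^sub>R f ps)" using integrable_mult_indicator[OF _ f, of "- {[]}"] by simp
 have 2: "integrable L (%ps. indicator {[]} ps *\<^sub>R f [])" using integrable_real_indicator[of "{[]}" L] by (intro integrable_scaleR_left) auto
 have "integrable (density L (%ps. en (indicator (- {[]}) ps))) f" using 1 by (subst integrable_density) auto
 then show "integrable (M >< L) (%z. f (fst z # snd z))" unfolding density_eq_distr_Cons by (subst (asm) integrable_distr_eq) auto
 have "(itg L (%ps. f ps)) = (itg L (%ps. indicator {[]} ps *\<^sub>R f [] + indicator (- {[]}) ps *\<^sub>R f ps))" by (intro Bochner_Integration.integral_cong) (auto simp: indicator_def)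
 also have "... = f [] + (itg L (%ps. indicator (- {[]}) ps *\<^sub>R f ps))" using 1 2 by (subst Bochner_Integration.integral_add) (auto simp: measure_def)
 also have "(itg L (%ps. indicator (- {[]}) ps *\<^sub>R f ps)) = (itg (density L (%ps. en (indicator (- {[]}) ps))) (%ps. f ps))" by (subst integral_density) auto
 also have "... = (itg (M >< L) (%z. f (fst z # snd z)))" unfolding density_eq_distr_Cons by (subst integral_distr) auto
 finally show "(itg L (%ps. f ps)) = f [] + (itg (M >< L) (%z. f (fst z # snd z)))" .
qed

lemma integral_L: fixes f :: "'a list => 'b::{banach, second_countable_topology}" assumes f: "integrable L f" shows "(itg L (%ps. f ps)) = f [] + (itg M (%p. itg L (%ps. f (p # ps))))"
  and "(itg L (%ps. f ps)) = f [] + (itg L (%ps. itg M (%p. f (p # ps))))" proof -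
 have i: "integrable (M >< L) (%(p, ps). f (p # ps))" using integral_L_pair(1)[OF f] by (simp add: split_beta')
 show "(itg L (%ps. f ps)) = f [] + (itg M (%p. itg L (%ps. f (p # ps))))" unfolding integral_L_pair(2)[OF f] using PL.integral_fst[OF i] by (simp add: split_beta')
 show "(itg L (%ps. f ps)) = f [] + (itg L (%ps. itg M (%p. f (p # ps))))" unfolding integral_L_pair(2)[OF f] using PL.integral_snd[OF i] by (simp add: split_beta')
qed

lemma AE_L_pair: assumes "AE qs in L. Q qs" shows "AE z in M >< L. Q (fst z # snd z)" proof -
 have "AE qs in density L (%ps. en (indicator (- {[]}) ps)). Q qs" using assms by (subst AE_density) auto
 then show ?thesis unfolding density_eq_distr_Cons by (rule AE_distrD[rotated]) measurable
qed

lemma AE_L_Cons: assumes "AE qs in L. Q qs" shows "AE p in M. AE ps in L. Q (p # ps)" "AE ps in L. AE p in M. Q (p # ps)" proof -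
 show "AE p in M. AE ps in L. Q (p # ps)" using PL.AE_pair[OF AE_L_pair[OF assms]] by simp
 interpret LM: pair_sigma_finite L M ..
 have "AE z in distr (L >< M) (M >< L) (%(x, y). (y, x)). Q (fst z # snd z)" using AE_L_pair[OF assms] by (subst (asm) PL.distr_pair_swap)
 then have "AE z in L >< M. Q (snd z # fst z)" by (rule AE_distrD[rotated, THEN eventually_mono]) (auto simp: split_beta')
 then show "AE ps in L. AE p in M. Q (p # ps)" using LM.AE_pair by fastforce
qed

lemma AE_L_Nil: "AE qs in L. Q qs ==> Q []" proof (rule ccontr)
 assume "AE qs in L. Q qs" "\<not> Q []"
 then obtain N where N: "{qs : space L. \<not> Q qs} <= N" "emeasure L N = 0" "N : sets L" by (auto elim: AE_E)
 then have "emeasure L {[]} <= emeasure L N" using \<open>\<not> Q []\<close> by (intro emeasure_mono) auto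
 then show False using N by simp
qed

text \<open>Removing an entry forgets a factor of possibly infinite mass, so it does not preserve
  the measure. It still pulls null sets back to null sets, which is what identities between classes
  of functions need.\<close>

lemma null_rem_nth: assumes "N : null_sets L" shows "{qs. k < length qs \<and> rem_nth k qs : N} : null_sets L" using assms proof (induction k arbitrary: N)
 case 0
 have [measurable]: "N : sets L" using 0 by auto
 have "{qs : space L. 0 < length qs \<and> rem_nth 0 qs : N} : sets L" by measurable
 then show ?case using 0 by (auto simp: null_sets_def emeasure_L_Cons)
next
 case (Suc k)
 have N [measurable]: "N : sets L" using Suc by auto
 let ?A = "{qs. Suc k < length qs \<and> rem_nth (Suc k) qs : N}"
 have "{qs : space L. Suc k < length qs \<and> rem_nth (Suc k) qs : N} : sets L" by measurable
 then have A: "?A : sets L" by simp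
 have "AE qs in L. qs \<notin> N" using Suc.prems by (rule AE_not_in)
 then have "AE p in M. AE ps in L. p # ps \<notin> N" by (rule AE_L_Cons)
 then have "AE p in M. emeasure L {ps. p # ps : ?A} = 0" proof eventually_elim
  case (elim p)
  then have "{ps. p # ps : N} : null_sets L" using sets_Cons_vimage[OF N, of p] by (subst AE_iff_null_sets) auto
  from Suc.IH[OF this] show ?case by (simp add: null_sets_def)
 qed
 then have "(nni M (%p. emeasure L {ps. p # ps : ?A})) = (nni M (%p. 0))" by (rule nn_integral_cong_AE)
 then show ?case using A by (auto simp: null_sets_def emeasure_L_Cons[OF A])
qed

lemma AE_rem_nth: assumes "AE qs in L. Q qs" shows "AE qs in L. \<forall>k<length qs. Q (rem_nth k qs)" proof -
 obtain N where N: "N : null_sets L" "{qs. \<not> Q qs} <= N" using assms by (auto simp: eventually_ae_filter)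
 have "AE qs in L. k < length qs --> Q (rem_nth k qs)" for k using AE_not_in[OF null_rem_nth[OF N(1), of k]] by eventually_elim (use N(2) in auto)
 then have "AE qs in L. \<forall>k. k < length qs --> Q (rem_nth k qs)" by (simp add: AE_all_countable)
 then show ?thesis by simp
qed

lemma null_nth: assumes "N : null_sets M" shows "{qs. k < length qs \<and> qs ! k : N} : null_sets L" proof (induction k)
 case 0
 have N [measurable]: "N : sets M" using assms by auto
 have "{qs : space L. 0 < length qs \<and> qs ! 0 : N} : sets L" by measurable
 moreover have "(nni M (%p. emeasure L {ps. p : N})) = (nni M (%p. 0))" by (rule nn_integral_cong_AE) (use AE_not_in[OF assms] in eventually_elim, auto)
 ultimately show ?case by (auto simp: null_sets_def emeasure_L_Cons)
next
 case (Suc k)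
 have N [measurable]: "N : sets M" using assms by auto
 have "{qs : space L. Suc k < length qs \<and> qs ! Suc k : N} : sets L" by measurable
 then show ?case using Suc by (auto simp: null_sets_def emeasure_L_Cons)
qed

lemma AE_nth: assumes "AE p in M. Q p" shows "AE qs in L. \<forall>k<length qs. Q (qs ! k)" proof -
 obtain N where N: "N : null_sets M" "{qs. \<not> Q qs} <= N" using assms by (auto simp: eventually_ae_filter)
 have "AE qs in L. k < length qs --> Q (qs ! k)" for k using AE_not_in[OF null_nth[OF N(1), of k]] by eventually_elim (use N(2) in auto)
 then have "AE qs in L. \<forall>k. k < length qs --> Q (qs ! k)" by (simp add: AE_all_countable)
 then show ?thesis by simp
qed

text \<open>\<open>move_nth (Suc k)\<close> exchanges the first two entries and then acts with index
  \<open>k\<close> on the tail, so the induction step is one application of Tonelli.\<close>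

lemma nn_integral_move_nth: assumes "F : bm L" shows "(nni L (%qs. F (move_nth k qs))) = (nni L (%qs. F qs))" using assms proof (induction k arbitrary: F)
 case 0
 have "move_nth 0 qs = qs" for qs :: "'a list" by (cases qs) (auto simp: move_nth_def)
 then show ?case by simp
next
 case (Suc k)
 note [measurable] = Suc.prems
 have "(nni L (%qs. F (move_nth (Suc k) qs))) = F [] + (nni M (%q. nni L (%qs. F (move_nth (Suc k) (q # qs)))))" by (subst nn_integral_L) auto
 also have "... = F [] + (nni M (%q. F [q] + (nni M (%r. nni L (%qs. F (r # move_nth k (q # qs)))))))" by (intro arg_cong2[where f = "(+)"] nn_integral_cong refl, subst nn_integral_L) (auto simp: move_nth_Suc)
 also have "... = F [] + ((nni M (%q. F [q])) + (nni M (%q. nni M (%r. nni L (%qs. F (r # move_nth k (q # qs)))))))" by (subst nn_integral_add) auto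
 also have "(nni M (%q. nni M (%r. nni L (%qs. F (r # move_nth k (q # qs)))))) = (nni M (%r. nni M (%q. nni L (%qs. F (r # move_nth k (q # qs))))))" proof -
  interpret MM: pair_sigma_finite M M ..
  show ?thesis by (rule MM.Fubini'[symmetric]) measurable
 qed
 also have "(nni M (%q. F [q])) + (nni M (%r. nni M (%q. nni L (%qs. F (r # move_nth k (q # qs)))))) = (nni M (%r. F [r] + (nni M (%q. nni L (%qs. F (r # move_nth k (q # qs)))))))" by (subst nn_integral_add) auto
 also have "... = (nni M (%r. (nni L (%qs. F (r # move_nth k qs)))))" by (intro nn_integral_cong) (subst (2) nn_integral_L, auto)
 also have "... = (nni M (%r. (nni L (%qs. F (r # qs)))))" by (intro nn_integral_cong Suc.IH) measurable
 also have "F [] + ... = (nni L (%qs. F qs))" by (rule nn_integral_L[symmetric]) measurable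
 finally show ?case .
qed

lemma distr_move_nth: "distr L L (move_nth k) = L" proof (rule measure_eqI)
 fix A assume "A : sets (distr L L (move_nth k))"
 then have A [measurable]: "A : sets L" by simp
 have "emeasure (distr L L (move_nth k)) A = (nni (distr L L (move_nth k)) (%qs. indicator A qs))" by simp
 also have "... = (nni L (%qs. indicator A (move_nth k qs)))" by (rule nn_integral_distr) measurable
 also have "... = emeasure L A" by (subst nn_integral_move_nth) auto
 finally show "emeasure (distr L L (move_nth k)) A = emeasure L A" .
qed simp

lemma integral_move_nth: fixes F :: "'a list => 'b::{banach, second_countable_topology}" assumes [measurable]: "F : bm L" shows "(itg L (%qs. F (move_nth k qs))) = (itg L (%qs. F qs))"
 using integral_distr[of "move_nth k" L L F] by (simp add: distr_move_nth)

lemma integrable_move_nth: fixes F :: "'a list => 'b::{banach, second_countable_topology}" assumes [measurable]: "F : bm L" shows "integrable L (%qs. F (move_nth k qs)) \<longleftrightarrow> integrable L F"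
 using integrable_distr_eq[of "move_nth k" L L F] by (simp add: distr_move_nth)

text \<open>The total weight of the ways to single out one entry.\<close>

lemma nn_integral_sum_rem_nth: assumes G: "(%(p, ps). G p ps) : bm (M >< L)" shows "(nni L (%qs. (\<Sum>k<length qs. G (qs ! k) (rem_nth k qs)))) = (nni M (%p. nni L (%ps. en (real (length ps + 1)) * G p ps)))" proof -
 have G' [measurable]: "(%x. G (f x) (g x)) : bm N" if "f : measurable N M" "g : measurable N L" for f g N using measurable_compose[OF measurable_Pair[OF that] G] by simp
 have "(nni L (%qs. (\<Sum>k<length qs. G (qs ! k) (rem_nth k qs)))) = (nni L (%qs. (\<Sum>k. if k < length qs then G (qs ! k) (rem_nth k qs) else 0)))" proof (rule nn_integral_cong)
  fix qs
  show "(\<Sum>k<length qs. G (qs ! k) (rem_nth k qs)) = (\<Sum>k. if k < length qs then G (qs ! k) (rem_nth k qs) else 0)" by (subst suminf_finite[of "{..<length qs}"]) auto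
 qed
 also have "... = (\<Sum>k. nni L (%qs. (if k < length qs then G (qs ! k) (rem_nth k qs) else 0)) )" by (rule nn_integral_suminf) measurable
 \<comment> \<open>Invariance under \<open>move_nth\<close> turns the contribution of each position
   \<open>k\<close> into the same integral over first entry and tail; the \<open>length qs\<close>
   equal terms become the factor \<open>length ps + 1\<close>.\<close>
 also have "... = (\<Sum>k. nni L (%qs. (if k < length qs then G (hd qs) (tl qs) else 0)) )" proof (rule suminf_cong)
  fix k
  have "(nni L (%qs. (if k < length qs then G (qs ! k) (rem_nth k qs) else 0))) = (nni L (%qs. (if k < length (move_nth k qs) then G (move_nth k qs ! k) (rem_nth k (move_nth k qs)) else 0)))"
   by (rule nn_integral_move_nth[symmetric]) measurable
  also have "... = (nni L (%qs. (if k < length qs then G (hd qs) (tl qs) else 0)))" by (intro nn_integral_cong) (auto simp: nth_move_nth rem_move_nth)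
  finally show "(nni L (%qs. (if k < length qs then G (qs ! k) (rem_nth k qs) else 0))) = (nni L (%qs. (if k < length qs then G (hd qs) (tl qs) else 0)))" .
 qed
 also have "... = (nni L (%qs. (\<Sum>k. if k < length qs then G (hd qs) (tl qs) else 0)))" by (rule nn_integral_suminf[symmetric]) measurable
 also have "... = (nni L (%qs. en (real (length qs)) * G (hd qs) (tl qs)))" proof (rule nn_integral_cong)
  fix qs
  show "(\<Sum>k. if k < length qs then G (hd qs) (tl qs) else 0) = en (real (length qs)) * G (hd qs) (tl qs)" by (subst suminf_finite[of "{..<length qs}"]) (auto simp: ennreal_of_nat_eq_real_of_nat)
 qed
 also have "... = (nni M (%p. nni L (%ps. en (real (length ps + 1)) * G p ps)))" by (subst nn_integral_L) (auto simp: add.commute)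
 finally show ?thesis .
qed

end

lemma list_measure_sets_cong: assumes "sets M = sets N" shows "sets (list_measure M) = sets (list_measure N)" proof -
 have s: "sets (\<Pi>\<^sub>M i\<in>{..<n::nat}. M) = sets (\<Pi>\<^sub>M i\<in>{..<n}. N)" for n by (rule sets_PiM_cong) (use assms in auto)
 from sets_eq_imp_space_eq[OF this] have "space (\<Pi>\<^sub>M i\<in>{..<n::nat}. M) = space (\<Pi>\<^sub>M i\<in>{..<n}. N)" for n .
 with s show ?thesis unfolding list_measure_def using sets_eq_imp_space_eq[OF assms] by (subst (1 2) sets_measure_of) auto
qed

text \<open>By induction on the length, null sets of the list measure depend only on those of
  \<open>M\<close>. Functions are identified with respect to Lebesgue measure but integrated with
  respect to \<open>mu m\<close>, and this reconciles the two.\<close>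

lemma list_measure_null_le: assumes M: "list_space M" and N: "list_space N" and sets: "sets M = sets N" and null: "null_sets M <= null_sets N" shows "null_sets (list_measure M) <= null_sets (list_measure N)" proof
 interpret M: list_space M by fact
 interpret N: list_space N by fact
 have eq: "sets M.L = sets N.L" by (rule list_measure_sets_cong[OF sets])
 have *: "A : null_sets M.L ==> A <= {ps. length ps = n} ==> A : null_sets N.L" for n A proof (induction n arbitrary: A)
  case 0
  then have A: "A : sets M.L" "A <= {[]}" "[] \<notin> A" using M.AE_L_Nil[OF AE_not_in[of A M.L]] by auto
  then have "A = {}" by auto
  then show ?case by simp
 next
  case (Suc n)
  have A: "A : sets M.L" "A : sets N.L" using Suc.prems eq by auto
  have "AE p in M. AE ps in M.L. p # ps \<notin> A" using Suc.prems(1) by (intro M.AE_L_Cons AE_not_in)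
  then have "AE p in M. emeasure N.L {ps. p # ps : A} = 0" proof eventually_elim
   case (elim p)
   then have "{ps. p # ps : A} : null_sets M.L" using M.sets_Cons_vimage[OF A(1), of p] by (subst AE_iff_null_sets) auto
   moreover have "{ps. p # ps : A} <= {ps. length ps = n}" using Suc.prems(2) by fastforce
   ultimately show ?case using Suc.IH by (auto simp: null_sets_def)
  qed
  then have "AE p in N. emeasure N.L {ps. p # ps : A} = 0" using null sets_eq_imp_space_eq[OF sets] by (auto simp: eventually_ae_filter)
  then have "(nni N (%p. emeasure N.L {ps. p # ps : A})) = (nni N (%p. 0))" by (rule nn_integral_cong_AE)
  moreover have "[] \<notin> A" using Suc.prems(2) by auto
  ultimately show ?case using A N.emeasure_L_Cons[OF A(2)] by (auto simp: null_sets_def)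
 qed
 fix A assume A: "A : null_sets M.L"
 have "A \<inter> {ps : space M.L. length ps = n} : null_sets M.L" for n by (rule null_set_Int2[OF A]) measurable
 then have "A \<inter> {ps : space M.L. length ps = n} : null_sets N.L" for n using *[of "A \<inter> {ps : space M.L. length ps = n}" n] by blast
 then have "(\<Union>n. A \<inter> {ps : space M.L. length ps = n}) : null_sets N.L" by (intro null_sets_UN) auto
 also have "(\<Union>n. A \<inter> {ps : space M.L. length ps = n}) = A" by auto
 finally show "A : null_sets N.L" .
qed

section \<open>Fock space\<close>

lemma borel_measurable_cnj [measurable]: "cnj : bm borel" by (intro borel_measurable_continuous_onI continuous_intros)

lemma omega_pos: "m > 0 ==> omega m p > 0" by (simp add: omega_def add_nonneg_pos)

lemma borel_measurable_omega [measurable]: "omega m : bm borel" unfolding omega_def by measurable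

lemma continuous_onshell: "continuous_on UNIV (onshell m)" unfolding onshell_def omega_def proof (intro continuous_on_vec_lambda)
 fix \<mu> :: "'a option"
 show "continuous_on UNIV (%p :: real ^ 'a. case \<mu> of None => sqrt ((norm p)^2 + m\<^sup>2) | Some j => p $ j)" by (cases \<mu>) (auto intro!: continuous_intros)
qed

lemma borel_measurable_onshell [measurable]: "onshell m : bm borel" by (rule borel_measurable_continuous_onI[OF continuous_onshell])

lemma total_momentum_simps [simp]: "total_momentum m [] = 0" "total_momentum m (p # ps) = onshell m p + total_momentum m ps" by (auto simp: total_momentum_def)

lemma total_momentum_mset: "mset ps = mset qs ==> total_momentum m ps = total_momentum m qs" unfolding total_momentum_def by (metis mset_map sum_mset_sum_list)

lemma sets_mu [simp, measurable_cong]: "sets (mu m) = sets borel" by (simp add: mu_def)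

lemma space_mu [simp]: "space (mu m) = UNIV" by (simp add: mu_def)

lemma list_space_lborel: "list_space (lborel :: 'a::euclidean_space measure)" by (simp add: list_space_def list_space_axioms_def lborel.sigma_finite_measure_axioms)

locale mass = fixes m :: real and s_type :: "'s::finite itself" assumes m_pos: "m > 0"
begin

abbreviation Mu :: "(real ^ 's) measure" where "Mu \<equiv> mu m"
abbreviation LL :: "(real ^ 's) list measure" where "LL \<equiv> list_measure Mu"

abbreviation (input) "cL == hcar (L2 LL)"
abbreviation (input) "ipL == hip (L2 LL)"
abbreviation (input) "nmL == hnorm (L2 LL)"

sublocale list_space Mu proof -
 have "sigma_finite_measure Mu" unfolding mu_def by (subst sigma_finite_measure.sigma_finite_iff_density_finite[OF lborel.sigma_finite_measure_axioms]) auto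
 then show "list_space Mu" by (simp add: list_space_def list_space_axioms_def)
qed

lemma null_sets_mu: "null_sets Mu = null_sets lborel" proof -
 have "en (1 / (2 * omega m p)) ~= 0" for p :: "real ^ 's" using omega_pos[OF m_pos, of p] by simp
 then show ?thesis unfolding mu_def by (subst set_eq_iff, subst null_sets_density_iff) (auto intro: AE_not_in simp: AE_iff_null_sets[symmetric])
qed

sublocale vm: vol_measure Mu by standard (auto simp: vol_vec_def null_sets_mu)

sublocale vl: vol_measure LL proof
 show "sets LL = sets vol" unfolding vol_list_def vol_vec_def by (rule list_measure_sets_cong) simp
 have l: "list_space Mu" "list_space (lborel :: (real ^ 's) measure)" using list_space_axioms list_space_lborel by auto
 show "null_sets LL = null_sets vol" unfolding vol_list_def vol_vec_def using list_measure_null_le[OF l] list_measure_null_le[OF l(2,1)] by (simp add: null_sets_mu)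
qed

lemma measurable_total_momentum [measurable]: "total_momentum m : bm LL" proof (subst measurable_L_iff, intro conjI allI)
 fix n
 have "total_momentum m (map x [0..<n]) = (\<Sum>i<n. onshell m (x i))" for x unfolding total_momentum_def by (simp add: sum_list_sum_nth atLeast0LessThan del: upt_Suc)
 then have eq: "(%x. total_momentum m (map x [0..<n])) = (%x. \<Sum>i<n. onshell m (x i))" ..
 show "(%x. total_momentum m (map x [0..<n])) : bm (P n)" unfolding eq by measurable
qed simp

abbreviation H1 :: "'s wf hilb" where "H1 \<equiv> one_particle m"

text \<open>On these closed subspaces creation and annihilation are bounded. The unsymmetrised
  version is there because a single tensor is in general not symmetric.\<close>

definition full_le :: "nat => ('s, complex) fk hilb" where "full_le N = inv_L2 LL (=) {ps. N < length ps}"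

definition fock_le :: "nat => ((real ^ 's) list, 'v::chilbert) aefun hilb" where "fock_le N = inv_L2 LL (%ps qs. mset ps = mset qs) {ps. N < length ps}"

abbreviation (input) "cF == hcar (fock m)"
abbreviation (input) "cN N == hcar (fock_le N)"

lemma fock_eq: "fock m = inv_L2 LL (%ps qs. mset ps = mset qs) {}" by (simp add: fock_def inv_L2_def full_fock_def)

lemma full_fock_eq: "full_fock m = L2 LL" by (simp add: full_fock_def)

lemma hip_simps [simp]: "hip (fock m) = ipL" "hip (full_fock m) = ipL"
 "hip (fock_le N) = ipL" "hip (full_le N) = ipL" by (simp_all add: fock_eq full_fock_eq fock_le_def full_le_def hip_inv_L2)

lemma hnorm_simps [simp]: "hnorm (fock m) = nmL" "hnorm (full_fock m) = nmL"
 "hnorm (fock_le N) = nmL" "hnorm (full_le N) = nmL" by (simp_all add: fock_eq full_fock_eq fock_le_def full_le_def hnorm_inv_L2)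

lemma one_particle_eq: "one_particle m = L2 Mu" by (simp add: one_particle_def)

sublocale H1: hspace H1 unfolding one_particle_eq by (rule vm.hspace_L2)

lemma hspace_L2_LL: "hspace (L2 LL)" by (rule vl.hspace_L2)

lemma hspace_fock: "hspace (fock m :: ((real ^ 's) list, 'v::chilbert) aefun hilb)" unfolding fock_eq by (rule vl.hspace_inv_L2)

lemma hspace_full: "hspace (full_fock m :: ((real ^ 's) list, 'v::chilbert) aefun hilb)" unfolding full_fock_eq by (rule vl.hspace_L2)

lemma hspace_fock_le: "hspace (fock_le N :: ((real ^ 's) list, 'v::chilbert) aefun hilb)" unfolding fock_le_def by (rule vl.hspace_inv_L2)

lemma hspace_full_le: "hspace (full_le N)" unfolding full_le_def by (rule vl.hspace_inv_L2)

lemma fock_le_fock: "cN N <= cF" unfolding fock_le_def fock_eq by (rule inv_L2_mono) auto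

lemma fock_le_full_le: "cN N <= hcar (full_le N)" unfolding fock_le_def full_le_def by (rule inv_L2_mono) auto

lemma fock_full: "cF <= cL" unfolding fock_eq L2_eq_inv_L2 by (rule inv_L2_mono) auto

lemma full_le_full: "hcar (full_le N) <= cL" unfolding full_le_def L2_eq_inv_L2 by (rule inv_L2_mono) auto

lemma fock_le_full: "cN N <= cL" using fock_le_fock fock_full by blast

lemma fock_le_mono: "N <= N' ==> cN N <= hcar (fock_le N')" unfolding fock_le_def by (rule inv_L2_mono) auto

lemma full_le_mono: "N <= N' ==> hcar (full_le N) <= hcar (full_le N')" unfolding full_le_def by (rule inv_L2_mono) auto

lemma fockE: assumes "u : cF" obtains f where "u = mk f" "sqint LL f" "!!ps qs. mset ps = mset qs ==> f ps = f qs" using assms unfolding fock_eq by (elim inv_L2E) blast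

lemma fock_leE: assumes "u : cN N" obtains f where "u = mk f" "sqint LL f" "!!ps qs. mset ps = mset qs ==> f ps = f qs"
  "!!ps. N < length ps ==> f ps = 0" using assms unfolding fock_le_def by (elim inv_L2E) blast

lemma full_leE: assumes "u : hcar (full_le N)" obtains f where "u = mk f" "sqint LL f" "!!ps. N < length ps ==> f ps = 0" using assms unfolding full_le_def by (elim inv_L2E) blast

lemma fock_leI: assumes "sqint LL f" "!!ps qs. mset ps = mset qs ==> f ps = f qs"
  "!!ps. N < length ps ==> f ps = 0" shows "mk f : cN N" unfolding fock_le_def by (rule inv_L2I) (rule assms | simp)+

lemma fockI: assumes "sqint LL f" "!!ps qs. mset ps = mset qs ==> f ps = f qs" shows "mk f : cF" unfolding fock_eq by (rule inv_L2I) (rule assms | simp)+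

lemma full_leI: assumes "sqint LL f" "!!ps. N < length ps ==> f ps = 0" shows "mk f : hcar (full_le N)" unfolding full_le_def by (rule inv_L2I) (rule assms | simp)+

lemma sqint_truncate: assumes "sqint LL f" shows "sqint LL (%ps. if length ps <= N then f ps else 0)" proof (rule vl.sqint_bounded[OF assms, where C = 1])
 have "smeas LL (%ps. (if length ps <= N then 1 else 0 :: complex) *c f ps)" by (intro smeas_cscale vl.sqint_strong assms) measurable
 then show "smeas LL (%ps. if length ps <= N then f ps else 0)" by (rule back_subst[where P = "smeas LL"]) (auto simp: cscale_one fun_eq_iff)
qed auto

text \<open>\<open>particles_le\<close> constrains a chosen representative almost everywhere, while
  the carrier asks for one that is symmetric and vanishes exactly. Truncation by length bridges the
  two, since the length depends only on the multiset.\<close>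

lemma particles_le_iff: assumes "u : cF" shows "particles_le N u \<longleftrightarrow> u : cN N" proof
 obtain f where f: "u = mk f" "sqint LL f" "!!ps qs. mset ps = mset qs ==> f ps = f qs" using assms by (rule fockE) blast
 have r: "AE ps in LL. repr u ps = f ps" unfolding f(1) by (rule vl.repr_M(3)[OF vl.sqint_strong[OF f(2)]])
 show "u : cN N" if "particles_le N u" proof -
  have "AE ps in LL. N < length ps --> repr u ps = 0" using that by (simp add: particles_le_def vl.AE_vol_iff)
  then have "u = mk (%ps. if length ps <= N then f ps else 0)" unfolding f(1) vl.mk_eq_iff_M using r unfolding f(1) by eventually_elim auto
  moreover have "mk (%ps. if length ps <= N then f ps else 0) : cN N" by (rule fock_leI[OF sqint_truncate[OF f(2)]]) (auto dest: mset_eq_length intro: f(3))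
  ultimately show ?thesis by simp
 qed
next
 assume "u : cN N"
 then obtain f where f: "u = mk f" "sqint LL f" "!!ps. N < length ps ==> f ps = 0" by (rule fock_leE) blast
 have "AE ps in LL. repr u ps = f ps" unfolding f(1) by (rule vl.repr_M(3)[OF vl.sqint_strong[OF f(2)]])
 then have "AE ps in LL. N < length ps --> repr u ps = 0" by eventually_elim (use f(3) in auto)
 then show "particles_le N u" by (simp add: particles_le_def vl.AE_vol_iff)
qed

lemma finite_particle_eq: "finite_particle m = (\<Union>N. cN N)" unfolding finite_particle_def using particles_le_iff fock_le_fock by blast

lemma csubspace_finite_particle: "csubspace (finite_particle m :: ((real ^ 's) list, 'v::chilbert) aefun set)" unfolding csubspace_def proof (intro conjI ballI allI)
 interpret F: hspace "fock_le N :: ('s, 'v) fk hilb" for N by (rule hspace_fock_le)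
 show "0 : (finite_particle m :: ('s, 'v) fk set)" unfolding finite_particle_eq using F.zero by blast
 fix u v :: "('s, 'v) fk"
 assume "u : finite_particle m" "v : finite_particle m"
 then obtain N N' where "u : cN N" "v : hcar (fock_le N')" unfolding finite_particle_eq by blast
 then have "u : hcar (fock_le (max N N'))" "v : hcar (fock_le (max N N'))" using fock_le_mono[of N "max N N'"] fock_le_mono[of N' "max N N'"] by auto
 then have "u + v : hcar (fock_le (max N N'))" by (rule F.add)
 then show "u + v : finite_particle m" unfolding finite_particle_eq by blast
next
 interpret F: hspace "fock_le N :: ('s, 'v) fk hilb" for N by (rule hspace_fock_le)
 fix c and u :: "('s, 'v) fk"
 assume "u : finite_particle m"
 then obtain N where "u : cN N" unfolding finite_particle_eq by blast
 then have "c *c u : cN N" by (rule F.scale)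
 then show "c *c u : finite_particle m" unfolding finite_particle_eq by blast
qed

lemma finite_particle_fock: "finite_particle m <= cF" by (auto simp: finite_particle_def)

subsection \<open>Tensors\<close>

text \<open>Recursive form of the product in \<open>tensor\<close>, suited to induction along the
  list together with the recursion of the list measure.\<close>

fun tfun :: "('p => complex) list => 'p list => complex" where
 "tfun [] [] = 1" | "tfun (f # fs) (p # ps) = f p * tfun fs ps" | "tfun _ _ = 0"

lemma tfun_eq: "tfun fs ps = (if length ps = length fs then \<Prod>i<length fs. (fs ! i) (ps ! i) else 0)" by (induction fs ps rule: tfun.induct) (auto simp: prod.lessThan_Suc_shift simp del: prod.lessThan_Suc)

lemma tensor_eq: "tensor fs = mk (tfun (map repr fs))" unfolding tensor_def tfun_eq by (rule arg_cong[where f = mk]) (auto simp: fun_eq_iff)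

lemma tfun_length: "length ps ~= length fs ==> tfun fs ps = 0" by (simp add: tfun_eq)

lemma measurable_tfun: "(!!f. f : set fs ==> f : bm borel) ==> tfun fs : bm LL" proof (induction fs)
 case Nil show ?case by (rule measurable_list_cases) auto
next
 case (Cons f fs)
 then have [measurable]: "tfun fs : bm LL" "f : bm borel" by auto
 show ?case by (rule measurable_list_cases) auto
qed

lemma measurable_mu_iff: "f : bm Mu \<longleftrightarrow> f : bm borel" by (rule arg_cong[where f = "%S. f : S"]) (rule measurable_cong_sets, auto)

lemma sqint_mu_borel: "sqint Mu f ==> f : bm borel" using vm.sqint_borel measurable_mu_iff by blast

lemma sqint_tfun: "(!!f. f : set fs ==> sqint Mu f) ==> sqint LL (tfun fs)" proof (induction fs)
 case Nil
 have [measurable]: "tfun [] : bm LL" by (rule measurable_tfun) simp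
 have "(nni LL (%ps. en ((cmod (tfun [] ps))^2))) = 1" by (subst nn_integral_L) auto
 then show ?case by (simp add: vl.sqint_iff)
next
 case (Cons f fs)
 have [measurable]: "tfun (f # fs) : bm LL" "tfun fs : bm LL" "f : bm borel" using Cons.prems by (auto intro!: measurable_tfun sqint_mu_borel)
 have sq: "sqint LL (tfun fs)" "sqint Mu f" using Cons by auto
 have "(nni LL (%ps. en ((cmod (tfun (f # fs) ps))^2))) = (nni Mu (%p. nni LL (%ps. en ((cmod (f p))^2) * en ((cmod (tfun fs ps))^2))))" by (subst nn_integral_L) (auto simp: norm_mult power_mult_distrib ennreal_mult)
 also have "... = (nni Mu (%p. en ((cmod (f p))^2))) * (nni LL (%ps. en ((cmod (tfun fs ps))^2)))" by (simp add: nn_integral_cmult nn_integral_multc)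
 also have "... < \<infinity>" using sq by (auto simp: vl.sqint_iff vm.sqint_iff ennreal_mult_less_top)
 finally show ?case by (simp add: vl.sqint_iff)
qed

lemma repr_H1: "h : hcar H1 ==> sqint Mu (repr h)" "h : hcar H1 ==> mk (repr h) = h" unfolding one_particle_eq by (rule vm.repr_L2; assumption)+

lemma sqint_tensor:
 "set fs <= hcar H1 ==> sqint LL (tfun (map repr fs))" by (rule sqint_tfun) (auto intro: repr_H1)

lemma tensor_full_le: assumes "set fs <= hcar H1" "length fs <= N" shows "tensor fs : hcar (full_le N)" unfolding tensor_eq using assms by (intro full_leI sqint_tensor) (auto intro: tfun_length)

lemma tensor_full: "set fs <= hcar H1 ==> tensor fs : cL" using tensor_full_le[of fs "length fs"] full_le_full by blast

lemma hip_tensor_Cons: assumes f: "f : hcar H1" and fs: "set fs <= hcar H1" and g: "sqint LL g" shows "ipL (tensor (f # fs)) (mk g) =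
  (itg Mu (%p. cnj (repr f p) * (itg LL (%ps. cnj (tfun (map repr fs) ps) * g (p # ps)))))" (is "_ = ?r1") and "ipL (tensor (f # fs)) (mk g) =
  (itg LL (%ps. cnj (tfun (map repr fs) ps) * (itg Mu (%p. cnj (repr f p) * g (p # ps)))))" (is "_ = ?r2") proof -
 have t: "sqint LL (tfun (map repr (f # fs)))" using f fs by (intro sqint_tensor) auto
 have i: "integrable LL (%qs. cnj (tfun (map repr (f # fs)) qs) * g qs)" using vl.integrable_cinner[OF t g] by simp
 have eq: "ipL (tensor (f # fs)) (mk g) = (itg LL (%qs. cnj (tfun (map repr (f # fs)) qs) * g qs))" unfolding tensor_eq using t g by (subst vl.hip_mk) (auto simp: vl.sqint_borel)
 show "ipL (tensor (f # fs)) (mk g) = ?r1" unfolding eq integral_L(1)[OF i] by (simp add: mult.assoc)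
 show "ipL (tensor (f # fs)) (mk g) = ?r2" unfolding eq integral_L(2)[OF i] by (simp add: mult.assoc mult.left_commute[of _ "cnj (tfun _ _)"])
qed

lemma hip_tensor: assumes "set fs <= hcar H1" "set gs <= hcar H1" shows "ipL (tensor fs) (tensor gs) = (if length fs = length gs then \<Prod>i<length fs. hip H1 (fs ! i) (gs ! i) else 0)" using assms
proof (induction fs gs rule: list_induct2')
 case 1
 have [measurable]: "tfun [] : bm LL" by (rule measurable_tfun) simp
 have sq: "sqint LL (tfun [])" using sqint_tfun[of "[]"] by simp
 have "integrable LL (%qs. cnj (tfun [] qs) * tfun [] qs)" using vl.integrable_cinner[OF sq sq] by simp
 from integral_L(1)[OF this] show ?case unfolding tensor_eq by (subst vl.hip_mk) auto
next
 case (4 f fs g gs)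
 have sq: "sqint LL (tfun (map repr (g # gs)))" "sqint LL (tfun (map repr gs))"
  "sqint LL (tfun (map repr fs))" using 4 by (auto intro!: sqint_tfun repr_H1)
 have "ipL (tensor (f # fs)) (tensor (g # gs)) = (itg Mu (%p. cnj (repr f p) * (itg LL (%ps. cnj (tfun (map repr fs) ps) * tfun (map repr (g # gs)) (p # ps)))))"
  unfolding tensor_eq[of "g # gs"] using 4 sq by (intro hip_tensor_Cons) auto
 also have "... = (itg Mu (%p. cnj (repr f p) * repr g p * (itg LL (%ps. cnj (tfun (map repr fs) ps) * tfun (map repr gs) ps))))" by (simp add: mult.left_commute[of "cnj (tfun _ _)"] mult.assoc)
 also have "... = hip H1 f g * ipL (tensor fs) (tensor gs)" unfolding tensor_eq[of fs] tensor_eq[of gs] using sq by (subst vl.hip_mk) (auto simp: one_particle_eq vm.hip_repr vl.sqint_borel)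
 finally show ?case using 4 by (simp add: prod.lessThan_Suc_shift del: prod.lessThan_Suc)
next
 case (2 f fs)
 have sq: "sqint LL (tfun (map repr (f # fs)))" "sqint LL (tfun [])" using 2 sqint_tfun[of "[]"] by (auto intro!: sqint_tfun repr_H1)
 have z: "cnj (tfun (map repr (f # fs)) qs) * tfun [] qs = 0" for qs by (cases qs) auto
 show ?case unfolding tensor_eq using sq by (simp add: vl.hip_mk vl.sqint_borel z del: list.map(2))
next
 case (3 f fs)
 have sq: "sqint LL (tfun (map repr (f # fs)))" "sqint LL (tfun [])" using 3 sqint_tfun[of "[]"] by (auto intro!: sqint_tfun repr_H1)
 have z: "cnj (tfun [] qs) * tfun (map repr (f # fs)) qs = 0" for qs by (cases qs) auto
 show ?case unfolding tensor_eq using sq by (simp add: vl.hip_mk vl.sqint_borel z del: list.map(2))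
qed

lemma sqint_Cons: assumes g: "sqint LL (g :: (real ^ 's) list => complex)" shows "AE ps in LL. sqint Mu (%p. g (p # ps))" proof -
 have [measurable]: "g : bm LL" using g by (rule vl.sqint_borel)
 have "(nni LL (%ps. nni Mu (%p. en ((cmod (g (p # ps)))^2)))) < \<infinity>" using g unfolding vl.sqint_iff by (subst (asm) nn_integral_L_swap) auto
 then have "AE ps in LL. (nni Mu (%p. en ((cmod (g (p # ps)))^2))) ~= \<infinity>" by (intro nn_integral_PInf_AE) auto
 then show ?thesis by eventually_elim (auto simp: vm.sqint_iff less_top)
qed

end

text \<open>Rational endpoints make the family countable, so the exceptional null sets of all boxes
  can be united; the family is still stable under intersection and generates the Borel sets.\<close>

definition rbox :: "'a::euclidean_space set set" where "rbox = {box a b | a b. \<forall>i\<in>Basis. a \<bullet> i : \<rat> \<and> b \<bullet> i : \<rat>}"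

lemma countable_rbox: "countable (rbox :: 'a::euclidean_space set set)" proof -
 let ?R = "{a :: 'a. \<forall>i\<in>Basis. a \<bullet> i : \<rat>}"
 have "?R <= (%f. \<Sum>i\<in>Basis. f i *\<^sub>R i) ` (Basis \<rightarrow>\<^sub>E \<rat>)" proof
  fix a :: 'a assume "a : ?R"
  then show "a : (%f. \<Sum>i\<in>Basis. f i *\<^sub>R i) ` (Basis \<rightarrow>\<^sub>E \<rat>)" by (intro image_eqI[of _ _ "\<lambda>i\<in>Basis. a \<bullet> i"]) (auto simp: euclidean_representation)
 qed
 moreover have "countable (Basis \<rightarrow>\<^sub>E \<rat> :: ('a => real) set)" by (intro countable_PiE) (auto simp: countable_rat)
 ultimately have "countable ?R" by (rule countable_subset[OF _ countable_image])
 then have "countable ((%(a, b). box a b) ` (?R \<times> ?R))" by auto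
 moreover have "rbox <= (%(a, b). box a b) ` (?R \<times> ?R)" by (auto simp: rbox_def)
 ultimately show ?thesis by (rule countable_subset[rotated])
qed

lemma Int_stable_rbox: "Int_stable (rbox :: 'a::euclidean_space set set)" proof (rule Int_stableI)
 fix A B :: "'a set" assume "A : rbox" "B : rbox"
 then obtain a b c d where AB: "A = box a b" "B = box c d"
  and r: "\<forall>i\<in>Basis. a \<bullet> i : \<rat> \<and> b \<bullet> i : \<rat>" "\<forall>i\<in>Basis. c \<bullet> i : \<rat> \<and> d \<bullet> i : \<rat>" by (auto simp: rbox_def)
 have "A \<inter> B = box (\<Sum>i\<in>Basis. max (a \<bullet> i) (c \<bullet> i) *\<^sub>R i) (\<Sum>i\<in>Basis. min (b \<bullet> i) (d \<bullet> i) *\<^sub>R i)" unfolding AB by (rule box_Int_box)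
 moreover have "\<forall>i\<in>Basis. (\<Sum>i\<in>Basis. max (a \<bullet> i) (c \<bullet> i) *\<^sub>R i) \<bullet> i : \<rat> \<and> (\<Sum>i\<in>Basis. min (b \<bullet> i) (d \<bullet> i) *\<^sub>R i) \<bullet> i : \<rat>"
  using r by (simp add: max_def min_def)
 ultimately show "A \<inter> B : rbox" unfolding rbox_def by blast
qed

lemma sigma_sets_rbox: "sigma_sets UNIV (rbox :: 'a::euclidean_space set set) = sets borel" proof -
 have "sigma_sets UNIV rbox = sigma_sets UNIV {S :: 'a set. open S}" proof (rule sigma_sets_eqI)
  fix a :: "'a set" assume "a : rbox"
  then show "a : sigma_sets UNIV {S. open S}" by (auto simp: rbox_def)
 next
  fix S :: "'a set" assume "S : {S. open S}"
  then have S: "open S" by simp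
  let ?a = "%f :: 'a => real \<times> real. \<Sum>i\<in>Basis. fst (f i) *\<^sub>R i"
  let ?b = "%f :: 'a => real \<times> real. \<Sum>i\<in>Basis. snd (f i) *\<^sub>R i"
  let ?I = "{f : Basis \<rightarrow>\<^sub>E \<rat> \<times> \<rat>. box (?a f) (?b f) <= S}"
  have "countable (Basis \<rightarrow>\<^sub>E \<rat> \<times> \<rat> :: ('a => real \<times> real) set)" by (intro countable_PiE) (auto simp: countable_rat)
  then have c: "countable ?I" by (rule countable_subset[rotated]) auto
  have "box (?a f) (?b f) : rbox" if "f : ?I" for f unfolding rbox_def using that by (intro CollectI exI[of _ "?a f"] exI[of _ "?b f"]) (auto simp: PiE_iff mem_Times_iff)
  then have "(\<Union>f\<in>?I. box (?a f) (?b f)) : sigma_sets UNIV rbox" by (intro sigma_sets_UNION) (use c in auto)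
  then show "S : sigma_sets UNIV rbox" using open_UNION_box[OF S] by simp
 qed
 then show ?thesis by (simp add: borel_def)
qed

lemma enn2real_cancel: "enn2real a = enn2real b ==> a ~= \<infinity> ==> b ~= \<infinity> ==> a = b" by (cases a; cases b) auto

text \<open>\<open>g\<close> is only locally integrable. On every box its positive and negative
  parts have the same finite integral, so the measures with these densities agree, and uniqueness of
  densities gives \<open>ennreal (g x) = ennreal (- g x)\<close>, which forces zero.\<close>

lemma AE_zero_if_box_integrals_zero_real: fixes g :: "'a::euclidean_space => real" assumes M: "sigma_finite_measure M" "sets M = sets borel" and g: "g : bm borel" and int: "!!B. B : rbox ==> integrable M (%x. indicator B x * g x)"
  and zero: "!!B. B : rbox ==> (itg M (%x. indicator B x * g x)) = 0" shows "AE x in M. g x = 0" proof -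
 have B: "B : sets borel" if "B : rbox" for B :: "'a set" using that by (auto simp: rbox_def)
 note [measurable_cong] = M(2)
 note [measurable] = g
 have fin: "(nni M (%x. en (g x) * indicator B x)) = (nni M (%x. en (- g x) * indicator B x)) \<and> (nni M (%x. en (g x) * indicator B x)) < \<infinity>" if BB: "B : rbox" for B proof -
  have e: "(nni M (%x. en (g x) * indicator B x)) = (nni M (%x. en (indicator B x * g x)))"
   "(nni M (%x. en (- g x) * indicator B x)) = (nni M (%x. en (- (indicator B x * g x))))" by (intro nn_integral_cong; simp add: indicator_def)+
  have f: "(nni M (%x. en (indicator B x * g x))) ~= \<infinity>" "(nni M (%x. en (- (indicator B x * g x)))) ~= \<infinity>" using int[OF BB] by (auto simp: real_integrable_def)
  have "enn2real (nni M (%x. en (indicator B x * g x))) = enn2real (nni M (%x. en (- (indicator B x * g x))))" using zero[OF BB] int[OF BB] by (simp add: real_lebesgue_integral_def)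
  then have "(nni M (%x. en (indicator B x * g x))) = (nni M (%x. en (- (indicator B x * g x))))" by (rule enn2real_cancel) (use f in auto)
  then show ?thesis using e f by (simp add: less_top)
 qed
 have "density M (%x. en (g x)) = density M (%x. en (- g x))" proof (rule measure_eqI_generator_eq[OF Int_stable_rbox, of UNIV])
  show "emeasure (density M (%x. en (g x))) X = emeasure (density M (%x. en (- g x))) X" if "X : rbox" for X using fin[OF that] B[OF that] M(2) by (simp add: emeasure_density)
  show "sets (density M (%x. en (g x))) = sigma_sets UNIV rbox"
   "sets (density M (%x. en (- g x))) = sigma_sets UNIV rbox" by (simp_all add: sigma_sets_rbox M(2))
  let ?A = "%n::nat. box (- (real n *\<^sub>R One)) (real n *\<^sub>R One :: 'a)"
  have A: "?A n : rbox" for n unfolding rbox_def by (intro CollectI exI[of _ "- (real n *\<^sub>R One)"] exI[of _ "real n *\<^sub>R One"]) (auto simp: inner_diff_left)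
  then show "range ?A <= rbox" by auto
  show "(\<Union>n. ?A n) = UNIV" by (rule UN_box_eq_UNIV)
  show "emeasure (density M (%x. en (g x))) (?A n) ~= \<infinity>" for n using conjunct2[OF fin[OF A, of n]] B[OF A, of n] M(2) by (simp add: emeasure_density less_top)
 qed simp
 then have "AE x in M. en (g x) = en (- g x)" by (intro sigma_finite_measure.density_unique[OF M(1)]) measurable
 then show ?thesis proof eventually_elim
  case (elim x)
  then show ?case by (cases "g x \<ge> 0") (auto simp: ennreal_neg ennreal_eq_0_iff not_le)
 qed
qed

lemma AE_zero_if_box_integrals_zero: fixes g :: "'a::euclidean_space => complex" assumes M: "sigma_finite_measure M" "sets M = sets borel" and g: "g : bm borel" and int: "!!B. B : rbox ==> integrable M (%x. indicator B x * g x)"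
  and zero: "!!B. B : rbox ==> (itg M (%x. indicator B x * g x)) = 0" shows "AE x in M. g x = 0" proof -
 have re: "Re (indicator B x * g x) = indicator B x * Re (g x)" "Im (indicator B x * g x) = indicator B x * Im (g x)" for B x by (auto simp: indicator_def)
 have [measurable]: "(%x. Re (g x)) : bm borel" "(%x. Im (g x)) : bm borel" using g by measurable
 have "AE x in M. Re (g x) = 0" proof (rule AE_zero_if_box_integrals_zero_real[OF M])
  fix B :: "'a set" assume B: "B : rbox"
  show "integrable M (%x. indicator B x * Re (g x))" using integrable_Re[OF int[OF B]] unfolding re .
  show "(itg M (%x. indicator B x * Re (g x))) = 0" using integral_Re[OF int[OF B]] unfolding re zero[OF B] by simp
 qed measurable
 moreover have "AE x in M. Im (g x) = 0" proof (rule AE_zero_if_box_integrals_zero_real[OF M])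
  fix B :: "'a set" assume B: "B : rbox"
  show "integrable M (%x. indicator B x * Im (g x))" using integrable_Im[OF int[OF B]] unfolding re .
  show "(itg M (%x. indicator B x * Im (g x))) = 0" using integral_Im[OF int[OF B]] unfolding re zero[OF B] by simp
 qed measurable
 ultimately show ?thesis by eventually_elim (simp add: complex_eq_iff)
qed

context mass
begin

lemma emeasure_mu_bounded: assumes "bounded B" "B : sets borel" shows "emeasure Mu B < \<infinity>" proof -
 have "emeasure Mu B = (nni lborel (%p. en (1 / (2 * omega m p)) * indicator B p))" unfolding mu_def using assms by (subst emeasure_density) auto
 also have "... <= (nni lborel (%p. en (1 / (2 * m)) * indicator B p))" proof (intro nn_integral_mono mult_right_mono ennreal_leI)
  fix p :: "real ^ 's"
  have "m <= omega m p" unfolding omega_def using m_pos by (intro real_le_rsqrt) simp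
  then show "1 / (2 * omega m p) <= 1 / (2 * m)" using m_pos by (intro divide_left_mono) auto
 qed auto
 also have "... = en (1 / (2 * m)) * emeasure lborel B" using assms by (simp add: nn_integral_cmult)
 also have "... < \<infinity>" using emeasure_bounded_finite[OF assms(1)] by (simp add: ennreal_mult_less_top)
 finally show ?thesis .
qed

text \<open>Bounded support bounds all products with powers of the squared momentum, so box
  indicators are admissible factors of core vectors.\<close>

lemma rbox_Delta_P: assumes "B : rbox" shows "sqint Mu (indicator B :: real ^ 's => complex)" "mk (indicator B) : Delta_P m" proof -
 have B [measurable]: "B : sets borel" and bd: "bounded B" using assms by (auto simp: rbox_def bounded_box)
 have "(nni Mu (%p. en ((cmod (indicator B p))^2))) = (nni Mu (%p. indicator B p))" by (intro nn_integral_cong) (auto simp: indicator_def)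
 also have "... < \<infinity>" using emeasure_mu_bounded[OF bd B] by simp
 finally show sq: "sqint Mu (indicator B :: real ^ 's => complex)" by (simp add: vm.sqint_iff)
 obtain c where c: "!!p. p : B ==> norm p <= c" using bd by (auto simp: bounded_iff)
 have "AE p in vol. cmod (cor (((norm p)^2) ^ r) * repr (mk (indicator B)) p) <= ((max c 0)^2) ^ r" for r using vm.repr_M(3)[OF vm.sqint_strong[OF sq]] unfolding vm.AE_vol_iff proof eventually_elim
  case e: (elim p)
  show ?case proof (cases "p : B")
   case True
   then have "norm p <= max c 0" using c by fastforce
   then show ?thesis using True by (simp add: e norm_mult norm_power power_mono)
  qed (simp add: e)
 qed
 then show "mk (indicator B) : Delta_P m" unfolding Delta_P_def one_particle_eq using vm.L2_mk[OF sq] by auto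
qed

lemma Delta_P_H1: "Delta_P m <= hcar H1" by (auto simp: Delta_P_def)

lemma measurable_section: "g : measurable LL N ==> (%p. g (p # ps)) : measurable Mu N" by (rule measurable_compose[of "%p. p # ps" Mu LL]) (intro measurable_Cons_L' measurable_ident_sets measurable_const, auto)

text \<open>Cauchy-Schwarz in the contracted momentum on almost every slice, followed by
  Tonelli.\<close>

lemma sqint_partial: assumes h: "sqint Mu h" and g: "sqint LL g" shows "sqint LL (%ps. itg Mu (%p. cnj (h p) * g (p # ps)) )" proof -
 have [measurable]: "h : bm Mu" "g : bm LL" using h g by (auto intro: vm.sqint_borel vl.sqint_borel)
 have meas: "(%ps. itg Mu (%p. cnj (h p) * g (p # ps)) ) : bm LL" by (rule borel_measurable_lebesgue_integral) measurable
 have "AE ps in LL. en ((cmod (itg Mu (%p. cnj (h p) * g (p # ps))))^2) <= (nni Mu (%p. en ((cmod (h p))^2))) * (nni Mu (%p. en ((cmod (g (p # ps)))^2)))" using sqint_Cons[OF g] proof eventually_elim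
  case (elim ps)
  interpret H: hspace "L2 Mu :: 's wf hilb" by (rule vm.hspace_L2)
  let ?g = "%p. g (p # ps)"
  have "cmod (hip (L2 Mu) (mk h) (mk ?g)) <= hnorm (L2 Mu) (mk h) * hnorm (L2 Mu) (mk ?g)" using vm.L2_mk[OF h] vm.L2_mk[OF elim] by (rule H.Cauchy_Schwarz)
  then have "(cmod (itg Mu (%p. cnj (h p) * g (p # ps))))^2 <= (hnorm (L2 Mu) (mk h))^2 * (hnorm (L2 Mu) (mk ?g))^2" unfolding vm.hip_mk[OF vm.sqint_strong[OF h] vm.sqint_strong[OF elim]]
   by (simp add: power_mono flip: power_mult_distrib)
  then have "en ((cmod (itg Mu (%p. cnj (h p) * g (p # ps))))^2) <= en ((hnorm (L2 Mu) (mk h))^2) * en ((hnorm (L2 Mu) (mk ?g))^2)" by (simp flip: ennreal_mult)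
  then show ?case by (simp only: vm.hnorm_mk[OF h] vm.hnorm_mk[OF elim])
 qed
 then have "(nni LL (%ps. en ((cmod (itg Mu (%p. cnj (h p) * g (p # ps))))^2))) <= (nni LL (%ps. (nni Mu (%p. en ((cmod (h p))^2))) * (nni Mu (%p. en ((cmod (g (p # ps)))^2)))))" by (rule nn_integral_mono_AE)
 also have "... = (nni Mu (%p. en ((cmod (h p))^2))) * (nni LL (%ps. nni Mu (%p. en ((cmod (g (p # ps)))^2))))" by (subst nn_integral_cmult) auto
 also have "... <= (nni Mu (%p. en ((cmod (h p))^2))) * (nni LL (%ps. en ((cmod (g ps))^2)))" by (subst (2) nn_integral_L_swap) (auto intro!: mult_left_mono)
 also have "... < \<infinity>" using g h by (auto simp: vl.sqint_iff vm.sqint_iff ennreal_mult_less_top)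
 finally show ?thesis using meas by (simp add: vl.sqint_iff)
qed

text \<open>Contracting the first momentum with a box indicator leaves a function orthogonal to all
  tensors with one factor less, hence zero by induction; letting the box vary then makes the
  function vanish in the first momentum.\<close>

lemma tensors_separate: assumes g: "sqint LL g" and "!!fs. set fs <= Delta_P m ==> length fs = n ==> ipL (tensor fs) (mk g) = 0" shows "AE ps in LL. length ps = n --> g ps = 0" using assms proof (induction n arbitrary: g)
 case 0
 have [measurable]: "tfun [] : bm LL" by (rule measurable_tfun) simp
 have sq: "sqint LL (tfun [])" using sqint_tfun[of "[]"] by simp
 have i: "integrable LL (%qs. cnj (tfun [] qs) * g qs)" using vl.integrable_cinner[OF sq 0(1)] by simp
 have "ipL (tensor []) (mk g) = g []" unfolding tensor_eq using integral_L(1)[OF i] 0(1) by (subst vl.hip_mk) (auto simp: vl.sqint_borel)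
 then have "g [] = 0" using 0(2)[of "[]"] by simp
 then show ?case by simp
next
 case (Suc n)
 note g = Suc.prems(1)
 have [measurable]: "g : bm LL" using g by (rule vl.sqint_borel)
 have sub: "AE ps in LL. length ps = n --> (itg Mu (%p. cnj (indicator B p) * g (p # ps))) = 0" if B: "B : rbox" for B proof (rule Suc.IH)
  show "sqint LL (%ps. itg Mu (%p. cnj (indicator B p) * g (p # ps)) )" by (rule sqint_partial[OF rbox_Delta_P(1)[OF B] g])
  fix fs :: "'s wf list" assume fs: "set fs <= Delta_P m" "length fs = n"
  let ?h = "mk (indicator B) :: 's wf"
  have fH: "set fs <= hcar H1" "?h : hcar H1" using fs(1) Delta_P_H1 rbox_Delta_P(2)[OF B] by auto
  have sq: "sqint LL (%ps. itg Mu (%p. cnj (indicator B p) * g (p # ps)) )" by (rule sqint_partial[OF rbox_Delta_P(1)[OF B] g])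
  have "(itg Mu (%p. cnj (indicator B p) * g (p # ps))) = (itg Mu (%p. cnj (repr ?h p) * g (p # ps)))" for ps proof (rule integral_cong_AE)
   have [measurable]: "B : sets borel" using B by (auto simp: rbox_def)
   note [measurable] = measurable_section[of g borel]
   show "(%p. cnj (indicator B p) * g (p # ps)) : bm Mu" by measurable
   have [measurable]: "repr ?h : bm Mu" by (intro vm.sqint_borel repr_H1 fH)
   show "(%p. cnj (repr ?h p) * g (p # ps)) : bm Mu" by measurable
   show "AE p in Mu. cnj (indicator B p) * g (p # ps) = cnj (repr ?h p) * g (p # ps)" using vm.repr_M(3)[OF vm.sqint_strong[OF rbox_Delta_P(1)[OF B]]] by eventually_elim simp
  qed
  then have "ipL (tensor fs) (mk (%ps. itg Mu (%p. cnj (indicator B p) * g (p # ps)) )) = ipL (tensor (?h # fs)) (mk g)" unfolding hip_tensor_Cons(2)[OF fH(2,1) g] tensor_eq[of fs] using sq sqint_tensor[OF fH(1)]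
   by (subst vl.hip_mk) (auto simp: vl.sqint_borel)
  also have "... = 0" using Suc.prems(2)[of "?h # fs"] fs rbox_Delta_P(2)[OF B] by simp
  finally show "ipL (tensor fs) (mk (%ps. itg Mu (%p. cnj (indicator B p) * g (p # ps)) )) = 0" .
 qed
 \<comment> \<open>Countability of \<open>rbox\<close> gives one null set of tails that works for
   all boxes at once.\<close>
 have "AE ps in LL. \<forall>B\<in>rbox. length ps = n --> (itg Mu (%p. cnj (indicator B p) * g (p # ps))) = 0" unfolding AE_ball_countable[OF countable_rbox] using sub by blast
 then have ae: "AE ps in LL. length ps = n --> (AE p in Mu. g (p # ps) = 0)" using sqint_Cons[OF g] proof eventually_elim
  case (elim ps)
  show ?case proof (intro impI AE_zero_if_box_integrals_zero)
   assume n: "length ps = n"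
   fix B :: "(real ^ 's) set" assume B: "B : rbox"
   have ci: "cnj (indicator B p) = indicator B p" for p :: "real ^ 's" by (simp add: indicator_def)
   show "integrable Mu (%p. indicator B p * g (p # ps))" using vm.integrable_cinner[OF rbox_Delta_P(1)[OF B] elim(2)] by (simp add: ci)
   show "(itg Mu (%p. indicator B p * g (p # ps))) = 0" using elim(1)[rule_format, OF B n] unfolding ci .
  qed (auto intro: sigma_finite_measure_axioms sqint_mu_borel elim(2))
 qed
 have "{qs : space LL. length qs = Suc n \<and> g qs ~= 0} : sets LL" by measurable
 then have S [measurable]: "{qs. length qs = Suc n \<and> g qs ~= 0} : sets LL" by simp
 have "emeasure LL {qs. length qs = Suc n \<and> g qs ~= 0} = (nni LL (%qs. indicator {qs. length qs = Suc n \<and> g qs ~= 0} qs))" by simp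
 also have "... = (nni LL (%ps. nni Mu (%p. indicator {qs. length qs = Suc n \<and> g qs ~= 0} (p # ps))))" by (subst nn_integral_L_swap) auto
 also have "... = (nni LL (%ps. 0))" proof (rule nn_integral_cong_AE, use ae in eventually_elim)
  fix ps assume z: "length ps = n --> (AE p in Mu. g (p # ps) = 0)"
  have "(nni Mu (%p. indicator {qs. length qs = Suc n \<and> g qs ~= 0} (p # ps))) = (nni Mu (%p. 0))" proof (cases "length ps = n")
   case True
   then have "AE p in Mu. g (p # ps) = 0" using z by simp
   then show ?thesis by (intro nn_integral_cong_AE) (auto elim!: eventually_mono)
  qed auto
  then show "(nni Mu (%p. indicator {qs. length qs = Suc n \<and> g qs ~= 0} (p # ps))) = 0" by simp
 qed
 finally have "emeasure LL {qs. length qs = Suc n \<and> g qs ~= 0} = 0" by simp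
 then have "{qs. length qs = Suc n \<and> g qs ~= 0} : null_sets LL" using S by (auto simp: null_sets_def)
 from AE_not_in[OF this] show ?case by eventually_elim auto
qed

lemma total_tensor: "hspace.total (L2 LL) (tensor ` {fs. set fs <= Delta_P m})" unfolding hspace.total_def[OF hspace_L2_LL] proof (intro conjI ballI impI)
 show "tensor ` {fs. set fs <= Delta_P m} <= cL" using tensor_full Delta_P_H1 by blast
 fix u assume "u : cL" and z: "\<forall>t\<in>tensor ` {fs. set fs <= Delta_P m}. ipL t u = 0"
 then obtain g where g: "u = mk g" "sqint LL g" by (auto simp: vl.L2_carrier)
 have "AE ps in LL. \<forall>n. length ps = n --> g ps = 0" unfolding AE_all_countable using z g by (intro allI tensors_separate) auto
 then have "AE ps in LL. g ps = 0" by eventually_elim auto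
 then show "u = 0" unfolding g mk_zero vl.mk_eq_iff_M .
qed

end

section \<open>Creation and annihilation operators with a kernel\<close>

context mass
begin

abbreviation tot :: "(real ^ 's) list => 's spacetime" where "tot \<equiv> total_momentum m"

text \<open>The kernel may depend on the created momentum and on the total momentum of the other
  particles. This form is stable under all that happens to the field: translation phases, averaging
  in the oscillatory integral and the limit only change \<open>kp\<close>.\<close>

definition crea_fun :: "(real ^ 's => 's spacetime => complex) => (real ^ 's => complex) => ((real ^ 's) list => complex) => (real ^ 's) list => complex" where "crea_fun kp h f qs = cor (1 / sqrt (real (length qs))) *
  (\<Sum>k<length qs. h (qs ! k) * kp (qs ! k) (tot (rem_nth k qs)) * f (rem_nth k qs))"

definition ann_fun :: "(real ^ 's => 's spacetime => complex) => (real ^ 's => complex) => ((real ^ 's) list => complex) => (real ^ 's) list => complex" where "ann_fun kp h f ps = cor (sqrt (real (length ps + 1))) *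
  (itg Mu (%p. cnj (h p) * kp p (tot ps) * f (p # ps)))"

definition creaK :: "(real ^ 's => 's spacetime => complex) => 's wf => ('s, complex) fk => ('s, complex) fk" where "creaK kp h \<Psi> = mk (crea_fun kp (repr h) (repr \<Psi>))"

definition annK :: "(real ^ 's => 's spacetime => complex) => 's wf => ('s, complex) fk => ('s, complex) fk" where "annK kp h \<Psi> = mk (ann_fun kp (repr h) (repr \<Psi>))"

text \<open>The constant is part of the predicate so that a bound common to a family of kernels can
  be expressed.\<close>

definition kernel :: "real => (real ^ 's => 's spacetime => complex) => bool" where "kernel C kp \<longleftrightarrow> (%z. kp (fst z) (snd z)) : bm (borel >< borel) \<and> (\<forall>p q. cmod (kp p q) <= C)"

lemma crea_eq: "crea h = creaK (%_ _. 1) h" unfolding crea_def creaK_def crea_fun_def rem_nth_def by simp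

lemma ann_eq: "ann m h = annK (%_ _. 1) h" unfolding ann_def annK_def ann_fun_def by simp

lemma kernel_one: "kernel 1 (%_ _. 1)" by (simp add: kernel_def)

lemma kernel_cnj: "kernel C kp ==> kernel C (%p q. cnj (kp p q))" by (auto simp: kernel_def intro: measurable_compose[OF _ borel_measurable_cnj])

lemma kernel_diff: "kernel C kp ==> kernel D kp' ==> kernel (C + D) (%p q. kp p q - kp' p q)" unfolding kernel_def proof (intro conjI allI; (elim conjE)?)
 fix p q
 assume "\<forall>p q. cmod (kp p q) <= C" "\<forall>p q. cmod (kp' p q) <= D"
 then show "cmod (kp p q - kp' p q) <= C + D" by (intro order_trans[OF norm_triangle_ineq4 add_mono]) auto
qed simp

lemma kernel_nonneg: "kernel C kp ==> 0 <= C" using norm_ge_zero order_trans unfolding kernel_def by blast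

lemma kernel_measurable: assumes "kernel C kp" "f : bm N" "g : bm N" shows "(%x. kp (f x) (g x)) : bm N" using measurable_compose[OF measurable_Pair[OF assms(2,3)], of "%z. kp (fst z) (snd z)" borel] assms(1)
 by (simp add: kernel_def)

lemma kernel_measurable_mu: assumes "kernel C kp" "f : measurable N Mu" "g : bm N" shows "(%x. kp (f x) (g x)) : bm N" proof -
 have "f : bm N" using assms(2) measurable_cong_sets[OF refl sets_mu] by blast
 then show ?thesis using assms by (intro kernel_measurable)
qed

lemma measurable_crea_term: assumes kp: "kernel C kp" and [measurable]: "h : bm Mu" "f : bm LL" shows "(%qs. h (qs ! k) * kp (qs ! k) (tot (rem_nth k qs)) * f (rem_nth k qs)) : bm LL" proof -
 have [measurable]: "(%qs. kp (qs ! k) (tot (rem_nth k qs))) : bm LL" by (rule kernel_measurable_mu[OF kp]) measurable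
 show ?thesis by measurable
qed

lemma measurable_crea_fun: assumes kp: "kernel C kp" and h: "h : bm Mu" and f: "f : bm LL" shows "crea_fun kp h f : bm LL" proof -
 note [measurable] = measurable_crea_term[OF assms]
 have [measurable]: "(%qs. \<Sum>k<length qs. h (qs ! k) * kp (qs ! k) (tot (rem_nth k qs)) * f (rem_nth k qs)) : bm LL" by (rule measurable_compose_countable[where g = length]) measurable
 show ?thesis unfolding crea_fun_def by measurable
qed

lemma measurable_ann_integrand: assumes kp: "kernel C kp" and [measurable]: "h : bm Mu" "f : bm LL" shows "(%p. cnj (h p) * kp p (tot ps) * f (p # ps)) : bm Mu" proof -
 have [measurable]: "(%p. kp p (tot ps)) : bm Mu" by (rule kernel_measurable_mu[OF kp]) (auto intro: measurable_ident_sets)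
 note [measurable] = measurable_section[of f borel]
 show ?thesis by measurable
qed

lemma measurable_ann_pair: assumes kp: "kernel C kp" and [measurable]: "h : bm Mu" "f : bm LL" shows "(%(ps, p). cnj (h p) * kp p (tot ps) * f (p # ps)) : bm (LL >< Mu)" proof -
 have [measurable]: "(%z. kp (snd z) (tot (fst z))) : bm (LL >< Mu)" by (rule kernel_measurable_mu[OF kp]) measurable
 show ?thesis by measurable
qed

lemma measurable_ann_fun: assumes kp: "kernel C kp" and h: "h : bm Mu" and f: "f : bm LL" shows "ann_fun kp h f : bm LL" proof -
 have [measurable]: "(%ps. itg Mu (%p. cnj (h p) * kp p (tot ps) * f (p # ps)) ) : bm LL" by (rule borel_measurable_lebesgue_integral[OF measurable_ann_pair[OF assms]])
 show ?thesis unfolding ann_fun_def by measurable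
qed

lemma crea_fun_cong_AE: assumes "AE p in Mu. h p = h' p" "AE ps in LL. f ps = f' ps" shows "AE qs in LL. crea_fun kp h f qs = crea_fun kp h' f' qs" using AE_nth[OF assms(1)] AE_rem_nth[OF assms(2)]
 by eventually_elim (auto simp: crea_fun_def intro!: sum.cong)

lemma ann_fun_cong_AE: assumes kp: "kernel C kp" and meas: "h : bm Mu" "h' : bm Mu"
  "f : bm LL" "f' : bm LL" and h: "AE p in Mu. h p = h' p" and f: "AE ps in LL. f ps = f' ps" shows "AE ps in LL. ann_fun kp h f ps = ann_fun kp h' f' ps" using AE_L_Cons(2)[OF f] proof eventually_elim
 case (elim ps)
 have "(itg Mu (%p. cnj (h p) * kp p (tot ps) * f (p # ps))) = (itg Mu (%p. cnj (h' p) * kp p (tot ps) * f' (p # ps)))" proof (rule integral_cong_AE)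
  show "AE p in Mu. cnj (h p) * kp p (tot ps) * f (p # ps) = cnj (h' p) * kp p (tot ps) * f' (p # ps)" using elim h by eventually_elim simp
 qed (intro measurable_ann_integrand[OF kp] meas)+
 then show ?case by (simp add: ann_fun_def)
qed

lemma creaK_mk: assumes "sqint Mu h" "sqint LL f" shows "creaK kp (mk h) (mk f) = mk (crea_fun kp h f)" unfolding creaK_def vl.mk_eq_iff_M by (intro crea_fun_cong_AE vm.repr_M vl.repr_M vm.sqint_strong vl.sqint_strong assms)

lemma annK_mk: assumes kp: "kernel C kp" and h: "sqint Mu h" and f: "sqint LL f" shows "annK kp (mk h) (mk f) = mk (ann_fun kp h f)" unfolding annK_def vl.mk_eq_iff_M
 by (intro ann_fun_cong_AE[OF kp] vm.repr_M(3) vl.repr_M(3) vm.sqint_strong vl.sqint_strong h f vm.sqint_borel vl.sqint_borel vm.repr_L2 vl.repr_L2 vm.L2_mk vl.L2_mk)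

lemma H1E: assumes "h : hcar H1" obtains g where "h = mk g" "sqint Mu g" using assms by (auto simp: one_particle_eq vm.L2_carrier)

lemma norm_sum_sq_le: "(cmod (cor (1 / sqrt (real n)) * (\<Sum>k<n. b k)))^2 <= (\<Sum>k<n. (cmod (b k))^2)" proof -
 have "(cmod (\<Sum>k<n. b k))^2 <= (\<Sum>k<n. cmod (b k))^2" by (intro power_mono norm_sum) auto
 also have "... <= (\<Sum>k<n. (cmod (b k))^2) * real n" using sum_squared_le_sum_of_squares[of "%k. cmod (b k)" "{..<n}"] by simp
 finally show ?thesis by (cases "n = 0") (auto simp: norm_mult norm_divide power_mult_distrib power_divide divide_le_eq)
qed

text \<open>The factor \<open>n\<close> lost in squaring a sum of \<open>n\<close> terms cancels the
  squared prefactor \<open>1 / n\<close>; integrating over the singled-out entry produces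
  \<open>length ps + 1\<close>. The bound stays an integral, since \<open>creaK_tendsto\<close>
  applies dominated convergence to it.\<close>

lemma crea_fun_bound: assumes kp: "kernel C kp" and h: "h : bm Mu" and f: "f : bm LL" shows "(nni LL (%qs. en ((cmod (crea_fun kp h f qs))^2))) <=
  (nni Mu (%p. nni LL (%ps. en (real (length ps + 1)) * en ((cmod (h p * kp p (tot ps) * f ps))^2))))" proof -
 have [measurable]: "(%z. kp (fst z) (tot (snd z))) : bm (Mu >< LL)" by (rule kernel_measurable_mu[OF kp]) measurable
 note [measurable] = h f
 have "(nni LL (%qs. en ((cmod (crea_fun kp h f qs))^2))) <= (nni LL (%qs. (\<Sum>k<length qs. en ((cmod (h (qs ! k) * kp (qs ! k) (tot (rem_nth k qs)) * f (rem_nth k qs)))^2))))" unfolding crea_fun_def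
  by (rule nn_integral_mono, subst sum_ennreal, simp, rule ennreal_leI, rule norm_sum_sq_le)
 also have "... = (nni Mu (%p. nni LL (%ps. en (real (length ps + 1)) * en ((cmod (h p * kp p (tot ps) * f ps))^2))))" by (rule nn_integral_sum_rem_nth) measurable
 finally show ?thesis .
qed

text \<open>Cauchy-Schwarz in the annihilated momentum on almost every slice; the weight
  \<open>length ps + 1\<close> is the square of the prefactor.\<close>

lemma ann_fun_bound: assumes kp: "kernel C kp" and h: "sqint Mu h" and f: "sqint LL f" shows "(nni LL (%ps. en ((cmod (ann_fun kp h f ps))^2))) <= (nni Mu (%p. en ((cmod (h p))^2))) *
  (nni Mu (%p. nni LL (%ps. en (real (length ps + 1)) * en ((cmod (kp p (tot ps) * f (p # ps)))^2))))" proof -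
 note [measurable] = vm.sqint_borel[OF h] vl.sqint_borel[OF f]
 have [measurable]: "(%z. kp (snd z) (tot (fst z))) : bm (LL >< Mu)" by (rule kernel_measurable_mu[OF kp]) measurable
 have [measurable]: "(%z. kp (fst z) (tot (snd z))) : bm (Mu >< LL)" by (rule kernel_measurable_mu[OF kp]) measurable
 have "AE ps in LL. en ((cmod (ann_fun kp h f ps))^2) <= (nni Mu (%p. en ((cmod (h p))^2))) * (nni Mu (%p. en (real (length ps + 1)) * en ((cmod (kp p (tot ps) * f (p # ps)))^2)))" using sqint_Cons[OF f] proof eventually_elim
  case (elim ps)
  interpret H: hspace "L2 Mu :: 's wf hilb" by (rule vm.hspace_L2)
  let ?g = "%p. kp p (tot ps) * f (p # ps)"
  have [measurable]: "(%p. kp p (tot ps)) : bm Mu" by (rule kernel_measurable_mu[OF kp]) (auto intro: measurable_ident_sets)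
  note [measurable] = measurable_section[of f borel]
  have g: "sqint Mu ?g" proof (rule vm.sqint_bounded[OF elim])
   show "smeas Mu ?g" by simp
   show "AE p in Mu. cmod (?g p) <= C * cmod (f (p # ps))" using kp by (auto simp: kernel_def norm_mult intro!: mult_right_mono)
  qed
  have "cmod (hip (L2 Mu) (mk h) (mk ?g)) <= hnorm (L2 Mu) (mk h) * hnorm (L2 Mu) (mk ?g)" using vm.L2_mk[OF h] vm.L2_mk[OF g] by (rule H.Cauchy_Schwarz)
  then have "(cmod (itg Mu (%p. cnj (h p) * ?g p)))^2 <= (hnorm (L2 Mu) (mk h))^2 * (hnorm (L2 Mu) (mk ?g))^2" unfolding vm.hip_mk[OF vm.sqint_strong[OF h] vm.sqint_strong[OF g]] by (simp add: power_mono flip: power_mult_distrib)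
  then have "en ((cmod (itg Mu (%p. cnj (h p) * ?g p)))^2) <= en ((hnorm (L2 Mu) (mk h))^2) * en ((hnorm (L2 Mu) (mk ?g))^2)" by (simp flip: ennreal_mult)
  then have le: "en ((cmod (itg Mu (%p. cnj (h p) * ?g p)))^2) <= (nni Mu (%p. en ((cmod (h p))^2))) * (nni Mu (%p. en ((cmod (?g p))^2)))" by (simp only: vm.hnorm_mk[OF h] vm.hnorm_mk[OF g])
  have "en ((cmod (ann_fun kp h f ps))^2) = en (real (length ps + 1)) * en ((cmod (itg Mu (%p. cnj (h p) * ?g p)))^2)" by (simp add: ann_fun_def norm_mult power_mult_distrib ennreal_mult mult.assoc)
  also have "... <= en (real (length ps + 1)) * ((nni Mu (%p. en ((cmod (h p))^2))) * (nni Mu (%p. en ((cmod (?g p))^2))))" using le by (intro mult_left_mono) auto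
  also have "... = (nni Mu (%p. en ((cmod (h p))^2))) * (nni Mu (%p. en (real (length ps + 1)) * en ((cmod (?g p))^2)))" by (subst nn_integral_cmult) (auto simp: ac_simps)
  finally show ?case .
 qed
 then have "(nni LL (%ps. en ((cmod (ann_fun kp h f ps))^2))) <= (nni LL (%ps. (nni Mu (%p. en ((cmod (h p))^2))) * (nni Mu (%p. en (real (length ps + 1)) * en ((cmod (kp p (tot ps) * f (p # ps)))^2)))))"
  by (rule nn_integral_mono_AE)
 also have "... = (nni Mu (%p. en ((cmod (h p))^2))) * (nni LL (%ps. nni Mu (%p. en (real (length ps + 1)) * en ((cmod (kp p (tot ps) * f (p # ps)))^2))))" by (rule nn_integral_cmult) measurable
 also have "(nni LL (%ps. nni Mu (%p. en (real (length ps + 1)) * en ((cmod (kp p (tot ps) * f (p # ps)))^2)))) = (nni Mu (%p. nni LL (%ps. en (real (length ps + 1)) * en ((cmod (kp p (tot ps) * f (p # ps)))^2))))"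
  by (rule PL.Fubini') (simp add: split_beta')
 finally show ?thesis .
qed

lemma crea_fun_sq_le: assumes kp: "kernel C kp" and h: "sqint Mu h" and f: "sqint LL f" and N: "!!ps. N < length ps ==> f ps = 0" shows "(nni LL (%qs. en ((cmod (crea_fun kp h f qs))^2))) <=
  en ((sqrt (real (N + 1)) * C * hnorm (L2 Mu) (mk h) * nmL (mk f))^2)" proof -
 note [measurable] = vm.sqint_borel[OF h] vl.sqint_borel[OF f]
 have C: "0 <= C" by (rule kernel_nonneg[OF kp])
 have "(nni LL (%qs. en ((cmod (crea_fun kp h f qs))^2))) <= (nni Mu (%p. nni LL (%ps. en (real (length ps + 1)) * en ((cmod (h p * kp p (tot ps) * f ps))^2))))" by (rule crea_fun_bound[OF kp]) measurable
 also have "... <= (nni Mu (%p. nni LL (%ps. en (real (N + 1) * C\<^sup>2) * en ((cmod (h p))^2) * en ((cmod (f ps))^2))))" proof (intro nn_integral_mono)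
  fix p ps
  show "en (real (length ps + 1)) * en ((cmod (h p * kp p (tot ps) * f ps))^2) <= en (real (N + 1) * C\<^sup>2) * en ((cmod (h p))^2) * en ((cmod (f ps))^2)" proof (cases "length ps <= N")
   case True
   have "(cmod (kp p (tot ps)))^2 <= C\<^sup>2" using kp by (intro power_mono) (auto simp: kernel_def)
   then have "real (length ps + 1) * (cmod (h p * kp p (tot ps) * f ps))^2 <= real (N + 1) * C\<^sup>2 * (cmod (h p))^2 * (cmod (f ps))^2"
    using True by (auto simp: norm_mult power_mult_distrib mult.assoc mult.left_commute[of _ "(cmod (h p))^2"] intro!: mult_mono)
   from ennreal_leI[OF this] show ?thesis by (simp only: ennreal_mult zero_le_power2 of_nat_0_le_iff mult_nonneg_nonneg)
  qed (simp add: N)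
 qed
 also have "... = en (real (N + 1) * C\<^sup>2) * (nni Mu (%p. en ((cmod (h p))^2))) * (nni LL (%ps. en ((cmod (f ps))^2)))" by (simp add: nn_integral_cmult nn_integral_multc)
 also have "... = en ((sqrt (real (N + 1)) * C * hnorm (L2 Mu) (mk h) * nmL (mk f))^2)" unfolding vm.hnorm_mk[OF h, symmetric] vl.hnorm_mk[OF f, symmetric] by (simp add: power_mult_distrib flip: ennreal_mult)
 finally show ?thesis .
qed

lemma ann_fun_sq_le: assumes kp: "kernel C kp" and h: "sqint Mu h" and f: "sqint LL f" and N: "!!ps. N < length ps ==> f ps = 0" shows "(nni LL (%qs. en ((cmod (ann_fun kp h f qs))^2))) <=
  en ((sqrt (real (N + 1)) * C * hnorm (L2 Mu) (mk h) * nmL (mk f))^2)" proof -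
 note [measurable] = vm.sqint_borel[OF h] vl.sqint_borel[OF f]
 have C: "0 <= C" by (rule kernel_nonneg[OF kp])
 have "(nni LL (%qs. en ((cmod (ann_fun kp h f qs))^2))) <= (nni Mu (%p. en ((cmod (h p))^2))) * (nni Mu (%p. nni LL (%ps. en (real (length ps + 1)) * en ((cmod (kp p (tot ps) * f (p # ps)))^2))))"
  by (rule ann_fun_bound[OF kp h f])
 also have "... <= (nni Mu (%p. en ((cmod (h p))^2))) * (nni Mu (%p. nni LL (%ps. en (real (N + 1) * C\<^sup>2) * en ((cmod (f (p # ps)))^2))))" proof (intro nn_integral_mono mult_left_mono)
  fix p ps
  show "en (real (length ps + 1)) * en ((cmod (kp p (tot ps) * f (p # ps)))^2) <= en (real (N + 1) * C\<^sup>2) * en ((cmod (f (p # ps)))^2)" proof (cases "length (p # ps) <= N")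
   case True
   have "(cmod (kp p (tot ps)))^2 <= C\<^sup>2" using kp by (intro power_mono) (auto simp: kernel_def)
   then have "real (length ps + 1) * (cmod (kp p (tot ps) * f (p # ps)))^2 <= real (N + 1) * C\<^sup>2 * (cmod (f (p # ps)))^2" using True by (auto simp: norm_mult power_mult_distrib mult.assoc intro!: mult_mono)
   from ennreal_leI[OF this] show ?thesis by (simp only: ennreal_mult zero_le_power2 of_nat_0_le_iff mult_nonneg_nonneg)
  qed (simp add: N)
 qed auto
 also have "... <= (nni Mu (%p. en ((cmod (h p))^2))) * (en (real (N + 1) * C\<^sup>2) * (nni LL (%ps. en ((cmod (f ps))^2))))"
  by (subst nn_integral_L[of "%ps. en ((cmod (f ps))^2)"]) (auto simp: nn_integral_cmult intro!: mult_left_mono)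
 also have "... = en ((sqrt (real (N + 1)) * C * hnorm (L2 Mu) (mk h) * nmL (mk f))^2)" unfolding vm.hnorm_mk[OF h, symmetric] vl.hnorm_mk[OF f, symmetric] using C by (simp add: power_mult_distrib mult_ac flip: ennreal_mult)
 finally show ?thesis .
qed

lemma sum_nth_mset: "mset xs = mset ys ==> (\<Sum>k<length xs. \<phi> (xs ! k)) = (\<Sum>k<length ys. \<phi> (ys ! k) :: complex)" proof -
 assume "mset xs = mset ys"
 then have "sum_mset (image_mset \<phi> (mset xs)) = sum_mset (image_mset \<phi> (mset ys))" by simp
 then show ?thesis by (simp only: mset_map[symmetric] sum_mset_sum_list) (simp add: sum_list_sum_nth atLeast0LessThan)
qed

lemma crea_fun_symmetric: assumes f: "!!ps qs. mset ps = mset qs ==> f ps = f qs" and eq: "mset ps = mset qs" shows "crea_fun kp h f ps = crea_fun kp h f qs" proof -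
 \<comment> \<open>\<open>s\<close> chooses one list for each multiset, so that every summand
   becomes a function of the multiset and one of its entries; such a sum does not depend on the
   order.\<close>
 define s where "s M = (SOME xs :: (real ^ 's) list. mset xs = M)" for M
 have s: "mset (s (mset xs)) = mset xs" for xs unfolding s_def by (rule someI[of _ xs]) simp
 define \<phi> where "\<phi> M p = h p * kp p (tot (s (M - {#p#}))) * f (s (M - {#p#}))" for M p
 have t: "h (xs ! k) * kp (xs ! k) (tot (rem_nth k xs)) * f (rem_nth k xs) = \<phi> (mset xs) (xs ! k)" if "k < length xs" for xs k unfolding \<phi>_def mset_rem_nth[OF that, symmetric]
  using s[of "rem_nth k xs"] f[OF s[of "rem_nth k xs"]] total_momentum_mset[OF s[of "rem_nth k xs"]] by simp
 have "crea_fun kp h f xs = cor (1 / sqrt (real (length xs))) * (\<Sum>k<length xs. \<phi> (mset xs) (xs ! k))" for xs by (simp add: crea_fun_def t)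
 then show ?thesis using eq sum_nth_mset[OF eq, of "\<phi> (mset qs)"] by (simp add: mset_eq_length[OF eq])
qed

lemma crea_fun_vanish: assumes "!!ps. N < length ps ==> f ps = 0" "Suc N < length qs" shows "crea_fun kp h f qs = 0" using assms by (auto simp: crea_fun_def length_rem_nth intro!: sum.neutral)

lemma ann_fun_symmetric: assumes f: "!!ps qs. mset ps = mset qs ==> f ps = f qs" and eq: "mset ps = mset qs" shows "ann_fun kp h f ps = ann_fun kp h f qs" proof -
 have "f (p # ps) = f (p # qs)" for p using eq by (intro f) simp
 then show ?thesis using mset_eq_length[OF eq] total_momentum_mset[OF eq, of m] by (simp add: ann_fun_def)
qed

lemma ann_fun_vanish: assumes "!!ps. N < length ps ==> f ps = 0" "N < length qs" shows "ann_fun kp h f qs = 0" using assms by (simp add: ann_fun_def)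

lemma sqint_crea_fun: assumes "kernel C kp" "sqint Mu h" "sqint LL f" "!!ps. N < length ps ==> f ps = 0" shows "sqint LL (crea_fun kp h f)" unfolding vl.sqint_iff smeas_complex proof
 show "crea_fun kp h f : bm LL" using assms by (intro measurable_crea_fun) (auto simp: vm.sqint_borel vl.sqint_borel)
 show "(nni LL (%qs. en ((cmod (crea_fun kp h f qs))^2))) < \<infinity>" using crea_fun_sq_le[OF assms] by (rule order_le_less_trans) auto
qed

lemma sqint_ann_fun: assumes "kernel C kp" "sqint Mu h" "sqint LL f" "!!ps. N < length ps ==> f ps = 0" shows "sqint LL (ann_fun kp h f)" unfolding vl.sqint_iff smeas_complex proof
 show "ann_fun kp h f : bm LL" using assms by (intro measurable_ann_fun) (auto simp: vm.sqint_borel vl.sqint_borel)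
 show "(nni LL (%qs. en ((cmod (ann_fun kp h f qs))^2))) < \<infinity>" using ann_fun_sq_le[OF assms] by (rule order_le_less_trans) auto
qed

lemma creaK_full_le: assumes kp: "kernel C kp" and h: "h : hcar H1" and u: "u : hcar (full_le N)" shows "creaK kp h u : hcar (full_le (Suc N))" and "nmL (creaK kp h u) <= sqrt (real (N + 1)) * C * hnorm H1 h * nmL u" proof -
 obtain g where g: "h = mk g" "sqint Mu g" using h by (rule H1E)
 obtain f where f: "u = mk f" "sqint LL f" "!!ps. N < length ps ==> f ps = 0" using u by (rule full_leE) blast
 have sq: "sqint LL (crea_fun kp g f)" by (rule sqint_crea_fun[where N = N, OF kp g(2) f(2)]) (rule f(3))
 have eq: "creaK kp h u = mk (crea_fun kp g f)" unfolding g(1) f(1) by (rule creaK_mk[OF g(2) f(2)])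
 show "creaK kp h u : hcar (full_le (Suc N))" unfolding eq by (rule full_leI[OF sq]) (rule crea_fun_vanish[of N], rule f(3))
 show "nmL (creaK kp h u) <= sqrt (real (N + 1)) * C * hnorm H1 h * nmL u" unfolding eq unfolding f(1) g(1) one_particle_eq using kernel_nonneg[OF kp]
  by (intro vl.hnorm_mk_le[OF sq] crea_fun_sq_le[where N = N, OF kp g(2) f(2)] f(3) mult_nonneg_nonneg vm.hnorm_mk_nonneg[OF g(2)] vl.hnorm_mk_nonneg[OF f(2)]) auto
qed

lemma creaK_fock_le: assumes kp: "kernel C kp" and h: "h : hcar H1" and u: "u : cN N" shows "creaK kp h u : hcar (fock_le (Suc N))" proof -
 obtain g where g: "h = mk g" "sqint Mu g" using h by (rule H1E)
 obtain f where f: "u = mk f" "sqint LL f" "!!ps qs. mset ps = mset qs ==> f ps = f qs"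
  "!!ps. N < length ps ==> f ps = 0" using u by (rule fock_leE) blast
 have eq: "creaK kp h u = mk (crea_fun kp g f)" unfolding g(1) f(1) by (rule creaK_mk[OF g(2) f(2)])
 show ?thesis unfolding eq proof (rule fock_leI)
  show "sqint LL (crea_fun kp g f)" by (rule sqint_crea_fun[where N = N, OF kp g(2) f(2)]) (rule f(4))
  show "crea_fun kp g f ps = crea_fun kp g f qs" if "mset ps = mset qs" for ps qs by (rule crea_fun_symmetric[OF _ that]) (rule f(3))
  show "crea_fun kp g f ps = 0" if "Suc N < length ps" for ps by (rule crea_fun_vanish[OF _ that]) (rule f(4))
 qed
qed

lemma annK_full_le: assumes kp: "kernel C kp" and h: "h : hcar H1" and u: "u : hcar (full_le N)" shows "annK kp h u : hcar (full_le N)" and "nmL (annK kp h u) <= sqrt (real (N + 1)) * C * hnorm H1 h * nmL u" proof -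
 obtain g where g: "h = mk g" "sqint Mu g" using h by (rule H1E)
 obtain f where f: "u = mk f" "sqint LL f" "!!ps. N < length ps ==> f ps = 0" using u by (rule full_leE) blast
 have sq: "sqint LL (ann_fun kp g f)" by (rule sqint_ann_fun[where N = N, OF kp g(2) f(2)]) (rule f(3))
 have eq: "annK kp h u = mk (ann_fun kp g f)" unfolding g(1) f(1) by (rule annK_mk[OF kp g(2) f(2)])
 show "annK kp h u : hcar (full_le N)" unfolding eq by (rule full_leI[OF sq]) (rule ann_fun_vanish[of N], rule f(3))
 show "nmL (annK kp h u) <= sqrt (real (N + 1)) * C * hnorm H1 h * nmL u" unfolding eq unfolding f(1) g(1) one_particle_eq using kernel_nonneg[OF kp]
  by (intro vl.hnorm_mk_le[OF sq] ann_fun_sq_le[where N = N, OF kp g(2) f(2)] f(3) mult_nonneg_nonneg vm.hnorm_mk_nonneg[OF g(2)] vl.hnorm_mk_nonneg[OF f(2)]) auto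
qed

lemma annK_fock_le: assumes kp: "kernel C kp" and h: "h : hcar H1" and u: "u : cN N" shows "annK kp h u : cN N" proof -
 obtain g where g: "h = mk g" "sqint Mu g" using h by (rule H1E)
 obtain f where f: "u = mk f" "sqint LL f" "!!ps qs. mset ps = mset qs ==> f ps = f qs"
  "!!ps. N < length ps ==> f ps = 0" using u by (rule fock_leE) blast
 have eq: "annK kp h u = mk (ann_fun kp g f)" unfolding g(1) f(1) by (rule annK_mk[OF kp g(2) f(2)])
 show ?thesis unfolding eq proof (rule fock_leI)
  show "sqint LL (ann_fun kp g f)" by (rule sqint_ann_fun[where N = N, OF kp g(2) f(2)]) (rule f(4))
  show "ann_fun kp g f ps = ann_fun kp g f qs" if "mset ps = mset qs" for ps qs by (rule ann_fun_symmetric[OF _ that]) (rule f(3))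
  show "ann_fun kp g f ps = 0" if "N < length ps" for ps by (rule ann_fun_vanish[OF _ that]) (rule f(4))
 qed
qed

lemma linear_creaK: assumes h: "h : hcar H1" shows "linear_on (cL) (creaK kp h)" proof -
 obtain g where g: "h = mk g" "sqint Mu g" using h by (rule H1E)
 show ?thesis unfolding linear_on_def proof (intro conjI ballI allI)
  fix u v :: "('s, complex) fk"
  assume "u : cL" "v : cL"
  then obtain f f' :: "(real ^ 's) list => complex" where "u = mk f" "sqint LL f" "v = mk f'" "sqint LL f'" by (auto simp: vl.L2_carrier)
  moreover have "crea_fun kp g (%x. f x + f' x) = (%x. crea_fun kp g f x + crea_fun kp g f' x)" by (rule ext) (simp add: crea_fun_def algebra_simps sum.distrib)
  ultimately show "creaK kp h (u + v) = creaK kp h u + creaK kp h v" using g by (simp add: mk_plus creaK_mk vl.sqint_add)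
 next
  fix c and u :: "('s, complex) fk"
  assume "u : cL"
  then obtain f :: "(real ^ 's) list => complex" where "u = mk f" "sqint LL f" by (auto simp: vl.L2_carrier)
  moreover have "crea_fun kp g (%x. c * f x) = (%x. c * crea_fun kp g f x)" by (rule ext) (simp add: crea_fun_def sum_distrib_left mult_ac)
  ultimately show "creaK kp h (c *c u) = c *c creaK kp h u" using g vl.sqint_scale[of f c] by (simp add: mk_scale creaK_mk)
 qed
qed

text \<open>Integrability is available on almost every slice only, so additivity of annihilation is
  an identity of classes, in contrast to the pointwise one for creation.\<close>

lemma integrable_ann_integrand: assumes kp: "kernel C kp" and h: "sqint Mu h" and f: "sqint LL f" shows "AE ps in LL. integrable Mu (%p. cnj (h p) * kp p (tot ps) * f (p # ps))" using sqint_Cons[OF f] proof eventually_elim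
 case (elim ps)
 note meas = vm.sqint_borel[OF h] vl.sqint_borel[OF f]
 show ?case proof (rule Bochner_Integration.integrable_bound)
  show "integrable Mu (%p. C * cmod (cnj (h p) * f (p # ps)))" using vm.integrable_cinner[OF h elim] by (intro integrable_mult_right integrable_norm) simp
  show "(%p. cnj (h p) * kp p (tot ps) * f (p # ps)) : bm Mu" by (rule measurable_ann_integrand[OF kp meas])
  have "cmod (h p) * cmod (kp p (tot ps)) * cmod (f (p # ps)) <= C * (cmod (h p) * cmod (f (p # ps)))" for p using kp mult_right_mono[of "cmod (kp p (tot ps))" C "cmod (h p) * cmod (f (p # ps))"] by (simp add: kernel_def mult_ac)
  then show "AE p in Mu. norm (cnj (h p) * kp p (tot ps) * f (p # ps)) <= norm (C * cmod (cnj (h p) * f (p # ps)))" using kernel_nonneg[OF kp] by (simp add: norm_mult)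
 qed
qed

lemma linear_annK: assumes kp: "kernel C kp" and h: "h : hcar H1" shows "linear_on (cL) (annK kp h)" proof -
 obtain g where g: "h = mk g" "sqint Mu g" using h by (rule H1E)
 show ?thesis unfolding linear_on_def proof (intro conjI ballI allI)
  fix u v :: "('s, complex) fk"
  assume "u : cL" "v : cL"
  then obtain f f' :: "(real ^ 's) list => complex" where f: "u = mk f" "sqint LL f" "v = mk f'" "sqint LL f'" by (auto simp: vl.L2_carrier)
  have "AE x in LL. ann_fun kp g (%x. f x + f' x) x = ann_fun kp g f x + ann_fun kp g f' x" using integrable_ann_integrand[OF kp g(2) f(2)] integrable_ann_integrand[OF kp g(2) f(4)]
   by eventually_elim (simp add: ann_fun_def algebra_simps)
  then show "annK kp h (u + v) = annK kp h u + annK kp h v" using f g by (simp add: mk_plus annK_mk[OF kp] vl.sqint_add vl.mk_eq_iff_M)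
 next
  fix c and u :: "('s, complex) fk"
  assume "u : cL"
  then obtain f :: "(real ^ 's) list => complex" where "u = mk f" "sqint LL f" by (auto simp: vl.L2_carrier)
  moreover have "ann_fun kp g (%x. c * f x) = (%x. c * ann_fun kp g f x)" by (rule ext) (simp add: ann_fun_def mult.left_commute[of _ c])
  ultimately show "annK kp h (c *c u) = c *c annK kp h u" using g vl.sqint_scale[of f c] by (simp add: mk_scale annK_mk[OF kp])
 qed
qed

lemma creaK_kernel_diff: assumes h: "h : hcar H1" and u: "u : cL" shows "creaK kp h u - creaK kp' h u = creaK (%p q. kp p q - kp' p q) h u"
 unfolding creaK_def mk_minus by (rule arg_cong[where f = mk]) (auto simp: fun_eq_iff crea_fun_def algebra_simps sum_subtractf)

lemma annK_kernel_diff: assumes kp: "kernel C kp" "kernel D kp'" and h: "h : hcar H1" and u: "u : cL" shows "annK kp h u - annK kp' h u = annK (%p q. kp p q - kp' p q) h u" proof -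
 note r = repr_H1(1)[OF h] vl.repr_L2(1)[OF u]
 have "AE ps in LL. ann_fun kp (repr h) (repr u) ps - ann_fun kp' (repr h) (repr u) ps = ann_fun (%p q. kp p q - kp' p q) (repr h) (repr u) ps" using integrable_ann_integrand[OF kp(1) r] integrable_ann_integrand[OF kp(2) r]
  by eventually_elim (simp add: ann_fun_def algebra_simps)
 then show ?thesis unfolding annK_def mk_minus vl.mk_eq_iff_M .
qed

subsection \<open>Adjoints\<close>

text \<open>Moving entry \<open>k\<close> to the front preserves the measure, and the symmetry of
  \<open>u\<close> makes all positions contribute equally. The number \<open>n\<close> of positions
  turns the prefactor \<open>1 / sqrt n\<close> of creation into the \<open>sqrt n\<close> of
  annihilation.\<close>

lemma crea_ann_adjoint: assumes kp: "kernel C kp" and h: "sqint Mu h" and f: "sqint LL f" and N: "!!ps. N < length ps ==> f ps = 0" and u: "sqint LL u" and sym: "!!ps qs. mset ps = mset qs ==> u ps = u qs"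
 shows "(itg LL (%qs. cnj (crea_fun kp h f qs) * u qs)) = (itg LL (%ps. cnj (f ps) * ann_fun (%p q. cnj (kp p q)) h u ps))" proof -
 note meas [measurable] = vm.sqint_borel[OF h] vl.sqint_borel[OF f]
 note [measurable] = vl.sqint_borel[OF u] measurable_crea_term[OF kp meas]
 let ?t = "%k qs. h (qs ! k) * kp (qs ! k) (tot (rem_nth k qs)) * f (rem_nth k qs)"
 \<comment> \<open>The guard \<open>k < length qs\<close> lets the sum run over the fixed range
   below \<open>Suc N\<close>, so that it can be exchanged with the integral.\<close>
 define c where "c k qs = (if k < length qs then cor (1 / sqrt (real (length qs))) * ?t k qs else 0)" for k qs
 have c_meas [measurable]: "c k : bm LL" for k unfolding c_def by measurable
 \<comment> \<open>Splitting the integral requires square integrability of each position separately;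
   it follows from the sum over all positions, which \<open>nn_integral_sum_rem_nth\<close>
   evaluates.\<close>
 have c_sq: "sqint LL (c k)" for k proof -
  have "(nni LL (%qs. en ((cmod (c k qs))^2))) <= (nni LL (%qs. (\<Sum>k<length qs. en ((cmod (?t k qs))^2))))" proof (rule nn_integral_mono)
   fix qs
   show "en ((cmod (c k qs))^2) <= (\<Sum>k<length qs. en ((cmod (?t k qs))^2))" proof (cases "k < length qs")
    case True
    have "real (length qs) \<ge> 1" using True by simp
    then have "cmod (cor (1 / sqrt (real (length qs)))) <= 1" by (simp add: norm_divide divide_le_eq_1)
    moreover have "cmod (c k qs) = cmod (cor (1 / sqrt (real (length qs)))) * cmod (?t k qs)" unfolding c_def using True by (simp only: if_True norm_mult[of "cor (1 / sqrt (real (length qs)))"])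
    ultimately have "cmod (c k qs) <= 1 * cmod (?t k qs)" by (metis mult_right_mono norm_ge_zero)
    then have "(cmod (c k qs))^2 <= (cmod (?t k qs))^2" by (intro power_mono) auto
    then have "en ((cmod (c k qs))^2) <= en ((cmod (?t k qs))^2)" by (rule ennreal_leI)
    also have "... <= (\<Sum>k<length qs. en ((cmod (?t k qs))^2))" using True by (intro member_le_sum) auto
    finally show ?thesis .
   qed (simp add: c_def)
  qed
  also have "... = (nni Mu (%p. nni LL (%ps. en (real (length ps + 1)) * en ((cmod (h p * kp p (tot ps) * f ps))^2))))" proof (rule nn_integral_sum_rem_nth)
   have [measurable]: "(%z. kp (fst z) (tot (snd z))) : bm (Mu >< LL)" by (rule kernel_measurable_mu[OF kp]) measurable
   show "(%(p, ps). en ((cmod (h p * kp p (tot ps) * f ps))^2)) : bm (Mu >< LL)" by measurable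
  qed
  also have "... <= (nni Mu (%p. nni LL (%ps. en (real (N + 1) * C\<^sup>2) * en ((cmod (h p))^2) * en ((cmod (f ps))^2))))" proof (intro nn_integral_mono)
   fix p ps
   show "en (real (length ps + 1)) * en ((cmod (h p * kp p (tot ps) * f ps))^2) <= en (real (N + 1) * C\<^sup>2) * en ((cmod (h p))^2) * en ((cmod (f ps))^2)" proof (cases "length ps <= N")
    case True
    have "(cmod (kp p (tot ps)))^2 <= C\<^sup>2" using kp by (intro power_mono) (auto simp: kernel_def)
    then have "real (length ps + 1) * (cmod (h p * kp p (tot ps) * f ps))^2 <= real (N + 1) * C\<^sup>2 * (cmod (h p))^2 * (cmod (f ps))^2"
     using True by (auto simp: norm_mult power_mult_distrib mult.assoc mult.left_commute[of _ "(cmod (h p))^2"] intro!: mult_mono)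
    from ennreal_leI[OF this] show ?thesis by (simp only: ennreal_mult zero_le_power2 of_nat_0_le_iff mult_nonneg_nonneg)
   qed (simp add: N)
  qed
  also have "... = en (real (N + 1) * C\<^sup>2) * (nni Mu (%p. en ((cmod (h p))^2))) * (nni LL (%ps. en ((cmod (f ps))^2)))" by (simp add: nn_integral_cmult nn_integral_multc)
  also have "... < \<infinity>" using h f by (auto simp: vm.sqint_iff vl.sqint_iff ennreal_mult_less_top)
  finally show ?thesis by (simp add: vl.sqint_iff)
 qed
 have i: "integrable LL (%qs. cnj (c k qs) * u qs)" for k using vl.integrable_cinner[OF c_sq u] by simp
 define d where "d k qs = (if k < length qs then cor (1 / sqrt (real (length qs))) * (cnj (h (hd qs) * kp (hd qs) (tot (tl qs)) * f (tl qs)) * u qs) else 0)" for k qs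
 have cd: "cnj (c k (move_nth k qs)) * u (move_nth k qs) = d k qs" for k qs using sym[of "move_nth k qs" qs] by (auto simp: c_def d_def nth_move_nth rem_move_nth)
 have d_int: "integrable LL (d k)" for k using integrable_move_nth[of "%qs. cnj (c k qs) * u qs" k] i[of k] by (simp add: cd)
 have d_eq: "(itg LL (%qs. cnj (c k qs) * u qs)) = (itg LL (%qs. d k qs))" for k using integral_move_nth[of "%qs. cnj (c k qs) * u qs" k] by (simp add: cd)
 have "crea_fun kp h f qs = (\<Sum>k<Suc N. c k qs)" for qs proof (cases "length qs <= Suc N")
  case True
  have "(\<Sum>k<Suc N. c k qs) = (\<Sum>k<length qs. c k qs)" by (rule sum.mono_neutral_right) (use True in "auto simp: c_def")
  then show ?thesis by (simp add: crea_fun_def c_def sum_distrib_left)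
 next
  case False
  then have "c k qs = 0" for k using N[of "rem_nth k qs"] by (auto simp: c_def length_rem_nth)
  then show ?thesis using False crea_fun_vanish[of N f qs kp h] N by simp
 qed
 then have "(itg LL (%qs. cnj (crea_fun kp h f qs) * u qs)) = (\<Sum>k<Suc N. itg LL (%qs. cnj (c k qs) * u qs) )" using i by (simp add: sum_distrib_right cnj_sum del: sum.lessThan_Suc)
 also have "... = (itg LL (%qs. (\<Sum>k<Suc N. d k qs)))" unfolding d_eq using d_int by (intro Bochner_Integration.integral_sum[symmetric])
 also have "... = (\<Sum>k<Suc N. d k []) + (itg LL (%ps. itg Mu (%p. (\<Sum>k<Suc N. d k (p # ps)))))" using d_int by (intro integral_L(2) Bochner_Integration.integrable_sum)
 also have "(\<Sum>k<Suc N. d k []) = 0" by (simp add: d_def)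
 finally have eq: "(itg LL (%qs. cnj (crea_fun kp h f qs) * u qs)) = (itg LL (%ps. itg Mu (%p. (\<Sum>k<Suc N. d k (p # ps)))))" by simp
 have "(\<Sum>k<Suc N. d k (p # ps)) = cnj (f ps) * (cor (sqrt (real (length ps + 1))) * (cnj (h p) * cnj (kp p (tot ps)) * u (p # ps)))" for p ps proof (cases "length ps <= N")
  case True
  let ?n = "length (p # ps)"
  let ?w = "cnj (h p * kp p (tot ps) * f ps) * u (p # ps)"
  have "(\<Sum>k<Suc N. d k (p # ps)) = (\<Sum>k<?n. d k (p # ps))" by (rule sum.mono_neutral_right) (use True in "auto simp: d_def")
  also have "... = of_nat ?n * (cor (1 / sqrt (real ?n)) * ?w)" by (simp add: d_def)
  also have "... = cor (real ?n / sqrt (real ?n)) * ?w" by simp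
  also have "real ?n / sqrt (real ?n) = sqrt (real ?n)" by (rule real_div_sqrt) simp
  finally show ?thesis by (simp add: mult_ac add.commute)
 qed (simp add: d_def N)
 then show ?thesis unfolding eq by (simp add: ann_fun_def mult.assoc)
qed

lemma hip_creaK: assumes kp: "kernel C kp" and h: "h : hcar H1" and v: "v : hcar (full_le N)" and u: "u : cF" shows "ipL (creaK kp h v) u = ipL v (annK (%p q. cnj (kp p q)) h u)" proof -
 obtain g where g: "h = mk g" "sqint Mu g" using h by (rule H1E)
 obtain f where f: "v = mk f" "sqint LL f" "!!ps. N < length ps ==> f ps = 0" using v by (rule full_leE) blast
 obtain w where w: "u = mk w" "sqint LL w" "!!ps qs. mset ps = mset qs ==> w ps = w qs" using u by (rule fockE) blast
 have m: "g : bm Mu" "f : bm LL" "w : bm LL" using g f w by (auto simp: vm.sqint_borel vl.sqint_borel)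
 show ?thesis unfolding g(1) f(1) w(1) creaK_mk[OF g(2) f(2)] annK_mk[OF kernel_cnj[OF kp] g(2) w(2)] using m measurable_crea_fun[OF kp m(1,2)] measurable_ann_fun[OF kernel_cnj[OF kp] m(1,3)]
  by (simp add: vl.hip_mk crea_ann_adjoint[OF kp g(2) f(2,3) w(2,3)])
qed

end

section \<open>Operators restricted to closed subspaces, and unitary operators\<close>

lemma (in hspace) total_mono: "total S ==> S <= S' ==> S' <= hcar H ==> total S'" unfolding total_def by blast

text \<open>Completeness makes \<open>K\<close> closed in \<open>H\<close>: images of vectors in the
  span converge in \<open>K\<close>, and the limit in \<open>H\<close> is the same. This is how
  \<open>Gam\<close> is seen to preserve symmetry and the bound on the particle number.\<close>

lemma bounded_op_invariant: assumes T: "bounded_op H H T" and H: "hspace H" and K: "hspace K" and KH: "hcar K <= hcar H" "hip K = hip H" and S: "hspace.total K S" and TS: "!!s. s : S ==> T s : hcar K" and u: "u : hcar K"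
 shows "T u : hcar K" proof -
 interpret H: hspace H by fact
 interpret K: hspace K by fact
 have n: "hnorm K = hnorm H" using KH(2) by (simp add: hnorm_def fun_eq_iff)
 obtain s where s: "!!n::nat. s n : cspan S" "(%n. hnorm K (s n - u)) ----> 0" using K.total_dense[OF S u] by blast
 have SK: "S <= hcar K" using S by (simp add: K.total_def)
 have sK: "s n : hcar K" for n using s(1) cspan_least[OF K.carrier SK] by auto
 have uH: "u : hcar H" and sH: "s n : hcar H" for n using u sK KH by auto
 have "csubspace {v : hcar H. T v : hcar K}" unfolding csubspace_def using linear_onD[OF bounded_opD(2)[OF T]] linear_on_zero[OF bounded_opD(2)[OF T] H.zero] by auto
 from cspan_least[OF this, of S] have TsK: "T (s n) : hcar K" for n using s(1) TS SK KH by blast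
 have lim: "(%n. hnorm H (T (s n) - T u)) ----> 0" using s(2) unfolding n by (intro bounded_op_tendsto[OF T H H]) (auto simp: uH sH)
 have TH: "T (s n) : hcar H" "T u : hcar H" for n using bounded_opD(3)[OF T] uH sH by auto
 have "\<exists>M. \<forall>m\<ge>M. \<forall>n\<ge>M. hnorm K (T (s m) - T (s n)) < e" if "e > 0" for e proof -
  have "e / 2 > 0" using that by simp
  then obtain M where M: "!!n. n \<ge> M ==> hnorm H (T (s n) - T u) < e / 2" using order_tendstoD(2)[OF lim] unfolding eventually_sequentially by blast
  have "hnorm K (T (s m) - T (s n)) < e" if "m \<ge> M" "n \<ge> M" for m n using H.hnorm_triangle_diff[of "T (s m)" "T u" "T (s n)"] M[OF that(1)] M[OF that(2)] TH H.hnorm_minus_commute[of "T u" "T (s n)"] by (simp add: n)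
  then show ?thesis by blast
 qed
 from K.complete[OF TsK this] obtain l where l: "l : hcar K" "(%n. hnorm K (T (s n) - l)) ----> 0" by blast
 have "T u = l" using l KH lim TH unfolding n by (intro H.hlimit_unique[of "%n. T (s n)" _ _ sequentially]) auto
 then show ?thesis using l by simp
qed

lemma ennreal_sq_tendsto_0: assumes "!!n. en ((x n)^2) <= B n" "B ----> 0" "!!n. 0 <= x n" shows "x ----> 0" proof -
 have "(%n. en ((x n)^2)) ----> en 0" by (rule tendsto_sandwich[of "%_. 0" _ _ B]) (use assms in auto)
 then have "(%n. (x n)^2) ----> 0" by (rule tendsto_ennrealD) auto
 from tendsto_real_sqrt[OF this] show ?thesis using assms(3) by simp
qed

lemma unitary_opD: assumes "unitary_op H K U" shows "linear_on (hcar H) U" "u : hcar H ==> U u : hcar K"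
  "u : hcar H ==> v : hcar H ==> hip K (U u) (U v) = hip H u v"
  "bij_betw U (hcar H) (hcar K)" using assms by (auto simp: unitary_op_def bij_betw_def)

lemma unitary_comp: assumes "unitary_op H K U" "unitary_op K K' U'" shows "unitary_op H K' (%u. U' (U u))" proof -
 have "bij_betw (U' \<circ> U) (hcar H) (hcar K')" using bij_betw_trans[OF unitary_opD(4)[OF assms(1)] unitary_opD(4)[OF assms(2)]] .
 moreover have "linear_on (hcar H) (%u. U' (U u))" unfolding linear_on_def by (simp add: unitary_opD(2)[OF assms(1)] linear_onD[OF unitary_opD(1)[OF assms(1)]] linear_onD[OF unitary_opD(1)[OF assms(2)]])
 ultimately show ?thesis by (simp add: unitary_op_def comp_def unitary_opD(2,3)[OF assms(1)] unitary_opD(3)[OF assms(2)])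
qed

lemma unitary_inv_into: assumes H: "hspace H" and U: "unitary_op H K U" shows "unitary_op K H (inv_into (hcar H) U)" proof -
 interpret H: hspace H by fact
 note bij = unitary_opD(4)[OF U]
 let ?W = "inv_into (hcar H) U"
 have inv: "?W (U u) = u" if "u : hcar H" for u using bij that by (simp add: bij_betw_inv_into_left)
 have surj: "\<exists>u\<in>hcar H. v = U u" if "v : hcar K" for v using bij that by (auto simp: bij_betw_def)
 show ?thesis unfolding unitary_op_def proof (intro conjI ballI)
  show "bij_betw ?W (hcar K) (hcar H)" using bij by (rule bij_betw_inv_into)
  show "hip H (?W u) (?W v) = hip K u v" if uv: "u : hcar K" "v : hcar K" for u v using surj[OF uv(1)] surj[OF uv(2)] by (auto simp: inv unitary_opD(3)[OF U])
  show "linear_on (hcar K) ?W" unfolding linear_on_def proof (intro conjI ballI allI)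
   fix v w assume "v : hcar K" "w : hcar K"
   then obtain a b where "a : hcar H" "v = U a" "b : hcar H" "w = U b" using surj by blast
   then show "?W (v + w) = ?W v + ?W w" by (simp add: inv flip: linear_onD(1)[OF unitary_opD(1)[OF U]])
  next
   fix c v assume "v : hcar K"
   then obtain a where "a : hcar H" "v = U a" using surj by blast
   then show "?W (c *c v) = c *c ?W v" by (simp add: inv flip: linear_onD(2)[OF unitary_opD(1)[OF U]])
  qed
 qed
qed

context mass
begin

subsection \<open>Convergence of kernels\<close>

text \<open>The difference of the kernels is itself a bounded kernel, to which
  \<open>crea_fun_bound\<close> applies; at most \<open>N\<close> particles and a uniform bound
  leave a constant multiple of \<open>|g|^2 |f|^2\<close> as majorant.\<close>

lemma creaK_tendsto: assumes kpn: "!!n. kernel C (kpn n)" and kp: "kernel C kp" and lim: "!!p q. (%n. kpn n p q) ----> kp p q" and h: "h : hcar H1" and u: "u : hcar (full_le N)"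
 shows "(%n. nmL (creaK (kpn n) h u - creaK kp h u)) ----> 0" proof -
 obtain g where g: "h = mk g" "sqint Mu g" using h by (rule H1E)
 obtain f where f: "u = mk f" "sqint LL f" "!!ps. N < length ps ==> f ps = 0" using u by (rule full_leE) blast
 note meas [measurable] = vm.sqint_borel[OF g(2)] vl.sqint_borel[OF f(2)]
 define D where "D n p q = kpn n p q - kp p q" for n p q
 define C' where "C' = C + C"
 have D: "kernel C' (D n)" for n unfolding D_def C'_def using kernel_diff[OF kpn kp] .
 have C: "0 <= C" by (rule kernel_nonneg[OF kp])
 have [measurable]: "(%z. D n (fst z) (tot (snd z))) : bm (Mu >< LL)" for n by (rule kernel_measurable_mu[OF D]) measurable
 have Dlim: "(%n. D n p q) ----> 0" for p q unfolding D_def using lim[of p q] by (simp add: LIM_zero)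
 have sq: "sqint LL (crea_fun (D n) g f)" for n by (rule sqint_crea_fun[where N = N, OF D g(2) f(2)]) (rule f(3))
 define b where "b n z = en (real (length (snd z) + 1) * (cmod (g (fst z) * D n (fst z) (tot (snd z)) * f (snd z)))^2)" for n z
 define w where "w z = en (real (N + 1) * C'\<^sup>2) * (en ((cmod (g (fst z)))^2) * en ((cmod (f (snd z)))^2))" for z
 have eq: "creaK (kpn n) h u - creaK kp h u = mk (crea_fun (D n) g f)" for n using creaK_kernel_diff[OF h, of u "kpn n" kp] u full_le_full[of N] creaK_mk[OF g(2) f(2)] by (auto simp: D_def[abs_def] g(1) f(1))
 show ?thesis proof (rule ennreal_sq_tendsto_0)
  show "en ((nmL (creaK (kpn n) h u - creaK kp h u))^2) <= (nni (Mu >< LL) (%z. b n z))" for n proof -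
   have "en ((nmL (creaK (kpn n) h u - creaK kp h u))^2) = (nni LL (%qs. en ((cmod (crea_fun (D n) g f qs))^2)))" unfolding eq by (rule vl.hnorm_mk[OF sq])
   also have "... <= (nni Mu (%p. nni LL (%ps. b n (p, ps))))" using crea_fun_bound[OF D meas, of n] unfolding b_def by (simp only: ennreal_mult zero_le_power2 of_nat_0_le_iff fst_conv snd_conv)
   also have "... = (nni (Mu >< LL) (%z. b n z))" by (rule L.nn_integral_fst) (unfold b_def, measurable)
   finally show ?thesis .
  qed
  have "(%n. nni (Mu >< LL) (%z. b n z) ) ----> (nni (Mu >< LL) (%z. 0))" proof (rule nn_integral_dominated_convergence[where w = w])
   show "b n : bm (Mu >< LL)" for n unfolding b_def by measurable
   show "w : bm (Mu >< LL)" unfolding w_def by measurable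
   show "AE z in Mu >< LL. b n z <= w z" for n proof (intro AE_I2)
    fix z
    show "b n z <= w z" proof (cases "length (snd z) <= N")
     case True
     have "(cmod (D n (fst z) (tot (snd z))))^2 <= C'\<^sup>2" using D by (intro power_mono) (auto simp: kernel_def)
     then have "real (length (snd z) + 1) * (cmod (g (fst z) * D n (fst z) (tot (snd z)) * f (snd z)))^2 <= real (N + 1) * C'\<^sup>2 * ((cmod (g (fst z)))^2 * (cmod (f (snd z)))^2)"
      using True by (auto simp: norm_mult power_mult_distrib mult.assoc mult.left_commute[of _ "(cmod (g (fst z)))^2"] intro!: mult_mono)
     from ennreal_leI[OF this] show ?thesis unfolding b_def w_def by (simp only: ennreal_mult zero_le_power2 of_nat_0_le_iff mult_nonneg_nonneg)
    qed (simp add: b_def f(3))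
   qed
   have "(nni (Mu >< LL) (%z. w z)) = (nni Mu (%p. nni LL (%ps. w (p, ps))))" by (rule L.nn_integral_fst[symmetric]) (unfold w_def, measurable)
   also have "... = en (real (N + 1) * C'\<^sup>2) * ((nni Mu (%p. en ((cmod (g p))^2))) * (nni LL (%ps. en ((cmod (f ps))^2))))" by (simp add: w_def nn_integral_cmult nn_integral_multc)
   also have "... < \<infinity>" using g f by (auto simp: vm.sqint_iff vl.sqint_iff ennreal_mult_less_top)
   finally show "(nni (Mu >< LL) (%z. w z)) < \<infinity>" .
   show "AE z in Mu >< LL. (%n. b n z) ----> 0" proof (intro AE_I2)
    fix z
    have "(%n. b n z) ----> en (real (length (snd z) + 1) * (cmod (g (fst z) * 0 * f (snd z)))^2)" unfolding b_def by (intro tendsto_ennrealI tendsto_intros Dlim)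
    then show "(%n. b n z) ----> 0" by simp
   qed
  qed simp
  then show "(%n. nni (Mu >< LL) (%z. b n z) ) ----> 0" by simp
  show "0 <= nmL (creaK (kpn n) h u - creaK kp h u)" for n unfolding eq by (rule vl.hnorm_mk_nonneg[OF sq])
 qed
qed

lemma annK_tendsto: assumes kpn: "!!n. kernel C (kpn n)" and kp: "kernel C kp" and lim: "!!p q. (%n. kpn n p q) ----> kp p q" and h: "h : hcar H1" and u: "u : hcar (full_le N)"
 shows "(%n. nmL (annK (kpn n) h u - annK kp h u)) ----> 0" proof -
 obtain g where g: "h = mk g" "sqint Mu g" using h by (rule H1E)
 obtain f where f: "u = mk f" "sqint LL f" "!!ps. N < length ps ==> f ps = 0" using u by (rule full_leE) blast
 note meas [measurable] = vm.sqint_borel[OF g(2)] vl.sqint_borel[OF f(2)]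
 define D where "D n p q = kpn n p q - kp p q" for n p q
 define C' where "C' = C + C"
 have D: "kernel C' (D n)" for n unfolding D_def C'_def using kernel_diff[OF kpn kp] .
 have [measurable]: "(%z. D n (fst z) (tot (snd z))) : bm (Mu >< LL)" for n by (rule kernel_measurable_mu[OF D]) measurable
 have Dlim: "(%n. D n p q) ----> 0" for p q unfolding D_def using lim[of p q] by (simp add: LIM_zero)
 have sq: "sqint LL (ann_fun (D n) g f)" for n by (rule sqint_ann_fun[where N = N, OF D g(2) f(2)]) (rule f(3))
 define G where "G = (nni Mu (%p. en ((cmod (g p))^2)))"
 have G: "G < \<infinity>" using g(2) by (simp add: G_def vm.sqint_iff)
 define b where "b n z = en (real (length (snd z) + 1) * (cmod (D n (fst z) (tot (snd z)) * f (fst z # snd z)))^2)" for n z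
 define w where "w z = en (real (N + 1) * C'\<^sup>2) * en ((cmod (f (fst z # snd z)))^2)" for z
 have eq: "annK (kpn n) h u - annK kp h u = mk (ann_fun (D n) g f)" for n using annK_kernel_diff[OF kpn kp h, of u n] u full_le_full[of N] annK_mk[OF D g(2) f(2), of n] by (auto simp: D_def[abs_def] g(1) f(1))
 show ?thesis proof (rule ennreal_sq_tendsto_0)
  show "en ((nmL (annK (kpn n) h u - annK kp h u))^2) <= G * (nni (Mu >< LL) (%z. b n z))" for n proof -
   have "en ((nmL (annK (kpn n) h u - annK kp h u))^2) = (nni LL (%qs. en ((cmod (ann_fun (D n) g f qs))^2)))" unfolding eq by (rule vl.hnorm_mk[OF sq])
   also have "... <= G * (nni Mu (%p. nni LL (%ps. b n (p, ps))))" using ann_fun_bound[OF D g(2) f(2), of n] unfolding b_def G_def by (simp only: ennreal_mult zero_le_power2 of_nat_0_le_iff fst_conv snd_conv)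
   also have "(nni Mu (%p. nni LL (%ps. b n (p, ps)))) = (nni (Mu >< LL) (%z. b n z))" by (rule L.nn_integral_fst) (unfold b_def, measurable)
   finally show ?thesis .
  qed
  have "(%n. nni (Mu >< LL) (%z. b n z) ) ----> (nni (Mu >< LL) (%z. 0))" proof (rule nn_integral_dominated_convergence[where w = w])
   show "b n : bm (Mu >< LL)" for n unfolding b_def by measurable
   show "w : bm (Mu >< LL)" unfolding w_def by measurable
   show "AE z in Mu >< LL. b n z <= w z" for n proof (intro AE_I2)
    fix z
    show "b n z <= w z" proof (cases "length (fst z # snd z) <= N")
     case True
     have "(cmod (D n (fst z) (tot (snd z))))^2 <= C'\<^sup>2" using D by (intro power_mono) (auto simp: kernel_def)
     then have "real (length (snd z) + 1) * (cmod (D n (fst z) (tot (snd z)) * f (fst z # snd z)))^2 <= real (N + 1) * C'\<^sup>2 * (cmod (f (fst z # snd z)))^2"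
      using True by (auto simp: norm_mult power_mult_distrib mult.assoc intro!: mult_mono)
     from ennreal_leI[OF this] show ?thesis unfolding b_def w_def by (simp only: ennreal_mult zero_le_power2 of_nat_0_le_iff mult_nonneg_nonneg)
    qed (simp add: b_def f(3))
   qed
   have "(nni (Mu >< LL) (%z. w z)) = en (real (N + 1) * C'\<^sup>2) * (nni (Mu >< LL) (%z. en ((cmod (f (fst z # snd z)))^2)))" unfolding w_def by (rule nn_integral_cmult) measurable
   also have "... <= en (real (N + 1) * C'\<^sup>2) * (nni LL (%ps. en ((cmod (f ps))^2)))" by (subst nn_integral_L_pair) (auto intro!: mult_left_mono)
   also have "... < \<infinity>" using f by (auto simp: vl.sqint_iff ennreal_mult_less_top)
   finally show "(nni (Mu >< LL) (%z. w z)) < \<infinity>" .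
   show "AE z in Mu >< LL. (%n. b n z) ----> 0" proof (intro AE_I2)
    fix z
    have "(%n. b n z) ----> en (real (length (snd z) + 1) * (cmod (0 * f (fst z # snd z)))^2)" unfolding b_def by (intro tendsto_ennrealI tendsto_intros Dlim)
    then show "(%n. b n z) ----> 0" by simp
   qed
  qed simp
  then have lim0: "(%n. nni (Mu >< LL) (%z. b n z) ) ----> 0" by simp
  show "(%n. G * (nni (Mu >< LL) (%z. b n z))) ----> 0" using ennreal_tendsto_cmult[OF _ lim0, of G] G by simp
  show "0 <= nmL (annK (kpn n) h u - annK kp h u)" for n unfolding eq by (rule vl.hnorm_mk_nonneg[OF sq])
 qed
qed

subsection \<open>Symmetric tensors\<close>

abbreviation k1 :: "real ^ 's => 's spacetime => complex" where "k1 \<equiv> %_ _. 1"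

lemma tfun_ins_nth:
 "k <= length fs ==> length qs = Suc (length fs) ==> tfun (ins_nth k h fs) qs = h (qs ! k) * tfun fs (rem_nth k qs)" proof (induction k arbitrary: fs qs)
 case 0
 then show ?case by (cases qs) auto
next
 case (Suc k)
 then obtain f fs' where fs: "fs = f # fs'" by (cases fs) auto
 obtain q qs' where qs: "qs = q # qs'" using Suc.prems by (cases qs) auto
 show ?case using Suc.IH[of fs' qs'] Suc.prems by (simp add: fs qs)
qed

lemma map_ins_nth: "map f (ins_nth k x xs) = ins_nth k (f x) (map f xs)" by (simp add: ins_nth_def take_map drop_map)

lemma set_ins_nth [simp]: "set (ins_nth k x xs) = insert x (set xs)" using mset_ins_nth[of k x xs] by (metis set_mset_add_mset_insert set_mset_mset)

text \<open>The new factor appears in every position because the sum in \<open>crea_fun\<close>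
  singles out each entry in turn.\<close>

lemma creaK_tensor: assumes h: "h : hcar H1" and fs: "set fs <= hcar H1" shows "creaK k1 h (tensor fs) = cor (1 / sqrt (real (Suc (length fs)))) *c (\<Sum>k<Suc (length fs). tensor (ins_nth k h fs))" proof -
 have "creaK k1 (mk (repr h)) (mk (tfun (map repr fs))) = mk (crea_fun k1 (repr h) (tfun (map repr fs)))" by (rule creaK_mk[OF repr_H1(1)[OF h] sqint_tensor[OF fs]])
 moreover have "crea_fun k1 (repr h) (tfun (map repr fs)) = (%qs. cor (1 / sqrt (real (Suc (length fs)))) * (\<Sum>k<Suc (length fs). tfun (map repr (ins_nth k h fs)) qs))" proof (rule ext)
  fix qs
  show "crea_fun k1 (repr h) (tfun (map repr fs)) qs = cor (1 / sqrt (real (Suc (length fs)))) * (\<Sum>k<Suc (length fs). tfun (map repr (ins_nth k h fs)) qs)" proof (cases "length qs = Suc (length fs)")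
  case True
  then show ?thesis by (simp add: crea_fun_def map_ins_nth tfun_ins_nth del: sum.lessThan_Suc)
 next
  case False
  then have "crea_fun k1 (repr h) (tfun (map repr fs)) qs = 0" by (auto simp: crea_fun_def length_rem_nth tfun_length intro!: sum.neutral)
  moreover have "tfun (map repr (ins_nth k h fs)) qs = 0" for k using False by (intro tfun_length) simp
  ultimately show ?thesis by simp
 qed
 qed
 ultimately show ?thesis unfolding tensor_eq repr_H1(2)[OF h] mk_sum mk_scale by simp
qed

lemma annK_tensor_Cons: assumes h: "h : hcar H1" and f: "f : hcar H1" and fs: "set fs <= hcar H1" shows "annK k1 h (tensor (f # fs)) = (cor (sqrt (real (Suc (length fs)))) * hip H1 h f) *c tensor fs" proof -
 have ffs: "set (f # fs) <= hcar H1" using f fs by simp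
 have "annK k1 (mk (repr h)) (mk (tfun (map repr (f # fs)))) = mk (ann_fun k1 (repr h) (tfun (map repr (f # fs))))" by (rule annK_mk[OF kernel_one repr_H1(1)[OF h] sqint_tensor[OF ffs]])
 moreover have "ann_fun k1 (repr h) (tfun (map repr (f # fs))) = (%ps. cor (sqrt (real (Suc (length fs)))) * hip H1 h f * tfun (map repr fs) ps)" proof (rule ext)
  fix ps
  show "ann_fun k1 (repr h) (tfun (map repr (f # fs))) ps = cor (sqrt (real (Suc (length fs)))) * hip H1 h f * tfun (map repr fs) ps" proof (cases "length ps = length fs")
  case True
  have "(itg Mu (%p. cnj (repr h p) * tfun (map repr (f # fs)) (p # ps))) = hip H1 h f * tfun (map repr fs) ps" by (simp add: one_particle_eq vm.hip_repr flip: mult.assoc)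
  then show ?thesis using True by (simp add: ann_fun_def add.commute)
 qed (simp add: ann_fun_def tfun_length)
 qed
 ultimately show ?thesis unfolding tensor_eq repr_H1(2)[OF h] mk_scale by simp
qed

lemma annK_tensor_Nil: assumes h: "h : hcar H1" shows "annK k1 h (tensor []) = 0" proof -
 have "annK k1 (mk (repr h)) (mk (tfun [])) = mk (ann_fun k1 (repr h) (tfun []))" by (rule annK_mk[OF kernel_one repr_H1(1)[OF h]]) (rule sqint_tfun, simp)
 then show ?thesis unfolding tensor_eq repr_H1(2)[OF h] by (simp add: ann_fun_def[abs_def] mk_zero)
qed

text \<open>Symmetrised tensors up to normalisation. They are symmetric because creation preserves
  symmetry, and they lie in the span of tensors by \<open>creaK_tensor\<close>.\<close>

fun cvec :: "'s wf list => ('s, complex) fk" where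
 "cvec [] = tensor []" | "cvec (f # fs) = creaK k1 f (cvec fs)"

definition fin :: "('s, complex) fk set" where "fin = (\<Union>N. hcar (full_le N))"

lemma fin_full: "fin <= cL" unfolding fin_def using full_le_full by blast

lemma csubspace_fin: "csubspace fin" unfolding csubspace_def proof (intro conjI ballI allI)
 interpret F: hspace "full_le N" for N by (rule hspace_full_le)
 show "0 : fin" unfolding fin_def using F.zero by blast
 fix u v assume "u : fin" "v : fin"
 then obtain N N' where "u : hcar (full_le N)" "v : hcar (full_le N')" unfolding fin_def by blast
 then have "u : hcar (full_le (max N N'))" "v : hcar (full_le (max N N'))" using full_le_mono[of N "max N N'"] full_le_mono[of N' "max N N'"] by auto
 then have "u + v : hcar (full_le (max N N'))" by (rule F.add)
 then show "u + v : fin" unfolding fin_def by blast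
next
 interpret F: hspace "full_le N" for N by (rule hspace_full_le)
 fix c u assume "u : fin"
 then obtain N where "u : hcar (full_le N)" unfolding fin_def by blast
 then have "c *c u : hcar (full_le N)" by (rule F.scale)
 then show "c *c u : fin" unfolding fin_def by blast
qed

lemma tensor_fin: "set fs <= hcar H1 ==> tensor fs : fin" unfolding fin_def using tensor_full_le[of fs "length fs"] by blast

lemma creaK_fin: "kernel C kp ==> h : hcar H1 ==> u : fin ==> creaK kp h u : fin" unfolding fin_def using creaK_full_le(1) by blast

lemma annK_fin: "kernel C kp ==> h : hcar H1 ==> u : fin ==> annK kp h u : fin" unfolding fin_def using annK_full_le(1) by blast

lemma tensor_Nil_fock_le: "tensor [] : cN N" unfolding tensor_eq proof (rule fock_leI)
 show "sqint LL (tfun (map repr []))" by (intro sqint_tfun) simp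
 show "tfun (map repr []) ps = tfun (map repr []) qs" if "mset ps = mset qs" for ps qs :: "(real ^ 's) list" using mset_eq_length[OF that] by (simp add: tfun_eq)
 show "tfun (map repr []) ps = 0" if "N < length ps" for ps :: "(real ^ 's) list" using that by (intro tfun_length) auto
qed

lemma cvec_fock_le: "set fs <= hcar H1 ==> cvec fs : hcar (fock_le (length fs))" by (induction fs) (auto intro: tensor_Nil_fock_le creaK_fock_le[OF kernel_one])

lemma cvec_span: assumes "D <= hcar H1" "set fs <= D" shows "cvec fs : cspan {tensor gs | gs. set gs <= D}" using assms(2) proof (induction fs)
 case Nil show ?case by (auto intro!: cspan_base exI[of _ "[]"])
next
 case (Cons f fs)
 let ?S = "{tensor gs | gs. set gs <= D}"
 have f: "f : hcar H1" using Cons.prems assms(1) by auto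
 have lin: "linear_on (cL) (creaK k1 f)" by (rule linear_creaK[OF f])
 have sub: "csubspace {u : cL. creaK k1 f u : cspan ?S}" using hspace.carrier[OF hspace_L2_LL] csubspace_cspan[of ?S] linear_onD[OF lin] linear_on_zero[OF lin, of 0] unfolding csubspace_def by auto
 have "tensor gs : {u : cL. creaK k1 f u : cspan ?S}" if gs: "set gs <= D" for gs proof -
  have gH: "set gs <= hcar H1" using gs assms(1) by auto
  have "tensor (ins_nth k f gs) : cspan ?S" for k using gs Cons.prems by (intro cspan_base CollectI exI[of _ "ins_nth k f gs"]) auto
  then have "creaK k1 f (tensor gs) : cspan ?S" unfolding creaK_tensor[OF f gH] using csubspace_sum[OF csubspace_cspan[of ?S], of "{..<Suc (length gs)}" "%k. tensor (ins_nth k f gs)"]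
    csubspace_cspan[of ?S] by (simp add: csubspace_def)
  then show ?thesis using tensor_full[OF gH] by simp
 qed
 then have "cspan ?S <= {u : cL. creaK k1 f u : cspan ?S}" by (intro cspan_least[OF sub]) auto
 then show ?case using Cons by auto
qed

text \<open>Taking the creators to the other side as annihilators contributes one factor
  \<open>sqrt (Suc n)\<close> per particle. Against symmetric vectors \<open>cvec\<close> and
  \<open>tensor\<close> are thus proportional, and totality of the tensors carries over.\<close>

lemma hip_cvec: assumes "set fs <= hcar H1" "u : cN N" shows "ipL (cvec fs) u = cor (sqrt (fact (length fs))) * ipL (tensor fs) u" using assms proof (induction fs arbitrary: u)
 case Nil
 then show ?case by simp
next
 case (Cons f fs)
 then have f: "f : hcar H1" and fs: "set fs <= hcar H1" by auto
 have u: "u : cF" using Cons.prems(2) fock_le_fock by blast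
 have au: "annK k1 f u : cN N" by (rule annK_fock_le[OF kernel_one f Cons.prems(2)])
 obtain w where w: "u = mk w" "sqint LL w" using u by (rule fockE) blast
 have "ipL (cvec (f # fs)) u = ipL (cvec fs) (annK k1 f u)" using hip_creaK[OF kernel_one f subsetD[OF fock_le_full_le cvec_fock_le[OF fs]] u] by simp
 also have "... = cor (sqrt (fact (length fs))) * ipL (tensor fs) (annK k1 f u)" by (rule Cons.IH[OF fs au])
 also have "ipL (tensor fs) (annK k1 f u) = cor (sqrt (real (Suc (length fs)))) * ipL (tensor (f # fs)) u" proof -
  have eq: "annK k1 f u = mk (ann_fun k1 (repr f) w)" using annK_mk[OF kernel_one repr_H1(1)[OF f] w(2)] by (simp add: repr_H1(2)[OF f] w(1))
  have sq: "sqint LL (tfun (map repr fs))" by (rule sqint_tensor[OF fs])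
  have "ipL (tensor fs) (annK k1 f u) = (itg LL (%ps. cnj (tfun (map repr fs) ps) * ann_fun k1 (repr f) w ps))" unfolding eq tensor_eq using sq
   by (subst vl.hip_mk) (auto simp: vl.sqint_borel intro!: measurable_ann_fun[OF kernel_one] vm.sqint_borel vl.sqint_borel[OF w(2)] repr_H1 f)
  also have "... = (itg LL (%ps. cor (sqrt (real (Suc (length fs)))) * (cnj (tfun (map repr fs) ps) * (itg Mu (%p. cnj (repr f p) * w (p # ps))))))" proof (rule Bochner_Integration.integral_cong)
   fix ps
   show "cnj (tfun (map repr fs) ps) * ann_fun k1 (repr f) w ps = cor (sqrt (real (Suc (length fs)))) * (cnj (tfun (map repr fs) ps) * (itg Mu (%p. cnj (repr f p) * w (p # ps))))"
    by (cases "length ps = length fs") (simp_all add: ann_fun_def add.commute tfun_length)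
  qed simp
  also have "... = cor (sqrt (real (Suc (length fs)))) * ipL (tensor (f # fs)) u" unfolding w(1) hip_tensor_Cons(2)[OF f fs w(2)] by simp
  finally show ?thesis .
 qed
 finally show ?case by (simp add: real_sqrt_mult mult_ac)
qed

lemma hip_tensor_fock_le: assumes "set fs <= hcar H1" "u : hcar (full_le N)" "N < length fs" shows "ipL (tensor fs) u = 0" proof -
 obtain f where f: "u = mk f" "sqint LL f" "!!ps. N < length ps ==> f ps = 0" using assms(2) by (rule full_leE) blast
 have z: "cnj (tfun (map repr fs) ps) * f ps = 0" for ps using f(3)[of ps] assms(3) tfun_length[of ps "map repr fs"] by (cases "N < length ps") auto
 show ?thesis unfolding tensor_eq f(1) using sqint_tensor[OF assms(1)] f(2) by (simp add: vl.hip_mk vl.sqint_borel z del: mult_eq_0_iff)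
qed

lemma total_cvec: "hspace.total (fock_le N) {cvec fs | fs. set fs <= Delta_P m \<and> length fs <= N}" unfolding hspace.total_def[OF hspace_fock_le] proof (intro conjI ballI impI)
 show "{cvec fs | fs. set fs <= Delta_P m \<and> length fs <= N} <= cN N" using cvec_fock_le fock_le_mono Delta_P_H1 by blast
 fix u assume u: "u : cN N" and z: "\<forall>s\<in>{cvec fs | fs. set fs <= Delta_P m \<and> length fs <= N}. hip (fock_le N) s u = 0"
 have "ipL (tensor fs) u = 0" if fs: "set fs <= Delta_P m" for fs proof (cases "length fs <= N")
  case True
  then have "ipL (cvec fs) u = 0" using z fs by auto
  then show ?thesis using hip_cvec[OF _ u, of fs] fs Delta_P_H1 by auto
 next
  case False
  then show ?thesis using fs Delta_P_H1 u fock_le_full_le by (intro hip_tensor_fock_le[of fs u N]) auto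
 qed
 then show "u = 0" using total_tensor u fock_le_full unfolding hspace.total_def[OF hspace_L2_LL] by blast
qed

text \<open>Projection to at most \<open>N\<close> particles; it brings arbitrary symmetric vectors
  into the range of statements about \<open>fock_le N\<close> and \<open>full_le N\<close>.\<close>

definition trunc :: "nat => ('s, complex) fk => ('s, complex) fk" where "trunc N u = mk (%ps. if length ps <= N then repr u ps else 0)"

lemma trunc_mk: assumes "sqint LL f" shows "trunc N (mk f) = mk (%ps. if length ps <= N then f ps else 0)" unfolding trunc_def vl.mk_eq_iff_M using vl.repr_M(3)[OF vl.sqint_strong[OF assms]] by eventually_elim simp

lemma trunc_fock: assumes u: "u : cF" shows "trunc N u : cN N" and "v : hcar (full_le N) ==> ipL (trunc N u) v = ipL u v" and "v : hcar (full_le N) ==> ipL v (trunc N u) = ipL v u" proof -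
 obtain w where w: "u = mk w" "sqint LL w" "!!ps qs. mset ps = mset qs ==> w ps = w qs" using u by (rule fockE) blast
 note sq = sqint_truncate[OF w(2), of N]
 show "trunc N u : cN N" unfolding w(1) trunc_mk[OF w(2)] by (rule fock_leI[OF sq]) (auto dest: mset_eq_length intro: w(3))
 assume "v : hcar (full_le N)"
 then obtain f where f: "v = mk f" "sqint LL f" "!!ps. N < length ps ==> f ps = 0" by (rule full_leE) blast
 have e: "cnj (if length ps <= N then w ps else 0) * f ps = cnj (w ps) * f ps"
  "cnj (f ps) * (if length ps <= N then w ps else 0) = cnj (f ps) * w ps" for ps using f(3)[of ps] by auto
 show "ipL (trunc N u) v = ipL u v" "ipL v (trunc N u) = ipL v u" unfolding w(1) trunc_mk[OF w(2)] f(1) using vl.sqint_borel[OF sq] vl.sqint_borel[OF w(2)] vl.sqint_borel[OF f(2)] by (simp_all add: vl.hip_mk e)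
qed

text \<open>A vector orthogonal to all of them has vanishing truncations, by totality in each
  \<open>fock_le N\<close>, and a function whose truncations all vanish is zero almost
  everywhere.\<close>

lemma total_cvec_fock: "hspace.total (fock m) {cvec fs | fs. set fs <= Delta_P m}" unfolding hspace.total_def[OF hspace_fock] proof (intro conjI ballI impI)
 show "{cvec fs | fs. set fs <= Delta_P m} <= cF" using cvec_fock_le fock_le_fock Delta_P_H1 by blast
 fix u :: "('s, complex) fk" assume u: "u : cF" and z: "\<forall>s\<in>{cvec fs | fs. set fs <= Delta_P m}. hip (fock m) s u = 0"
 have 0: "trunc N u = 0" for N proof -
  have "ipL (cvec fs) (trunc N u) = 0" if fs: "set fs <= Delta_P m" "length fs <= N" for fs proof -
   have "cvec fs : hcar (full_le N)" using cvec_fock_le[of fs] fs Delta_P_H1 fock_le_mono[OF fs(2)] fock_le_full_le[of N] by blast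
   then show ?thesis using trunc_fock(3)[OF u] z fs(1) by auto
  qed
  then show ?thesis using total_cvec[of N] trunc_fock(1)[OF u, of N] unfolding hspace.total_def[OF hspace_fock_le] by auto
 qed
 obtain w where w: "u = mk w" "sqint LL w" using u by (rule fockE) blast
 have "AE ps in LL. \<forall>N. (if length ps <= N then w ps else 0) = 0" unfolding AE_all_countable using 0 unfolding w(1) trunc_mk[OF w(2)] mk_zero vl.mk_eq_iff_M by blast
 then have "AE ps in LL. w ps = 0" by eventually_elim (metis order_refl)
 then show "u = 0" unfolding w(1) mk_zero vl.mk_eq_iff_M .
qed

subsection \<open>Second quantization\<close>

text \<open>Inner products of tensors are products of one-particle inner products, so
  \<open>V\<close> preserves their Gram matrix; since \<open>V\<close> is onto, the images are again
  all tensors and \<open>isometry_extension\<close> applies.\<close>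

lemma Gam_facts: assumes V: "unitary_op H1 H1 V" shows Gam_bounded: "bounded_op (full_fock m) (full_fock m) (Gam m V)" and Gam_tensor: "set fs <= hcar H1 ==> Gam m V (tensor fs) = tensor (map V fs)"
  and Gam_unitary: "unitary_op (full_fock m) (full_fock m) (Gam m V)" proof -
 let ?I = "{fs. set fs <= hcar H1}"
 let ?t = "%fs. tensor (map V fs)"
 have VH: "V f : hcar H1" if "f : hcar H1" for f using unitary_opD(2)[OF V that] .
 have mapV: "set (map V fs) <= hcar H1" if "set fs <= hcar H1" for fs using that VH by auto
 have tot: "hspace.total (full_fock m) (tensor ` ?I)" unfolding full_fock_eq by (rule hspace.total_mono[OF hspace_L2_LL total_tensor]) (use Delta_P_H1 tensor_full in auto)
 have "?t ` ?I = tensor ` ?I" proof (intro equalityI subsetI)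
  fix x assume "x : tensor ` ?I"
  then obtain gs where gs: "x = tensor gs" "set gs <= hcar H1" by auto
  let ?fs = "map (inv_into (hcar H1) V) gs"
  have im: "V ` hcar H1 = hcar H1" using unitary_opD(4)[OF V] by (simp add: bij_betw_def)
  have "V (inv_into (hcar H1) V g) = g" if "g : set gs" for g using that gs(2) im by (intro f_inv_into_f) auto
  then have "map V ?fs = gs" by (simp add: map_idI)
  moreover have "set ?fs <= hcar H1" using gs(2) im by (auto intro!: inv_into_into)
  ultimately show "x : ?t ` ?I" using gs(1) by (intro image_eqI[of _ _ ?fs]) auto
 qed (use mapV in auto)
 then have tot': "hspace.total (full_fock m) (?t ` ?I)" using tot by simp
 have gram: "hip (full_fock m) (?t fs) (?t gs) = hip (full_fock m) (tensor fs) (tensor gs)" if "fs : ?I" "gs : ?I" for fs gs proof -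
  have "hip H1 (V (fs ! i)) (V (gs ! i)) = hip H1 (fs ! i) (gs ! i)" if "i < length fs" "length fs = length gs" for i
   using \<open>fs : ?I\<close> \<open>gs : ?I\<close> that nth_mem[of i fs] nth_mem[of i gs] by (intro unitary_opD(3)[OF V]) auto
  then show ?thesis using that mapV by (simp add: hip_tensor)
 qed
 obtain T where T: "bounded_op (full_fock m) (full_fock m) T" "!!fs. fs : ?I ==> T (tensor fs) = ?t fs"
  "unitary_op (full_fock m) (full_fock m) T"
  "!!T'. bounded_op (full_fock m) (full_fock m) T' ==> (!!fs. fs : ?I ==> T' (tensor fs) = ?t fs) ==> T' = T" by (rule isometry_extension[OF hspace_full hspace_full tot tot' gram]) (assumption, assumption, (rule that; blast))
 have G: "Gam m V = T" unfolding Gam_def proof (rule the_equality)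
  show "bounded_op (full_fock m) (full_fock m) T \<and> (\<forall>fs. set fs <= hcar H1 --> T (tensor fs) = tensor (map V fs))" using T(1,2) by simp
  fix T' assume T': "bounded_op (full_fock m) (full_fock m) T' \<and> (\<forall>fs. set fs <= hcar H1 --> T' (tensor fs) = tensor (map V fs))"
  show "T' = T" by (rule T(4)) (use T' in auto)
 qed
 show "bounded_op (full_fock m) (full_fock m) (Gam m V)" unfolding G by (rule T(1))
 show "Gam m V (tensor fs) = tensor (map V fs)" if "set fs <= hcar H1" unfolding G using T(2) that by blast
 show "unitary_op (full_fock m) (full_fock m) (Gam m V)" unfolding G by (rule T(3))
qed

lemma Gam_linear: "unitary_op H1 H1 V ==> linear_on (cL) (Gam m V)" using bounded_opD(2)[OF Gam_bounded, of V] by (simp add: full_fock_eq)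

lemma Gam_hip: "unitary_op H1 H1 V ==> u : cL ==> v : cL ==> ipL (Gam m V u) (Gam m V v) = ipL u v" using unitary_opD(3)[OF Gam_unitary, of V u v] by (simp add: full_fock_eq)

lemma Gam_full: "unitary_op H1 H1 V ==> u : cL ==> Gam m V u : cL" using unitary_opD(2)[OF Gam_unitary, of V u] by (simp add: full_fock_eq)

lemma Gam_hnorm: "unitary_op H1 H1 V ==> u : cL ==> nmL (Gam m V u) = nmL u" by (simp add: hnorm_def Gam_hip)

lemma Gam_cancel: assumes V: "unitary_op H1 H1 V" and W: "unitary_op H1 H1 W" and inv: "!!f. f : hcar H1 ==> W (V f) = f" and u: "u : cL" shows "Gam m W (Gam m V u) = u" proof -
 let ?I = "{fs. set fs <= (Delta_P m :: 's wf set)}"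
 let ?T = "\<lambda>u\<in>hcar (full_fock m). Gam m W (Gam m V u)"
 let ?J = "\<lambda>u\<in>hcar (full_fock m). u :: ('s, complex) fk"
 have "?T = ?J" proof (rule bounded_op_eqI[OF _ _ hspace_full hspace_full])
  show "bounded_op (full_fock m) (full_fock m) ?J" unfolding bounded_op_def linear_on_def using hspace.add[OF hspace_full] hspace.scale[OF hspace_full] by (auto intro!: exI[of _ 1])
  show "bounded_op (full_fock m) (full_fock m) ?T" unfolding bounded_op_def linear_on_def using hspace.add[OF hspace_full] hspace.scale[OF hspace_full] linear_onD[OF Gam_linear[OF V]] linear_onD[OF Gam_linear[OF W]]
    Gam_full[OF V] Gam_full[OF W] Gam_hnorm[OF V] Gam_hnorm[OF W] by (auto simp: full_fock_eq intro!: exI[of _ 1])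
  show "hspace.total (full_fock m) (tensor ` ?I)" unfolding full_fock_eq by (rule total_tensor)
  fix s assume "s : tensor ` ?I"
  then obtain fs where fs: "s = tensor fs" "set fs <= hcar H1" using Delta_P_H1 by auto
  have "set (map V fs) <= hcar H1" using fs(2) unitary_opD(2)[OF V] by auto
  moreover have "map W (map V fs) = fs" using fs(2) inv by (auto intro!: map_idI)
  ultimately have "Gam m W (Gam m V s) = s" using fs by (simp add: Gam_tensor[OF V] Gam_tensor[OF W])
  then show "?T s = ?J s" by simp
 qed
 from fun_cong[OF this, of u] show ?thesis using u by (simp add: full_fock_eq)
qed

text \<open>Both sides are explicit on tensors, which settles their span;
  \<open>Gam_intertwine\<close> extends the identity by boundedness at fixed particle
  number.\<close>

lemma Gam_crea_span: assumes V: "unitary_op H1 H1 V" and h: "h : hcar H1" and u: "u : cspan {tensor gs | gs. set gs <= hcar H1}" shows "Gam m V (creaK k1 h u) = creaK k1 (V h) (Gam m V u)" proof -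
 have Vh: "V h : hcar H1" by (rule unitary_opD(2)[OF V h])
 show ?thesis proof (rule linear_on_eq_on_cspan[OF csubspace_fin _ _ _ _ u, where T = "%u. Gam m V (creaK k1 h u)" and T' = "%u. creaK k1 (V h) (Gam m V u)"])
  show "{tensor gs | gs. set gs <= hcar H1} <= fin" using tensor_fin by auto
  have cL: "creaK k1 h u : cL" if "u : fin" for u using creaK_fin[OF kernel_one h that] fin_full by blast
  have f: "u : cL" if "u : fin" for u using that fin_full by blast
  show "linear_on fin (%u. Gam m V (creaK k1 h u))" unfolding linear_on_def using linear_onD[OF linear_creaK[OF h]] linear_onD[OF Gam_linear[OF V]] f cL by simp
  show "linear_on fin (%u. creaK k1 (V h) (Gam m V u))" unfolding linear_on_def using linear_onD[OF linear_creaK[OF Vh]] linear_onD[OF Gam_linear[OF V]] f Gam_full[OF V] by simp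
  fix s assume "s : {tensor gs | gs. set gs <= hcar H1}"
  then obtain gs where gs: "s = tensor gs" "set gs <= hcar H1" by auto
  have Vgs: "set (map V gs) <= hcar H1" using gs(2) unitary_opD(2)[OF V] by auto
  have t: "tensor (ins_nth k h gs) : cL" for k using gs h by (intro tensor_full) auto
  interpret L: hspace "L2 LL :: ('s, complex) fk hilb" by (rule hspace_L2_LL)
  have s: "(\<Sum>k<Suc (length gs). tensor (ins_nth k h gs)) : cL" by (intro csubspace_sum L.carrier t)
  have "Gam m V (creaK k1 h s) = cor (1 / sqrt (real (Suc (length gs)))) *c (\<Sum>k<Suc (length gs). Gam m V (tensor (ins_nth k h gs)))" unfolding gs(1) creaK_tensor[OF h gs(2)] linear_onD(2)[OF Gam_linear[OF V] s]
   by (subst linear_on_sum[OF L.carrier Gam_linear[OF V] t]) simp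
  also have "... = cor (1 / sqrt (real (Suc (length gs)))) *c (\<Sum>k<Suc (length gs). tensor (ins_nth k (V h) (map V gs)))" using gs h by (simp add: Gam_tensor[OF V] map_ins_nth del: sum.lessThan_Suc)
  also have "... = creaK k1 (V h) (Gam m V s)" unfolding gs(1) Gam_tensor[OF V gs(2)] creaK_tensor[OF Vh Vgs] by simp
  finally show "Gam m V (creaK k1 h s) = creaK k1 (V h) (Gam m V s)" .
 qed
qed

lemma Gam_ann_span: assumes V: "unitary_op H1 H1 V" and h: "h : hcar H1" and u: "u : cspan {tensor gs | gs. set gs <= hcar H1}" shows "Gam m V (annK k1 h u) = annK k1 (V h) (Gam m V u)" proof -
 have Vh: "V h : hcar H1" by (rule unitary_opD(2)[OF V h])
 show ?thesis proof (rule linear_on_eq_on_cspan[OF csubspace_fin _ _ _ _ u, where T = "%u. Gam m V (annK k1 h u)" and T' = "%u. annK k1 (V h) (Gam m V u)"])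
  show "{tensor gs | gs. set gs <= hcar H1} <= fin" using tensor_fin by auto
  have cL: "annK k1 h u : cL" if "u : fin" for u using annK_fin[OF kernel_one h that] fin_full by blast
  have f: "u : cL" if "u : fin" for u using that fin_full by blast
  show "linear_on fin (%u. Gam m V (annK k1 h u))" unfolding linear_on_def using linear_onD[OF linear_annK[OF kernel_one h]] linear_onD[OF Gam_linear[OF V]] f cL by simp
  show "linear_on fin (%u. annK k1 (V h) (Gam m V u))" unfolding linear_on_def using linear_onD[OF linear_annK[OF kernel_one Vh]] linear_onD[OF Gam_linear[OF V]] f Gam_full[OF V] by simp
  fix s assume "s : {tensor gs | gs. set gs <= hcar H1}"
  then obtain gs where gs: "s = tensor gs" "set gs <= hcar H1" by auto
  show "Gam m V (annK k1 h s) = annK k1 (V h) (Gam m V s)" proof (cases gs)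
   case Nil
   have "Gam m V 0 = 0" using linear_on_zero[OF Gam_linear[OF V] hspace.zero[OF hspace_L2_LL]] .
   then show ?thesis using Gam_tensor[OF V, of "[]"] by (simp add: gs Nil annK_tensor_Nil[OF h] annK_tensor_Nil[OF Vh])
  next
   case (Cons g gs')
   have g: "g : hcar H1" "set gs' <= hcar H1" using gs(2) Cons by auto
   have Vg: "V g : hcar H1" "set (map V gs') <= hcar H1" using g unitary_opD(2)[OF V] by auto
   show ?thesis using Gam_tensor[OF V gs(2)] linear_onD(2)[OF Gam_linear[OF V] tensor_full[OF g(2)]] unitary_opD(3)[OF V h g(1)] by (simp add: gs(1) Cons annK_tensor_Cons[OF h g] annK_tensor_Cons[OF Vh Vg] Gam_tensor[OF V g(2)])
  qed
 qed
qed

lemma Gam_cvec: assumes V: "unitary_op H1 H1 V" shows "set fs <= hcar H1 ==> Gam m V (cvec fs) = cvec (map V fs)" proof (induction fs)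
 case Nil
 then show ?case using Gam_tensor[OF V, of "[]"] by simp
next
 case (Cons f fs)
 then show ?case using Gam_crea_span[OF V, of f "cvec fs"] cvec_span[of "hcar H1" fs] by simp
qed

lemma Gam_fock_le: assumes V: "unitary_op H1 H1 V" and u: "u : cN N" shows "Gam m V u : cN N" proof (rule bounded_op_invariant[OF Gam_bounded[OF V] hspace_full hspace_fock_le _ _ total_cvec _ u])
 show "cN N <= hcar (full_fock m)" unfolding full_fock_eq by (rule fock_le_full)
 fix s assume "s : {cvec fs | fs. set fs <= Delta_P m \<and> length fs <= N}"
 then obtain fs where fs: "s = cvec fs" "set fs <= hcar H1" "length fs <= N" using Delta_P_H1 by auto
 have "set (map V fs) <= hcar H1" using fs(2) unitary_opD(2)[OF V] by auto
 from cvec_fock_le[OF this] show "Gam m V s : cN N" using fs fock_le_mono[OF fs(3)] by (auto simp: Gam_cvec[OF V])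
qed simp

lemma Gam_fock: assumes V: "unitary_op H1 H1 V" and u: "u : cF" shows "Gam m V u : cF" proof (rule bounded_op_invariant[OF Gam_bounded[OF V] hspace_full hspace_fock _ _ total_cvec_fock _ u])
 show "hcar (fock m :: ('s, complex) fk hilb) <= hcar (full_fock m)" unfolding full_fock_eq by (rule fock_full)
 fix s assume "s : {cvec fs | fs. set fs <= Delta_P m}"
 then obtain fs where fs: "s = cvec fs" "set fs <= hcar H1" using Delta_P_H1 by auto
 have "set (map V fs) <= hcar H1" using fs(2) unitary_opD(2)[OF V] by auto
 from cvec_fock_le[OF this] show "Gam m V s : cF" using fs fock_le_fock by (auto simp: Gam_cvec[OF V])
qed simp

text \<open>Both sides are bounded operators on \<open>fock_le N\<close> that agree on the total set
  of vectors \<open>cvec fs\<close>.\<close>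

lemma Gam_intertwine: assumes V: "unitary_op H1 H1 V" and h: "h : hcar H1" and u: "u : cN N" shows Gam_crea: "Gam m V (creaK k1 h u) = creaK k1 (V h) (Gam m V u)" and Gam_ann: "Gam m V (annK k1 h u) = annK k1 (V h) (Gam m V u)"
proof -
 interpret F: hspace "fock_le N :: ('s, complex) fk hilb" by (rule hspace_fock_le)
 have Vh: "V h : hcar H1" by (rule unitary_opD(2)[OF V h])
 have f: "u : hcar (full_le N)" if "u : cN N" for u using that fock_le_full_le by blast
 have L: "u : cL" if "u : hcar (full_le N)" for u N using that full_le_full by blast
 note [simp] = linear_onD[OF Gam_linear[OF V]] Gam_hnorm[OF V] Gam_full[OF V] Gam_fock_le[OF V]
 have c: "creaK k1 h u : cL" "annK k1 h u : cL"
  "creaK k1 (V h) u : cL" "annK k1 (V h) u : cL" if "u : cN N" for u using creaK_full_le(1)[OF kernel_one _ f[OF that]] annK_full_le(1)[OF kernel_one _ f[OF that]] h Vh L by blast+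
 have bdI: "bounded_op (fock_le N) (L2 LL) (\<lambda>u\<in>cN N. F u)" if "!!u v. u : cN N ==> v : cN N ==> F (u + v) = F u + F v"
   "!!c u. u : cN N ==> F (c *c u) = c *c F u"
   "!!u. u : cN N ==> F u : cL"
   "!!u. u : cN N ==> nmL (F u) <= B * nmL u" for F :: "('s, complex) fk => ('s, complex) fk" and B :: real unfolding bounded_op_def linear_on_def using that by (auto intro!: exI[of _ B])
 have fL: "u : cL" if "u : cN N" for u :: "('s, complex) fk" using L[OF f[OF that]] .
 have bd1: "bounded_op (fock_le N) (L2 LL) (\<lambda>u\<in>cN N. Gam m V (creaK k1 h u))" by (rule bdI[of _ "sqrt (real (N + 1)) * 1 * hnorm H1 h"])
   (use creaK_full_le(2)[OF kernel_one h f] in "simp_all add: fL c linear_onD[OF linear_creaK[OF h]]")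
 have bd2: "bounded_op (fock_le N) (L2 LL) (\<lambda>u\<in>cN N. creaK k1 (V h) (Gam m V u))" by (rule bdI[of _ "sqrt (real (N + 1)) * 1 * hnorm H1 (V h)"])
   (use creaK_full_le(2)[OF kernel_one Vh f[OF Gam_fock_le[OF V]]] in "simp_all add: fL c linear_onD[OF linear_creaK[OF Vh]]")
 have bd3: "bounded_op (fock_le N) (L2 LL) (\<lambda>u\<in>cN N. Gam m V (annK k1 h u))" by (rule bdI[of _ "sqrt (real (N + 1)) * 1 * hnorm H1 h"])
   (use annK_full_le(2)[OF kernel_one h f] in "simp_all add: fL c linear_onD[OF linear_annK[OF kernel_one h]]")
 have bd4: "bounded_op (fock_le N) (L2 LL) (\<lambda>u\<in>cN N. annK k1 (V h) (Gam m V u))" by (rule bdI[of _ "sqrt (real (N + 1)) * 1 * hnorm H1 (V h)"])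
   (use annK_full_le(2)[OF kernel_one Vh f[OF Gam_fock_le[OF V]]] in "simp_all add: fL c linear_onD[OF linear_annK[OF kernel_one Vh]]")
 have sp: "s : cspan {tensor gs | gs. set gs <= hcar H1}" if "s : {cvec fs | fs. set fs <= Delta_P m \<and> length fs <= N}" for s using that cvec_span[of "hcar H1"] Delta_P_H1 by auto
 have "(\<lambda>u\<in>cN N. Gam m V (creaK k1 h u)) = (\<lambda>u\<in>cN N. creaK k1 (V h) (Gam m V u))"
  by (rule bounded_op_eqI[OF bd1 bd2 hspace_fock_le hspace_L2_LL total_cvec]) (simp add: restrict_def Gam_crea_span[OF V h sp])
 from fun_cong[OF this, of u] show "Gam m V (creaK k1 h u) = creaK k1 (V h) (Gam m V u)" using u by simp
 have "(\<lambda>u\<in>cN N. Gam m V (annK k1 h u)) = (\<lambda>u\<in>cN N. annK k1 (V h) (Gam m V u))" by (rule bounded_op_eqI[OF bd3 bd4 hspace_fock_le hspace_L2_LL total_cvec]) (simp add: restrict_def Gam_ann_span[OF V h sp])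
 from fun_cong[OF this, of u] show "Gam m V (annK k1 h u) = annK k1 (V h) (Gam m V u)" using u by simp
qed

end

section \<open>Unitary groups and translations\<close>

lemma unitary_groupD: assumes "unitary_group H U" shows "unitary_op H H (U t)" "u : hcar H ==> U (s + t) u = U s (U t u)"
  "u : hcar H ==> ((%t. hnorm H (U t u - u)) ---> 0) (at 0)"
  "u : hcar H ==> U t u : hcar H" using assms by (auto simp: unitary_group_def intro: unitary_opD(2))

lemma unitary_group_0: assumes "unitary_group H U" "u : hcar H" shows "U 0 u = u" proof -
 have "U 0 (U 0 u) = U 0 u" using unitary_groupD(2)[OF assms, of 0 0] by simp
 moreover have "inj_on (U 0) (hcar H)" using unitary_opD(4)[OF unitary_groupD(1)[OF assms(1), of 0]] by (simp add: bij_betw_def)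
 ultimately show ?thesis using assms unitary_groupD(4)[OF assms] by (auto dest: inj_onD)
qed

lemma unitary_group_cancel: assumes "unitary_group H U" "u : hcar H" shows "U t (U (- t) u) = u" using unitary_groupD(2)[OF assms, of t "- t"] unitary_group_0[OF assms] by simp

lemma filterlim_uminus_at_0: "filterlim uminus (at 0) (at (0::real))" unfolding filterlim_at by (auto simp: eventually_at_filter intro!: tendsto_eq_intros)

lemma generator_symmetric: assumes H: "hspace H" and U: "unitary_group H U" and uw: "(u, w) : generator H U" and vz: "(v, z) : generator H U" shows "hip H w v = hip H u z" proof -
 interpret H: hspace H by fact
 define d where "d t u = (1 / (\<i> * cor t)) *c (U t u - u)" for t u
 have in_H: "u : hcar H" "w : hcar H" "v : hcar H" "z : hcar H" using uw vz by (auto simp: generator_def)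
 note UH = unitary_groupD(4)[OF U]
 have dH: "d t u : hcar H" if "u : hcar H" for t u unfolding d_def using that UH by simp
 have du: "((%t. hnorm H (d t u - w)) ---> 0) (at 0)" and dv: "((%t. hnorm H (d t v - z)) ---> 0) (at 0)" using uw vz by (auto simp: generator_def d_def)
 have eq: "hip H (d t u) v = hip H u (d (- t) v)" for t proof -
  have "hip H (U t u) v = hip H (U t u) (U t (U (- t) v))" using unitary_group_cancel[OF U in_H(3)] by simp
  also have "... = hip H u (U (- t) v)" using in_H UH by (intro unitary_opD(3)[OF unitary_groupD(1)[OF U]]) auto
  finally show ?thesis unfolding d_def using in_H UH by (simp add: H.hip_scale_left H.hip_scale_right H.hip_diff_left H.hip_diff_right)
 qed
 have "((%t. hip H (d t u) v) ---> hip H w v) (at 0)" using in_H dH du by (intro H.tendsto_hip) auto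
 moreover have "((%t. hip H u (d (- t) v)) ---> hip H u z) (at 0)" using in_H dH filterlim_compose[OF dv filterlim_uminus_at_0] by (intro H.tendsto_hip) auto
 ultimately show ?thesis using tendsto_unique[of "at (0::real)"] unfolding eq by auto
qed

lemma generator_invariant: assumes H: "hspace H" and U: "unitary_group H U" and uw: "(u, w) : generator H U" shows "(U t u, U t w) : generator H U" proof -
 interpret H: hspace H by fact
 note UH = unitary_groupD(4)[OF U]
 have in_H: "u : hcar H" "w : hcar H" using uw by (auto simp: generator_def)
 have lin: "linear_on (hcar H) (U t)" by (rule unitary_opD(1)[OF unitary_groupD(1)[OF U]])
 have n: "hnorm H (U t x) = hnorm H x" if "x : hcar H" for x unfolding hnorm_def using unitary_opD(3)[OF unitary_groupD(1)[OF U] that that] by simp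
 have "(1 / (\<i> * cor h)) *c (U h (U t u) - U t u) - U t w = U t ((1 / (\<i> * cor h)) *c (U h u - u) - w)" for h proof -
  have "U h (U t u) = U t (U h u)" using unitary_groupD(2)[OF U in_H(1), of h t] unitary_groupD(2)[OF U in_H(1), of t h] by (simp add: add.commute)
  then show ?thesis using in_H UH by (simp add: linear_on_diff[OF H.carrier lin] linear_onD(2)[OF lin])
 qed
 then have "hnorm H ((1 / (\<i> * cor h)) *c (U h (U t u) - U t u) - U t w) = hnorm H ((1 / (\<i> * cor h)) *c (U h u - u) - w)" for h using in_H UH by (simp add: n)
 then show ?thesis using uw UH by (auto simp: generator_def)
qed

text \<open>The uniqueness half of Stone's theorem: on the domain, symmetry of the common generator
  makes the derivative of \<open>Re (hip H (U t u) (U' t u))\<close> vanish, so the two orbits stay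
  at distance zero; density does the rest.\<close>

lemma unitary_group_unique: assumes H: "hspace H" and U: "unitary_group H U" and U': "unitary_group H U'" and gen: "generator H U' = generator H U"
  and dense: "!!u. u : hcar H ==> \<exists>s. (\<forall>n::nat. s n : Domain (generator H U)) \<and> (%n. hnorm H (s n - u)) ----> 0" and u: "u : hcar H" shows "U t u = U' t u" proof -
 interpret H: hspace H by fact
 note UH = unitary_groupD(4)[OF U] and UH' = unitary_groupD(4)[OF U']
 have n: "hnorm H (U t x) = hnorm H x" "hnorm H (U' t x) = hnorm H x" if "x : hcar H" for x t
  unfolding hnorm_def using unitary_opD(3)[OF unitary_groupD(1)[OF U] that that] unitary_opD(3)[OF unitary_groupD(1)[OF U'] that that] by simp_all
 have core: "U t u = U' t u" if "u : Domain (generator H U)" for u t proof -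
  obtain w where uw: "(u, w) : generator H U" using \<open>u : Domain (generator H U)\<close> by auto
  have in_H: "u : hcar H" "w : hcar H" using uw by (auto simp: generator_def)
  define F where "F t = hip H (U t u) (U' t u)" for t
  define d where "d h = (1 / (\<i> * cor h)) *c (U h u - u)" for h
  define d' where "d' h = (1 / (\<i> * cor h)) *c (U' h u - u)" for h
  have dH: "d h : hcar H" "d' h : hcar H" for h unfolding d_def d'_def using in_H UH UH' by auto
  have dl: "((%t. hnorm H (d t - w)) ---> 0) (at 0)" "((%t. hnorm H (d' t - w)) ---> 0) (at 0)" using uw uw[folded gen] by (auto simp: generator_def d_def d'_def)
  have "((%t. Re (F t)) has_field_derivative 0) (at t)" for t proof -
   have lin: "linear_on (hcar H) (U t)" "linear_on (hcar H) (U' t)" using unitary_opD(1)[OF unitary_groupD(1)[OF U]] unitary_opD(1)[OF unitary_groupD(1)[OF U']] by auto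
   \<comment> \<open>Product rule at the level of difference quotients: the factor
     \<open>\<i>\<close> converts them into the quotients \<open>d\<close> and \<open>d'\<close> of
     the generator, both of which converge to \<open>w\<close>.\<close>
   have quot: "(F (t + h) - F t) / cor h = hip H (\<i> *c U t (d h)) (U' t (U' h u)) + hip H (U t u) (\<i> *c U' t (d' h))" if h: "h ~= 0" for h proof -
    have 1: "\<i> *c U t (d h) = (1 / cor h) *c (U t (U h u) - U t u)" unfolding d_def using in_H UH h by (simp add: linear_onD(2)[OF lin(1)] linear_on_diff[OF H.carrier lin(1)] cscale_cscale)
    have 2: "\<i> *c U' t (d' h) = (1 / cor h) *c (U' t (U' h u) - U' t u)" unfolding d'_def using in_H UH' h by (simp add: linear_onD(2)[OF lin(2)] linear_on_diff[OF H.carrier lin(2)] cscale_cscale)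
    have F: "F (t + h) = hip H (U t (U h u)) (U' t (U' h u))" unfolding F_def using unitary_groupD(2)[OF U in_H(1)] unitary_groupD(2)[OF U' in_H(1)] by simp
    show ?thesis unfolding 1 2 F using in_H UH UH' h by (simp add: F_def H.hip_scale_left H.hip_scale_right H.hip_diff_left H.hip_diff_right field_simps)
   qed
   have n': "hnorm H (\<i> *c U t (d h) - \<i> *c U t w) = hnorm H (d h - w)"
    "hnorm H (\<i> *c U' t (d' h) - \<i> *c U' t w) = hnorm H (d' h - w)" for h using dH in_H UH UH' n(1)[of "d h - w" t] n(2)[of "d' h - w" t]
    by (simp_all add: linear_on_diff[OF H.carrier lin(1)] linear_on_diff[OF H.carrier lin(2)] H.hnorm_scale flip: cscale_diff_right)
   have n'': "hnorm H (U' t (U' h u) - U' t u) = hnorm H (U' h u - u)" for h using in_H UH' n(2)[of "U' h u - u" t] by (simp add: linear_on_diff[OF H.carrier lin(2)])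
   have "((%h. hip H (\<i> *c U t (d h)) (U' t (U' h u)) + hip H (U t u) (\<i> *c U' t (d' h))) ---> hip H (\<i> *c U t w) (U' t u) + hip H (U t u) (\<i> *c U' t w)) (at 0)" using in_H dH UH UH' dl unitary_groupD(3)[OF U' in_H(1)]
    by (intro tendsto_add H.tendsto_hip) (simp_all add: n' n'')
   moreover have "hip H (\<i> *c U t w) (U' t u) + hip H (U t u) (\<i> *c U' t w) = 0" using generator_symmetric[OF H U generator_invariant[OF H U uw, of t] generator_invariant[OF H U', of u w t, unfolded gen, OF uw]]
     in_H UH UH' by (simp add: H.hip_scale_left H.hip_scale_right)
   ultimately have "((%h. hip H (\<i> *c U t (d h)) (U' t (U' h u)) + hip H (U t u) (\<i> *c U' t (d' h))) ---> 0) (at 0)" by simp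
   then have "((%h. (F (t + h) - F t) / cor h) ---> 0) (at 0)" by (rule Lim_transform_eventually) (auto simp: quot eventually_at_filter)
   from tendsto_Re[OF this] show ?thesis unfolding DERIV_def by (simp add: Re_divide_of_real)
  qed
  then have "Re (F t) = Re (F 0)" by (intro DERIV_isconst_all) auto
  then have "(hnorm H (U t u - U' t u))^2 = 0" using in_H UH UH' unitary_group_0[OF U in_H(1)] unitary_group_0[OF U' in_H(1)] H.hip_self[of u] by (simp add: H.hnorm_diff_sq n F_def)
  then show ?thesis using H.hnorm_eq_0[of "U t u - U' t u"] in_H UH UH' by simp
 qed
 obtain s where s: "!!n::nat. s n : Domain (generator H U)" "(%n. hnorm H (s n - u)) ----> 0" using dense[OF u] by blast
 have sH: "s n : hcar H" for n using s(1)[of n] by (auto simp: generator_def)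
 have lin: "linear_on (hcar H) (U t)" "linear_on (hcar H) (U' t)" using unitary_opD(1)[OF unitary_groupD(1)[OF U]] unitary_opD(1)[OF unitary_groupD(1)[OF U']] by auto
 have "hnorm H (U t (s n) - U t u) = hnorm H (s n - u)" "hnorm H (U t (s n) - U' t u) = hnorm H (s n - u)" for n using n[of "s n - u" t] sH u core[OF s(1), of t n]
  by (simp_all add: linear_on_diff[OF H.carrier lin(1)] linear_on_diff[OF H.carrier lin(2)])
 then show ?thesis using s(2) sH u UH UH' by (intro H.hlimit_unique[of "%n. U t (s n)" _ _ sequentially]) auto
qed

text \<open>Evaluates \<open>expi\<close> from one exhibited group with generator \<open>A\<close>;
  in the application the group is conjugated multiplication by phases.\<close>

lemma expi_eq: assumes H: "hspace H" and U: "exp_group H A U" and dense: "!!u. u : hcar H ==> \<exists>s. (\<forall>n::nat. s n : Domain A) \<and> (%n. hnorm H (s n - u)) ----> 0" shows "expi H A = restrict (U 1) (hcar H)"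
 unfolding expi_def proof (rule the_equality)
 show "\<exists>U'. exp_group H A U' \<and> restrict (U 1) (hcar H) = restrict (U' 1) (hcar H)" using U by blast
 fix T assume "\<exists>U'. exp_group H A U' \<and> T = restrict (U' 1) (hcar H)"
 then obtain U' where U': "exp_group H A U'" "T = restrict (U' 1) (hcar H)" by blast
 have "U 1 u = U' 1 u" if "u : hcar H" for u by (rule unitary_group_unique[OF H _ _ _ _ that]) (use U U' dense in "auto simp: exp_group_def")
 then show "T = restrict (U 1) (hcar H)" unfolding U' by (auto simp: restrict_def)
qed

definition conj_graph :: "'a::cvector hilb => ('a => 'a) => ('a \<times> 'a) set => ('a \<times> 'a) set" where "conj_graph H W B = {(u, w). u : hcar H \<and> w : hcar H \<and> (W u, W w) : B}"

locale unitary_pair = hspace H for H :: "'a::cvector hilb" + fixes W Wi :: "'a => 'a" assumes W: "unitary_op H H W" and Wi: "unitary_op H H Wi"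
  and WiW [simp]: "u : hcar H ==> Wi (W u) = u" and WWi [simp]: "u : hcar H ==> W (Wi u) = u"
begin

lemma W_simps [simp]: "u : hcar H ==> W u : hcar H" "u : hcar H ==> Wi u : hcar H" using unitary_opD(2)[OF W] unitary_opD(2)[OF Wi] by auto

lemma hnorm_W [simp]: "u : hcar H ==> hnorm H (W u) = hnorm H u" "u : hcar H ==> hnorm H (Wi u) = hnorm H u" unfolding hnorm_def using unitary_opD(3)[OF W, of u u] unitary_opD(3)[OF Wi, of u u] by auto

lemma W_diff: "u : hcar H ==> v : hcar H ==> W (u - v) = W u - W v" and Wi_diff: "u : hcar H ==> v : hcar H ==> Wi (u - v) = Wi u - Wi v" and W_scale: "u : hcar H ==> W (c *c u) = c *c W u"
 using linear_on_diff[OF carrier unitary_opD(1)[OF W]] linear_on_diff[OF carrier unitary_opD(1)[OF Wi]] linear_onD(2)[OF unitary_opD(1)[OF W]] by auto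

lemma hnorm_Wi_W_diff: "u : hcar H ==> v : hcar H ==> hnorm H (Wi u - v) = hnorm H (u - W v)" using hnorm_W(2)[of "u - W v"] by (simp add: Wi_diff)

lemma graph_closure_conj: assumes B: "B <= hcar H \<times> hcar H" shows "graph_closure H (conj_graph H W B) = conj_graph H W (graph_closure H B)" proof (intro equalityI subrelI)
 fix u w assume "(u, w) : graph_closure H (conj_graph H W B)"
 then obtain s where in_H: "u : hcar H" "w : hcar H" and s: "!!n::nat. s n : conj_graph H W B"
  "(%n. hnorm H (fst (s n) - u)) ----> 0" "(%n. hnorm H (snd (s n) - w)) ----> 0" by (auto simp: graph_closure_def)
 have sH: "fst (s n) : hcar H" "snd (s n) : hcar H" "(W (fst (s n)), W (snd (s n))) : B" for n using s(1)[of n] by (auto simp: conj_graph_def split_beta)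
 have "hnorm H (W (fst (s n)) - W u) = hnorm H (fst (s n) - u)" "hnorm H (W (snd (s n)) - W w) = hnorm H (snd (s n) - w)" for n using sH in_H by (simp_all flip: W_diff)
 then have "(W u, W w) : graph_closure H B" using in_H sH s(2,3) by (auto simp: graph_closure_def intro!: exI[of _ "%n. (W (fst (s n)), W (snd (s n)))"])
 then show "(u, w) : conj_graph H W (graph_closure H B)" using in_H by (simp add: conj_graph_def)
next
 fix u w assume "(u, w) : conj_graph H W (graph_closure H B)"
 then have in_H: "u : hcar H" "w : hcar H" and "(W u, W w) : graph_closure H B" by (auto simp: conj_graph_def)
 then obtain s where s: "!!n::nat. s n : B"
  "(%n. hnorm H (fst (s n) - W u)) ----> 0" "(%n. hnorm H (snd (s n) - W w)) ----> 0" by (auto simp: graph_closure_def)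
 have sH: "fst (s n) : hcar H" "snd (s n) : hcar H" for n using s(1)[of n] B by auto
 show "(u, w) : graph_closure H (conj_graph H W B)" using in_H sH s by (auto simp: graph_closure_def conj_graph_def hnorm_Wi_W_diff intro!: exI[of _ "%n. (Wi (fst (s n)), Wi (snd (s n)))"])
qed

lemma unitary_group_conj: assumes U: "unitary_group H U" shows "unitary_group H (%t u. Wi (U t (W u)))" unfolding unitary_group_def proof (intro conjI allI ballI)
 note UH = unitary_groupD(4)[OF U]
 show "unitary_op H H (%u. Wi (U t (W u)))" for t using unitary_comp[OF unitary_comp[OF W unitary_groupD(1)[OF U]] Wi] .
 fix u assume u: "u : hcar H"
 show "Wi (U (s + t) (W u)) = Wi (U s (W (Wi (U t (W u)))))" for s t using u UH by (simp add: unitary_groupD(2)[OF U])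
 show "((%t. hnorm H (Wi (U t (W u)) - u)) ---> 0) (at 0)" using unitary_groupD(3)[OF U, of "W u"] u UH by (simp add: hnorm_Wi_W_diff)
qed

lemma generator_conj: assumes U: "unitary_group H U" shows "generator H (%t u. Wi (U t (W u))) = conj_graph H W (generator H U)" proof -
 note UH = unitary_groupD(4)[OF U]
 have "hnorm H ((1 / (\<i> * cor t)) *c (Wi (U t (W u)) - u) - w) = hnorm H ((1 / (\<i> * cor t)) *c (U t (W u) - W u) - W w)" if "u : hcar H" "w : hcar H" for u w t proof -
  have "W ((1 / (\<i> * cor t)) *c (Wi (U t (W u)) - u) - w) = (1 / (\<i> * cor t)) *c (U t (W u) - W u) - W w" using that UH by (simp add: W_diff W_scale)
  then show ?thesis using hnorm_W(1)[of "(1 / (\<i> * cor t)) *c (Wi (U t (W u)) - u) - w"] that UH by simp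
 qed
 then show ?thesis by (auto simp: generator_def conj_graph_def)
qed

end

section \<open>Multiplication operators on Fock space and the translations\<close>

context vol_measure
begin

lemma L2_dominated: fixes f :: "nat => 'a => complex" assumes f: "!!n. f n : bm M" and g: "g : bm M" and w: "sqint M w" and le: "!!n x. cmod (f n x) <= norm (w x)" and lim: "AE x in M. (%n. f n x) ----> g x"
 shows "sqint M (f n)" "sqint M g" "(%n. hnorm (L2 M) (mk (f n) - mk g)) ----> 0" proof -
 note [measurable] = f g sqint_borel[OF w]
 show fsq: "sqint M (f n)" for n by (rule sqint_bounded[OF w, where C = 1]) (use le f in auto)
 have gle: "AE x in M. cmod (g x) <= 1 * norm (w x)" using lim proof eventually_elim
  case (elim x)
  then show ?case using le by (intro LIMSEQ_le_const2[OF tendsto_norm]) auto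
 qed
 show gsq: "sqint M g" by (rule sqint_bounded[OF w _ gle]) (use g in auto)
 note dsq = sqint_diff[OF fsq gsq]
 show "(%n. hnorm (L2 M) (mk (f n) - mk g)) ----> 0" proof (rule ennreal_sq_tendsto_0)
  show "en ((hnorm (L2 M) (mk (f n) - mk g))^2) <= (nni M (%x. en ((cmod (f n x - g x))^2)))" for n unfolding mk_minus hnorm_mk[OF dsq] ..
  show "0 <= hnorm (L2 M) (mk (f n) - mk g)" for n unfolding mk_minus by (rule hnorm_mk_nonneg[OF dsq])
  have "(%n. nni M (%x. en ((cmod (f n x - g x))^2)) ) ----> (nni M (%x. 0))" proof (rule nn_integral_dominated_convergence[where w = "%x. 4 * en ((norm (w x))^2)"])
   show "AE x in M. en ((cmod (f n x - g x))^2) <= 4 * en ((norm (w x))^2)" for n using gle proof eventually_elim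
    case (elim x)
    have "cmod (f n x - g x) <= 2 * norm (w x)" using norm_triangle_ineq4[of "f n x" "g x"] le[of n x] elim by simp
    then have "(cmod (f n x - g x))^2 <= (2 * norm (w x))^2" by (intro power_mono) auto
    from ennreal_leI[OF this] show ?case by (simp add: power_mult_distrib ennreal_mult)
   qed
   have "(nni M (%x. 4 * en ((norm (w x))^2))) = 4 * (nni M (%x. en ((norm (w x))^2)))" by (rule nn_integral_cmult) measurable
   also have "... < \<infinity>" using w by (simp add: sqint_iff ennreal_mult_less_top)
   finally show "(nni M (%x. 4 * en ((norm (w x))^2))) < \<infinity>" .
   show "AE x in M. (%n. en ((cmod (f n x - g x))^2)) ----> 0" using lim proof eventually_elim
    case (elim x)
    have "(%n. en ((cmod (f n x - g x))^2)) ----> en ((cmod (g x - g x))^2)" by (intro tendsto_ennrealI tendsto_intros elim)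
    then show ?case by simp
   qed
  qed measurable
  then show "(%n. nni M (%x. en ((cmod (f n x - g x))^2)) ) ----> 0" by simp
 qed
qed

end

lemma cmod_exp_i_diff_le: "cmod (exp (\<i> * cor t) - 1) <= \<bar>t\<bar>" proof -
 have "cmod (exp (\<i> * cor t) - 1) = 2 * \<bar>sin (t / 2)\<bar>" using dist_exp_i_1[of t] by (simp add: dist_norm)
 then show ?thesis using abs_sin_x_le_abs_x[of "t / 2"] by simp
qed

lemma exp_i_quotient_tendsto: assumes "t ----> 0" "!!n. t n ~= (0::real)" shows "(%n. 1 / (\<i> * cor (t n)) * (exp (\<i> * cor (t n * a)) - 1)) ----> cor a" proof -
 have "((%z. exp (z * cor a)) has_field_derivative cor a) (at 0)" by (auto intro!: derivative_eq_intros)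
 then have "((%z. (exp (z * cor a) - 1) / z) ---> cor a) (at 0)" by (simp add: DERIV_def)
 moreover have "filterlim (%n. \<i> * cor (t n)) (at 0) sequentially" unfolding filterlim_at using assms by (auto intro!: tendsto_eq_intros)
 ultimately have "(%n. (exp (\<i> * cor (t n) * cor a) - 1) / (\<i> * cor (t n))) ----> cor a" by (rule filterlim_compose)
 then show ?thesis by (simp add: mult.assoc)
qed

lemma mink_eq_sum: "mink x y = (\<Sum>\<mu>\<in>UNIV. eta \<mu> * x $ \<mu> * y $ \<mu>)" proof -
 have "(\<Sum>\<mu>\<in>UNIV. eta \<mu> * x $ \<mu> * y $ \<mu>) = x $ None * y $ None + (\<Sum>j\<in>UNIV. - (x $ Some j * y $ Some j))" by (simp add: UNIV_option_conv sum.reindex eta_def)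
 then show ?thesis by (simp add: mink_def sum_negf)
qed

context mass
begin

definition mulop :: "((real ^ 's) list => complex) => ('s, complex) fk => ('s, complex) fk" where "mulop g u = mk (%ps. g ps * repr u ps)"

definition symm :: "((real ^ 's) list => 'b) => bool" where "symm g \<longleftrightarrow> (\<forall>ps qs. mset ps = mset qs --> g ps = g qs)"

lemma symm_tot: "symm tot" by (auto simp: symm_def intro: total_momentum_mset)

lemma symm_comp: "symm g ==> symm (%ps. h (g ps))" unfolding symm_def by metis

lemma mulop_mk: assumes "sqint LL f" shows "mulop g (mk f) = mk (%ps. g ps * f ps)" unfolding mulop_def vl.mk_eq_iff_M using vl.repr_M(3)[OF vl.sqint_strong[OF assms]] by eventually_elim simp

lemma sqint_mul: assumes g: "g : bm LL" "!!ps. cmod (g ps) <= C" and f: "sqint LL f" shows "sqint LL (%ps. g ps * f ps)" by (rule vl.sqint_bounded[OF f, where C = C])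
  (use g vl.sqint_borel[OF f] in "auto simp: norm_mult intro!: mult_right_mono borel_measurable_times")

lemma mulop_L2: assumes "g : bm LL" "!!ps. cmod (g ps) <= C" "u : cL" shows "mulop g u : cL" using assms sqint_mul[OF assms(1,2)] by (auto simp: vl.L2_carrier mulop_mk)

lemma mulop_fock: assumes "g : bm LL" "!!ps. cmod (g ps) <= C" "symm g" "u : cF" shows "mulop g u : cF" proof -
 obtain f where f: "u = mk f" "sqint LL f" "!!ps qs. mset ps = mset qs ==> f ps = f qs" using assms(4) by (rule fockE) blast
 show ?thesis unfolding f(1) mulop_mk[OF f(2)] proof (rule fockI[OF sqint_mul[OF assms(1,2) f(2)]])
  fix ps qs :: "(real ^ 's) list" assume e: "mset ps = mset qs"
  show "g ps * f ps = g qs * f qs" using f(3)[OF e] assms(3) e unfolding symm_def by metis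
 qed
qed

lemma mulop_fock_le: assumes "g : bm LL" "!!ps. cmod (g ps) <= C" "symm g" "u : cN N" shows "mulop g u : cN N" proof -
 obtain f where f: "u = mk f" "sqint LL f" "!!ps qs. mset ps = mset qs ==> f ps = f qs" "!!ps. N < length ps ==> f ps = 0" using assms(4) by (rule fock_leE) blast
 show ?thesis unfolding f(1) mulop_mk[OF f(2)] proof (rule fock_leI[OF sqint_mul[OF assms(1,2) f(2)]])
  fix ps qs :: "(real ^ 's) list" assume e: "mset ps = mset qs"
  show "g ps * f ps = g qs * f qs" using f(3)[OF e] assms(3) e unfolding symm_def by metis
 qed (simp add: f(4))
qed

lemma mulop_linear: "linear_on (cL) (mulop g)" unfolding linear_on_def proof (intro conjI ballI allI)
 fix u v :: "('s, complex) fk"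
 assume "u : cL" "v : cL"
 then obtain f f' :: "(real ^ 's) list => complex" where "u = mk f" "sqint LL f" "v = mk f'" "sqint LL f'" by (auto simp: vl.L2_carrier)
 then show "mulop g (u + v) = mulop g u + mulop g v" by (simp add: mk_plus mulop_mk vl.sqint_add algebra_simps)
next
 fix c and u :: "('s, complex) fk"
 assume "u : cL"
 then obtain f :: "(real ^ 's) list => complex" where "u = mk f" "sqint LL f" by (auto simp: vl.L2_carrier)
 then show "mulop g (c *c u) = c *c mulop g u" using vl.sqint_scale[of f c] by (simp add: mk_scale mulop_mk mult_ac)
qed

lemma mulop_mulop: assumes "g : bm LL" "!!ps. cmod (g ps) <= C" "u : cL" shows "mulop h (mulop g u) = mulop (%ps. h ps * g ps) u" using assms sqint_mul[OF assms(1,2)] by (auto simp: vl.L2_carrier mulop_mk mult.assoc)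

lemma mulop_hnorm_le: assumes g: "g : bm LL" "!!ps. cmod (g ps) <= C" and C: "0 <= C" and u: "u : cL" shows "nmL (mulop g u) <= C * nmL u" proof -
 obtain f where f: "u = mk f" "sqint LL f" using u by (auto simp: vl.L2_carrier)
 have [measurable]: "f : bm LL" by (rule vl.sqint_borel[OF f(2)])
 show ?thesis unfolding f(1) mulop_mk[OF f(2)] proof (rule vl.hnorm_mk_le[OF sqint_mul[OF g f(2)]])
  have "(nni LL (%ps. en ((cmod (g ps * f ps))^2))) <= (nni LL (%ps. en (C\<^sup>2) * en ((cmod (f ps))^2)))" proof (rule nn_integral_mono)
   fix ps
   have "cmod (g ps * f ps) <= C * cmod (f ps)" using g(2)[of ps] by (simp add: norm_mult mult_right_mono)
   then have "(cmod (g ps * f ps))^2 <= (C * cmod (f ps))^2" by (intro power_mono) auto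
   from ennreal_leI[OF this] show "en ((cmod (g ps * f ps))^2) <= en (C\<^sup>2) * en ((cmod (f ps))^2)" by (simp add: power_mult_distrib ennreal_mult)
  qed
  also have "... = en ((C * nmL (mk f))^2)" by (simp add: nn_integral_cmult power_mult_distrib ennreal_mult vl.hnorm_mk[OF f(2)])
  finally show "(nni LL (%ps. en ((cmod (g ps * f ps))^2))) <= en ((C * nmL (mk f))^2)" .
 qed (use C vl.hnorm_mk_nonneg[OF f(2)] in auto)
qed

lemma mulop_tendsto: assumes g: "g : bm LL" "!!ps. cmod (g ps) <= C" and s: "!!n. s n : cL" and u: "u : cL" and lim: "((%n. nmL (s n - u)) ---> 0) F" shows "((%n. nmL (mulop g (s n) - mulop g u)) ---> 0) F" proof -
 interpret L: hspace "L2 LL :: ('s, complex) fk hilb" by (rule hspace_L2_LL)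
 have C: "0 <= C" using g(2)[of "[]"] norm_ge_zero order_trans by blast
 have le: "nmL (mulop g (s n) - mulop g u) <= C * nmL (s n - u)" for n using mulop_hnorm_le[OF g C, of "s n - u"] s u linear_on_diff[OF L.carrier mulop_linear] by simp
 have "0 <= nmL (mulop g (s n) - mulop g u)" for n using mulop_L2[OF g] s u by (intro L.hnorm_nonneg L.diff) auto
 then show ?thesis using le by (intro Lim_null_comparison[OF _ tendsto_mult_right_zero[OF lim, of C]]) auto
qed

lemma mulop_hip: assumes g: "g : bm LL" "!!ps. cmod (g ps) = 1" and u: "u : cL" and v: "v : cL" shows "ipL (mulop g u) (mulop g v) = ipL u v" proof -
 obtain f f' where f: "u = mk f" "sqint LL f" "v = mk f'" "sqint LL f'" using u v by (auto simp: vl.L2_carrier)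
 have [measurable]: "f : bm LL" "f' : bm LL" using f by (auto simp: vl.sqint_borel)
 have "cnj (g ps * f ps) * (g ps * f' ps) = cnj (f ps) * f' ps" for ps using complex_norm_square[of "g ps"] by (simp add: g(2) mult_ac)
 then have eq: "cnj (g ps) * cnj (f ps) * (g ps * f' ps) = cnj (f ps) * f' ps" for ps by simp
 then show ?thesis unfolding f(1,3) mulop_mk[OF f(2)] mulop_mk[OF f(4)] using g(1) by (subst (1 2) vl.hip_mk) (auto simp: eq)
qed

lemma mulop_one: "u : cL ==> (!!ps. g ps = 1) ==> mulop g u = u" by (auto simp: vl.L2_carrier mulop_mk)

lemma mulop_unitary: assumes g: "g : bm LL" "!!ps. cmod (g ps) = 1" "symm g" shows "unitary_op (fock m) (fock m) (mulop g)" proof -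
 have fL: "u : cL" if "u : cF" for u :: "('s, complex) fk" using that fock_full by blast
 have le: "!!ps. cmod (g ps) <= 1" "!!ps. cmod (cnj (g ps)) <= 1" using g(2) by auto
 have cg: "(%ps. cnj (g ps)) : bm LL" using g(1) by measurable
 have c1: "cnj (g ps) * g ps = 1" for ps using complex_norm_square[of "g ps"] g(2) by (simp add: mult.commute)
 have inv: "mulop (%ps. cnj (g ps)) (mulop g u) = u" "mulop g (mulop (%ps. cnj (g ps)) u) = u" if "u : cF" for u
  using fL[OF that] c1 by (auto simp: mulop_mulop[OF g(1) le(1)] mulop_mulop[OF cg le(2)] mult.commute intro!: mulop_one)
 have "bij_betw (mulop g) (cF) (cF)" by (rule bij_betw_byWitness[where f' = "mulop (%ps. cnj (g ps))"]) (use inv mulop_fock[OF g(1) le(1) g(3)] mulop_fock[OF cg le(2) symm_comp[OF g(3)]] in auto)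
 moreover have "linear_on (cF) (mulop g)" using mulop_linear[of g] fL unfolding linear_on_def by blast
 ultimately show ?thesis unfolding unitary_op_def using mulop_hip[OF g(1,2) fL fL] by auto
qed

definition mul_graph :: "((real ^ 's) list => real) => (('s, complex) fk \<times> ('s, complex) fk) set" where "mul_graph a = {(u, w). u : cF \<and> w : cF \<and> w = mulop (%ps. cor (a ps)) u}"

text \<open>Multiplication by an unbounded \<open>a\<close> is not continuous, so limits are
  identified after cutting off to \<open>|a| <= k\<close>, where it is bounded; countably many
  \<open>k\<close> reach every point.\<close>

lemma mul_graphI_trunc: assumes a [measurable]: "a : bm LL" and u: "u : cF" and w: "w : cF"
  and eq: "!!k::nat. mulop (%ps. if \<bar>a ps\<bar> <= real k then 1 else 0) w = mulop (%ps. if \<bar>a ps\<bar> <= real k then cor (a ps) else 0) u" shows "(u, w) : mul_graph a" proof -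
 obtain f g where f: "u = mk f" "sqint LL f" and g: "w = mk g" "sqint LL g" using u w by (elim fockE) blast
 have "AE ps in LL. \<forall>k. (if \<bar>a ps\<bar> <= real k then 1 else 0) * g ps = (if \<bar>a ps\<bar> <= real k then cor (a ps) else 0) * f ps"
  unfolding AE_all_countable using eq unfolding f(1) g(1) mulop_mk[OF f(2)] mulop_mk[OF g(2)] vl.mk_eq_iff_M by blast
 then have "AE ps in LL. g ps = cor (a ps) * f ps" proof eventually_elim
  case (elim ps)
  obtain k where "\<bar>a ps\<bar> <= real k" using real_arch_simple by blast
  with elim[rule_format, of k] show ?case by simp
 qed
 then have "w = mulop (%ps. cor (a ps)) u" unfolding f(1) g(1) mulop_mk[OF f(2)] vl.mk_eq_iff_M .
 then show ?thesis using u w by (simp add: mul_graph_def)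
qed

text \<open>The generator is the maximal multiplication operator. One inclusion is dominated
  convergence with majorant \<open>|a f|\<close>, which is square-integrable on the domain; the
  other uses the cutoffs \<open>|a| <= k\<close>, where the quotients \<open>q t\<close> converge
  boundedly.\<close>

lemma mul_group: assumes a [measurable]: "a : bm LL" and sym: "symm a"
 defines "U \<equiv> %t. mulop (%ps. exp (\<i> * cor (t * a ps)))" shows unitary_group_mulop: "unitary_group (fock m) U" and generator_mulop: "generator (fock m) U = mul_graph a" proof -
 have fL: "u : cL" if "u : cF" for u :: "('s, complex) fk" using that fock_full by blast
 have e [measurable]: "(%ps. exp (\<i> * cor (t * a ps))) : bm LL" for t by measurable
 have e1: "cmod (exp (\<i> * cor (t * a ps))) = 1" for t ps by (simp add: norm_exp_i_times)
 have e1': "cmod (exp (\<i> * cor (t * a ps))) <= 1" for t ps using e1[of t ps] by simp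
 show "unitary_group (fock m) U" unfolding unitary_group_def proof (intro conjI allI ballI)
  show "unitary_op (fock m) (fock m) (U t)" for t unfolding U_def by (rule mulop_unitary[OF e e1 symm_comp[OF sym]])
  fix u :: "('s, complex) fk" assume u: "u : cF"
  show "U (s + t) u = U s (U t u)" for s t unfolding U_def mulop_mulop[OF e e1' fL[OF u]] by (simp add: exp_add[symmetric] algebra_simps)
  obtain f where f: "u = mk f" "sqint LL f" using u by (rule fockE) blast
  have [measurable]: "f : bm LL" by (rule vl.sqint_borel[OF f(2)])
  show "((%t. hnorm (fock m) (U t u - u)) ---> 0) (at 0)" unfolding tendsto_at_iff_sequentially comp_def proof (intro allI impI)
   fix X :: "nat => real" assume X: "\<forall>i. X i : UNIV - {0}" "X ----> 0"
   have "(%n. nmL (mk (%ps. exp (\<i> * cor (X n * a ps)) * f ps) - mk f)) ----> 0" proof (rule vl.L2_dominated(3)[where w = f])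
    show "AE ps in LL. (%n. exp (\<i> * cor (X n * a ps)) * f ps) ----> f ps" using X(2) by (intro AE_I2) (auto intro!: tendsto_eq_intros)
   qed (use f e1 in "auto simp: norm_mult")
   then show "(%n. hnorm (fock m) (U (X n) u - u)) ----> 0" by (simp add: U_def f(1) mulop_mk[OF f(2)])
  qed
 qed
 define q where "q t ps = 1 / (\<i> * cor t) * (exp (\<i> * cor (t * a ps)) - 1)" for t ps
 have q_meas [measurable]: "q t : bm LL" for t unfolding q_def by measurable
 have q_le: "cmod (q t ps) <= \<bar>a ps\<bar>" if "t ~= 0" for t ps using cmod_exp_i_diff_le[of "t * a ps"] that by (simp add: q_def norm_mult norm_divide abs_mult divide_le_eq mult.commute)
 have diffq: "(1 / (\<i> * cor t)) *c (U t u - u) = mulop (q t) u" if u: "u : cF" for t u proof -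
  obtain f where f: "u = mk f" "sqint LL f" using u by (rule fockE) blast
  show ?thesis by (simp add: U_def f(1) mulop_mk[OF f(2)] mk_minus mk_scale q_def algebra_simps)
 qed
 have q_lim: "(%n. q (X n) ps) ----> cor (a ps)" if "\<forall>i. X i : UNIV - {0}" "X ----> 0" for X ps unfolding q_def using that by (intro exp_i_quotient_tendsto) auto
 show "generator (fock m) U = mul_graph a" proof (intro equalityI subrelI)
  fix u w assume "(u, w) : mul_graph a"
  then have u: "u : cF" and w: "w : cF" "w = mulop (%ps. cor (a ps)) u" by (auto simp: mul_graph_def)
  obtain f where f: "u = mk f" "sqint LL f" using u by (rule fockE) blast
  have [measurable]: "f : bm LL" by (rule vl.sqint_borel[OF f(2)])
  have w': "w = mk (%ps. cor (a ps) * f ps)" unfolding w(2) f(1) mulop_mk[OF f(2)] ..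
  have af: "sqint LL (%ps. cor (a ps) * f ps)" proof -
   obtain g where g: "w = mk g" "sqint LL g" using w(1) by (rule fockE) blast
   show ?thesis by (rule vl.sqint_cong_AE[OF g(2)]) (use trans[OF g(1)[symmetric] w'] in "simp_all add: vl.mk_eq_iff_M")
  qed
  have "((%t. nmL (mulop (q t) u - w)) ---> 0) (at 0)" unfolding tendsto_at_iff_sequentially comp_def proof (intro allI impI)
   fix X :: "nat => real" assume X: "\<forall>i. X i : UNIV - {0}" "X ----> 0"
   show "(%n. nmL (mulop (q (X n)) u - w)) ----> 0" unfolding w' f(1) mulop_mk[OF f(2)] proof (rule vl.L2_dominated(3)[OF _ _ af])
    show "cmod (q (X n) ps * f ps) <= cmod (cor (a ps) * f ps)" for n ps using q_le[of "X n" ps] X(1) by (auto simp: norm_mult intro!: mult_right_mono)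
    show "AE ps in LL. (%n. q (X n) ps * f ps) ----> cor (a ps) * f ps" by (intro AE_I2 tendsto_mult tendsto_const q_lim X)
   qed measurable
  qed
  then show "(u, w) : generator (fock m) U" using u w(1) by (simp add: generator_def diffq)
 next
  fix u w assume "(u, w) : generator (fock m) U"
  then have u: "u : cF" and w: "w : cF" and lim: "((%t. nmL (mulop (q t) u - w)) ---> 0) (at 0)" by (auto simp: generator_def diffq)
  show "(u, w) : mul_graph a" proof (rule mul_graphI_trunc[OF a u w])
   fix k :: nat
   let ?\<chi> = "%ps. if \<bar>a ps\<bar> <= real k then 1 else 0 :: complex"
   have \<chi>: "?\<chi> : bm LL" by measurable
   obtain f where f: "u = mk f" "sqint LL f" using u by (rule fockE) blast
   have [measurable]: "f : bm LL" by (rule vl.sqint_borel[OF f(2)])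
   \<comment> \<open>Along this sequence each \<open>q (X n)\<close> is bounded, with a bound
     growing in \<open>n\<close>; this puts \<open>mulop (q (X n)) u\<close> into the carrier. The
     estimate uniform in \<open>n\<close> comes from \<open>|q| <= |a| <= k\<close> after the
     cutoff.\<close>
   define X where "X n = 1 / real (Suc n)" for n
   have X: "\<forall>i. X i : UNIV - {0}" "X ----> 0" using LIMSEQ_inverse_real_of_nat by (auto simp: X_def[abs_def] inverse_eq_divide)
   have lim1: "(%n. nmL (mulop (q (X n)) u - w)) ----> 0" using lim X unfolding tendsto_at_iff_sequentially comp_def by blast
   have qb: "cmod (q (X n) ps) <= 2 * real (Suc n)" for n ps proof -
    have "cmod (exp (\<i> * cor (X n * a ps)) - 1) <= 2" using norm_triangle_ineq4[of "exp (\<i> * cor (X n * a ps))" 1] e1[of "X n" ps] by simp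
    then have "real (Suc n) * cmod (exp (\<i> * cor (X n * a ps)) - 1) <= real (Suc n) * 2" by (rule mult_left_mono) simp
    then show ?thesis by (simp add: q_def norm_mult norm_divide X_def mult.commute norm_of_nat[of "Suc n", where 'a = complex] del: of_nat_Suc)
   qed
   have qL: "mulop (q (X n)) u : cL" for n by (rule mulop_L2[OF q_meas qb fL[OF u]])
   have \<chi>b: "cmod (?\<chi> ps) <= 1" for ps by simp
   have lim2: "(%n. nmL (mulop ?\<chi> (mulop (q (X n)) u) - mulop ?\<chi> w)) ----> 0" by (rule mulop_tendsto[OF \<chi> \<chi>b qL fL[OF w] lim1])
   have ab: "cmod (if \<bar>a ps\<bar> <= real k then cor (a ps) else 0) <= real k" for ps by simp
   have am: "(%ps. if \<bar>a ps\<bar> <= real k then cor (a ps) else 0) : bm LL" by measurable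
   have lim3: "(%n. nmL (mulop ?\<chi> (mulop (q (X n)) u) - mulop (%ps. if \<bar>a ps\<bar> <= real k then cor (a ps) else 0) u)) ----> 0" unfolding mulop_mulop[OF q_meas qb fL[OF u]] unfolding f(1) mulop_mk[OF f(2)]
   proof (rule vl.L2_dominated(3)[where w = "%ps. cor (real k) * f ps"])
    show "sqint LL (%ps. cor (real k) * f ps)" by (rule sqint_mul[OF _ _ f(2), of _ "real k"]) auto
    show "cmod (?\<chi> ps * q (X n) ps * f ps) <= cmod (cor (real k) * f ps)" for n ps using order_trans[OF q_le[of "X n" ps], of "real k"] X(1) by (auto simp: norm_mult intro!: mult_right_mono)
    have l: "(%n. ?\<chi> ps * q (X n) ps * f ps) ----> ?\<chi> ps * cor (a ps) * f ps" for ps by (intro tendsto_mult tendsto_const q_lim X)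
    show "AE ps in LL. (%n. ?\<chi> ps * q (X n) ps * f ps) ----> (if \<bar>a ps\<bar> <= real k then cor (a ps) else 0) * f ps" by (intro AE_I2 l[THEN back_subst[of "%z. _ ----> z"]]) simp
   qed measurable
   show "mulop ?\<chi> w = mulop (%ps. if \<bar>a ps\<bar> <= real k then cor (a ps) else 0) u" by (rule hspace.hlimit_unique[OF hspace_L2_LL _ _ _ _ lim2 lim3])
     (auto intro: mulop_L2[OF \<chi> \<chi>b] mulop_L2[OF am ab] qL fL w u)
  qed
 qed
qed

lemma mom_P_eq: "mom_P m \<mu> = mul_graph (%ps. tot ps $ \<mu>)" by (auto simp: mom_P_def mul_graph_def mulop_def)

lemma mulop_sum: assumes u: "u : cL" shows "(\<Sum>\<mu>\<in>I. c \<mu> *c mulop (g \<mu>) u) = mulop (%ps. \<Sum>\<mu>\<in>I. c \<mu> * g \<mu> ps) u" proof -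
 obtain f where f: "u = mk f" "sqint LL f" using u by (auto simp: vl.L2_carrier)
 show ?thesis unfolding f(1) mulop_mk[OF f(2)] mk_scale mk_sum by (rule arg_cong[where f = mk]) (simp add: fun_eq_iff sum_distrib_right mult.assoc)
qed

text \<open>A combination of the momenta is at first defined only where all components are, whereas
  multiplication by the combined function may have a larger domain owing to cancellations. Vectors
  cut off in all components lie in both domains and approximate the graph of the larger
  operator.\<close>

lemma momentum_graph: fixes c :: "'s option => real"
 defines "a \<equiv> %ps. \<Sum>\<mu>\<in>UNIV. c \<mu> * tot ps $ \<mu>" shows graph_closure_momentum: "graph_closure (fock m) (lin_comb c (mom_P m)) = mul_graph a"
  and momentum_dense: "u : cF ==> \<exists>s. (\<forall>n::nat. s n : Domain (mul_graph a)) \<and> (%n. hnorm (fock m) (s n - u)) ----> 0" and lin_comb_fock: "lin_comb c (mom_P m) <= cF \<times> cF" proof -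
 have fL: "u : cL" if "u : cF" for u :: "('s, complex) fk" using that fock_full by blast
 have tot_nth [measurable]: "(%ps. tot ps $ \<mu>) : bm LL" for \<mu> by (rule measurable_compose[OF measurable_total_momentum]) (auto intro!: borel_measurable_continuous_onI continuous_intros)
 have a [measurable]: "a : bm LL" unfolding a_def by measurable
 show lin_fock: "lin_comb c (mom_P m) <= cF \<times> cF" unfolding lin_comb_def mom_P_eq mul_graph_def by (auto intro!: csubspace_sum[OF hspace.carrier[OF hspace_fock]] hspace.scale[OF hspace_fock])
 have lin_sub: "w = mulop (%ps. cor (a ps)) u" if "(u, w) : lin_comb c (mom_P m)" for u w proof -
  obtain v where v: "w = (\<Sum>\<mu>\<in>UNIV. cor (c \<mu>) *c v \<mu>)" "!!\<mu>. (u, v \<mu>) : mom_P m \<mu>" using \<open>(u, w) : lin_comb c (mom_P m)\<close> by (auto simp: lin_comb_def)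
  have vm: "v \<mu> = mulop (%ps. cor (tot ps $ \<mu>)) u" "u : cF" for \<mu> using v(2)[of \<mu>] by (auto simp: mom_P_eq mul_graph_def)
  show ?thesis unfolding v(1) vm(1) mulop_sum[OF fL[OF vm(2)]] by (simp add: a_def)
 qed
 \<comment> \<open>The cutoff involves all components at once, so its product with any single
   component is bounded by \<open>n\<close>.\<close>
 define ct where "ct n ps = (if (\<forall>\<mu>. \<bar>tot ps $ \<mu>\<bar> <= real n) then 1 else 0 :: complex)" for n :: nat and ps
 have ct [measurable]: "ct n : bm LL" for n unfolding ct_def by measurable
 have ctb: "cmod (ct n ps) <= 1" for n ps by (simp add: ct_def)
 have cts: "symm (ct n)" for n unfolding ct_def by (rule symm_comp[OF symm_tot])
 have ct_lim: "(%n. ct n ps) ----> 1" for ps proof (rule tendsto_eventually)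
  obtain n where n: "Max (range (%\<mu>. \<bar>tot ps $ \<mu>\<bar>)) <= real n" using real_arch_simple by blast
  have "ct k ps = 1" if "k \<ge> n" for k proof -
   have "\<bar>tot ps $ \<mu>\<bar> <= real k" for \<mu> using n that by (auto intro: order_trans[of _ "real n"])
   then show ?thesis by (simp add: ct_def)
  qed
  then show "\<forall>\<^sub>F k in sequentially. ct k ps = 1" by (auto simp: eventually_sequentially)
 qed
 have in_lin: "(mulop (ct n) u, mulop (%ps. cor (a ps)) (mulop (ct n) u)) : lin_comb c (mom_P m)" if u: "u : cF" for u n proof -
  have cu: "mulop (ct n) u : cF" by (rule mulop_fock[OF ct ctb cts u])
  have "(mulop (ct n) u, mulop (%ps. cor (tot ps $ \<mu>)) (mulop (ct n) u)) : mom_P m \<mu>" for \<mu> proof -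
   have "mulop (%ps. cor (tot ps $ \<mu>)) (mulop (ct n) u) = mulop (%ps. cor (tot ps $ \<mu>) * ct n ps) u" by (rule mulop_mulop[OF ct ctb fL[OF u]])
   moreover have "... : cF" proof (rule mulop_fock[where C = "real n", OF _ _ _ u])
    show "symm (%ps. cor (tot ps $ \<mu>) * ct n ps)" unfolding ct_def by (rule symm_comp[OF symm_tot])
   qed (auto simp: ct_def norm_mult)
   ultimately show ?thesis using cu by (simp add: mom_P_eq mul_graph_def)
  qed
  moreover have eq: "mulop (%ps. cor (a ps)) (mulop (ct n) u) = (\<Sum>\<mu>\<in>UNIV. cor (c \<mu>) *c mulop (%ps. cor (tot ps $ \<mu>)) (mulop (ct n) u))" unfolding mulop_sum[OF fL[OF cu]] by (simp add: a_def)
  ultimately show ?thesis unfolding lin_comb_def by (intro CollectI exI[of _ "mulop (ct n) u"] exI[of _ "%\<mu>. mulop (%ps. cor (tot ps $ \<mu>)) (mulop (ct n) u)"] conjI) (simp_all only: simp_thms)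
 qed
 have limct: "(%n. nmL (mulop (ct n) u - u)) ----> 0" if u: "u : cF" for u proof -
  obtain f where f: "u = mk f" "sqint LL f" using u by (rule fockE) blast
  have [measurable]: "f : bm LL" by (rule vl.sqint_borel[OF f(2)])
  show ?thesis unfolding f(1) mulop_mk[OF f(2)] proof (rule vl.L2_dominated(3)[OF _ _ f(2)])
   show "cmod (ct n ps * f ps) <= cmod (f ps)" for n ps using mult_right_mono[OF ctb norm_ge_zero] by (simp add: norm_mult)
   show "AE ps in LL. (%n. ct n ps * f ps) ----> f ps" using tendsto_mult[OF ct_lim tendsto_const] by (intro AE_I2) simp
  qed measurable
 qed
 show "graph_closure (fock m) (lin_comb c (mom_P m)) = mul_graph a" proof (intro equalityI subrelI)
  fix u w assume "(u, w) : graph_closure (fock m) (lin_comb c (mom_P m))"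
  then obtain s where u: "u : cF" and w: "w : cF" and s: "!!n::nat. s n : lin_comb c (mom_P m)"
   "(%n. nmL (fst (s n) - u)) ----> 0" "(%n. nmL (snd (s n) - w)) ----> 0" by (auto simp: graph_closure_def)
  have sH: "fst (s n) : cF" "snd (s n) : cF" for n using s(1)[of n] lin_fock by auto
  have sa: "snd (s n) = mulop (%ps. cor (a ps)) (fst (s n))" for n using lin_sub[of "fst (s n)" "snd (s n)"] s(1)[of n] by simp
  show "(u, w) : mul_graph a" proof (rule mul_graphI_trunc[OF a u w])
   fix k :: nat
   let ?ct = "%ps. if \<bar>a ps\<bar> <= real k then 1 else 0 :: complex"
   let ?a = "%ps. if \<bar>a ps\<bar> <= real k then cor (a ps) else 0"
   have m: "?ct : bm LL" "?a : bm LL" by measurable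
   have b: "cmod (?ct ps) <= 1" "cmod (?a ps) <= real k" for ps by auto
   have eq: "mulop ?ct (snd (s n)) = mulop ?a (fst (s n))" for n proof -
    obtain f where f: "fst (s n) = mk f" "sqint LL f" using sH(1)[of n] by (rule fockE) blast
    obtain g where g: "snd (s n) = mk g" "sqint LL g" using sH(2)[of n] by (rule fockE) blast
    have "AE ps in LL. g ps = cor (a ps) * f ps" using sa[of n] unfolding f(1) g(1) mulop_mk[OF f(2)] vl.mk_eq_iff_M .
    then have "AE ps in LL. ?ct ps * g ps = ?a ps * f ps" by eventually_elim auto
    then show ?thesis unfolding f(1) g(1) mulop_mk[OF f(2)] mulop_mk[OF g(2)] vl.mk_eq_iff_M .
   qed
   have l1: "(%n. nmL (mulop ?ct (snd (s n)) - mulop ?ct w)) ----> 0" by (rule mulop_tendsto[OF m(1) b(1) fL[OF sH(2)] fL[OF w] s(3)])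
   have l2: "(%n. nmL (mulop ?ct (snd (s n)) - mulop ?a u)) ----> 0" unfolding eq by (rule mulop_tendsto[OF m(2) b(2) fL[OF sH(1)] fL[OF u] s(2)])
   show "mulop ?ct w = mulop ?a u" by (rule hspace.hlimit_unique[OF hspace_L2_LL _ _ _ _ l1 l2]) (auto intro: mulop_L2[OF m(1) b(1)] mulop_L2[OF m(2) b(2)] fL sH w u)
  qed
 next
  fix u w assume uw: "(u, w) : mul_graph a"
  then have u: "u : cF" and w: "w : cF" "w = mulop (%ps. cor (a ps)) u" by (auto simp: mul_graph_def)
  have "mulop (%ps. cor (a ps)) (mulop (ct n) u) = mulop (ct n) w" for n proof -
   obtain f where f: "u = mk f" "sqint LL f" using u by (rule fockE) blast
   obtain g where g: "w = mk g" "sqint LL g" using w(1) by (rule fockE) blast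
   have "AE ps in LL. g ps = cor (a ps) * f ps" using w(2) unfolding f(1) g(1) mulop_mk[OF f(2)] vl.mk_eq_iff_M .
   then have "AE ps in LL. cor (a ps) * ct n ps * f ps = ct n ps * g ps" by eventually_elim auto
   then show ?thesis unfolding mulop_mulop[OF ct ctb fL[OF u]] unfolding f(1) g(1) mulop_mk[OF f(2)] mulop_mk[OF g(2)] vl.mk_eq_iff_M .
  qed
  then show "(u, w) : graph_closure (fock m) (lin_comb c (mom_P m))" using u w(1) in_lin[OF u] limct[OF u] limct[OF w(1)]
   by (auto simp: graph_closure_def intro!: exI[of _ "%n. (mulop (ct n) u, mulop (%ps. cor (a ps)) (mulop (ct n) u))"])
 qed
 show "\<exists>s. (\<forall>n::nat. s n : Domain (mul_graph a)) \<and> (%n. hnorm (fock m) (s n - u)) ----> 0" if u: "u : cF" proof (intro exI conjI allI)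
  show "mulop (ct n) u : Domain (mul_graph a)" for n using in_lin[OF u, of n] lin_fock by (auto simp: mul_graph_def)
  show "(%n. hnorm (fock m) (mulop (ct n) u - u)) ----> 0" using limct[OF u] by simp
 qed
qed

lemma inv_op_facts: assumes V: "unitary_op H1 H1 V" shows inv_op_unitary: "unitary_op H1 H1 (inv_op m V)" and inv_op_left: "f : hcar H1 ==> inv_op m V (V f) = f" and inv_op_right: "f : hcar H1 ==> V (inv_op m V f) = f"
 using unitary_inv_into[OF H1.hspace_axioms V] unitary_opD(4)[OF V] unfolding inv_op_def by (auto simp: bij_betw_inv_into_left bij_betw_inv_into_right)

lemma Gam_inv: assumes V: "unitary_op H1 H1 V" and u: "u : cL" shows "Gam m (inv_op m V) (Gam m V u) = u" "Gam m V (Gam m (inv_op m V) u) = u"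
 using Gam_cancel[OF V inv_op_unitary[OF V] inv_op_left[OF V] u] Gam_cancel[OF inv_op_unitary[OF V] V inv_op_right[OF V] u] by auto

lemma unitary_Gam_fock: assumes V: "unitary_op H1 H1 V" shows "unitary_op (fock m) (fock m) (Gam m V)" proof -
 have fL: "u : cL" if "u : cF" for u :: "('s, complex) fk" using that fock_full by blast
 have "bij_betw (Gam m V) (cF) (cF)" by (rule bij_betw_byWitness[where f' = "Gam m (inv_op m V)"]) (use Gam_inv[OF V fL] Gam_fock[OF V] Gam_fock[OF inv_op_unitary[OF V]] in auto)
 moreover have "linear_on (cF) (Gam m V)" using Gam_linear[OF V] fL unfolding linear_on_def by blast
 ultimately show ?thesis unfolding unitary_op_def using Gam_hip[OF V fL fL] by auto
qed

lemma unitary_pair_Gam: assumes V: "unitary_op H1 H1 V" shows "unitary_pair (fock m) (Gam m V) (Gam m (inv_op m V))"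
 using Gam_inv[OF V subsetD[OF fock_full]] unitary_Gam_fock[OF V] unitary_Gam_fock[OF inv_op_unitary[OF V]] hspace_fock by (auto simp: unitary_pair_def unitary_pair_axioms_def)

text \<open>\<open>coord_X\<close> is the pullback of \<open>mom_P\<close> under
  \<open>Gam m V\<close>; linear combinations, graph closures and generators commute with this
  conjugation. The signs \<open>eta\<close> in the combination assemble into the Minkowski
  product.\<close>

lemma translation_eq: assumes V: "unitary_op H1 H1 V" shows "translation (fock m) (coord_X m V) x = (\<lambda>u\<in>cF. Gam m (inv_op m V) (mulop (%ps. exp (\<i> * cor (mink x (tot ps)))) (Gam m V u)))" proof -
 interpret W: unitary_pair "fock m" "Gam m V" "Gam m (inv_op m V)" by (rule unitary_pair_Gam[OF V])
 let ?c = "%\<mu>. eta \<mu> * x $ \<mu>"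
 let ?a = "%ps. \<Sum>\<mu>\<in>UNIV. ?c \<mu> * tot ps $ \<mu>"
 let ?U = "%t. mulop (%ps. exp (\<i> * cor (t * ?a ps)))"
 have tot_nth [measurable]: "(%ps. tot ps $ \<mu>) : bm LL" for \<mu> by (rule measurable_compose[OF measurable_total_momentum]) (auto intro!: borel_measurable_continuous_onI continuous_intros)
 have a: "?a : bm LL" by measurable
 have s: "symm ?a" by (rule symm_comp[OF symm_tot])
 have X: "coord_X m V \<mu> = conj_graph (fock m) (Gam m V) (mom_P m \<mu>)" for \<mu> unfolding coord_X_def conj_graph_def proof (intro equalityI subrelI)
  fix u w assume "(u, w) : {(\<Psi>, Gam m (inv_op m V) \<Phi>) |\<Psi> \<Phi>. \<Psi> : cF \<and> (Gam m V \<Psi>, \<Phi>) : mom_P m \<mu>}"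
  then obtain \<Phi> where P: "w = Gam m (inv_op m V) \<Phi>" "u : cF" "(Gam m V u, \<Phi>) : mom_P m \<mu>" by auto
  then have "\<Phi> : cF" by (auto simp: mom_P_def)
  with P show "(u, w) : {(u, w). u : cF \<and> w : cF \<and> (Gam m V u, Gam m V w) : mom_P m \<mu>}" by simp
 next
  fix u w assume "(u, w) : {(u, w). u : cF \<and> w : cF \<and> (Gam m V u, Gam m V w) : mom_P m \<mu>}"
  then have "u : cF" "w : cF" "(Gam m V u, Gam m V w) : mom_P m \<mu>" by auto
  then show "(u, w) : {(\<Psi>, Gam m (inv_op m V) \<Phi>) |\<Psi> \<Phi>. \<Psi> : cF \<and> (Gam m V \<Psi>, \<Phi>) : mom_P m \<mu>}" by (intro CollectI exI[of _ u] exI[of _ "Gam m V w"]) simp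
 qed
 have lin: "lin_comb ?c (coord_X m V) = conj_graph (fock m) (Gam m V) (lin_comb ?c (mom_P m))" proof (intro equalityI subrelI)
  fix u w assume "(u, w) : lin_comb ?c (coord_X m V)"
  then obtain v where v: "w = (\<Sum>\<mu>\<in>UNIV. cor (?c \<mu>) *c v \<mu>)" "!!\<mu>. (u, v \<mu>) : coord_X m V \<mu>" by (auto simp: lin_comb_def)
  have vm: "u : cF" "v \<mu> : cF" "(Gam m V u, Gam m V (v \<mu>)) : mom_P m \<mu>" for \<mu> using v(2)[of \<mu>] by (auto simp: X conj_graph_def)
  have "Gam m V w = (\<Sum>\<mu>\<in>UNIV. cor (?c \<mu>) *c Gam m V (v \<mu>))"
   unfolding v(1) by (subst linear_on_sum[OF W.carrier unitary_opD(1)[OF W.W], where f = "%\<mu>. cor (?c \<mu>) *c v \<mu>"]) (simp_all only: W.W_scale W.scale vm(2))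
  then have "(Gam m V u, Gam m V w) : lin_comb ?c (mom_P m)" unfolding lin_comb_def by (intro CollectI exI[of _ "Gam m V u"] exI[of _ "%\<mu>. Gam m V (v \<mu>)"] conjI) (simp_all add: vm(3))
  moreover have "w : cF" unfolding v(1) using vm(2) by (intro csubspace_sum W.carrier) auto
  ultimately show "(u, w) : conj_graph (fock m) (Gam m V) (lin_comb ?c (mom_P m))" using vm(1) by (simp add: conj_graph_def)
 next
  fix u w assume "(u, w) : conj_graph (fock m) (Gam m V) (lin_comb ?c (mom_P m))"
  then have uw: "u : cF" "w : cF" "(Gam m V u, Gam m V w) : lin_comb ?c (mom_P m)" by (auto simp: conj_graph_def)
  then obtain v where v: "Gam m V w = (\<Sum>\<mu>\<in>UNIV. cor (?c \<mu>) *c v \<mu>)" "!!\<mu>. (Gam m V u, v \<mu>) : mom_P m \<mu>" by (auto simp: lin_comb_def)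
  have vm: "v \<mu> : cF" for \<mu> using v(2)[of \<mu>] by (auto simp: mom_P_def)
  have "w = Gam m (inv_op m V) (Gam m V w)" using uw by simp
  also have "... = (\<Sum>\<mu>\<in>UNIV. cor (?c \<mu>) *c Gam m (inv_op m V) (v \<mu>))" unfolding v(1) by (subst linear_on_sum[OF W.carrier unitary_opD(1)[OF W.Wi], where f = "%\<mu>. cor (?c \<mu>) *c v \<mu>"])
    (simp_all only: linear_onD(2)[OF unitary_opD(1)[OF W.Wi]] W.scale vm)
  finally show "(u, w) : lin_comb ?c (coord_X m V)" unfolding lin_comb_def using uw vm v(2) by (auto simp: X conj_graph_def intro!: exI[of _ "%\<mu>. Gam m (inv_op m V) (v \<mu>)"])
 qed
 have A: "graph_closure (fock m) (lin_comb ?c (coord_X m V)) = conj_graph (fock m) (Gam m V) (mul_graph ?a)" unfolding lin W.graph_closure_conj[OF lin_comb_fock] graph_closure_momentum ..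
 have "exp_group (fock m) (conj_graph (fock m) (Gam m V) (mul_graph ?a)) (%t u. Gam m (inv_op m V) (?U t (Gam m V u)))"
  unfolding exp_group_def using W.unitary_group_conj[OF unitary_group_mulop[OF a s]] W.generator_conj[OF unitary_group_mulop[OF a s]] generator_mulop[OF a s] by simp
 note eg = this
 have "\<exists>s. (\<forall>n::nat. s n : Domain (conj_graph (fock m) (Gam m V) (mul_graph ?a))) \<and> (%n. hnorm (fock m) (s n - u)) ----> 0" if u: "u : cF" for u proof -
  obtain s where s: "!!n::nat. s n : Domain (mul_graph ?a)" "(%n. hnorm (fock m) (s n - Gam m V u)) ----> 0" using momentum_dense[of "Gam m V u" ?c] u by auto
  have sH: "s n : cF" for n using s(1)[of n] by (auto simp: mul_graph_def)
  have "Gam m (inv_op m V) (s n) : Domain (conj_graph (fock m) (Gam m V) (mul_graph ?a))" for n proof -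
   obtain w where "(s n, w) : mul_graph ?a" using s(1)[of n] by auto
   moreover from this have "w : cF" by (auto simp: mul_graph_def)
   ultimately have "(Gam m (inv_op m V) (s n), Gam m (inv_op m V) w) : conj_graph (fock m) (Gam m V) (mul_graph ?a)" using sH by (simp add: conj_graph_def)
   then show ?thesis by blast
  qed
  moreover have "(%n. hnorm (fock m) (Gam m (inv_op m V) (s n) - u)) ----> 0" unfolding W.hnorm_Wi_W_diff[OF sH u] by (rule s(2))
  ultimately show ?thesis by (intro exI[of _ "%n. Gam m (inv_op m V) (s n)"] conjI allI)
 qed
 then have "expi (fock m) (conj_graph (fock m) (Gam m V) (mul_graph ?a)) = restrict (%u. Gam m (inv_op m V) (?U 1 (Gam m V u))) (cF)" by (rule expi_eq[OF hspace_fock eg])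
 then show ?thesis unfolding translation_def A by (simp add: mink_eq_sum)
qed

end

section \<open>Oscillatory integrals\<close>

text \<open>Against the volume of a ball of radius \<open>k + 1\<close> this power leaves
  \<open>(k + 1)^-2\<close>, hence integrability. The same exponent is the number of integrations by
  parts in \<open>fourier_decay\<close>.\<close>

definition decay :: "'a::euclidean_space => real" where "decay x = 1 / (1 + norm x) ^ (DIM('a) + 2)"

lemma decay_pos: "0 < decay x" unfolding decay_def by (intro divide_pos_pos zero_less_power) (auto intro: add_pos_nonneg)

lemma decay_le_1: "decay x <= 1" unfolding decay_def inverse_eq_divide[symmetric] inverse_le_1_iff by (rule disjI2, rule one_le_power) simp

lemma borel_measurable_decay [measurable]: "decay : bm borel" unfolding decay_def[abs_def] by measurable

lemma decay_shift: assumes "norm h <= 1" shows "decay (x + h) <= 2 ^ (DIM('a) + 2) * decay (x::'a::euclidean_space)" proof -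
 have "1 + norm x <= 2 * (1 + norm (x + h))" using assms norm_diff_ineq[of x h] norm_ge_zero[of "x + h"] unfolding distrib_left by linarith
 then have "(1 + norm x) ^ (DIM('a) + 2) <= 2 ^ (DIM('a) + 2) * (1 + norm (x + h)) ^ (DIM('a) + 2)" unfolding power_mult_distrib[symmetric] by (intro power_mono) auto
 moreover have "0 < (1 + norm (x + h)) ^ (DIM('a) + 2)" "0 < (1 + norm x) ^ (DIM('a) + 2)" by (rule zero_less_power, rule add_pos_nonneg, simp, simp)+
 ultimately show ?thesis unfolding decay_def by (simp only: divide_simps mult_1 if_True) (simp add: mult.commute)
qed

lemma integrable_decay: "integrable lborel (decay :: 'a::euclidean_space => real)" proof (rule integrableI_bounded)
 have [measurable]: "cball (0::'a) r : sets borel" for r by simp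
 let ?n = "DIM('a)"
 let ?t = "%k x. indicator (cball 0 (real (Suc k))) (x::'a) * en (1 / real (Suc k) ^ (?n + 2))"
 have le: "en (norm (decay x)) <= (\<Sum>k. ?t k x)" for x :: 'a proof -
  define k where "k = nat \<lfloor>norm x\<rfloor>"
  have k: "real k <= norm x" "norm x <= real (Suc k)" unfolding k_def by (simp_all add: of_nat_floor) linarith
  have "decay x <= 1 / real (Suc k) ^ (?n + 2)" unfolding decay_def using k by (intro divide_left_mono power_mono) (auto intro!: mult_pos_pos add_pos_nonneg)
  then have "en (norm (decay x)) <= ?t k x" using k decay_pos[of x] by (simp add: ennreal_leI)
  also have "g k <= (\<Sum>k. g k)" for g :: "nat => en" using sum_le_suminf[of g "{k}"] by simp
  finally show ?thesis .
 qed
 have "(nni lborel (%x. en (norm (decay (x::'a))))) <= (nni lborel (%x. (\<Sum>k. ?t k x)))" by (intro nn_integral_mono le)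
 also have "... = (\<Sum>k. nni lborel (%x. ?t k x) )" by (intro nn_integral_suminf borel_measurable_times_ennreal borel_measurable_indicator borel_measurable_const) simp
 also have "... = (\<Sum>k. en (unit_ball_vol (real ?n) * (1 / real (Suc k) ^ 2)))" proof (rule arg_cong[where f = suminf], rule ext)
  fix k show "(nni lborel (%x. ?t k x)) = en (unit_ball_vol (real ?n) * (1 / real (Suc k) ^ 2))" proof -
  have "(nni lborel (%x. ?t k x)) = emeasure lborel (cball (0::'a) (real (Suc k))) * en (1 / real (Suc k) ^ (?n + 2))" by (simp add: nn_integral_multc)
  also have "... = en (unit_ball_vol (real ?n) * (real (Suc k) ^ ?n * (1 / real (Suc k) ^ (?n + 2))))" by (simp add: emeasure_cball ennreal_mult'[symmetric] mult.assoc del: of_nat_Suc)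
  also have "real (Suc k) ^ ?n * (1 / real (Suc k) ^ (?n + 2)) = 1 / real (Suc k) ^ 2" by (simp add: power_add power2_eq_square del: of_nat_Suc)
  finally show ?thesis .
 qed
 qed
 also have "... < \<infinity>" proof -
  have s: "summable (%k. 1 / real (Suc k) ^ 2)" using inverse_power_summable[of 2, where 'a = real] by (subst summable_Suc_iff) (simp add: inverse_eq_divide)
  show ?thesis unfolding infinity_ennreal_def less_top[symmetric] by (rule ennreal_suminf_neq_top[OF summable_mult[OF s]]) simp
 qed
 finally show "(nni lborel (%x. en (norm (decay (x::'a))))) < \<infinity>" .
qed measurable

lemma integrable_decay_bound: fixes f :: "'a::euclidean_space => complex" assumes "f : bm borel" "!!x. cmod (f x) <= C * decay x" shows "integrable lborel f" by (rule Bochner_Integration.integrable_bound[of _ "%x. C * decay x"])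
  (use assms in "auto intro: integrable_decay order_trans[OF _ abs_ge_self]")

lemma cmod_integral_decay: fixes f :: "'a::euclidean_space => complex" assumes "f : bm borel" "!!x. cmod (f x) <= C * decay x" shows "cmod (itg lborel (%x. f x)) <= C * (itg lborel (%x. decay (x::'a)))" proof -
 have "cmod (itg lborel (%x. f x)) <= (itg lborel (%x. cmod (f x)))" by (rule integral_norm_bound)
 also have "... <= (itg lborel (%x. C * decay (x::'a)))" by (rule integral_mono) (use integrable_decay_bound[OF assms] assms(2) in "auto intro: integrable_decay")
 finally show ?thesis by simp
qed

lemma lborel_integral_affine: fixes f :: "'a::euclidean_space => complex" assumes "f : bm borel" "c ~= 0" shows "(itg lborel (%x. f x)) = cor (\<bar>c\<bar> ^ DIM('a)) * (itg lborel (%x. f (t + c *\<^sub>R x)))" proof -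
 have "(itg lborel (%x. f x)) = (itg (density (distr lborel borel (%x. t + c *\<^sub>R x)) (%_. en (\<bar>c\<bar> ^ DIM('a)))) (%x. f x))" by (subst lborel_affine[OF assms(2), of t]) (simp add: ennreal_power)
 also have "... = (itg lborel (%x. \<bar>c\<bar> ^ DIM('a) *\<^sub>R f (t + c *\<^sub>R x)))" using assms(1) by (subst integral_density) (auto simp: integral_distr)
 finally show ?thesis by (simp add: scaleR_conv_of_real)
qed

text \<open>By translation invariance the difference quotients of \<open>u\<close> have integral
  zero. They converge to \<open>v\<close>, and the mean value inequality bounds them by a shifted
  \<open>decay\<close>, which for shifts of length at most \<open>1\<close> is comparable to
  \<open>decay\<close> itself.\<close>

lemma integral_deriv_zero: fixes u v :: "'a::euclidean_space => complex" assumes D: "!!x. (u has_derivative D x) (at x)" "!!x. D x b = v x" and b: "norm b = 1"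
  and u: "!!x. cmod (u x) <= C * decay x" and v: "!!x. cmod (v x) <= C * decay x" and vm: "v : bm borel" shows "(itg lborel (%x. v x)) = 0" proof -
 have "continuous_on UNIV u" using has_derivative_continuous[OF D(1)] by (simp add: continuous_on_eq_continuous_at)
 then have um [measurable]: "u : bm borel" by (rule borel_measurable_continuous_onI)
 have ui: "integrable lborel u" by (rule integrable_decay_bound[OF um u])
 have C: "0 <= C" using order_trans[OF norm_ge_zero u[of 0]] decay_pos[of "0::'a"] by (simp add: zero_le_mult_iff)
 define t where "t n = 1 / real (Suc n)" for n
 have t: "0 < t n" "t n <= 1" for n by (auto simp: t_def)
 have t0: "t ----> 0" unfolding t_def[abs_def] using LIMSEQ_inverse_real_of_nat by (simp add: inverse_eq_divide)
 define q where "q n x = (u (x + t n *\<^sub>R b) - u x) /\<^sub>R t n" for n x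
 have qm: "q n : bm lborel" for n unfolding q_def by measurable
 have q0: "(itg lborel (%x. q n x)) = 0" for n proof -
  have "(itg lborel (%x. u (t n *\<^sub>R b + 1 *\<^sub>R x))) = (itg lborel (%x. u x))" using lborel_integral_affine[OF um, of 1 "t n *\<^sub>R b"] by simp
  moreover have "integrable lborel (%x. u (x + t n *\<^sub>R b))" using order_trans[OF u mult_left_mono[OF decay_shift C]] t[of n] b
   by (intro integrable_decay_bound[of _ "C * 2 ^ (DIM('a) + 2)"]) (auto simp only: mult.assoc norm_scaleR mult_1_right abs_of_pos, measurable)
  ultimately show ?thesis unfolding q_def using ui by (simp add: add.commute)
 qed
 have qv: "(%n. q n x) ----> v x" for x proof -
  have "(%h. norm (u (x + h) - u x - D x h) / norm h) \<midarrow>0\<rightarrow> 0" using D(1)[of x] by (simp add: has_derivative_at)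
  moreover have "filterlim (%n. t n *\<^sub>R b) (at 0) sequentially" unfolding filterlim_at using b tendsto_scaleR[OF t0 tendsto_const, of b] t(1)[THEN less_imp_neq, THEN not_sym] by (auto intro!: always_eventually)
  ultimately have "(%n. norm (u (x + t n *\<^sub>R b) - u x - D x (t n *\<^sub>R b)) / norm (t n *\<^sub>R b)) ----> 0" by (rule filterlim_compose)
  moreover have "norm (u (x + t n *\<^sub>R b) - u x - D x (t n *\<^sub>R b)) / norm (t n *\<^sub>R b) = norm (q n x - v x)" for n proof -
   have "D x (t n *\<^sub>R b) = t n *\<^sub>R v x" by (simp add: linear_scale[OF has_derivative_linear[OF D(1)]] D(2))
   then have "q n x - v x = (u (x + t n *\<^sub>R b) - u x - D x (t n *\<^sub>R b)) /\<^sub>R t n" using t(1)[of n] by (simp add: q_def scaleR_diff_right)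
   then show ?thesis using t(1)[of n] b by (simp add: divide_inverse mult.commute)
  qed
  ultimately have "(%n. norm (q n x - v x)) ----> 0" by simp
  then show ?thesis by (rule LIM_zero_cancel[OF tendsto_norm_zero_cancel])
 qed
 have "(%n. itg lborel (%x. q n x) ) ----> (itg lborel (%x. v x))" proof (rule integral_dominated_convergence[where w = "%x. C * 2 ^ (DIM('a) + 2) * decay x"])
  fix n
  have "cmod (q n x) <= C * 2 ^ (DIM('a) + 2) * decay x" for x proof -
   let ?B = "C * 2 ^ (DIM('a) + 2) * decay x"
   let ?g = "%s. u (x + s *\<^sub>R b)"
   have "norm (?g (t n) - ?g 0) <= ?B * norm (t n - 0)" proof (rule differentiable_bound[where S = "{0..1}" and f' = "%s r. r *\<^sub>R v (x + s *\<^sub>R b)"])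
    fix s :: real assume s: "s : {0..1}"
    have "(?g has_derivative (%r. D (x + s *\<^sub>R b) (r *\<^sub>R b))) (at s within {0..1})" by (rule has_derivative_compose[OF _ D(1)]) (auto intro!: derivative_eq_intros)
    moreover have "D (x + s *\<^sub>R b) (r *\<^sub>R b) = r *\<^sub>R v (x + s *\<^sub>R b)" for r by (simp add: linear_scale[OF has_derivative_linear[OF D(1)]] D(2))
    ultimately show "(?g has_derivative (%r. r *\<^sub>R v (x + s *\<^sub>R b))) (at s within {0..1})" by simp
    have "cmod (v (x + s *\<^sub>R b)) <= ?B" using order_trans[OF v mult_left_mono[OF decay_shift C], of "s *\<^sub>R b"] s b by (simp only: mult.assoc) simp
    then show "onorm (%r. r *\<^sub>R v (x + s *\<^sub>R b)) <= ?B" by (intro onorm_le) (auto simp: mult.commute mult_left_mono)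
   qed (use t[of n] in auto)
   then show ?thesis using t(1)[of n] by (simp add: q_def divide_simps)
  qed
  then show "AE x in lborel. cmod (q n x) <= C * 2 ^ (DIM('a) + 2) * decay x" by simp
 qed (use vm qm qv in "auto intro: integrable_decay")
 then show ?thesis unfolding q0 by (simp add: LIMSEQ_const_iff)
qed

text \<open>Integration by parts: \<open>integral_deriv_zero\<close> applied to the product of
  \<open>g\<close> with the character.\<close>

lemma fourier_deriv: fixes g g' :: "'a::euclidean_space => complex" assumes G: "!!x. (g has_derivative G x) (at x)" "!!x. G x b = g' x" and b: "norm b = 1"
  and g: "!!x. cmod (g x) <= C * decay x" and g': "!!x. cmod (g' x) <= C' * decay x" and g'm [measurable]: "g' : bm borel" shows "(itg lborel (%x. exp (\<i> * cor (x \<bullet> k)) * g' x)) =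
  - (\<i> * cor (b \<bullet> k)) * (itg lborel (%x. exp (\<i> * cor (x \<bullet> k)) * g x))" proof -
 let ?e = "%x. exp (\<i> * cor (x \<bullet> k))"
 have e1: "cmod (?e x) = 1" for x by (simp add: norm_exp_i_times)
 have "continuous_on UNIV g" using has_derivative_continuous[OF G(1)] by (simp add: continuous_on_eq_continuous_at)
 then have gm [measurable]: "g : bm borel" by (rule borel_measurable_continuous_onI)
 let ?v = "%x. ?e x * g' x + \<i> * cor (b \<bullet> k) * (?e x * g x)"
 have pos: "0 <= c" if "!!x. cmod (h x) <= c * decay x" for c and h :: "'a => complex" using order_trans[OF norm_ge_zero that[of 0]] decay_pos[of "0::'a"] by (simp add: zero_le_mult_iff)
 have "(itg lborel (%x. ?v x)) = 0" proof (rule integral_deriv_zero[where u = "%x. ?e x * g x" and C = "C' + (1 + \<bar>b \<bullet> k\<bar>) * C" and b = b])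
  have "(?e has_derivative (%h. \<i> * cor (h \<bullet> k) * ?e x)) (at x)" for x proof -
   have "((%x. \<i> * cor (x \<bullet> k)) has_derivative (%h. \<i> * cor (h \<bullet> k))) (at x)" by (auto intro!: derivative_eq_intros)
   from has_derivative_compose[OF this DERIV_exp[unfolded has_field_derivative_def]] show ?thesis by (simp add: mult.commute)
  qed
  then show "((%x. ?e x * g x) has_derivative (%h. ?e x * G x h + (\<i> * cor (h \<bullet> k) * ?e x) * g x)) (at x)" for x by (intro has_derivative_mult G(1))
  show "cmod (?e x * g x) <= (C' + (1 + \<bar>b \<bullet> k\<bar>) * C) * decay x" for x
   using g[of x] mult_nonneg_nonneg[OF mult_nonneg_nonneg[OF pos[OF g] less_imp_le[OF decay_pos[of x]]] abs_ge_zero[of "b \<bullet> k"]] mult_nonneg_nonneg[OF pos[OF g'] less_imp_le[OF decay_pos[of x]]]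
   by (simp add: norm_mult e1 algebra_simps)
  have v: "cmod (?v x) <= C' * decay x + \<bar>b \<bullet> k\<bar> * (C * decay x)" for x by (rule order_trans[OF norm_triangle_ineq]) (use g[of x] g'[of x] in "auto simp: norm_mult e1 intro!: add_mono mult_left_mono")
  have n: "0 <= C * decay x" for x using pos[OF g] decay_pos[of x] by simp
  show "cmod (?v x) <= (C' + (1 + \<bar>b \<bullet> k\<bar>) * C) * decay x" for x by (rule order_trans[OF v]) (use n[of x] in "simp add: algebra_simps")
 qed (auto simp: G(2) b mult_ac)
 moreover have "integrable lborel (%x. ?e x * g' x)" by (rule integrable_decay_bound[where C = C']) (auto simp: norm_mult e1 g')
 moreover have "integrable lborel (%x. ?e x * g x)" by (rule integrable_decay_bound[where C = C]) (auto simp: norm_mult e1 g)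
 ultimately show ?thesis by (simp add: eq_neg_iff_add_eq_0)
qed

text \<open>Integrate by parts \<open>N\<close> times along the coordinate in which \<open>k\<close>
  is largest. The constant is explicit in the bounds \<open>C\<close>, hence uniform when
  \<open>D\<close> depends on a parameter, as in \<open>schwartz_slices\<close>.\<close>

lemma fourier_decay: fixes D :: "'a::euclidean_space list => 'a => complex" assumes D: "!!bs x. set bs <= Basis ==> (D bs has_derivative (%h. \<Sum>b\<in>Basis. (h \<bullet> b) *\<^sub>R D (b # bs) x)) (at x)"
  and C: "!!bs x. set bs <= Basis ==> cmod (D bs x) <= C bs * decay x"
 defines "A \<equiv> (itg lborel (%x. decay (x::'a)))" and "N \<equiv> DIM('a) + 2" shows "cmod (itg lborel (%x. exp (\<i> * cor (x \<bullet> k)) * D [] x)) <=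
  real (DIM('a) + 1) ^ N * ((C [] + (\<Sum>b\<in>Basis. C (replicate N b))) * A) * decay k" proof -
 let ?e = "%x. exp (\<i> * cor (x \<bullet> k))"
 let ?I = "%bs. \<integral>x. ?e x * D bs x \<partial>lborel"
 have Dm [measurable]: "D bs : bm borel" if "set bs <= Basis" for bs using has_derivative_continuous[OF D[OF that]] by (intro borel_measurable_continuous_onI) (simp add: continuous_on_eq_continuous_at)
 have I_le: "cmod (?I bs) <= C bs * A" if "set bs <= Basis" for bs unfolding A_def using C[OF that] Dm[OF that] by (intro cmod_integral_decay) (auto simp: norm_mult norm_exp_i_times)
 have rep: "cmod (?I (replicate n b)) = \<bar>k \<bullet> b\<bar> ^ n * cmod (?I [])" if b: "b : Basis" for b n proof (induction n)
  case (Suc n)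
  have s: "set (replicate n b) <= Basis" "set (b # replicate n b) <= Basis" using b by auto
  have "?I (b # replicate n b) = - (\<i> * cor (b \<bullet> k)) * ?I (replicate n b)" by (rule fourier_deriv[OF D[OF s(1)] _ _ C[OF s(1)] C[OF s(2)] Dm[OF s(2)]])
    (use b in "auto simp: inner_Basis if_distrib if_distribR sum.delta cong: if_cong")
  then show ?case by (simp add: norm_mult Suc.IH inner_commute)
 qed simp
 \<comment> \<open>Including \<open>1\<close> covers small \<open>k\<close>, where the integral is
   estimated directly; in all cases \<open>1 + norm k\<close> is at most \<open>DIM('a) + 1\<close>
   times \<open>M\<close>.\<close>
 define M where "M = Max (insert 1 ((%b. \<bar>k \<bullet> b\<bar>) ` Basis))"
 have M1: "1 <= M" and Mb: "!!b. b : Basis ==> \<bar>k \<bullet> b\<bar> <= M" unfolding M_def by (rule Max_ge; auto)+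
 have "M : insert 1 ((%b. \<bar>k \<bullet> b\<bar>) ` Basis)" unfolding M_def by (rule Max_in) auto
 then have a: "M ^ N * cmod (?I []) <= (C [] + (\<Sum>b\<in>Basis. C (replicate N b))) * A" proof
  have nn: "0 <= C bs * A" if "set bs <= Basis" for bs using order_trans[OF norm_ge_zero I_le[OF that]] .
  assume "M = 1"
  moreover have "0 <= C (replicate N b) * A" if "b : Basis" for b by (rule nn) (use that in auto)
  ultimately show ?thesis using I_le[of "[]"] by (auto simp: distrib_right sum_distrib_right intro!: add_increasing2 sum_nonneg)
 next
  have nn: "0 <= C bs * A" if "set bs <= Basis" for bs using order_trans[OF norm_ge_zero I_le[OF that]] .
  assume "M : (%b. \<bar>k \<bullet> b\<bar>) ` Basis"
  then obtain b where b: "b : Basis" "M = \<bar>k \<bullet> b\<bar>" by auto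
  have "set (replicate N b) <= Basis" using b(1) by (auto simp: set_replicate_conv_if)
  then have "M ^ N * cmod (?I []) <= C (replicate N b) * A" using I_le[of "replicate N b"] rep[OF b(1), of N] b by simp
  also have "... <= (\<Sum>b\<in>Basis. C (replicate N b) * A)" by (rule member_le_sum) (use b in "auto intro!: nn")
  finally show ?thesis using nn[of "[]"] by (simp add: distrib_right sum_distrib_right)
 qed
 have b: "(1 + norm k) ^ N <= real (DIM('a) + 1) ^ N * M ^ N" proof -
  have "1 + norm k <= M + (\<Sum>b\<in>Basis. \<bar>k \<bullet> b\<bar>)" using M1 norm_le_l1[of k] by simp
  also have "... <= real (DIM('a) + 1) * M" using sum_bounded_above[of Basis "%b. \<bar>k \<bullet> b\<bar>" M] Mb by (simp add: algebra_simps)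
  finally show ?thesis unfolding power_mult_distrib[symmetric] by (intro power_mono) auto
 qed
 have "(1 + norm k) ^ N * cmod (?I []) <= real (DIM('a) + 1) ^ N * ((C [] + (\<Sum>b\<in>Basis. C (replicate N b))) * A)"
  using order_trans[OF mult_right_mono[OF b norm_ge_zero[of "?I []"], unfolded mult.assoc] mult_left_mono[OF a]] by simp
 moreover have "0 < (1 + norm k) ^ N" by (intro zero_less_power add_pos_nonneg) auto
 ultimately show ?thesis unfolding decay_def N_def[symmetric] by (simp add: pos_le_divide_eq mult.commute)
qed

subsection \<open>Fourier inversion at the origin\<close>

text \<open>As a product of normal densities its Fourier transform follows from the characteristic
  function of the standard normal distribution; \<open>gauss_eq\<close> shows that it depends only
  on the norm.\<close>

definition gauss :: "'a::euclidean_space => real" where "gauss k = (\<Prod>b\<in>Basis. std_normal_density (k \<bullet> b))"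

lemma borel_measurable_gauss [measurable]: "gauss : bm borel" unfolding gauss_def[abs_def] by measurable

lemma gauss_eq: "gauss (k::'a::euclidean_space) = (1 / sqrt (2 * pi)) ^ DIM('a) * exp (- (norm k)\<^sup>2 / 2)" proof -
 have "gauss k = (\<Prod>b\<in>(Basis::'a set). 1 / sqrt (2 * pi)) * (\<Prod>b\<in>Basis. exp (- (k \<bullet> b)\<^sup>2 / 2))" unfolding gauss_def std_normal_density_def by (rule prod.distrib)
 also have "(\<Prod>b\<in>Basis. exp (- (k \<bullet> b)\<^sup>2 / 2)) = exp (\<Sum>b\<in>Basis. - (k \<bullet> b)\<^sup>2 / 2)" by (simp add: exp_sum)
 also have "(\<Sum>b\<in>Basis. - (k \<bullet> b)\<^sup>2 / 2) = - (norm k)\<^sup>2 / 2" unfolding norm_eq_sqrt_inner euclidean_inner[of k k] by (simp add: sum_nonneg sum_divide_distrib sum_negf power2_eq_square)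
 finally show ?thesis by simp
qed

lemma gauss_fourier: fixes x :: "'a::euclidean_space" shows "integrable lborel (%k. cor (gauss k) * exp (\<i> * cor (k \<bullet> x)))" (is ?int)
  and "(itg lborel (%k. cor (gauss k) * exp (\<i> * cor (k \<bullet> x)))) = cor (sqrt (2 * pi) ^ DIM('a) * gauss x)" proof -
 interpret product_sigma_finite "%_::'a. lborel :: real measure" by standard
 let ?f = "%b t. cor (std_normal_density t) * exp (\<i> * cor (t * (b \<bullet> x)))"
 have int1: "integrable lborel (?f b)" for b by (rule Bochner_Integration.integrable_bound[of _ std_normal_density]) (auto simp: norm_mult norm_exp_i_times intro: integrable_normal_density)
 have I1: "(itg lborel (%t. ?f b t)) = cor (exp (- (b \<bullet> x)\<^sup>2 / 2))" for b proof -
  have "cor (exp (- (b \<bullet> x)\<^sup>2 / 2)) = char std_normal_distribution (b \<bullet> x)" by (simp add: char_std_normal_distribution)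
  also have "... = (itg lborel (%t. ?f b t))" unfolding char_def by (subst integral_density) (auto simp: scaleR_conv_of_real mult.commute normal_density_nonneg)
  finally show ?thesis ..
 qed
 have prod: "cor (gauss k) * exp (\<i> * cor (k \<bullet> x)) = (\<Prod>b\<in>Basis. ?f b (k \<bullet> b))" for k
  unfolding gauss_def euclidean_inner[of k x] by (simp add: prod.distrib exp_sum[symmetric] sum_distrib_left inner_commute)
 have "lborel = distr (\<Pi>\<^sub>M b\<in>Basis. lborel) borel (%f. \<Sum>b\<in>Basis. f b *\<^sub>R (b::'a))" by (subst lborel_def) (simp add: lborel_eq_real)
 note l = this
 have A: "integrable (\<Pi>\<^sub>M b\<in>Basis. lborel) (%y. \<Prod>b\<in>(Basis::'a set). ?f b (y b))" by (rule product_integrable_prod, simp, rule int1)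
 have B: "(itg (\<Pi>\<^sub>M b\<in>Basis. lborel) (%y. (\<Prod>b\<in>(Basis::'a set). ?f b (y b)))) = (\<Prod>b\<in>Basis. integral\<^sup>L lborel (?f b))" by (rule product_integral_prod, simp, rule int1)
 have m: "(%k. \<Prod>b\<in>(Basis::'a set). ?f b (k \<bullet> b)) : bm borel" by measurable
 have bm: "(%f. \<Sum>b\<in>Basis. f b *\<^sub>R (b::'a)) : measurable (\<Pi>\<^sub>M b\<in>Basis. lborel) borel" by measurable
 have pe: "(\<Prod>b\<in>Basis. ?f b ((\<Sum>c\<in>Basis. y c *\<^sub>R (c::'a)) \<bullet> b)) = (\<Prod>b\<in>Basis. ?f b (y b))" for y
  by (rule prod.cong) (simp_all add: inner_sum_left inner_Basis if_distrib sum.delta cong: if_cong)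
 show ?int unfolding prod by (subst l, subst integrable_distr_eq[OF bm m]) (simp only: pe A)
 have "(\<Prod>b\<in>Basis. cor (exp (- (b \<bullet> x)\<^sup>2 / 2))) = cor (sqrt (2 * pi) ^ DIM('a) * gauss x)" by (simp add: gauss_def std_normal_density_def prod_dividef inner_commute power_divide flip: of_real_prod)
 then show "(itg lborel (%k. cor (gauss k) * exp (\<i> * cor (k \<bullet> x)))) = cor (sqrt (2 * pi) ^ DIM('a) * gauss x)" unfolding prod by (subst l, subst integral_distr[OF bm m]) (simp only: pe B I1)
qed

text \<open>A factor \<open>gauss (t k)\<close> makes the double integral absolutely convergent, and
  exchanging the integrals turns it into an average of \<open>g\<close> concentrating at
  \<open>0\<close>. The map \<open>J\<close> carries the signs of the Minkowski product; it drops
  out because the transformed Gaussian depends only on the norm.\<close>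

lemma fourier_inversion_0: fixes g F :: "'a::euclidean_space => complex" and J :: "'a => 'a" assumes g: "continuous_on UNIV g" "!!x. cmod (g x) <= C * decay x"
  and F: "!!k. cmod (F k) <= C' * decay k" "!!k. F k = (itg lborel (%x. exp (\<i> * cor (k \<bullet> J x)) * g x))" and J: "continuous_on UNIV J" "!!x. norm (J x) = norm x"
 shows "(itg lborel (%k. F k)) = cor ((2 * pi) ^ DIM('a)) * g 0" proof -
 let ?n = "DIM('a)"
 let ?s = "sqrt (2 * pi) ^ ?n"
 have [measurable]: "g : bm borel" "J : bm borel" using g J by (auto intro: borel_measurable_continuous_onI)
 have Fm [measurable]: "F : bm borel" unfolding F(2)[abs_def] by measurable
 have Gi: "integrable lborel (%k. cor (gauss (k::'a)))" and G1: "(itg lborel (%k. cor (gauss (k::'a)))) = 1" using gauss_fourier[of "0::'a"] by (auto simp: gauss_eq power_divide)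
 have gl: "0 <= gauss k" "gauss k <= (1 / sqrt (2 * pi)) ^ ?n" for k :: 'a unfolding gauss_eq by (auto intro!: mult_left_le)
 have gi: "integrable lborel g" by (rule integrable_decay_bound[OF _ g(2)]) measurable
 define t where "t n = 1 / real (Suc n)" for n
 have t: "0 < t n" "t n ~= 0" for n by (auto simp: t_def)
 have t0: "t ----> 0" unfolding t_def[abs_def] using LIMSEQ_inverse_real_of_nat by (simp add: inverse_eq_divide)
 have gc: "isCont g x" for x using g(1) by (simp add: continuous_on_eq_continuous_at)
 have gaussc: "isCont gauss x" for x :: 'a unfolding gauss_eq[abs_def] by (intro continuous_intros) auto
 \<comment> \<open>Fubini, the Fourier transform of the Gaussian, and the rescaling of
   \<open>x\<close> by \<open>t n\<close>; the powers of \<open>t n\<close> cancel.\<close>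
 have eq: "(itg lborel (%k. cor (gauss (t n *\<^sub>R k)) * F k)) = cor ?s * (itg lborel (%x. cor (gauss x) * g (t n *\<^sub>R x)))" for n proof -
  have il: "inverse (cor (t n)) * (cor (t n) * z) = z" for z using t(2)[of n] by simp
  let ?h = "%k x. cor (gauss (t n *\<^sub>R k)) * (exp (\<i> * cor (k \<bullet> J x)) * g x)"
  have Gsc: "integrable lborel (%k::'a. cor (gauss (t n *\<^sub>R k)))" proof -
   have "integrable (density (distr lborel borel (%x::'a. 0 + t n *\<^sub>R x)) (%_. en (\<bar>t n\<bar> ^ ?n))) (%k. cor (gauss k))" using Gi by (subst (asm) lborel_affine[OF t(2), of 0]) (simp add: ennreal_power)
   then have "integrable lborel (%k::'a. t n ^ ?n *\<^sub>R cor (gauss (t n *\<^sub>R k)))" using t[of n] by (simp add: integrable_density integrable_distr_eq)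
   from integrable_scaleR_right[OF this, of "inverse (t n ^ ?n)"] show ?thesis using t[of n] by simp
  qed
  have hi: "integrable (lborel >< lborel) (%(k, x). ?h k x)" proof (rule lborel_pair.Fubini_integrable)
   have "integrable lborel (%k::'a. gauss (t n *\<^sub>R k) * (itg lborel (%x. cmod (g x))))" using integrable_norm[OF Gsc] gl by (simp add: abs_of_nonneg)
   then show "integrable lborel (%k. itg lborel (%x. cmod (case (k, x) of (k, x) => ?h k x)) )" using gl by (simp add: norm_mult norm_exp_i_times abs_of_nonneg)
   have "integrable lborel (%x. exp (\<i> * cor (k \<bullet> J x)) * g x)" for k by (rule integrable_decay_bound[where C = C]) (use g(2) in "auto simp: norm_mult norm_exp_i_times")
   then show "AE k in lborel. integrable lborel (%x. case (k, x) of (k, x) => ?h k x)" by simp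
  qed measurable
  have "(itg lborel (%k. cor (gauss (t n *\<^sub>R k)) * F k)) = (itg lborel (%k. (itg lborel (%x. ?h k x))))" by (simp add: F(2))
  also have "... = (itg lborel (%x. (itg lborel (%k. ?h k x))))" by (rule lborel_pair.Fubini_integral[OF hi, symmetric])
  also have "... = (itg lborel (%x. g x * (cor ?s * cor (gauss (inverse (t n) *\<^sub>R x)) * cor (inverse (t n) ^ ?n))))" proof (rule Bochner_Integration.integral_cong[OF refl])
   fix x :: 'a
   have "(itg lborel (%k. cor (gauss k) * exp (\<i> * cor (k \<bullet> (inverse (t n) *\<^sub>R J x))))) = cor (t n ^ ?n) * (itg lborel (%k. cor (gauss (t n *\<^sub>R k)) * exp (\<i> * cor (k \<bullet> J x))))"
    using t(1)[of n] by (subst lborel_integral_affine[where t = 0 and c = "t n"]) (auto simp: il)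
   moreover have "gauss (inverse (t n) *\<^sub>R J x) = gauss (inverse (t n) *\<^sub>R x)" by (simp add: gauss_eq J(2))
   ultimately have "(itg lborel (%k. cor (gauss (t n *\<^sub>R k)) * exp (\<i> * cor (k \<bullet> J x)))) = cor ?s * cor (gauss (inverse (t n) *\<^sub>R x)) * cor (inverse (t n) ^ ?n)"
    using t(1)[of n] unfolding gauss_fourier(2) by (simp add: field_simps power_inverse)
   moreover have "(itg lborel (%k. ?h k x)) = g x * (itg lborel (%k. cor (gauss (t n *\<^sub>R k)) * exp (\<i> * cor (k \<bullet> J x))))" by (subst integral_mult_right_zero[symmetric]) (simp add: mult_ac)
   ultimately show "(itg lborel (%k. ?h k x)) = g x * (cor ?s * cor (gauss (inverse (t n) *\<^sub>R x)) * cor (inverse (t n) ^ ?n))" by simp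
  qed
  also have "... = cor (t n ^ ?n) * (itg lborel (%x. g (t n *\<^sub>R x) * (cor ?s * cor (gauss x) * cor (inverse (t n) ^ ?n))))" using t(1)[of n] by (subst lborel_integral_affine[where t = 0 and c = "t n"]) auto
  also have "... = cor (t n ^ ?n) * (itg lborel (%x. cor (?s * inverse (t n) ^ ?n) * (cor (gauss x) * g (t n *\<^sub>R x))))" by (simp add: mult_ac)
  also have "... = cor (t n ^ ?n) * (cor (?s * inverse (t n) ^ ?n) * (itg lborel (%x. cor (gauss x) * g (t n *\<^sub>R x))))" by (simp only: integral_mult_right_zero)
  also have "cor (t n ^ ?n) * (cor (?s * inverse (t n) ^ ?n) * I) = cor ?s * I" for I using t(1)[of n] by (simp add: power_inverse field_simps)
  finally show ?thesis .
 qed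
 have "(%n. itg lborel (%k. cor (gauss (t n *\<^sub>R k)) * F k) ) ----> (itg lborel (%k. cor (gauss (0::'a)) * F k))" proof (rule integral_dominated_convergence[where w = "%k. (1 / sqrt (2 * pi)) ^ ?n * (C' * decay k)"])
  have "(%n. gauss (t n *\<^sub>R k)) ----> gauss (0::'a)" for k :: 'a by (rule isCont_tendsto_compose[OF gaussc]) (use tendsto_scaleR[OF t0 tendsto_const, of k] in simp)
  then show "AE k in lborel. (%n. cor (gauss (t n *\<^sub>R k)) * F k) ----> cor (gauss (0::'a)) * F k" by (intro AE_I2 tendsto_mult tendsto_of_real tendsto_const)
  show "AE k in lborel. cmod (cor (gauss (t n *\<^sub>R k)) * F k) <= (1 / sqrt (2 * pi)) ^ ?n * (C' * decay k)" for n using gl F(1) by (intro AE_I2) (auto simp: norm_mult abs_of_nonneg simp del: power_divide intro!: mult_mono)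
 qed (auto intro: integrable_decay)
 moreover have "(%n. itg lborel (%x. cor (gauss x) * g (t n *\<^sub>R x)) ) ----> (itg lborel (%x. cor (gauss (x::'a)) * g 0))" proof (rule integral_dominated_convergence[where w = "%x. gauss x * C"])
  have "(%n. g (t n *\<^sub>R x)) ----> g 0" for x by (rule isCont_tendsto_compose[OF gc]) (use tendsto_scaleR[OF t0 tendsto_const, of x] in simp)
  then show "AE x in lborel. (%n. cor (gauss x) * g (t n *\<^sub>R x)) ----> cor (gauss x) * g 0" by (intro AE_I2 tendsto_mult tendsto_const)
  have "0 <= C" using order_trans[OF norm_ge_zero g(2)[of 0]] decay_pos[of "0::'a"] by (simp add: zero_le_mult_iff)
  then have "cmod (g x) <= C" for x using order_trans[OF g(2) mult_left_le[OF decay_le_1]] by blast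
  then show "AE x in lborel. cmod (cor (gauss x) * g (t n *\<^sub>R x)) <= gauss x * C" for n using gl by (intro AE_I2) (auto simp: norm_mult abs_of_nonneg intro!: mult_left_mono)
  show "integrable lborel (%x::'a. gauss x * C)" using integrable_norm[OF Gi] gl by (simp add: abs_of_nonneg)
 qed measurable
 ultimately have "cor (gauss (0::'a)) * (itg lborel (%k. F k)) = cor ?s * g 0" unfolding eq using LIMSEQ_unique[OF _ tendsto_mult[OF tendsto_const]] G1 by (simp add: LIMSEQ_unique)
 \<comment> \<open>One factor \<open>?s\<close> comes from the Fourier transform of the Gaussian,
   the other from \<open>gauss 0\<close>, which is \<open>1 / ?s\<close>.\<close>
 moreover have "(2 * pi) ^ ?n = ?s * ?s" unfolding power_mult_distrib[symmetric] by simp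
 ultimately show ?thesis by (simp add: gauss_eq power_divide field_simps del: of_real_power)
qed

subsection \<open>Schwartz functions\<close>

lemma schwartz_cnj: assumes "schwartz f" shows "schwartz (%x. cnj (f x))" proof -
 obtain D where D: "D [] = f" "!!bs x. bs : lists Basis ==> (D bs has_derivative (%h. \<Sum>b\<in>Basis. (h \<bullet> b) *\<^sub>R D (b # bs) x)) (at x)"
  "!!bs N. bs : lists Basis ==> \<exists>C. \<forall>x. (1 + norm x) ^ N * norm (D bs x) <= C" using assms unfolding schwartz_def by blast
 show ?thesis unfolding schwartz_def proof (intro exI[of _ "%bs x. cnj (D bs x)"] conjI ballI allI)
  fix bs x assume "bs : lists (Basis :: 'a set)"
  from bounded_linear.has_derivative[OF bounded_linear_cnj D(2)[OF this]]
  show "((%x. cnj (D bs x)) has_derivative (%h. \<Sum>b\<in>Basis. (h \<bullet> b) *\<^sub>R cnj (D (b # bs) x))) (at x)" by simp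
 qed (use D in auto)
qed

lemma schwartzE: fixes f :: "'a::euclidean_space => complex" assumes "schwartz f" obtains D C where "D [] = f"
  "!!bs x. set bs <= Basis ==> (D bs has_derivative (%h. \<Sum>b\<in>Basis. (h \<bullet> b) *\<^sub>R D (b # bs) x)) (at x)"
  "!!bs x N. set bs <= Basis ==> cmod (D bs x) <= C bs N / (1 + norm x) ^ N" proof -
 obtain D where D: "D [] = f" "!!bs x. bs : lists Basis ==> (D bs has_derivative (%h. \<Sum>b\<in>Basis. (h \<bullet> b) *\<^sub>R D (b # bs) x)) (at x)"
  "!!bs N. bs : lists Basis ==> \<exists>C. \<forall>x. (1 + norm x) ^ N * norm (D bs x) <= C" using assms unfolding schwartz_def by blast
 then obtain C where C: "!!bs N x. bs : lists Basis ==> (1 + norm x) ^ N * norm (D bs x) <= C bs N" by metis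
 show thesis proof (rule that[of D C])
  fix bs :: "'a list" and N and x :: 'a assume "set bs <= Basis"
  then have "(1 + norm x) ^ N * norm (D bs x) <= C bs N" by (intro C) (auto simp: in_lists_conv_set)
  moreover have "0 < (1 + norm x) ^ N" by (intro zero_less_power add_pos_nonneg) auto
  ultimately show "cmod (D bs x) <= C bs N / (1 + norm x) ^ N" by (simp add: pos_le_divide_eq mult.commute)
 qed (rule D(1), rule D(2), auto simp: in_lists_conv_set)
qed

lemma schwartz_fourier: fixes f :: "'a::euclidean_space => complex" assumes "schwartz f" obtains C where "continuous_on UNIV f" "!!x. cmod (f x) <= C * decay x"
  "!!k. cmod (itg lborel (%x. exp (\<i> * cor (x \<bullet> k)) * f x)) <= C * decay k" proof -
 obtain D C where D: "D [] = f"
  "!!bs x. set bs <= Basis ==> (D bs has_derivative (%h. \<Sum>b\<in>Basis. (h \<bullet> b) *\<^sub>R D (b # bs) x)) (at x)"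
  "!!bs x N. set bs <= Basis ==> cmod (D bs x) <= C bs N / (1 + norm x) ^ N" using assms by (rule schwartzE) blast
 have d: "cmod (D bs x) <= C bs (DIM('a) + 2) * decay x" if "set bs <= Basis" for bs x using D(3)[OF that, of x "DIM('a) + 2"] by (simp add: decay_def)
 obtain E where E: "!!k. cmod (itg lborel (%x. exp (\<i> * cor (x \<bullet> k)) * D [] x)) <= E * decay k" using fourier_decay[OF D(2) d] by blast
 let ?M = "max E (C [] (DIM('a) + 2))"
 have m: "c * decay y <= ?M * decay y" if "c <= ?M" for c and y :: 'a using that decay_pos[of y] by (simp add: mult_right_mono)
 show thesis proof (rule that[of ?M])
  show "continuous_on UNIV f" using has_derivative_continuous[OF D(2)[of "[]"]] by (simp add: D(1) continuous_on_eq_continuous_at)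
 qed (use order_trans[OF d[of "[]"] m] order_trans[OF E m] in "auto simp: D(1)")
qed

text \<open>Only derivatives in the first variable are taken, and decay in \<open>(x, y)\<close>
  implies the same decay in \<open>x\<close>; the constants are therefore common to all
  \<open>y\<close>.\<close>

lemma schwartz_slices: fixes rh :: "'a::euclidean_space \<times> 'b::euclidean_space => complex" assumes "schwartz rh" obtains C where "!!x y. cmod (rh (x, y)) <= C * decay x"
  "!!y k. cmod (itg lborel (%x. exp (\<i> * cor (x \<bullet> k)) * rh (x, y))) <= C * decay k" proof -
 obtain D C where D: "D [] = rh"
  "!!bs x. set bs <= Basis ==> (D bs has_derivative (%h. \<Sum>b\<in>Basis. (h \<bullet> b) *\<^sub>R D (b # bs) x)) (at x)"
  "!!bs x N. set bs <= Basis ==> cmod (D bs x) <= C bs N / (1 + norm x) ^ N" using assms by (rule schwartzE) blast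
 let ?l = "map (%b::'a. (b, 0::'b))"
 let ?C = "%bs. C (?l bs) (DIM('a) + 2)"
 have l: "set (?l bs) <= Basis" if "set bs <= Basis" for bs using that by (auto simp: Basis_prod_def)
 have d: "cmod (D (?l bs) (x, y)) <= ?C bs * decay x" if "set bs <= Basis" for bs x y proof -
  have n: "norm x <= norm (x, y)" by (rule norm_fst_le)
  have pos: "0 < (1 + norm x) ^ (DIM('a) + 2)" by (intro zero_less_power add_pos_nonneg) auto
  have "0 <= ?C bs" using order_trans[OF norm_ge_zero D(3)[OF l[OF that], of 0]] by simp
  then have "?C bs / (1 + norm (x, y)) ^ (DIM('a) + 2) <= ?C bs / (1 + norm x) ^ (DIM('a) + 2)" by (intro divide_left_mono power_mono mult_pos_pos zero_less_power add_pos_nonneg) (use n in simp_all)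
  then show ?thesis using D(3)[OF l[OF that], of "(x, y)" "DIM('a) + 2"] by (simp add: decay_def)
 qed
 have der: "((%x. D (?l bs) (x, y)) has_derivative (%h. \<Sum>b\<in>Basis. (h \<bullet> b) *\<^sub>R D (?l (b # bs)) (x, y))) (at x)" if "set bs <= Basis" for bs x y proof -
  have "((%x. (x, y)) has_derivative (%h. (h, 0))) (at x)" by (intro has_derivative_Pair has_derivative_ident has_derivative_const)
  moreover have "(\<Sum>b\<in>Basis. ((h, 0 :: 'b) \<bullet> b) *\<^sub>R G b) = (\<Sum>b\<in>Basis. (h \<bullet> b) *\<^sub>R G (b, 0))" for h :: 'a and G :: "'a \<times> 'b => complex"
   unfolding Basis_prod_def by (subst sum.union_disjoint) (auto simp: sum.reindex inj_on_def)
  ultimately show ?thesis using has_derivative_compose[OF _ D(2)[OF l[OF that]], of "%x. (x, y)" "%h. (h, 0)" x UNIV] by simp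
 qed
 have "\<exists>E. \<forall>y k. cmod (itg lborel (%x. exp (\<i> * cor (x \<bullet> k)) * D (?l []) (x, y))) <= E * decay k" proof (intro exI allI)
  fix y k
  show "cmod (itg lborel (%x. exp (\<i> * cor (x \<bullet> k)) * D (?l []) (x, y))) <=
    real (DIM('a) + 1) ^ (DIM('a) + 2) * ((?C [] + (\<Sum>b\<in>Basis. ?C (replicate (DIM('a) + 2) b))) * (itg lborel (%x. decay (x::'a)))) * decay k" by (rule fourier_decay[where D = "%bs x. D (?l bs) (x, y)", OF der d])
 qed
 then obtain E where E: "!!y k. cmod (itg lborel (%x. exp (\<i> * cor (x \<bullet> k)) * D (?l []) (x, y))) <= E * decay k" by blast
 let ?M = "max E (?C [])"
 have m: "c * decay y <= ?M * decay y" if "c <= ?M" for c and y :: 'a using that decay_pos[of y] by (simp add: mult_right_mono)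
 show thesis by (rule that[of ?M]) (use order_trans[OF d[of "[]"] m] order_trans[OF E m] in "auto simp: D(1)")
qed

subsection \<open>Minkowski products\<close>

text \<open>Reversing the spatial components is an isometry that turns the Minkowski product into
  the Euclidean one, so the Euclidean Fourier estimates apply.\<close>

definition mrefl :: "'s::finite spacetime => 's spacetime" where "mrefl x = (\<chi> \<mu>. eta \<mu> * x $ \<mu>)"

lemma eta_sq: "eta \<mu> * eta \<mu> = 1" by (simp add: eta_def split: option.split)

lemma mink_refl: "mink x y = x \<bullet> mrefl y" "mink x y = mrefl x \<bullet> y" by (auto simp: mink_eq_sum inner_vec_def mrefl_def mult_ac intro!: sum.cong)

lemma norm_mrefl: "norm (mrefl x) = norm x" proof -
 have "mrefl x \<bullet> mrefl x = x \<bullet> x" by (simp add: inner_vec_def mrefl_def mult_ac eta_sq) (simp add: mult.assoc[symmetric] eta_sq)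
 then show ?thesis by (simp add: norm_eq_sqrt_inner)
qed

lemma continuous_mrefl: "continuous_on UNIV mrefl" unfolding mrefl_def by (intro continuous_intros)

lemma mink_commute: "mink x y = mink y x" by (simp add: mink_def mult.commute)

lemma mink_add_left: "mink (x + y) z = mink x z + mink y z" and mink_add_right: "mink z (x + y) = mink z x + mink z y" and mink_diff_left: "mink (x - y) z = mink x z - mink y z"
 and mink_diff_right: "mink z (x - y) = mink z x - mink z y" and mink_scale_left: "mink (c *\<^sub>R x) z = c * mink x z" and mink_scale_right: "mink z (c *\<^sub>R x) = c * mink z x"
 and mink_minus_left: "mink (- x) z = - mink x z" and mink_minus_right: "mink z (- x) = - mink z x" and mink_zero: "mink 0 z = 0" "mink z 0 = 0"
 by (simp_all add: mink_def algebra_simps sum.distrib sum_subtractf sum_distrib_left sum_negf)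

lemmas mink_simps = mink_add_left mink_add_right mink_diff_left mink_diff_right mink_scale_left mink_scale_right mink_minus_left mink_minus_right mink_zero

lemma continuous_on_mink [continuous_intros]:
 "continuous_on S f ==> continuous_on S g ==> continuous_on S (%x. mink (f x) (g x))" unfolding mink_eq_sum by (intro continuous_intros)

lemma borel_measurable_mink [measurable (raw)]:
 "f : bm M ==> g : bm M ==> (%x. mink (f x) (g x)) : bm M" by (rule borel_measurable_continuous_Pair) (auto intro!: continuous_intros)

lemma continuous_on_mult_vec [continuous_intros]:
 "continuous_on S f ==> continuous_on S (%x. (th :: real ^ 'a::finite ^ 'b::finite) *v f x)" by (rule continuous_on_compose2[OF linear_continuous_on[OF matrix_vector_mul_bounded_linear]]) auto

lemma borel_measurable_mult_vec [measurable (raw)]: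
 "f : bm M ==> (%x. (th :: real ^ 'a::finite ^ 'b::finite) *v f x) : bm M" by (rule measurable_compose[OF _ borel_measurable_continuous_onI]) (auto intro!: continuous_intros)

lemma skew_swap: "lorentz_skew th ==> mink (th *v x) y = - mink x (th *v y)" by (simp add: lorentz_skew_def)

subsection \<open>The regularised kernel\<close>

text \<open>
 \<open>osc_weight rh eps\<close> is the scalar part of the regularised integrand, and \<open>osc_phase th z p q\<close> the phase that
 the translations give to a creation operator of momentum \<open>p\<close> acting on total momentum \<open>q\<close>. \<close>

definition osc_weight :: "('s::finite spacetime \<times> 's spacetime => complex) => real => 's spacetime \<times> 's spacetime => complex" where "osc_weight rh eps z = cor (1 / (2 * pi) ^ CARD('s option)) *
  (exp (- \<i> * cor (mink (fst z) (snd z))) * rh (eps *\<^sub>R z))"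

definition osc_phase :: "real ^ ('s::finite option) ^ ('s option) => 's spacetime \<times> 's spacetime => 's spacetime => 's spacetime => complex"
 where "osc_phase th z p q = exp (\<i> * cor (mink (th *v fst z) p + mink (snd z) q))"

definition osc_kernel :: "real ^ ('s::finite option) ^ ('s option) => ('s spacetime \<times> 's spacetime => complex) => real => 's spacetime => 's spacetime => complex"
 where "osc_kernel th rh eps p q = (itg lborel (%z. osc_weight rh eps z * osc_phase th z p q))"

lemma cmod_osc_phase [simp]: "cmod (osc_phase th z p q) = 1" unfolding osc_phase_def by (rule norm_exp_i_times)

lemma borel_measurable_osc_phase [measurable (raw)]: assumes [measurable]: "f : bm M" "g : bm M" "h : bm M" shows "(%x. osc_phase th (f x) (g x) (h x)) : bm M" proof -
 have [measurable]: "(%x. fst (f x)) : bm M" "(%x. snd (f x)) : bm M" by (auto intro!: measurable_compose[OF assms(1)] borel_measurable_continuous_onI continuous_intros)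
 show ?thesis unfolding osc_phase_def by measurable
qed

text \<open>After integration over \<open>x\<close>, substituting \<open>y\<close> by
  \<open>eps *\<^sub>R k - th *v p\<close> turns the integrand into \<open>h\<close>. All dependence
  on \<open>eps\<close>, \<open>p\<close> and \<open>q\<close> then sits in a phase and in the
  second argument of \<open>F\<close>, neither of which affects the majorant
  \<open>C * decay k\<close>; the powers of \<open>eps\<close> from the two rescalings
  cancel.\<close>

lemma osc_facts: fixes rh :: "'s::finite spacetime \<times> 's spacetime => complex" assumes rh: "schwartz rh" shows integrable_osc_weight: "0 < eps ==> integrable lborel (osc_weight rh eps)"
  and borel_measurable_osc_kernel: "(%z. osc_kernel th rh eps (fst z) (snd z)) : bm borel" and osc_kernel_bound: "lorentz_skew th ==> \<exists>C. \<forall>eps>0. \<forall>p q. cmod (osc_kernel th rh eps p q) <= C"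
  and osc_kernel_tendsto: "lorentz_skew th ==> rh (0, 0) = 1 ==> (!!n. 0 < S n) ==> S ----> 0 ==> (%n. osc_kernel th rh (S n) p q) ----> exp (\<i> * cor (mink p (th *v q)))" proof -
 let ?d = "DIM('s spacetime)"
 let ?c = "cor (1 / (2 * pi) ^ CARD('s option))"
 obtain C0 where rhc: "continuous_on UNIV rh" and rhd: "!!x. cmod (rh x) <= C0 * decay x" by (rule schwartz_fourier[OF rh]) blast
 obtain C where C: "!!x y. cmod (rh (x, y)) <= C * decay x"
  "!!y k. cmod (itg lborel (%x. exp (\<i> * cor (x \<bullet> k)) * rh (x, y))) <= C * decay k" by (rule schwartz_slices[OF rh]) blast
 have rhm [measurable]: "rh : bm borel" by (rule borel_measurable_continuous_onI[OF rhc])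
 have wm [measurable]: "osc_weight rh eps : bm borel" for eps proof -
  have [measurable]: "fst : bm borel" "snd : bm (borel :: ('s spacetime \<times> 's spacetime) measure)" by (auto intro!: borel_measurable_continuous_onI continuous_intros)
  show ?thesis unfolding osc_weight_def[abs_def] by measurable
 qed
 show wi: "integrable lborel (osc_weight rh eps)" if "0 < eps" for eps proof -
  have "integrable lborel rh" by (rule integrable_decay_bound[OF rhm rhd])
  define e where "e = eps ^ DIM('s spacetime \<times> 's spacetime)"
  have e: "0 < e" unfolding e_def using that by (rule zero_less_power)
  have "integrable lborel (%z. e *\<^sub>R rh (eps *\<^sub>R z))" using \<open>integrable lborel rh\<close> that by (subst (asm) lborel_affine[of eps 0]) (auto simp: integrable_density integrable_distr_eq e_def)
  from integrable_scaleR_right[OF this, of "inverse e"]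
  have "integrable lborel (%z. rh (eps *\<^sub>R z))" using e by simp
  moreover have "cmod (exp (- \<i> * cor t)) = 1" for t using norm_exp_i_times[of "- t"] by simp
  moreover have "(%z. exp (- \<i> * cor (mink (fst z) (snd z))) * rh (eps *\<^sub>R z)) : bm (borel :: ('s spacetime \<times> 's spacetime) measure)" unfolding borel_prod[symmetric] by measurable (auto simp: borel_prod)
  ultimately have "integrable lborel (%z. exp (- \<i> * cor (mink (fst z) (snd z))) * rh (eps *\<^sub>R z))" by (elim Bochner_Integration.integrable_bound) (auto simp: norm_mult)
  then show ?thesis unfolding osc_weight_def[abs_def] by (rule integrable_mult_right)
 qed
 have "(%x. itg lborel (%z. (case x of (p, q) => osc_weight rh eps z * osc_phase th z p q)) ) : bm (borel >< borel)" for eps by (rule lborel.borel_measurable_lebesgue_integral) measurable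
 then show "(%z. osc_kernel th rh eps (fst z) (snd z)) : bm borel" by (simp add: osc_kernel_def split_beta borel_prod)
 \<comment> \<open>Fourier transform of \<open>rh\<close> in its first variable with respect to the
   Minkowski product, which \<open>mrefl\<close> reduces to the Euclidean one.\<close>
 define F where "F k y = (itg lborel (%x. exp (\<i> * cor (- mink x k)) * rh (x, y)))" for k y
 have F_le: "cmod (F k y) <= C * decay k" for k y proof -
  have "F k y = (itg lborel (%x. exp (\<i> * cor (x \<bullet> (- mrefl k))) * rh (x, y)))" by (simp add: F_def mink_refl(1))
  then show ?thesis using C(2)[of "- mrefl k" y] by (simp add: decay_def norm_mrefl)
 qed
 have "(%x. itg lborel (%z. (case x of (k, y) => exp (\<i> * cor (- mink z k)) * rh (z, y))) ) : bm (borel >< borel)" by (rule lborel.borel_measurable_lebesgue_integral) measurable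
 then have Fm: "(%z. F (fst z) (snd z)) : bm borel" by (simp add: F_def split_beta borel_prod)
 have Fm' [measurable (raw)]: "(%x. F (f x) (g x)) : bm N" if [measurable]: "f : bm N" "g : bm N" for f g and N :: "'z measure" using measurable_compose[OF borel_measurable_Pair[OF that] Fm] by simp
 have F_lim: "(%n. F k (s n)) ----> F k y" if "s ----> y" for s k y unfolding F_def proof (rule integral_dominated_convergence[where w = "%x. C * decay x"])
  have "isCont rh z" for z using rhc unfolding continuous_on_eq_continuous_at[OF open_UNIV] by blast
  then have "(%n. rh (x, s n)) ----> rh (x, y)" for x by (rule isCont_tendsto_compose) (intro tendsto_Pair tendsto_const that)
  then show "AE x in lborel. (%n. exp (\<i> * cor (- mink x k)) * rh (x, s n)) ----> exp (\<i> * cor (- mink x k)) * rh (x, y)" by (intro AE_I2 tendsto_mult tendsto_const)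
 qed (use C(1) in "auto simp: norm_mult norm_exp_i_times simp del: of_real_minus intro: integrable_decay")
 \<comment> \<open>Inversion is applied to the slice \<open>y = 0\<close> alone, with
   \<open>- mrefl x\<close> for \<open>J x\<close>; this is where the value \<open>rh (0, 0)\<close>
   enters.\<close>
 have F_int: "(itg lborel (%k. F k 0)) = cor ((2 * pi) ^ ?d) * rh (0, 0)" proof (rule fourier_inversion_0[where g = "%x. rh (x, 0)" and C = C and C' = C and J = "%x. - mrefl x"])
  show "continuous_on UNIV (%x. rh (x, 0))" by (rule continuous_on_compose2[OF rhc]) (auto intro!: continuous_intros)
  show "F k 0 = (itg lborel (%x. exp (\<i> * cor (k \<bullet> - mrefl x)) * rh (x, 0)))" for k by (simp add: F_def mink_refl(2) inner_commute)
 qed (auto simp: norm_mrefl C F_le intro!: continuous_intros continuous_mrefl)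
 define h where "h eps p q k = exp (\<i> * cor (mink (eps *\<^sub>R k - th *v p) q)) * F k (eps *\<^sub>R (eps *\<^sub>R k - th *v p))" for eps p q k
 have hm [measurable]: "h eps p q : bm borel" for eps p q unfolding h_def by measurable
 have h_le: "cmod (h eps p q k) <= C * decay k" for eps p q k by (simp add: h_def norm_mult norm_exp_i_times F_le)
 have osc: "osc_kernel th rh eps p q = ?c * (itg lborel (%k. h eps p q k))" if th: "lorentz_skew th" and eps: "0 < eps" for eps p q proof -
  let ?g = "%x y. exp (\<i> * cor (mink y q)) * (exp (\<i> * cor (- mink x (y + th *v p))) * rh (eps *\<^sub>R x, eps *\<^sub>R y))"
  have g: "osc_weight rh eps (x, y) * osc_phase th (x, y) p q = ?c * ?g x y" for x y proof -
   \<comment> \<open>Skewness moves \<open>th\<close> from \<open>x\<close> to \<open>p\<close>, so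
     all terms in \<open>x\<close> combine to \<open>- mink x (y + th *v p)\<close>.\<close>
   have "exp (- \<i> * cor (mink x y)) * osc_phase th (x, y) p q = exp (\<i> * cor (mink y q)) * exp (\<i> * cor (- mink x (y + th *v p)))"
    by (simp add: osc_phase_def skew_swap[OF th] mink_simps flip: exp_add) (simp add: algebra_simps)
   then show ?thesis by (simp add: osc_weight_def mult_ac)
  qed
  have "integrable lborel (%z. osc_weight rh eps z * osc_phase th z p q)" by (rule Bochner_Integration.integrable_bound[OF wi[OF eps]]) (auto simp: norm_mult)
  then have i: "integrable (lborel >< lborel) (%(x, y). ?c * ?g x y)" unfolding lborel_prod g[symmetric] by (simp add: case_prod_beta')
  have inner: "(itg lborel (%x. exp (\<i> * cor (- mink x (y + th *v p))) * rh (eps *\<^sub>R x, eps *\<^sub>R y))) = cor (inverse eps ^ ?d) * F (inverse eps *\<^sub>R (y + th *v p)) (eps *\<^sub>R y)" for y proof -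
   have "F (inverse eps *\<^sub>R (y + th *v p)) (eps *\<^sub>R y) = cor (eps ^ ?d) * (itg lborel (%x. exp (\<i> * cor (- mink x (y + th *v p))) * rh (eps *\<^sub>R x, eps *\<^sub>R y)))"
    unfolding F_def using eps by (subst lborel_integral_affine[where t = 0 and c = eps]) (auto simp: mink_scale_left mink_scale_right mult.assoc[symmetric])
   then show ?thesis using eps by (simp add: field_simps power_inverse)
  qed
  have "osc_kernel th rh eps p q = (itg (lborel >< lborel) (%z. (case z of (x, y) => ?c * ?g x y)))" unfolding osc_kernel_def lborel_prod by (rule Bochner_Integration.integral_cong) (auto simp only: g split: prod.split)
  also have "... = (itg lborel (%y. itg lborel (%x. ?c * ?g x y)))" by (rule lborel_pair.integral_snd[OF i, symmetric])
  also have "... = ?c * (itg lborel (%y. exp (\<i> * cor (mink y q)) * (itg lborel (%x. exp (\<i> * cor (- mink x (y + th *v p))) * rh (eps *\<^sub>R x, eps *\<^sub>R y)))))" by simp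
  also have "... = ?c * (itg lborel (%y. exp (\<i> * cor (mink y q)) * (cor (inverse eps ^ ?d) * F (inverse eps *\<^sub>R (y + th *v p)) (eps *\<^sub>R y))))" by (simp only: inner)
  also have "(itg lborel (%y. exp (\<i> * cor (mink y q)) * (cor (inverse eps ^ ?d) * F (inverse eps *\<^sub>R (y + th *v p)) (eps *\<^sub>R y)))) = (itg lborel (%k. h eps p q k))" proof -
   have Q: "exp (\<i> * cor (mink (- (th *v p) + eps *\<^sub>R k) q)) * (cor (inverse eps ^ ?d) *
     F (inverse eps *\<^sub>R (- (th *v p) + eps *\<^sub>R k + th *v p)) (eps *\<^sub>R (- (th *v p) + eps *\<^sub>R k))) = cor (inverse eps ^ ?d) * h eps p q k" for k using eps by (simp add: h_def)
   have "cor (\<bar>eps\<bar> ^ n) * (cor (inverse eps ^ n) * I) = I" for I and n :: nat using eps by (simp add: power_inverse field_simps)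
   then show ?thesis using eps by (subst lborel_integral_affine[where t = "- (th *v p)" and c = eps]) (measurable, simp only: Q integral_mult_right_zero)
  qed
  finally show ?thesis .
 qed
 show "\<exists>C. \<forall>eps>0. \<forall>p q. cmod (osc_kernel th rh eps p q) <= C" if th: "lorentz_skew th" using mult_left_mono[OF cmod_integral_decay[OF hm h_le] norm_ge_zero, of ?c]
  by (intro exI allI impI) (simp only: osc[OF th] norm_mult)
 show "(%n. osc_kernel th rh (S n) p q) ----> exp (\<i> * cor (mink p (th *v q)))" if th: "lorentz_skew th" and rh0: "rh (0, 0) = 1" and S: "!!n. 0 < S n" "S ----> 0" proof -
  have "(%n. itg lborel (%k. h (S n) p q k) ) ----> (itg lborel (%k. exp (\<i> * cor (mink (- (th *v p)) q)) * F k 0))" proof (rule integral_dominated_convergence[where w = "%x. C * decay x"])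
   have 1: "(%n. S n *\<^sub>R k - th *v p) ----> - (th *v p)" for k using tendsto_diff[OF tendsto_scaleR[OF S(2) tendsto_const] tendsto_const, of k "th *v p"] by simp
   have 2: "(%n. S n *\<^sub>R (S n *\<^sub>R k - th *v p)) ----> 0" for k using tendsto_scaleR[OF S(2) 1] by simp
   have "isCont (%x. mink x q) z" for z using continuous_on_mink[of UNIV "%x. x" "%_. q"] by (simp add: continuous_on_eq_continuous_at continuous_intros)
   then show "AE k in lborel. (%n. h (S n) p q k) ----> exp (\<i> * cor (mink (- (th *v p)) q)) * F k 0"
    unfolding h_def by (intro AE_I2 tendsto_mult F_lim 2 tendsto_exp tendsto_const tendsto_of_real isCont_tendsto_compose[OF _ 1])
  qed (auto simp: h_le intro: integrable_decay)
  \<comment> \<open>The remaining phase \<open>exp (- \<i> (th p) q)\<close> becomes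
    \<open>exp (\<i> p (th q))\<close> by skewness, and inversion supplies the power of
    \<open>2 * pi\<close> that cancels the normalisation of \<open>osc_weight\<close>.\<close>
  also have "(itg lborel (%k. exp (\<i> * cor (mink (- (th *v p)) q)) * F k 0)) = exp (\<i> * cor (mink p (th *v q))) * cor ((2 * pi) ^ ?d)" by (simp add: F_int rh0 mink_simps skew_swap[OF th])
  finally have "(%n. ?c * (itg lborel (%k. h (S n) p q k))) ----> ?c * (exp (\<i> * cor (mink p (th *v q))) * cor ((2 * pi) ^ ?d))" by (intro tendsto_mult tendsto_const)
  moreover have "?c * (exp (\<i> * cor (mink p (th *v q))) * cor ((2 * pi) ^ ?d)) = exp (\<i> * cor (mink p (th *v q)))" by simp
  ultimately show ?thesis using osc[OF th S(1)] by simp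
 qed
qed

subsection \<open>Smearing functions on the mass shell\<close>

context mass
begin

text \<open>Restricting the space-time Fourier transform to the mass shell keeps its decay, because
  \<open>norm p <= norm (onshell m p)\<close>. Positive mass bounds the density
  \<open>1 / (2 * omega m p)\<close> by \<open>1 / (2 * m)\<close>.\<close>

lemma f_pm_H1: fixes f :: "'s spacetime => complex" assumes f: "schwartz f" shows f_plus_H1: "f_plus m f : hcar H1" and f_minus_H1: "f_minus m f : hcar H1" proof -
 obtain C where fc: "continuous_on UNIV f" and C: "!!k. cmod (itg lborel (%x. exp (\<i> * cor (x \<bullet> k)) * f x)) <= C * decay k" by (rule schwartz_fourier[OF f]) blast
 have [measurable]: "f : bm borel" by (rule borel_measurable_continuous_onI[OF fc])
 have sq: "sqint Mu (%p. itg lborel (%x. f x * exp (c * cor (mink (onshell m p) x))) )" if c: "c = \<i> * cor s" "\<bar>s\<bar> = 1" for c s proof -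
  let ?F = "%p. \<integral>x. f x * exp (c * cor (mink (onshell m p) x)) \<partial>lborel"
  have m: "?F : bm borel" proof -
   have [measurable]: "onshell m : bm (borel :: (real ^ 's) measure)" by (rule borel_measurable_continuous_onI[OF continuous_onshell])
   show ?thesis by (rule lborel.borel_measurable_lebesgue_integral) measurable
  qed
  have n: "norm p <= norm (onshell m p)" for p :: "real ^ 's" proof -
   have "p \<bullet> p <= onshell m p \<bullet> onshell m p" by (simp add: inner_vec_def onshell_def UNIV_option_conv sum.reindex)
   then show ?thesis by (simp add: norm_eq_sqrt_inner)
  qed
  have C0: "0 <= C" using order_trans[OF norm_ge_zero C[of 0]] decay_pos[of "0 :: 's spacetime"] by (simp add: zero_le_mult_iff)
  have le: "cmod (?F p) <= C * decay p" for p proof -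
   have e: "c * cor (mink (onshell m p) x) = \<i> * cor (x \<bullet> (s *\<^sub>R mrefl (onshell m p)))" for x unfolding c(1) mink_refl(2) by (simp add: inner_commute)
   have F: "?F p = (itg lborel (%x. exp (\<i> * cor (x \<bullet> (s *\<^sub>R mrefl (onshell m p)))) * f x))" unfolding e by (simp only: mult.commute)
   have "cmod (?F p) <= C * decay (s *\<^sub>R mrefl (onshell m p))" unfolding F by (rule C)
   also have "... <= C * decay p" proof (rule mult_left_mono[OF _ C0])
    \<comment> \<open>The space-time exponent exceeds the spatial one by one and the bases are at
      least \<open>1\<close>, so decay on the shell implies \<open>decay\<close> in the spatial
      momentum.\<close>
    have "(1 + norm p) ^ (CARD('s) + 2) <= (1 + norm (onshell m p)) ^ (CARD('s option) + 2)" using n[of p] by (intro order_trans[OF power_mono power_increasing]) auto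
    moreover have "0 < (1 + norm p) ^ (CARD('s) + 2)" by (intro zero_less_power add_pos_nonneg) auto
    ultimately show "decay (s *\<^sub>R mrefl (onshell m p)) <= decay p" unfolding decay_def by (simp add: c(2) norm_mrefl frac_le)
   qed
   finally show ?thesis .
  qed
  have "(nni Mu (%p. en ((norm (?F p))^2))) <= (nni (lborel :: (real ^ 's) measure) (%p. en (1 / (2 * m)) * en (C\<^sup>2 * decay p)))" unfolding mu_def proof (subst nn_integral_density, goal_cases)
   case 3
   show ?case proof (rule nn_integral_mono, rule mult_mono)
    fix p :: "real ^ 's"
    have "m <= omega m p" using m_pos unfolding omega_def by (intro real_le_rsqrt) auto
    then show "en (1 / (2 * omega m p)) <= en (1 / (2 * m))" using m_pos by (intro ennreal_leI) (simp add: frac_le)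
    have "(norm (?F p))^2 <= (C * decay p)^2" by (intro power_mono le) auto
    also have "... = C\<^sup>2 * decay p * decay p" by (simp add: power2_eq_square)
    also have "... <= C\<^sup>2 * decay p" using decay_pos[of p] decay_le_1[of p] by (intro mult_left_le) auto
    finally show "en ((norm (?F p))^2) <= en (C\<^sup>2 * decay p)" by (rule ennreal_leI)
   qed auto
  qed (use m in measurable)
  also have "... < \<infinity>" proof -
   have "integrable lborel (%p::real ^ 's. C\<^sup>2 * decay p)" by (simp add: integrable_decay)
   then have "(nni (lborel :: (real ^ 's) measure) (%p. en (C\<^sup>2 * decay p))) < \<infinity>"
    unfolding integrable_iff_bounded by (simp only: real_norm_def abs_of_nonneg[OF mult_nonneg_nonneg[OF zero_le_power2 less_imp_le[OF decay_pos]]])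
   then show ?thesis by (subst nn_integral_cmult) (auto simp: ennreal_mult_less_top)
  qed
  finally show ?thesis using m by (simp add: vm.sqint_iff vm.sqint_strong smeas_complex measurable_mu_iff)
 qed
 show "f_plus m f : hcar H1" unfolding f_plus_def one_particle_eq using sq[of \<i> 1] by (intro vm.L2_mk) simp
 show "f_minus m f : hcar H1" unfolding f_minus_def one_particle_eq using sq[of "- \<i>" "-1"] by (intro vm.L2_mk) simp
qed

lemma aconj_mk: "sqint Mu f ==> aconj (mk f) = mk (%p. cnj (f p))" unfolding aconj_def vm.mk_eq_iff_M using vm.repr_M(3)[OF vm.sqint_strong] by fastforce

lemma sqint_cnj: "sqint Mu f ==> sqint Mu (%p. cnj (f p))" by (auto simp: vm.sqint_iff intro: measurable_compose[OF _ borel_measurable_cnj])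

lemma aconj_H1: "h : hcar H1 ==> aconj h : hcar H1" by (elim H1E) (auto simp: aconj_mk one_particle_eq intro!: vm.L2_mk sqint_cnj)

text \<open>Complex conjugation reverses the sign in the exponential. This is the source of the
  adjoint relation between the fields for \<open>f\<close> and for its conjugate.\<close>

lemma aconj_f_pm: fixes f :: "'s spacetime => complex" shows aconj_f_minus: "schwartz f ==> aconj (f_minus m f) = f_plus m (%x. cnj (f x))" and aconj_f_plus: "schwartz f ==> aconj (f_plus m f) = f_minus m (%x. cnj (f x))" proof -
 assume f: "schwartz f"
 have 1: "aconj (mk g) = mk (%p. cnj (g p))" if "mk g : hcar H1" for g proof -
  obtain h where h: "mk g = mk h" "sqint Mu h" using \<open>mk g : hcar H1\<close> by (rule H1E)
  have "AE p in Mu. g p = h p" using h(1) by (simp add: vm.mk_eq_iff_M)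
  then show ?thesis unfolding h(1) aconj_mk[OF h(2)] vm.mk_eq_iff_M by eventually_elim simp
 qed
 show "aconj (f_minus m f) = f_plus m (%x. cnj (f x))" using 1[OF f_minus_H1[OF f, unfolded f_minus_def]] unfolding f_minus_def f_plus_def Bochner_Integration.integral_cnj[symmetric] by (simp add: exp_cnj)
 show "aconj (f_plus m f) = f_minus m (%x. cnj (f x))" using 1[OF f_plus_H1[OF f, unfolded f_plus_def]] unfolding f_minus_def f_plus_def Bochner_Integration.integral_cnj[symmetric] by (simp add: exp_cnj)
qed

end

section \<open>The deformed field\<close>

lemma integrable_product_pair: fixes f :: "'a => real" and g :: "'b => real" assumes "pair_sigma_finite M N" "integrable M f" "integrable N g" shows "integrable (M >< N) (%x. f (fst x) * g (snd x))" proof -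
 interpret pair_sigma_finite M N by fact
 have [measurable]: "f : bm M" "g : bm N" using assms by auto
 show ?thesis by (rule Fubini_integrable) (use assms in "auto simp: abs_mult")
qed

context mass
begin

text \<open>Symmetry and the particle bound may be witnessed by different representatives;
  truncating the symmetric one produces a representative with both properties.\<close>

lemma fock_inter_full_le: "u : cF ==> u : hcar (full_le N) ==> u : cN N" for u :: "('s, complex) fk" proof (elim full_leE)
 fix f assume u: "u : cF" and f: "u = mk f" "sqint LL f" "!!ps. N < length ps ==> f ps = 0"
 have "(%ps. if length ps <= N then f ps else 0) = f" using f(3) by (auto simp: fun_eq_iff)
 then have "trunc N u = u" unfolding f(1) trunc_mk[OF f(2)] by simp
 then show "u : cN N" using trunc_fock(1)[OF u, of N] by simp
qed

lemma tot_rem_nth: "k < length qs ==> onshell m (qs ! k) + tot (rem_nth k qs) = tot qs" using total_momentum_mset[of "qs ! k # rem_nth k qs" qs m] by (simp add: mset_rem_nth)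

text \<open>Multipliers applied before and after creation see the list without and with the new
  particle, and so merge into a single kernel.\<close>

lemma mulop_creaK_mulop: assumes a: "a : bm LL" and b: "b : bm LL" "!!ps. cmod (b ps) <= C" and eq: "!!k qs. k < length qs ==> a qs * b (rem_nth k qs) = kp (qs ! k) (tot (rem_nth k qs))"
  and h: "h : hcar H1" and u: "u : hcar (full_le N)" shows "mulop a (creaK k1 h (mulop b u)) = creaK kp h u" proof -
 obtain g where g: "h = mk g" "sqint Mu g" using h by (rule H1E)
 obtain f where f: "u = mk f" "sqint LL f" "!!ps. N < length ps ==> f ps = 0" using u by (rule full_leE) blast
 have bf: "sqint LL (%ps. b ps * f ps)" by (rule sqint_mul[OF b f(2)])
 have "sqint LL (crea_fun k1 g (%ps. b ps * f ps))" by (rule sqint_crea_fun[where N = N, OF kernel_one g(2) bf]) (simp add: f(3))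
 moreover have "a qs * crea_fun k1 g (%ps. b ps * f ps) qs = crea_fun kp g f qs" for qs unfolding crea_fun_def by (simp add: sum_distrib_left eq[symmetric] mult_ac)
 ultimately show ?thesis unfolding f(1) g(1) mulop_mk[OF f(2)] creaK_mk[OF g(2) bf] creaK_mk[OF g(2) f(2)] by (simp add: mulop_mk)
qed

lemma mulop_annK_mulop: assumes a: "a : bm LL" and b: "b : bm LL" "!!ps. cmod (b ps) <= C" and kp: "kernel C' kp" and eq: "!!p ps. a ps * b (p # ps) = kp p (tot ps)" and h: "h : hcar H1" and u: "u : hcar (full_le N)"
 shows "mulop a (annK k1 h (mulop b u)) = annK kp h u" proof -
 obtain g where g: "h = mk g" "sqint Mu g" using h by (rule H1E)
 obtain f where f: "u = mk f" "sqint LL f" "!!ps. N < length ps ==> f ps = 0" using u by (rule full_leE) blast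
 have bf: "sqint LL (%ps. b ps * f ps)" by (rule sqint_mul[OF b f(2)])
 have "sqint LL (ann_fun k1 g (%ps. b ps * f ps))" by (rule sqint_ann_fun[where N = N, OF kernel_one g(2) bf]) (simp add: f(3))
 moreover have "a ps * ann_fun k1 g (%ps. b ps * f ps) ps = ann_fun kp g f ps" for ps proof -
  have "a ps * (itg Mu (%p. cnj (g p) * 1 * (b (p # ps) * f (p # ps)))) = (itg Mu (%p. cnj (g p) * kp p (tot ps) * f (p # ps)))" unfolding integral_mult_right_zero[symmetric] by (simp add: eq[symmetric] mult_ac)
  then show ?thesis unfolding ann_fun_def by (simp add: mult.left_commute)
 qed
 ultimately show ?thesis unfolding f(1) g(1) mulop_mk[OF f(2)] annK_mk[OF kernel_one g(2) bf] annK_mk[OF kp g(2) f(2)] by (simp add: mulop_mk)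
qed

text \<open>Fubini absorbs an average of creation operators into the kernel. The claim is about
  pairings with a vector \<open>v\<close> because \<open>warped\<close> is described through its
  matrix elements.\<close>

lemma creaK_weak_integral: fixes w :: "'z::euclidean_space => complex" and E :: "'z => real ^ 's => 's spacetime => complex" assumes w: "integrable lborel w"
  and Em: "(%x. E (fst x) (fst (snd x)) (snd (snd x))) : bm (borel >< (borel >< borel))" and E1: "!!z p q. cmod (E z p q) <= 1" and h: "h : hcar H1" and u: "u : hcar (full_le N)" and v: "v : cL"
 defines "K \<equiv> %p q. \<integral>z. w z * E z p q \<partial>lborel" shows "integrable lborel (%z. w z * ipL v (creaK (E z) h u))" and "(itg lborel (%z. w z * ipL v (creaK (E z) h u))) = ipL v (creaK K h u)"
  and "kernel (itg lborel (%z. cmod (w z))) K" proof -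
 obtain g where g: "h = mk g" "sqint Mu g" using h by (rule H1E)
 obtain f where f: "u = mk f" "sqint LL f" "!!ps. N < length ps ==> f ps = 0" using u by (rule full_leE) blast
 obtain e where e: "v = mk e" "sqint LL e" using v by (auto simp: vl.L2_carrier)
 have wm [measurable]: "w : bm borel" using w by auto
 have gm [measurable]: "g : bm Mu" by (rule vm.sqint_borel[OF g(2)])
 have fm [measurable]: "f : bm LL" and em [measurable]: "e : bm LL" using f(2) e(2) by (auto simp: vl.sqint_borel)
 have Ec: "(%x. E (a x) (b x) (c x)) : bm M" if "a : bm M" "b : bm M" "c : bm M" for a b c and M :: "'y measure" using measurable_compose[OF measurable_Pair[OF that(1) measurable_Pair[OF that(2,3)]] Em] by simp
 have kE: "kernel 1 (E z)" for z unfolding kernel_def by (intro conjI allI Ec E1) auto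
 have iw: "integrable lborel (%z. w z * E z p q)" for p q by (rule Bochner_Integration.integrable_bound[OF w]) (auto simp: norm_mult intro!: mult_left_le E1 borel_measurable_times Ec)
 show kK: "kernel (itg lborel (%z. cmod (w z))) K" unfolding kernel_def proof (intro conjI allI)
  have "(%x. itg lborel (%z. (%x z. w z * E z (fst x) (snd x)) x z) ) : bm (borel >< borel)" proof (rule lborel.borel_measurable_lebesgue_integral)
   have [measurable]: "(%x. E (snd x) (fst (fst x)) (snd (fst x))) : bm ((borel >< borel) >< lborel)" by (rule Ec) auto
   show "(%(x, z). w z * E z (fst x) (snd x)) : bm ((borel >< borel) >< lborel)" unfolding split_beta by measurable
  qed
  then show "(%z. K (fst z) (snd z)) : bm (borel >< borel)" by (simp add: K_def)
  fix p q
  have "cmod (K p q) <= (itg lborel (%z. cmod (w z * E z p q)))" unfolding K_def by (rule integral_norm_bound)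
  also have "... <= (itg lborel (%z. cmod (w z)))" by (rule integral_mono[OF integrable_norm[OF iw] integrable_norm[OF w]]) (simp add: norm_mult mult_left_le E1)
  finally show "cmod (K p q) <= (itg lborel (%z. cmod (w z)))" .
 qed
 \<comment> \<open>The kernels have modulus at most one, so creation with absolute values and
   trivial kernel bounds the integrand for all \<open>z\<close> at once; its pairing with
   \<open>e\<close> is integrable.\<close>
 define b where "b = crea_fun k1 (%p. cor (cmod (g p))) (%ps. cor (cmod (f ps)))"
 have bsq: "sqint LL b" unfolding b_def proof (rule sqint_crea_fun[where N = N, OF kernel_one])
  show "sqint Mu (%p. cor (cmod (g p)))" using g(2) by (simp add: vm.sqint_iff)
  show "sqint LL (%p. cor (cmod (f p)))" using f(2) by (simp add: vl.sqint_iff)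
 qed (simp add: f(3))
 have cb: "cmod (crea_fun (E z) g f qs) <= cmod (b qs)" for z qs proof -
  let ?S = "\<Sum>k<length qs. cmod (g (qs ! k)) * cmod (f (rem_nth k qs))"
  have "b qs = cor (1 / sqrt (real (length qs)) * ?S)" by (simp add: b_def crea_fun_def)
  then have "cmod (b qs) = 1 / sqrt (real (length qs)) * ?S" by (simp only: norm_of_real) (simp add: sum_nonneg)
  moreover have "cmod (\<Sum>k<length qs. g (qs ! k) * E z (qs ! k) (tot (rem_nth k qs)) * f (rem_nth k qs)) <= ?S" by (rule sum_norm_le) (auto simp: norm_mult intro!: mult_right_mono mult_left_le E1)
  ultimately show ?thesis unfolding crea_fun_def by (simp add: norm_mult norm_divide divide_right_mono)
 qed
 interpret PZ: pair_sigma_finite "lborel :: 'z measure" LL by standard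
 let ?G = "%z qs. w z * (cnj (e qs) * crea_fun (E z) g f qs)"
 have sqE: "sqint LL (crea_fun (E z) g f)" for z by (rule sqint_crea_fun[where N = N, OF kE g(2) f(2)]) (rule f(3))
 have hipE: "w z * ipL v (creaK (E z) h u) = (itg LL (%qs. ?G z qs))" for z unfolding e(1) f(1) g(1) creaK_mk[OF g(2) f(2)] using sqE[of z] e(2) by (simp add: vl.hip_mk vl.sqint_borel)
 have cm: "(%x. crea_fun (E (fst x)) g f (snd x)) : bm (lborel >< LL)" proof -
  have "(%x. snd x ! k) : measurable (lborel >< LL) Mu" for k by measurable
  then have nth: "(%x. snd x ! k) : bm (lborel >< LL)" for k by (subst (asm) measurable_cong_sets[OF refl sets_mu])
  have [measurable]: "(%x. E (fst x) (snd x ! k) (tot (rem_nth k (snd x)))) : bm (lborel >< LL)" for k by (rule Ec[OF _ nth]) measurable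
  have [measurable]: "(%x. \<Sum>k<length (snd x). g (snd x ! k) * E (fst x) (snd x ! k) (tot (rem_nth k (snd x))) * f (rem_nth k (snd x))) : bm (lborel >< LL)"
   by (rule measurable_compose_countable[where g = "%x. length (snd x)"]) measurable
  show ?thesis unfolding crea_fun_def by measurable
 qed
 have Gi: "integrable (lborel >< LL) (%(z, qs). ?G z qs)" proof (rule Bochner_Integration.integrable_bound)
  show "integrable (lborel >< LL) (%x. cmod (w (fst x)) * cmod (cinner (e (snd x)) (b (snd x))))"
   by (rule integrable_product_pair[OF PZ.pair_sigma_finite_axioms integrable_norm[OF w] integrable_norm[OF vl.integrable_cinner[OF e(2) bsq]]])
  show "(%(z, qs). ?G z qs) : bm (lborel >< LL)" unfolding split_beta using cm by measurable
  show "AE x in lborel >< LL. norm (case x of (z, qs) => ?G z qs) <= norm (cmod (w (fst x)) * cmod (cinner (e (snd x)) (b (snd x))))" by (intro AE_I2) (auto simp: norm_mult intro!: mult_left_mono cb)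
 qed
 show "integrable lborel (%z. w z * ipL v (creaK (E z) h u))" unfolding hipE using PZ.integrable_fst'[OF Gi] by simp
 have inner: "(itg lborel (%z. ?G z qs)) = cnj (e qs) * crea_fun K g f qs" for qs proof -
  let ?c = "cor (1 / sqrt (real (length qs)))"
  have "?G z qs = cnj (e qs) * (?c * (\<Sum>k<length qs. g (qs ! k) * f (rem_nth k qs) * (w z * E z (qs ! k) (tot (rem_nth k qs)))))" for z by (simp add: crea_fun_def sum_distrib_left mult_ac)
  moreover have "(itg lborel (%z. (\<Sum>k<length qs. g (qs ! k) * f (rem_nth k qs) * (w z * E z (qs ! k) (tot (rem_nth k qs)))))) = (\<Sum>k<length qs. g (qs ! k) * f (rem_nth k qs) * K (qs ! k) (tot (rem_nth k qs)))"
   by (subst Bochner_Integration.integral_sum) (auto simp: K_def iw)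
  ultimately show ?thesis by (simp only: integral_mult_right_zero) (simp add: crea_fun_def mult_ac)
 qed
 have "(itg lborel (%z. w z * ipL v (creaK (E z) h u))) = (itg LL (%qs. itg lborel (%z. ?G z qs)))" unfolding hipE by (rule PZ.Fubini_integral[OF Gi, symmetric])
 also have "... = (itg LL (%qs. cnj (e qs) * crea_fun K g f qs))" by (simp only: inner)
 also have "... = ipL v (creaK K h u)" unfolding e(1) f(1) g(1) creaK_mk[OF g(2) f(2)] using measurable_crea_fun[OF kK gm fm] e(2) by (simp add: vl.hip_mk vl.sqint_borel)
 finally show "(itg lborel (%z. w z * ipL v (creaK (E z) h u))) = ipL v (creaK K h u)" .
qed

text \<open>The annihilated vector has at most \<open>N\<close> particles, so only
  \<open>trunc N v\<close> is seen; this provides the particle bound that \<open>hip_creaK\<close>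
  requires on its creation side.\<close>

lemma hip_annK: assumes kp: "kernel C kp" and h: "h : hcar H1" and u: "u : cN N" and v: "v : cF" shows "ipL v (annK kp h u) = cnj (ipL u (creaK (%p q. cnj (kp p q)) h (trunc N v)))" proof -
 interpret L: hspace "L2 LL :: ('s, complex) fk hilb" by (rule hspace_L2_LL)
 have t: "trunc N v : hcar (full_le N)" using trunc_fock(1)[OF v] fock_le_full_le by blast
 have uf: "u : hcar (full_le N)" "u : cF" using u fock_le_full_le fock_le_fock by blast+
 have "ipL v (annK kp h u) = ipL (trunc N v) (annK kp h u)" by (rule trunc_fock(2)[OF v annK_full_le(1)[OF kp h uf(1)], symmetric])
 also have "... = ipL (creaK (%p q. cnj (kp p q)) h (trunc N v)) u" using hip_creaK[OF kernel_cnj[OF kp] h t uf(2)] by simp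
 also have "... = cnj (ipL u (creaK (%p q. cnj (kp p q)) h (trunc N v)))" by (rule L.hip_commute) (use creaK_full_le(1)[OF kernel_cnj[OF kp] h t] full_le_full uf fock_full in blast)+
 finally show ?thesis .
qed

text \<open>Passing to adjoints and complex conjugates reduces this to
  \<open>creaK_weak_integral\<close>.\<close>

lemma annK_weak_integral: fixes w :: "'z::euclidean_space => complex" and E :: "'z => real ^ 's => 's spacetime => complex" assumes w: "integrable lborel w"
  and Em: "(%x. E (fst x) (fst (snd x)) (snd (snd x))) : bm (borel >< (borel >< borel))" and E1: "!!z p q. cmod (E z p q) <= 1" and h: "h : hcar H1" and u: "u : cN N" and v: "v : cF"
 defines "K \<equiv> %p q. \<integral>z. w z * E z p q \<partial>lborel" shows "integrable lborel (%z. w z * ipL v (annK (E z) h u))" and "(itg lborel (%z. w z * ipL v (annK (E z) h u))) = ipL v (annK K h u)"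
  and "kernel (itg lborel (%z. cmod (w z))) K" proof -
 let ?E = "%z p q. cnj (E z p q)"
 have t: "trunc N v : hcar (full_le N)" using trunc_fock(1)[OF v] fock_le_full_le by blast
 have uL: "u : cL" using u fock_le_full by blast
 have kE: "kernel 1 (E z)" for z unfolding kernel_def using measurable_compose[OF measurable_Pair[OF measurable_const measurable_ident] Em, of z] E1 by simp
 have w': "integrable lborel (%z. cnj (w z))" using w by simp
 note ci = creaK_weak_integral[OF w' measurable_compose[OF Em borel_measurable_cnj] _ h t uL]
 have K: "(%p q. itg lborel (%z. cnj (w z) * ?E z p q) ) = (%p q. cnj (K p q))" unfolding K_def Bochner_Integration.integral_cnj[symmetric] by simp
 have kc: "kernel (itg lborel (%z. cmod (w z))) (%p q. cnj (K p q))" using ci(3) E1 unfolding K by simp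
 show kK: "kernel (itg lborel (%z. cmod (w z))) K" using kernel_cnj[OF kc] by simp
 have eq: "w z * ipL v (annK (E z) h u) = cnj (cnj (w z) * ipL u (creaK (?E z) h (trunc N v)))" for z by (simp add: hip_annK[OF kE h u v])
 show "integrable lborel (%z. w z * ipL v (annK (E z) h u))" unfolding eq by (rule integrable_cnj, rule ci(1)) (simp add: E1)
 have "(itg lborel (%z. w z * ipL v (annK (E z) h u))) = cnj (itg lborel (%z. cnj (w z) * ipL u (creaK (?E z) h (trunc N v))))" unfolding eq by (rule Bochner_Integration.integral_cnj)
 also have "(itg lborel (%z. cnj (w z) * ipL u (creaK (?E z) h (trunc N v)))) = ipL u (creaK (%p q. cnj (K p q)) h (trunc N v))" using ci(2) E1 unfolding K by simp
 also have "cnj ... = ipL v (annK K h u)" by (rule hip_annK[OF kK h u v, symmetric])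
 finally show "(itg lborel (%z. w z * ipL v (annK (E z) h u))) = ipL v (annK K h u)" .
qed

end

section \<open>The deformed field in momentum space\<close>

locale deformation = mass m s_type for m :: real and s_type :: "'s::finite itself" + fixes V :: "'s wf => 's wf" and th :: "real ^ ('s option) ^ ('s option)" and rh :: "'s spacetime \<times> 's spacetime => complex"
 assumes V: "unitary_op H1 H1 V" and skew: "lorentz_skew th" and rh: "schwartz rh" and rh0: "rh (0, 0) = 1"
begin

abbreviation "FK \<equiv> fock m :: ('s, complex) fk hilb"
abbreviation "G \<equiv> Gam m V"
abbreviation "Gi \<equiv> Gam m (inv_op m V)"
abbreviation "FP \<equiv> finite_particle m :: ('s, complex) fk set"

lemmas Vi = inv_op_unitary[OF V]
lemmas GiG = Gam_inv(1)[OF V] and GGi = Gam_inv(2)[OF V]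

definition kp :: "real ^ 's => 's spacetime => complex" where "kp p q = exp (\<i> * cor (mink (onshell m p) (th *v q)))"

abbreviation ckp :: "real ^ 's => 's spacetime => complex" where "ckp \<equiv> %p q. cnj (kp p q)"

text \<open>The deformed field, conjugated to momentum space: each mode of the free field acquires a momentum-dependent phase.\<close>

definition tfield :: "('s spacetime => complex) => ('s, complex) fk => ('s, complex) fk" where "tfield f \<Phi> = annK ckp (V (aconj (f_minus m f))) \<Phi> + creaK kp (V (f_plus m f)) \<Phi>"

definition dfield :: "('s spacetime => complex) => ('s, complex) fk => ('s, complex) fk" where "dfield f \<Psi> = Gi (tfield f (G \<Psi>))"

lemma measurable_onshell_borel [measurable]: "onshell m : bm (borel :: (real ^ 's) measure)" by (rule borel_measurable_continuous_onI[OF continuous_onshell])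

lemma kernel_kp: "kernel 1 kp" unfolding kernel_def kp_def by (simp add: norm_exp_i_times)

lemmas kernel_ckp = kernel_cnj[OF kernel_kp]

lemma V_H1: "h : hcar H1 ==> V h : hcar H1" by (rule unitary_opD(2)[OF V])

lemma smear_H1: "schwartz f ==> V (aconj (f_minus m f)) : hcar H1" "schwartz f ==> V (f_plus m f) : hcar H1" by (auto intro!: V_H1 aconj_H1 f_minus_H1 f_plus_H1)

lemma fp_full: "u : FP ==> u : cL" using finite_particle_fock fock_full by blast

lemma tfield_linear: assumes f: "schwartz f" shows "linear_on (cL) (tfield f)" using linear_annK[OF kernel_ckp smear_H1(1)[OF f]] linear_creaK[OF smear_H1(2)[OF f], of kp]
 unfolding linear_on_def tfield_def by (auto simp: cscale_add_right)

lemma tfield_fock_le: "schwartz f ==> u : cN N ==> tfield f u : hcar (fock_le (Suc N))" unfolding tfield_def using fock_le_mono[of N "Suc N"] annK_fock_le[OF kernel_ckp smear_H1(1)] creaK_fock_le[OF kernel_kp smear_H1(2)]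
 by (intro hspace.add[OF hspace_fock_le]) auto

lemma tfield_bound: assumes f: "schwartz f" shows "\<exists>C. \<forall>u\<in>cN N. nmL (tfield f u) <= C * nmL u" proof (intro exI ballI)
 interpret L: hspace "L2 LL :: ('s, complex) fk hilb" by (rule hspace_L2_LL)
 fix u :: "('s, complex) fk" assume "u : cN N"
 then have u: "u : hcar (full_le N)" using fock_le_full_le by blast
 note a = annK_full_le[OF kernel_ckp smear_H1(1)[OF f] u] and c = creaK_full_le[OF kernel_kp smear_H1(2)[OF f] u]
 have "nmL (tfield f u) <= nmL (annK ckp (V (aconj (f_minus m f))) u) + nmL (creaK kp (V (f_plus m f)) u)" unfolding tfield_def using a(1) c(1) full_le_full by (intro L.hnorm_triangle) blast+
 also have "... <= (sqrt (real (N + 1)) * 1 * hnorm H1 (V (aconj (f_minus m f))) + sqrt (real (N + 1)) * 1 * hnorm H1 (V (f_plus m f))) * nmL u" unfolding distrib_right by (intro add_mono a c)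
 finally show "nmL (tfield f u) <= ..." .
qed

text \<open>Adjoints interchange creation and annihilation and conjugate the kernels;
  \<open>aconj_f_minus\<close>, used for \<open>f\<close> and for its conjugate, identifies the
  smearing functions that result.\<close>

lemma hip_tfield: assumes f: "schwartz f" and u: "u : cN N" and v: "v : cN N" shows "ipL (tfield f u) v = ipL u (tfield (%x. cnj (f x)) v)" proof -
 interpret L: hspace "L2 LL :: ('s, complex) fk hilb" by (rule hspace_L2_LL)
 let ?h1 = "V (aconj (f_minus m f))" and ?h2 = "V (f_plus m f)"
 note h = smear_H1[OF f]
 have le: "w : hcar (full_le N)" "w : cF" "w : cL" if "w : cN N" for w using that fock_le_full_le fock_le_fock fock_le_full by blast+
 have cl: "annK ckp h w : cL" "creaK kp h w : cL" if "w : cN N" "h : hcar H1" for h w using annK_full_le(1)[OF kernel_ckp that(2) le(1)[OF that(1)]] creaK_full_le(1)[OF kernel_kp that(2) le(1)[OF that(1)]] full_le_full by blast+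
 have 1: "ipL (creaK kp h w) w' = ipL w (annK ckp h w')" if "w : cN N" "w' : cN N" "h : hcar H1" for h w w' using hip_creaK[OF kernel_kp that(3) le(1)[OF that(1)] le(2)[OF that(2)]] .
 have "ipL (annK ckp ?h1 u) v = cnj (ipL v (annK ckp ?h1 u))" by (rule L.hip_commute) (use cl le u v h in auto)
 also have "... = cnj (ipL (creaK kp ?h1 v) u)" unfolding 1[OF v u h(1)] ..
 also have "... = ipL u (creaK kp ?h1 v)" by (rule L.hip_commute[symmetric]) (use cl le u v h in auto)
 finally have "ipL (tfield f u) v = ipL u (creaK kp ?h1 v) + ipL u (annK ckp ?h2 v)" unfolding tfield_def using cl le u v h by (subst L.hip_add_left) (auto simp: 1[OF u v h(2)])
 also have "... = ipL u (annK ckp ?h2 v + creaK kp ?h1 v)" using cl le u v h by (subst L.hip_add_right) auto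
 finally show ?thesis unfolding tfield_def using f by (simp add: aconj_f_minus schwartz_cnj)
qed

lemma dfield_fp: assumes f: "schwartz f" and u: "u : FP" shows "dfield f u : FP" proof -
 obtain N where "u : cN N" using u by (auto simp: finite_particle_eq)
 from Gam_fock_le[OF Vi tfield_fock_le[OF f Gam_fock_le[OF V this]]] show ?thesis by (auto simp: finite_particle_eq dfield_def)
qed

lemma dfield_linear: assumes f: "schwartz f" shows "linear_on FP (dfield f)" proof -
 have T: "tfield f (G u) : cL" if u: "u : FP" for u proof -
  obtain N where "u : cN N" using u by (auto simp: finite_particle_eq)
  then show ?thesis using tfield_fock_le[OF f Gam_fock_le[OF V]] fock_le_full by blast
 qed
 show ?thesis unfolding linear_on_def dfield_def by (auto simp: linear_onD[OF Gam_linear[OF V]] linear_onD[OF tfield_linear[OF f]] linear_onD[OF Gam_linear[OF Vi]] fp_full Gam_full[OF V] T)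
qed

lemma dfield_bound: assumes f: "schwartz f" shows "\<exists>C. \<forall>u\<in>cN N. nmL (dfield f u) <= C * nmL u" proof -
 obtain C where C: "!!u. u : cN N ==> nmL (tfield f u) <= C * nmL u" using tfield_bound[OF f] by blast
 have "nmL (dfield f u) <= C * nmL u" if u: "u : cN N" for u proof -
  have t: "tfield f (G u) : cL" using tfield_fock_le[OF f Gam_fock_le[OF V u]] fock_le_full by blast
  have uL: "u : cL" using u fock_le_full by blast
  show ?thesis using C[OF Gam_fock_le[OF V u]] by (simp add: dfield_def Gam_hnorm[OF Vi t] Gam_hnorm[OF V uL])
 qed
 then show ?thesis by blast
qed

lemma hip_Gi: "u : cL ==> v : cL ==> ipL (Gi u) v = ipL u (G v)"
 "u : cL ==> v : cL ==> ipL v (Gi u) = ipL (G v) u" using Gam_hip[OF V Gam_full[OF Vi], of u v] Gam_hip[OF V _ Gam_full[OF Vi], of v u] by (auto simp: GGi)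

lemma hip_dfield: assumes f: "schwartz f" and u: "u : FP" and v: "v : FP" shows "ipL (dfield f u) v = ipL u (dfield (%x. cnj (f x)) v)" proof -
 obtain N where "u : cN N" "v : cN N" proof -
  obtain N N' where "u : cN N" "v : hcar (fock_le N')" using u v by (auto simp: finite_particle_eq)
  then show thesis using that[of "max N N'"] fock_le_mono[of N "max N N'"] fock_le_mono[of N' "max N N'"] by auto
 qed
 note g = Gam_fock_le[OF V this(1)] Gam_fock_le[OF V this(2)]
 have t: "tfield f (G u) : cL" "tfield (%x. cnj (f x)) (G v) : cL" using tfield_fock_le[OF f g(1)] tfield_fock_le[OF schwartz_cnj[OF f] g(2)] fock_le_full by blast+
 show ?thesis unfolding dfield_def using hip_tfield[OF f g] t fp_full[OF u] fp_full[OF v] by (simp add: hip_Gi)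
qed

abbreviation "ex x \<equiv> %ps. exp (\<i> * cor (mink x (tot ps)))"

lemma ex_facts: "ex x : bm LL" "cmod (ex x ps) <= 1" "symm (ex x)" proof -
 show "ex x : bm LL" by measurable
 show "cmod (ex x ps) <= 1" using norm_exp_i_times[of "mink x (tot ps)"] by simp
 show "symm (ex x)" by (rule symm_comp[OF symm_tot])
qed

lemma translation_Gi: assumes "u : hcar FK" shows "translation FK (coord_X m V) x (Gi u) = Gi (mulop (ex x) u)" using assms Gam_fock[OF Vi assms] GGi[of u] fock_full by (auto simp: translation_eq[OF V])

lemma free_field_Gi: assumes f: "schwartz f" and u: "u : cN N" shows "free_field m f (Gi u) = Gi (annK k1 (V (aconj (f_minus m f))) u + creaK k1 (V (f_plus m f)) u)" proof -
 have u': "u : hcar (full_le N)" using u fock_le_full_le by blast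
 have L: "annK k1 (V (aconj (f_minus m f))) u : cL" "creaK k1 (V (f_plus m f)) u : cL" using annK_full_le(1)[OF kernel_one smear_H1(1)[OF f] u'] creaK_full_le(1)[OF kernel_one smear_H1(2)[OF f] u'] full_le_full by blast+
 show ?thesis unfolding linear_onD(1)[OF Gam_linear[OF Vi] L] Gam_ann[OF Vi smear_H1(1)[OF f] u] Gam_crea[OF Vi smear_H1(2)[OF f] u]
  using f by (simp add: free_field_def ann_eq crea_eq inv_op_left[OF V] aconj_H1 f_minus_H1 f_plus_H1)
qed

abbreviation "Kc eps \<equiv> %p q. osc_kernel th rh eps (onshell m p) q"
text \<open>Annihilating \<open>p\<close> from total momentum \<open>p + q\<close> leaves
  \<open>q\<close>: the translation by \<open>y\<close> sees \<open>p + q\<close>, and the two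
  translations by \<open>th *v x\<close> together see the change \<open>-p\<close>.\<close>

abbreviation "Ka eps \<equiv> %p q. osc_kernel th rh eps (- onshell m p) (onshell m p + q)"

text \<open>This bound, the total mass of the weight, depends on \<open>eps\<close> and serves to
  make the operators well defined; the limit rests on the uniform bound of
  \<open>osc_kernel_bound\<close>.\<close>

lemma kernel_osc: assumes "0 < eps" shows "kernel (itg lborel (%z. cmod (osc_weight rh eps z))) (Ka eps)" "kernel (itg lborel (%z. cmod (osc_weight rh eps z))) (Kc eps)" proof -
 have om: "(%x. osc_kernel th rh eps (a x) (b x)) : bm M" if "a : bm M" "b : bm M" for a b and M :: "'z measure" using measurable_compose[OF borel_measurable_Pair[OF that] borel_measurable_osc_kernel[OF rh]] by simp
 have "cmod (osc_kernel th rh eps p q) <= (itg lborel (%z. cmod (osc_weight rh eps z)))" for p q unfolding osc_kernel_def by (rule order_trans[OF integral_norm_bound]) (simp add: norm_mult)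
 then show "kernel (itg lborel (%z. cmod (osc_weight rh eps z))) (Ka eps)" "kernel (itg lborel (%z. cmod (osc_weight rh eps z))) (Kc eps)" unfolding kernel_def by (auto intro!: om)
qed

text \<open>The candidate is checked against all matrix elements, and definiteness of the inner
  product makes it the only vector with these pairings.\<close>

lemma warped_Gi: assumes f: "schwartz f" and u: "u : cN N" and eps: "0 < eps" shows "warped FK (translation FK (coord_X m V)) th rh (free_field m f) eps (Gi u) =
  Gi (annK (Ka eps) (V (aconj (f_minus m f))) u + creaK (Kc eps) (V (f_plus m f)) u)" proof -
 interpret L: hspace "L2 LL :: ('s, complex) fk hilb" by (rule hspace_L2_LL)
 let ?h1 = "V (aconj (f_minus m f))" and ?h2 = "V (f_plus m f)" and ?T = "translation FK (coord_X m V)"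
 let ?Ec = "%z p q. osc_phase th z (onshell m p) q" and ?Ea = "%z p q. osc_phase th z (- onshell m p) (onshell m p + q)"
 let ?w = "osc_weight rh eps"
 note h = smear_H1[OF f]
 have u': "u : hcar (full_le N)" "u : hcar FK" "u : cL" using u fock_le_full_le fock_le_fock fock_le_full by blast+
 have [measurable]: "(%x :: ('s spacetime \<times> 's spacetime) \<times> (real ^ 's) \<times> 's spacetime. onshell m (fst (snd x))) : bm (borel >< (borel >< borel))"
  by (rule measurable_compose[OF measurable_compose[OF measurable_snd measurable_fst] measurable_onshell_borel])
 have Em: "(%x. ?Ec (fst x) (fst (snd x)) (snd (snd x))) : bm (borel >< (borel >< borel))"
  "(%x. ?Ea (fst x) (fst (snd x)) (snd (snd x))) : bm (borel >< (borel >< borel))" by measurable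
 have w: "integrable lborel ?w" by (rule integrable_osc_weight[OF rh eps])
 have kEa: "kernel 1 (?Ea z)" and kEc: "kernel 1 (?Ec z)" for z unfolding kernel_def by auto
 \<comment> \<open>The two inner translations merge into the multiplier \<open>?b\<close> before the
   field, the outer one acts after it; the change of total momentum in between leaves the phases
   \<open>?Ea\<close> and \<open>?Ec\<close>.\<close>
 have step: "?T (th *v x) (free_field m f (?T (- (th *v x)) (?T y (Gi u)))) = Gi (annK (?Ea (x, y)) ?h1 u + creaK (?Ec (x, y)) ?h2 u)" for x y proof -
  let ?b = "%ps. ex (- (th *v x)) ps * ex y ps"
  have b: "?b : bm LL" "cmod (?b ps) <= 1" "symm ?b" for ps by (measurable, simp add: norm_mult norm_exp_i_times, rule symm_comp[OF symm_tot])
  have yu: "mulop (ex y) u : hcar FK" by (rule mulop_fock[OF ex_facts u'(2)])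
  have bu: "mulop ?b u : cN N" by (rule mulop_fock_le[OF b u])
  have "?T (- (th *v x)) (?T y (Gi u)) = Gi (mulop ?b u)" unfolding translation_Gi[OF u'(2)] translation_Gi[OF yu] mulop_mulop[OF ex_facts(1,2) u'(3)] ..
  then have "free_field m f (?T (- (th *v x)) (?T y (Gi u))) = Gi (annK k1 ?h1 (mulop ?b u) + creaK k1 ?h2 (mulop ?b u))" by (simp only: free_field_Gi[OF f bu])
  moreover have A: "annK k1 ?h1 (mulop ?b u) : hcar FK" "creaK k1 ?h2 (mulop ?b u) : hcar FK" using annK_fock_le[OF kernel_one h(1) bu] creaK_fock_le[OF kernel_one h(2) bu] fock_le_fock by blast+
  moreover have "mulop (ex (th *v x)) (annK k1 ?h1 (mulop ?b u) + creaK k1 ?h2 (mulop ?b u)) = mulop (ex (th *v x)) (annK k1 ?h1 (mulop ?b u)) + mulop (ex (th *v x)) (creaK k1 ?h2 (mulop ?b u))"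
   by (rule linear_onD(1)[OF mulop_linear]) (use A fock_full in blast)+
  moreover have "mulop (ex (th *v x)) (annK k1 ?h1 (mulop ?b u)) = annK (?Ea (x, y)) ?h1 u" by (rule mulop_annK_mulop[OF ex_facts(1) b(1,2) kEa _ h(1) u'(1)]) (simp add: osc_phase_def mink_simps algebra_simps flip: exp_add)
  moreover have "mulop (ex (th *v x)) (creaK k1 ?h2 (mulop ?b u)) = creaK (?Ec (x, y)) ?h2 u" proof (rule mulop_creaK_mulop[OF ex_facts(1) b(1,2) _ h(2) u'(1)])
   fix k and qs :: "(real ^ 's) list" assume "k < length qs"
   from tot_rem_nth[OF this, symmetric] show "ex (th *v x) qs * ?b (rem_nth k qs) = ?Ec (x, y) (qs ! k) (tot (rem_nth k qs))" by (simp add: osc_phase_def mink_simps algebra_simps flip: exp_add)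
  qed
  ultimately show ?thesis using translation_Gi[OF hspace.add[OF hspace_fock A]] by simp
 qed
 note ai = annK_weak_integral[OF w Em(2) _ h(1) u, unfolded osc_kernel_def[symmetric]]
 note ci = creaK_weak_integral[OF w Em(1) _ h(2) u'(1), unfolded osc_kernel_def[symmetric]]
 note kK = kernel_osc[OF eps]
 let ?A = "annK (Ka eps) ?h1 u" and ?B = "creaK (Kc eps) ?h2 u"
 have AB: "?A : hcar FK" "?B : hcar FK" using annK_fock_le[OF kK(1) h(1) u] creaK_fock_le[OF kK(2) h(2) u] fock_le_fock by blast+
 have ABE: "annK (?Ea z) ?h1 u : hcar FK" "creaK (?Ec z) ?h2 u : hcar FK" for z using annK_fock_le[OF kEa h(1) u] creaK_fock_le[OF kEc h(2) u] fock_le_fock by blast+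
 have fL: "v : hcar FK ==> v : cL" for v using fock_full by blast
 have key: "cor (1 / (2 * pi) ^ CARD('s option)) * (itg lborel (%z. (case z of (x, y) => exp (- \<i> * cor (mink x y)) *
   rh (eps *\<^sub>R x, eps *\<^sub>R y) * hip FK v (?T (th *v x) (free_field m f (?T (- (th *v x)) (?T y (Gi u)))))))) = hip FK v (Gi (?A + ?B))" if v: "v : hcar FK" for v proof -
  note Gv = Gam_fock[OF V v] and vL = fL[OF v]
  have "cor (1 / (2 * pi) ^ CARD('s option)) * (case z of (x, y) => exp (- \<i> * cor (mink x y)) * rh (eps *\<^sub>R x, eps *\<^sub>R y) * hip FK v (?T (th *v x) (free_field m f (?T (- (th *v x)) (?T y (Gi u)))))) =
    ?w z * ipL (G v) (annK (?Ea z) ?h1 u) + ?w z * ipL (G v) (creaK (?Ec z) ?h2 u)" for z proof (cases z)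
   case (Pair x y)
   show ?thesis unfolding Pair prod.case step hip_simps hip_Gi(2)[OF L.add[OF fL[OF ABE(1)] fL[OF ABE(2)]] vL] L.hip_add_right[OF fL[OF Gv] fL[OF ABE(1)] fL[OF ABE(2)]] by (simp add: osc_weight_def algebra_simps)
  qed
  then have "cor (1 / (2 * pi) ^ CARD('s option)) * (itg lborel (%z. (case z of (x, y) => exp (- \<i> * cor (mink x y)) *
    rh (eps *\<^sub>R x, eps *\<^sub>R y) * hip FK v (?T (th *v x) (free_field m f (?T (- (th *v x)) (?T y (Gi u)))))))) = (itg lborel (%z. ?w z * ipL (G v) (annK (?Ea z) ?h1 u) + ?w z * ipL (G v) (creaK (?Ec z) ?h2 u)))"
   by (simp only: integral_mult_right_zero[symmetric])
  also have "... = ipL (G v) ?A + ipL (G v) ?B" using ai(1,2)[OF _ Gv] ci(1,2)[OF _ fL[OF Gv]] by (subst Bochner_Integration.integral_add) auto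
  also have "... = hip FK v (Gi (?A + ?B))" using AB Gv v fL by (simp add: hip_Gi L.hip_add_right)
  finally show ?thesis .
 qed
 have Gi_mem: "Gi (?A + ?B) : hcar FK" by (intro Gam_fock[OF Vi] hspace.add[OF hspace_fock] AB)
 show ?thesis unfolding warped_def proof (rule the_equality)
  show "Gi (?A + ?B) : hcar FK \<and> (\<forall>v\<in>hcar FK. hip FK v (Gi (?A + ?B)) = cor (1 / (2 * pi) ^ CARD('s option)) *
    (itg lborel (%z. (case z of (x, y) => exp (- \<i> * cor (mink x y)) * rh (eps *\<^sub>R x, eps *\<^sub>R y) * hip FK v (?T (th *v x) (free_field m f (?T (- (th *v x)) (?T y (Gi u)))))))))" using Gi_mem key by simp
  fix w assume "w : hcar FK \<and> (\<forall>v\<in>hcar FK. hip FK v w = cor (1 / (2 * pi) ^ CARD('s option)) * (itg lborel (%z. (case z of (x, y) => exp (- \<i> * cor (mink x y)) * rh (eps *\<^sub>R x, eps *\<^sub>R y) *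
     hip FK v (?T (th *v x) (free_field m f (?T (- (th *v x)) (?T y (Gi u)))))))))"
  then show "w = Gi (?A + ?B)" using Gi_mem key by (intro hspace.hip_eqI[OF hspace_fock]) auto
 qed
qed

lemma warped_tendsto: assumes f: "schwartz f" and u: "u : cN N" shows "((%eps. hnorm FK (warped FK (translation FK (coord_X m V)) th rh (free_field m f) eps (Gi u) - Gi (tfield f u))) ---> 0) (at_right 0)"
proof (rule tendsto_at_right_sequentially[of 0 1])
 interpret L: hspace "L2 LL :: ('s, complex) fk hilb" by (rule hspace_L2_LL)
 fix S :: "nat => real" assume S: "!!n. 0 < S n" "S ----> 0"
 let ?h1 = "V (aconj (f_minus m f))" and ?h2 = "V (f_plus m f)"
 note h = smear_H1[OF f]
 have u': "u : hcar (full_le N)" using u fock_le_full_le by blast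
 obtain C where C: "!!eps p q. 0 < eps ==> cmod (osc_kernel th rh eps p q) <= C" using osc_kernel_bound[OF rh skew] by blast
 \<comment> \<open>One constant for the regularised kernels and for their unimodular limit.\<close>
 let ?C = "max 1 C"
 have om: "(%x. osc_kernel th rh eps (a x) (b x)) : bm M" if "a : bm M" "b : bm M" for eps a b and M :: "'z measure" using measurable_compose[OF borel_measurable_Pair[OF that] borel_measurable_osc_kernel[OF rh]] by simp
 have k: "kernel ?C (Ka (S n))" "kernel ?C (Kc (S n))" for n unfolding kernel_def using C[OF S(1)] by (auto intro!: om simp: le_max_iff_disj)
 have k1: "kernel ?C kp" "kernel ?C ckp" using kernel_kp kernel_ckp by (auto simp: kernel_def le_max_iff_disj)
 have lc: "(%n. Kc (S n) p q) ----> kp p q" for p q unfolding kp_def by (rule osc_kernel_tendsto[OF rh skew rh0 S])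
 have la: "(%n. Ka (S n) p q) ----> ckp p q" for p q proof -
  \<comment> \<open>Skewness makes the quadratic term vanish, so the limit of the kernel at
    \<open>-p\<close> and \<open>p + q\<close> is exactly the conjugate of
    \<open>kp p q\<close>.\<close>
  have "mink (onshell m p) (th *v onshell m p) = 0" using skew_swap[OF skew, of "onshell m p" "onshell m p"] by (simp add: mink_commute)
  then have "exp (\<i> * cor (mink (- onshell m p) (th *v (onshell m p + q)))) = ckp p q" by (simp add: kp_def mink_simps matrix_vector_right_distrib exp_cnj)
  then show ?thesis using osc_kernel_tendsto[OF rh skew rh0 S, of "- onshell m p" "onshell m p + q"] by simp
 qed
 let ?A = "%n. annK (Ka (S n)) ?h1 u" and ?B = "%n. creaK (Kc (S n)) ?h2 u"
 have l: "(%n. nmL (?A n - annK ckp ?h1 u) + nmL (?B n - creaK kp ?h2 u)) ----> 0" using tendsto_add[OF annK_tendsto[OF k(1) k1(2) la h(1) u'] creaK_tendsto[OF k(2) k1(1) lc h(2) u']] by simp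
 have M: "?A n : cL" "annK ckp ?h1 u : cL" "?B n : cL" "creaK kp ?h2 u : cL" for n
  using annK_full_le(1)[OF k(1) h(1) u'] annK_full_le(1)[OF k1(2) h(1) u'] creaK_full_le(1)[OF k(2) h(2) u'] creaK_full_le(1)[OF k1(1) h(2) u'] full_le_full by blast+
 show "(%n. hnorm FK (warped FK (translation FK (coord_X m V)) th rh (free_field m f) (S n) (Gi u) - Gi (tfield f u))) ----> 0" proof (rule Lim_null_comparison[OF _ l], intro always_eventually allI)
  fix n
  have "Gi (?A n + ?B n) - Gi (tfield f u) = Gi ((?A n + ?B n) - tfield f u)" unfolding tfield_def by (rule linear_on_diff[OF L.carrier Gam_linear[OF Vi], symmetric]) (use M in auto)
  then have "hnorm FK (Gi (?A n + ?B n) - Gi (tfield f u)) = nmL ((?A n - annK ckp ?h1 u) + (?B n - creaK kp ?h2 u))" unfolding tfield_def using M by (simp add: Gam_hnorm[OF Vi] algebra_simps)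
  also have "... <= nmL (?A n - annK ckp ?h1 u) + nmL (?B n - creaK kp ?h2 u)" by (rule L.hnorm_triangle) (use M in auto)
  finally show "norm (hnorm FK (warped FK (translation FK (coord_X m V)) th rh (free_field m f) (S n) (Gi u) - Gi (tfield f u))) <= nmL (?A n - annK ckp ?h1 u) + nmL (?B n - creaK kp ?h2 u)"
   unfolding warped_Gi[OF f u S(1)] real_norm_def using M hspace.hnorm_nonneg[OF hspace_L2_LL L.diff[OF Gam_full[OF Vi L.add[OF M(1,3)]] Gam_full[OF Vi L.add[OF M(2,4)]]]] by (simp add: tfield_def)
 qed
qed simp

lemma core_fock_le: "u : core_domain m V ==> \<exists>N. \<exists>v\<in>cN N. u = Gi v" proof -
 assume "u : core_domain m V"
 then obtain v where v: "u = Gi v" "v : cspan {tensor fs |fs. set fs <= Delta_P m}" "v : hcar FK" by (auto simp: core_domain_def)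
 have "cspan {tensor fs |fs. set fs <= Delta_P m} <= fin" using Delta_P_H1 tensor_fin by (intro cspan_least[OF csubspace_fin]) blast
 then obtain N where "v : hcar (full_le N)" using v(2) by (auto simp: fin_def)
 then show ?thesis using fock_inter_full_le[OF v(3)] v(1) by blast
qed

lemma warped_core_tendsto: assumes f: "schwartz f" and u: "u : core_domain m V" shows "((%eps. hnorm FK (warped FK (translation FK (coord_X m V)) th rh (free_field m f) eps u - dfield f u)) ---> 0) (at_right 0)" proof -
 obtain N v where v: "v : cN N" "u = Gi v" using core_fock_le[OF u] by blast
 have "G (Gi v) = v" using v(1) fock_le_full by (intro GGi) blast
 then show ?thesis using warped_tendsto[OF f v(1)] by (simp add: dfield_def v(2))
qed

text \<open>The approximation must stay within \<open>fock_le N\<close>, since the deformed field is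
  continuous at bounded particle number. The vectors \<open>cvec\<close> with factors in
  \<open>Delta_P m\<close> achieve this: they are total there and lie in the span of
  tensors.\<close>

lemma core_dense: assumes u: "u : cN N" shows "\<exists>s. (\<forall>n::nat. s n : core_domain m V \<inter> cN N) \<and> (%n. nmL (s n - u)) ----> 0" proof -
 let ?S = "{cvec fs |fs. set fs <= Delta_P m \<and> length fs <= N}"
 obtain s where s: "!!n::nat. s n : cspan ?S" "(%n. nmL (s n - G u)) ----> 0" using hspace.total_dense[OF hspace_fock_le total_cvec Gam_fock_le[OF V u]] by auto
 have "?S <= cN N" using total_cvec by (simp add: hspace.total_def[OF hspace_fock_le])
 then have le: "s n : cN N" for n using cspan_least[OF hspace.carrier[OF hspace_fock_le]] s(1) by blast
 have "?S <= cspan {tensor fs |fs. set fs <= Delta_P m}" using cvec_span[OF Delta_P_H1] by auto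
 then have "s n : cspan {tensor fs |fs. set fs <= Delta_P m}" for n using cspan_least[OF csubspace_cspan] s(1) by blast
 then have core: "Gi (s n) : core_domain m V" for n unfolding core_domain_def using le fock_le_fock by blast
 have "nmL (Gi (s n) - u) = nmL (s n - G u)" for n using unitary_pair.hnorm_Wi_W_diff[OF unitary_pair_Gam[OF V], of "s n" u] le u fock_le_fock by auto
 then show ?thesis using core Gam_fock_le[OF Vi le] s(2) by (intro exI[of _ "%n. Gi (s n)"]) simp
qed

text \<open>\<open>dfield\<close> fits the description; conversely the limits fix any candidate on
  the core, and its bounds at fixed \<open>N\<close> extend the equality to all finite particle
  vectors.\<close>

lemma deformed_field_eq: assumes f: "schwartz f" shows "deformed_field m V th rh f = restrict (dfield f) FP" unfolding deformed_field_def proof (rule the_equality, goal_cases)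
 case 1
 have core_fp: "u : FP" if "u : core_domain m V" for u using core_fock_le[OF that] Gam_fock_le[OF Vi] by (auto simp: finite_particle_eq)
 show ?case proof (intro conjI allI ballI)
  show "linear_on FP (restrict (dfield f) FP)" using dfield_linear[OF f] csubspace_finite_particle unfolding linear_on_def csubspace_def by auto
  fix N
  obtain C where "!!u. u : cN N ==> nmL (dfield f u) <= C * nmL u" using dfield_bound[OF f] by blast
  then show "\<exists>C. \<forall>u\<in>FP. particles_le N u --> hnorm FK (restrict (dfield f) FP u) <= C * hnorm FK u" using particles_le_iff finite_particle_fock by (intro exI[of _ C]) auto
 qed (use dfield_fp[OF f] warped_core_tendsto[OF f] core_fp in auto)
 case (2 T)
 have "T u = dfield f u" if u: "u : FP" for u proof -
  interpret L: hspace "L2 LL :: ('s, complex) fk hilb" by (rule hspace_L2_LL)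
  obtain N where N: "u : cN N" using u by (auto simp: finite_particle_eq)
  have TF: "T v : cL" "dfield f v : cL" if "v : FP" for v using 2 dfield_fp[OF f that] that fp_full by blast+
  obtain C where C: "!!v. v : FP ==> particles_le N v ==> hnorm FK (T v) <= C * hnorm FK v" using 2 by blast
  obtain C' where C': "!!v. v : cN N ==> nmL (dfield f v) <= C' * nmL v" using dfield_bound[OF f] by blast
  obtain s where s: "!!n::nat. s n : core_domain m V" "!!n. s n : cN N" "(%n. nmL (s n - u)) ----> 0" using core_dense[OF N] by auto
  have sF: "s n : FP" for n using s(2) by (auto simp: finite_particle_eq)
  have eq: "T (s n) = dfield f (s n)" for n proof -
   obtain M v where v: "v : hcar (fock_le M)" "s n = Gi v" using core_fock_le[OF s(1)] by blast
   have h1: "annK (Ka eps) (V (aconj (f_minus m f))) v + creaK (Kc eps) (V (f_plus m f)) v : cL" if "0 < eps" for eps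
    using annK_full_le(1) creaK_full_le(1) smear_H1[OF f] kernel_osc[OF that] v(1) fock_le_full_le full_le_full by (intro L.add) blast+
   \<comment> \<open>Uniqueness of limits needs every approximant in the carrier, which
     \<open>warped_Gi\<close> gives for positive parameters; sampling at
     \<open>1 / real (Suc k)\<close> keeps all of them positive.\<close>
   have "filterlim (%k. 1 / real (Suc k)) (at_right 0) sequentially" using LIMSEQ_inverse_real_of_nat by (auto simp: filterlim_at inverse_eq_divide)
   note lim = filterlim_compose[OF _ this]
   show ?thesis proof (rule L.hlimit_unique)
    let ?w = "%k. warped FK (translation FK (coord_X m V)) th rh (free_field m f) (1 / real (Suc k)) (s n)"
    show "(%k. nmL (?w k - T (s n))) ----> 0" by (rule lim) (use 2 s(1) in simp)
    show "(%k. nmL (?w k - dfield f (s n))) ----> 0" by (rule lim) (use warped_core_tendsto[OF f s(1)] in simp)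
    show "?w k : cL" for k unfolding v(2) by (subst warped_Gi[OF f v(1)]) (auto intro!: Gam_full[OF Vi] h1)
   qed (use TF sF in auto)
  qed
  have Tl: "linear_on FP T" using 2 by blast
  show ?thesis proof (rule L.hlimit_unique)
   show "(%n. nmL (T (s n) - T u)) ----> 0" proof (rule Lim_null_comparison[OF _ tendsto_mult_right_zero[OF s(3), of C]], intro always_eventually allI)
    fix n
    have d: "s n - u : cN N" using s(2) N by (intro hspace.diff[OF hspace_fock_le])
    then have "s n - u : FP" "particles_le N (s n - u)" using particles_le_iff fock_le_fock by (auto simp: finite_particle_eq)
    then show "norm (nmL (T (s n) - T u)) <= C * nmL (s n - u)" using C[of "s n - u"] L.hnorm_nonneg[OF L.diff[OF TF(1)[OF sF] TF(1)[OF u]], of n] linear_on_diff[OF csubspace_finite_particle Tl sF u] by simp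
   qed
   show "(%n. nmL (T (s n) - dfield f u)) ----> 0" unfolding eq proof (rule Lim_null_comparison[OF _ tendsto_mult_right_zero[OF s(3), of C']], intro always_eventually allI)
    fix n
    have d: "s n - u : cN N" using s(2) N by (intro hspace.diff[OF hspace_fock_le])
    show "norm (nmL (dfield f (s n) - dfield f u)) <= C' * nmL (s n - u)" using C'[OF d] L.hnorm_nonneg[OF L.diff[OF TF(2)[OF sF] TF(2)[OF u]], of n] linear_on_diff[OF csubspace_finite_particle dfield_linear[OF f] sF u] by simp
   qed
  qed (use TF sF u in auto)
 qed
 then show ?case using 2 by (intro extensionalityI[of _ FP]) (auto simp: PiE_def)
qed

end

section \<open>The Moyal--Weyl side\<close>

locale weyl = fixes th :: "real ^ ('s::finite option) ^ ('s option)" and xh :: "'s option => ('v::chilbert \<times> 'v) set" and W :: "'s spacetime => 'v => 'v" assumes weyl: "moyal_weyl th xh W"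
begin

lemma W_group: "unitary_group whole (%t. W (t *\<^sub>R p))" using weyl by (simp add: moyal_weyl_def exp_group_def)

lemma W_unitary: "unitary_op whole whole (W p)" using unitary_groupD(1)[OF W_group[of p], of 1] by simp

lemma W_add: "W p (u + v) = W p u + W p v" and W_scale: "W p (c *c u) = c *c W p u" and W_cinner: "cinner (W p u) (W p v) = cinner u v" using linear_onD[OF unitary_opD(1)[OF W_unitary]] unitary_opD(3)[OF W_unitary] by auto

lemma W_norm: "norm (W p u) = norm u" proof -
 have "cor ((norm (W p u))^2) = cor ((norm u)^2)" unfolding cinner_norm[symmetric] by (rule W_cinner)
 then show ?thesis using power2_eq_imp_eq[OF _ norm_ge_zero norm_ge_zero] of_real_eq_iff by blast
qed

lemma W_zero: "W 0 u = u" using unitary_group_0[OF W_group, of u 0] by simp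

lemma W_diff: "W p (u - v) = W p u - W p v" using W_add[of p "u - v" v] by simp

text \<open>The metric sign in \<open>lower\<close> completes the double sum to a Minkowski product,
  and \<open>- 1/2\<close> times \<open>- 2 * \<i>\<close> leaves the coefficient
  \<open>\<i>\<close>, matching the limit of the oscillatory kernel.\<close>

lemma W_mult: "W p (W q u) = exp (\<i> * cor (mink p (th *v q))) *c W (p + q) u" proof -
 have "mink p (th *v q) = (\<Sum>\<mu>\<in>UNIV. \<Sum>\<nu>\<in>UNIV. p $ \<mu> * q $ \<nu> * lower th \<mu> \<nu>)" by (simp add: mink_eq_sum lower_def matrix_vector_mult_def sum_distrib_left mult_ac)
 then have "- (1/2) * (\<Sum>\<mu>\<in>UNIV. \<Sum>\<nu>\<in>UNIV. cor (p $ \<mu> * q $ \<nu>) * (- 2 * \<i> * cor (lower th \<mu> \<nu>))) = \<i> * cor (mink p (th *v q))" by (simp add: sum_distrib_left mult_ac)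
 then show ?thesis using weyl by (simp only: moyal_weyl_def)
qed

text \<open>Strong continuity in the parameter and isometry together give joint continuity in
  parameter and vector.\<close>

lemma W_tendsto: assumes t: "t ----> a" and v: "v ----> b" shows "(%n. W (t n *\<^sub>R p) (v n)) ----> W (a *\<^sub>R p) b" proof -
 have g: "((%s. norm (W (s *\<^sub>R p) b - b)) ---> norm (W (0 *\<^sub>R p) b - b)) (at 0)" using unitary_groupD(3)[OF W_group, of b p] by (simp add: W_zero)
 then have "(%n. norm (W ((t n - a) *\<^sub>R p) b - b)) ----> norm (W (0 *\<^sub>R p) b - b)" by (intro isCont_tendsto_compose[of 0 "%s. norm (W (s *\<^sub>R p) b - b)"]) (use t in "auto simp: isCont_def LIM_zero_iff")
 then have l: "(%n. norm (v n - b) + norm (W ((t n - a) *\<^sub>R p) b - b)) ----> 0" using tendsto_add[OF tendsto_norm_zero[OF LIM_zero[OF v]]] by (fastforce simp: W_zero)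
 have "norm (W (t n *\<^sub>R p) (v n) - W (a *\<^sub>R p) b) <= norm (v n - b) + norm (W ((t n - a) *\<^sub>R p) b - b)" for n proof -
  have "W (t n *\<^sub>R p) b = W (a *\<^sub>R p) (W ((t n - a) *\<^sub>R p) b)" using unitary_groupD(2)[OF W_group, of b a "t n - a" p] by simp
  then have "W (t n *\<^sub>R p) (v n) - W (a *\<^sub>R p) b = W (t n *\<^sub>R p) (v n - b) + W (a *\<^sub>R p) (W ((t n - a) *\<^sub>R p) b - b)" by (simp add: W_diff)
  then show ?thesis by (metis norm_triangle_ineq W_norm)
 qed
 then have "(%n. W (t n *\<^sub>R p) (v n) - W (a *\<^sub>R p) b) ----> 0" by (intro Lim_null_comparison[OF _ l]) auto
 then show ?thesis by (rule LIM_zero_cancel)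
qed

text \<open>Continuity is available along one direction at a time, so \<open>W (a x)\<close> is
  composed from the coordinate directions by the Weyl relation, with a measurable phase correcting
  each composition.\<close>

lemma smeas_W: assumes a: "a : bm M" and f: "smeas M f" shows "smeas M (%x. W (a x) (f x))" proof -
 have am: "(%x. a x $ \<mu>) : bm M" for \<mu> by (rule measurable_compose[OF a]) (auto intro!: borel_measurable_continuous_onI continuous_intros)
 let ?P = "%A x. \<Sum>\<mu>\<in>A. a x $ \<mu> *\<^sub>R axis \<mu> (1::real)"
 have *: "smeas M (%x. W (?P A x) (f x))" if "finite A" for A :: "'s option set" using that proof induction
  case empty then show ?case by (simp add: W_zero f)
 next
  case (insert \<mu> A)
  have m: "(%x. exp (- \<i> * cor (mink (a x $ \<mu> *\<^sub>R axis \<mu> 1) (th *v ?P A x)))) : bm M" using am by measurable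
  \<comment> \<open>The real coordinate is passed as a complex number because
    \<open>smeas_continuous2\<close> expects both arguments in Hilbert spaces.\<close>
  have "smeas M (%x. W (Re (cor (a x $ \<mu>)) *\<^sub>R axis \<mu> 1) (W (?P A x) (f x)))" by (rule smeas_continuous2[where h = "%c v. W (Re c *\<^sub>R axis \<mu> 1) v", OF _ insert.IH])
    (use am in "auto intro: W_tendsto tendsto_Re")
  from smeas_cscale[OF m this] show ?case using insert.hyps by (simp add: W_mult cscale_cscale cscale_one flip: exp_add)
 qed
 have "?P UNIV x = a x" for x by (simp add: vec_eq_iff axis_def if_distrib cong: if_cong)
 then show ?thesis using *[OF finite, of UNIV] by (simp only:)
qed

end

section \<open>Tensor products with the Moyal-Weyl representation space\<close>

context mass
begin

lemma cscale_sum_left: "(\<Sum>i\<in>I. c i) *c x = (\<Sum>i\<in>I. c i *c x)" by (induction I rule: infinite_finite_induct) (auto simp: cscale_add_left)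

lemma vtensor_mk: assumes f: "sqint LL f" shows "vtensor v (mk f) = mk (%ps. f ps *c v)" unfolding vtensor_def vl.mk_eq_iff_M using vl.repr_M(3)[OF vl.sqint_strong[OF f]] by eventually_elim simp

lemma sqint_cscale_unit: fixes f :: "(real ^ 's) list => complex" and w :: "(real ^ 's) list => 'v::chilbert" assumes f: "sqint LL f" and w: "smeas LL w" "!!ps. norm (w ps) = c" shows "sqint LL (%ps. f ps *c w ps)" proof -
 have "integrable LL (%ps. (cmod (f ps))^2 * c\<^sup>2)" using vl.sqint_norm_sq[OF f] by simp
 then have "(nni LL (%ps. en ((norm (f ps *c w ps))^2))) < \<infinity>" unfolding integrable_iff_bounded by (simp add: norm_cscale w(2) power_mult_distrib)
 then show ?thesis unfolding vl.sqint_iff using smeas_cscale[OF vl.sqint_borel[OF f] w(1)] by simp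
qed

lemma hip_vtensor: assumes f: "sqint LL f" and g: "sqint LL g" shows "ipL (vtensor v (mk f)) (mk g) = (itg LL (%ps. cnj (f ps) * cinner v (g ps)))" unfolding vtensor_mk[OF f]
 by (subst vl.hip_mk[OF vl.sqint_strong[OF sqint_cscale_unit[OF f smeas_const refl]] vl.sqint_strong[OF g]]) (simp add: cinner_cscale_left)

lemma vtensor_fock: fixes u :: "('s, complex) fk" shows "u : cF ==> vtensor v u : cF" proof (elim fockE)
 fix f assume f: "u = mk f" "sqint LL f" "!!ps qs. mset ps = mset qs ==> f ps = f qs"
 show "vtensor v u : cF" unfolding f(1) vtensor_mk[OF f(2)] by (rule fockI[OF sqint_cscale_unit[OF f(2) smeas_const refl]]) (use f(3) in metis)
qed

lemma hip_vtensor_vtensor: assumes u: "u : cF" "u' : cF" shows "ipL (vtensor v u) (vtensor v' u') = cinner v v' * ipL u u'" proof -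
 obtain f where f: "u = mk f" "sqint LL f" using u(1) by (rule fockE) blast
 obtain g where g: "u' = mk g" "sqint LL g" using u(2) by (rule fockE) blast
 show ?thesis unfolding f(1) g(1) vtensor_mk[OF g(2)] using f(2) g(2) by (subst hip_vtensor[OF f(2) sqint_cscale_unit[OF g(2) smeas_const refl]])
   (simp add: vl.hip_mk vl.sqint_borel cinner_cscale_right mult.left_commute[of "cnj _" "f' _" for f'] mult.commute[of _ "cinner v v'"] mult.left_commute[of _ "cinner v v'"])
qed

text \<open>Testing with the scalar function \<open>cinner v (g ps)\<close> tensored with
  \<open>v\<close> shows that this function vanishes almost everywhere. Strong measurability
  supplies a countable \<open>C\<close> whose closure contains all values of \<open>g\<close>, so
  countably many \<open>v\<close> force \<open>g ps = 0\<close>.\<close>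

lemma total_vtensor: "hspace.total (fock m) ((%(v, u). vtensor v u) ` (UNIV \<times> cF) :: ((real ^ 's) list, 'v::chilbert) aefun set)" unfolding hspace.total_def[OF hspace_fock] proof (intro conjI ballI impI)
 show "(%(v, u). vtensor v u) ` (UNIV \<times> cF) <= hcar (fock m :: ('s, 'v) fk hilb)" using vtensor_fock by auto
 fix w :: "('s, 'v) fk" assume w: "w : cF" and z: "\<forall>s\<in>(%(v, u). vtensor v u) ` (UNIV \<times> cF). hip (fock m) s w = 0"
 obtain g where g: "w = mk g" "sqint LL g" "!!ps qs. mset ps = mset qs ==> g ps = g qs" using w by (rule fockE) blast
 have gm: "smeas LL g" by (rule vl.sqint_strong[OF g(2)])
 have AE0: "AE ps in LL. cinner v (g ps) = 0" for v proof -
  have sq: "sqint LL (%ps. cinner v (g ps))" proof -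
   have m: "(%ps. cinner v (g ps)) : bm LL" by (rule borel_measurable_cinner[OF smeas_const gm])
   have "integrable LL (%ps. (norm v)^2 * (norm (g ps))^2)" using vl.sqint_norm_sq[OF g(2)] by simp
   then have "(nni LL (%ps. en ((norm v)^2 * (norm (g ps))^2))) < \<infinity>" unfolding integrable_iff_bounded by simp
   moreover have "(nni LL (%ps. en ((cmod (cinner v (g ps)))^2))) <= (nni LL (%ps. en ((norm v)^2 * (norm (g ps))^2)))"
    unfolding power_mult_distrib[symmetric] by (intro nn_integral_mono ennreal_leI power_mono cinner_Cauchy_Schwarz) auto
   ultimately show ?thesis using m by (simp add: vl.sqint_iff)
  qed
  have F: "mk (%ps. cinner v (g ps)) : cF" by (rule fockI[OF sq]) (use g(3) in metis)
  have "ipL (vtensor v (mk (%ps. cinner v (g ps)))) w = 0" using z F by auto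
  then have "ipL (mk (%ps. cinner v (g ps))) (mk (%ps. cinner v (g ps))) = 0" unfolding g(1) hip_vtensor[OF sq g(2)] using sq by (simp add: vl.hip_mk vl.sqint_borel)
  then have "mk (%ps. cinner v (g ps)) = (0 :: ('s, complex) fk)" using hspace.hip_definite[OF hspace_fock F] by simp
  then have "mk (%ps. cinner v (g ps)) = mk (%_ :: (real ^ 's) list. 0 :: complex)" by (simp only: mk_zero)
  then show ?thesis unfolding vl.mk_eq_iff_M .
 qed
 obtain C where C: "countable C" "!!ps. ps : space LL ==> g ps : closure C" using gm by (auto simp: strongly_measurable_def)
 have "AE ps in LL. \<forall>v\<in>C. cinner v (g ps) = 0" unfolding AE_ball_countable[OF C(1)] using AE0 by blast
 then have "AE ps in LL. g ps = 0" using AE_space proof eventually_elim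
  case (elim ps)
  obtain x where x: "!!n::nat. x n : C" "x ----> g ps" using C(2)[OF elim(2)] closure_sequential by blast
  have "(%n. cinner (x n) (g ps)) ----> cinner (g ps) (g ps)" by (intro tendsto_cinner x tendsto_const)
  then have "cinner (g ps) (g ps) = 0" using x(1) elim(1) by (simp add: LIMSEQ_const_iff)
  then show ?case by (simp add: cinner_norm)
 qed
 then have "mk g = mk (%_ :: (real ^ 's) list. 0 :: 'v)" unfolding vl.mk_eq_iff_M .
 then show "w = 0" by (simp only: g(1) mk_zero)
qed

text \<open>Inner products of the vectors \<open>vtensor v u\<close> factorise, so a unitary
  \<open>A\<close> preserves their Gram matrix, and \<open>isometry_extension\<close> yields the
  operator described by \<open>amplify\<close>.\<close>

lemma amplify_facts: fixes A :: "('s, complex) fk => ('s, complex) fk" assumes A: "unitary_op (fock m) (fock m) A"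
 defines "T \<equiv> amplify m A :: ((real ^ 's) list, 'v::chilbert) aefun => ('s, 'v) fk" shows amplify_bounded: "bounded_op (fock m) (fock m) T" and amplify_unitary: "unitary_op (fock m) (fock m) T"
  and amplify_vtensor: "u : cF ==> T (vtensor v u) = vtensor v (A u)" proof -
 let ?I = "UNIV \<times> cF :: ('v \<times> ('s, complex) fk) set"
 let ?t = "%(v, u). vtensor v (A u) :: ('s, 'v) fk"
 have AF: "A u : cF" if "u : cF" for u using unitary_opD(2)[OF A that] .
 have "?t ` ?I = (%(v, u). vtensor v u) ` ?I" proof
  show "?t ` ?I <= (%(v, u). vtensor v u) ` ?I" using AF by force
  show "(%(v, u). vtensor v u) ` ?I <= ?t ` ?I" proof clarify
   fix v :: 'v and u :: "('s, complex) fk" assume "u : cF"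
   then obtain u' where "u' : cF" "u = A u'" using unitary_opD(4)[OF A] by (auto simp: bij_betw_def)
   then show "vtensor v u : ?t ` ?I" by (intro image_eqI[of _ _ "(v, u')"]) auto
  qed
 qed
 then have t: "hspace.total (fock m) (?t ` ?I)" using total_vtensor by simp
 have gram: "hip (fock m) (?t i) (?t j) = hip (fock m) (case i of (v, u) => vtensor v u) (case j of (v, u) => vtensor v u)" if "i : ?I" "j : ?I" for i j using that AF unitary_opD(3)[OF A] by (auto simp: hip_vtensor_vtensor)
 have "\<exists>T'. bounded_op (fock m) (fock m) T' \<and> (\<forall>i\<in>?I. T' (case i of (v, u) => vtensor v u) = ?t i) \<and> unitary_op (fock m) (fock m) T' \<and>
  (\<forall>T''. bounded_op (fock m) (fock m) T'' --> (\<forall>i\<in>?I. T'' (case i of (v, u) => vtensor v u) = ?t i) --> T'' = T')" proof (rule isometry_extension[OF hspace_fock hspace_fock total_vtensor t])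
  fix T' assume T': "bounded_op (fock m) (fock m) T'" "!!i. i : ?I ==> T' (case i of (v, u) => vtensor v u) = ?t i" "unitary_op (fock m) (fock m) T'"
   "!!T''. bounded_op (fock m) (fock m) T'' ==> (!!i. i : ?I ==> T'' (case i of (v, u) => vtensor v u) = ?t i) ==> T'' = T'"
  show ?thesis proof (intro exI[of _ T'] conjI ballI allI impI)
   show "T'' = T'" if "bounded_op (fock m) (fock m) T''" "\<forall>i\<in>?I. T'' (case i of (v, u) => vtensor v u) = ?t i" for T'' by (rule T'(4)[OF that(1)]) (rule bspec[OF that(2)])
  qed (fact T')+
 qed (rule gram)
 then obtain T' where T': "bounded_op (fock m) (fock m) T'" "!!i. i : ?I ==> T' (case i of (v, u) => vtensor v u) = ?t i"
  "unitary_op (fock m) (fock m) T'"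
  "!!T''. bounded_op (fock m) (fock m) T'' ==> (\<forall>i\<in>?I. T'' (case i of (v, u) => vtensor v u) = ?t i) ==> T'' = T'" by (elim exE conjE) (rule that, assumption, erule bspec, assumption+, blast)
 have "T = T'" unfolding T_def amplify_def proof (rule the_equality)
  show "bounded_op (fock m) (fock m) T' \<and> (\<forall>v. \<forall>\<Psi>\<in>cF. T' (vtensor v \<Psi>) = vtensor v (A \<Psi>))" using T'(1) T'(2)[of "(v, \<Psi>)" for v \<Psi>] by auto
  show "T'' = T'" if "bounded_op (fock m) (fock m) T'' \<and> (\<forall>v. \<forall>\<Psi>\<in>cF. T'' (vtensor v \<Psi>) = vtensor v (A \<Psi>))" for T'' using that by (intro T'(4)) auto
 qed
 then show "bounded_op (fock m) (fock m) T" "unitary_op (fock m) (fock m) T" "u : cF ==> T (vtensor v u) = vtensor v (A u)" using T'(1,3) T'(2)[of "(v, u)"] by auto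
qed

lemma amplify_cancel: fixes A B :: "('s, complex) fk => ('s, complex) fk" and w :: "((real ^ 's) list, 'v::chilbert) aefun" assumes A: "unitary_op (fock m) (fock m) A" and B: "unitary_op (fock m) (fock m) B"
  and AB: "!!u. u : cF ==> A (B u) = u" and w: "w : cF" shows "amplify m A (amplify m B w) = w" proof -
 let ?H = "fock m :: ('s, 'v) fk hilb"
 let ?T = "restrict (%w. amplify m A (amplify m B w)) (hcar ?H)"
 note a = amplify_unitary[OF A, where 'v = 'v] and b = amplify_unitary[OF B, where 'v = 'v]
 have ab: "unitary_op ?H ?H (%w. amplify m A (amplify m B w))" using unitary_comp[OF b a] by (simp add: comp_def)
 interpret H: hspace ?H by (rule hspace_fock)
 have bnd: "bounded_op ?H ?H ?T" unfolding bounded_op_def using unitary_opD[OF ab] H.carrier by (auto simp: linear_on_def csubspace_def hnorm_def intro!: exI[of _ 1])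
 have id: "bounded_op ?H ?H (restrict (%w. w) (hcar ?H))" unfolding bounded_op_def using H.carrier by (auto simp: linear_on_def csubspace_def intro!: exI[of _ 1])
 have "?T = restrict (%w. w) (hcar ?H)" by (rule bounded_op_eqI[OF bnd id hspace_fock hspace_fock total_vtensor]) (auto simp: amplify_vtensor[OF B] amplify_vtensor[OF A] unitary_opD(2)[OF B] AB vtensor_fock)
 from fun_cong[OF this, of w] show ?thesis using w by simp
qed

end

section \<open>Intertwining of the deformed field with the field on Moyal-Weyl space\<close>

locale mw = deformation m s_type V th rh + weyl th xh W for m and s_type :: "'s::finite itself" and V th rh and xh :: "'s option => ('v::chilbert \<times> 'v) set" and W + fixes \<xi> :: 'v assumes \<xi>: "norm \<xi> = 1"
begin

abbreviation "FV \<equiv> fock m :: ('s, 'v) fk hilb"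
abbreviation "AG \<equiv> amplify m G :: ('s, 'v) fk => _"
abbreviation "AGi \<equiv> amplify m Gi :: ('s, 'v) fk => _"
abbreviation "VP \<equiv> V_P m W \<xi>"
abbreviation "VT \<equiv> Vtilde m V W \<xi>"

lemmas GU = unitary_Gam_fock[OF V] and GiU = unitary_Gam_fock[OF Vi]

lemma AGi: "w : hcar FV ==> AGi w : hcar FV" "w : hcar FV ==> w' : hcar FV ==> ipL (AGi w) (AGi w') = ipL w w'"
 "linear_on (hcar FV) AGi" using unitary_opD[OF amplify_unitary[OF GiU, where 'v = 'v]] by auto

lemma AG_AGi: "w : hcar FV ==> AG (AGi w) = w" by (rule amplify_cancel[OF GU GiU]) (use GGi fock_full in blast)

lemma Wtot: "smeas LL (%ps. W (tot ps) \<xi>)" by (rule smeas_W[OF measurable_total_momentum smeas_const])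

lemma V_P_mk: assumes f: "sqint LL f" shows "VP (mk f) = mk (%ps. f ps *c W (tot ps) \<xi>)" "sqint LL (%ps. f ps *c W (tot ps) \<xi>)" proof -
 show "VP (mk f) = mk (%ps. f ps *c W (tot ps) \<xi>)" unfolding V_P_def vl.mk_eq_iff_M using vl.repr_M(3)[OF vl.sqint_strong[OF f]] by eventually_elim simp
 show "sqint LL (%ps. f ps *c W (tot ps) \<xi>)" by (rule sqint_cscale_unit[OF f Wtot]) (simp add: W_norm)
qed

lemma V_P_fock: assumes u: "u : hcar FK" shows "VP u : hcar FV" proof -
 obtain f where f: "u = mk f" "sqint LL f" "!!ps qs. mset ps = mset qs ==> f ps = f qs" using u by (rule fockE) blast
 show ?thesis unfolding f(1) V_P_mk(1)[OF f(2)] by (rule fockI[OF V_P_mk(2)[OF f(2)]]) (metis f(3) total_momentum_mset)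
qed

lemma V_P_linear: "linear_on (cL) VP" unfolding linear_on_def proof (intro conjI ballI allI)
 fix u v :: "('s, complex) fk" and c assume "u : cL" "v : cL"
 then obtain f g :: "(real ^ 's) list => complex" where f: "u = mk f" "sqint LL f" and g: "v = mk g" "sqint LL g" by (auto simp: vl.L2_carrier)
 show "VP (u + v) = VP u + VP v" unfolding f(1) g(1) mk_plus V_P_mk(1)[OF f(2)] V_P_mk(1)[OF g(2)] V_P_mk(1)[OF vl.sqint_add[OF f(2) g(2)]] by (simp add: cscale_add_left)
 show "VP (c *c u) = c *c VP u" unfolding f(1) mk_scale V_P_mk(1)[OF f(2)] V_P_mk(1)[OF vl.sqint_scale[OF f(2)]] by (simp add: cscale_cscale cscale_complex_def)
qed

lemma V_P_hip: assumes "u : cL" "v : cL" shows "ipL (VP u) (VP v) = ipL u v" proof -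
 obtain f g :: "(real ^ 's) list => complex" where f: "u = mk f" "sqint LL f" and g: "v = mk g" "sqint LL g" using assms by (auto simp: vl.L2_carrier)
 have "cinner \<xi> \<xi> = 1" by (simp add: cinner_norm \<xi>)
 then have "cinner (f ps *c W (tot ps) \<xi>) (g ps *c W (tot ps) \<xi>) = cinner (f ps) (g ps)" for ps by (simp add: cinner_cscale_left cinner_cscale_right W_cinner cinner_complex_def)
 then show ?thesis unfolding f(1) g(1) V_P_mk(1)[OF f(2)] V_P_mk(1)[OF g(2)] using V_P_mk(2)[OF f(2)] V_P_mk(2)[OF g(2)] f(2) g(2) by (subst (1 2) vl.hip_mk) (auto intro: vl.sqint_strong simp del: cinner_complex)
qed

lemma crea_mw_V_P: assumes h: "h : hcar H1" and u: "u : cN N" shows "crea_mw m W h (VP u) = VP (creaK kp h u)" proof -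
 obtain g where g: "h = mk g" "sqint Mu g" using h by (rule H1E)
 obtain f where f: "u = mk f" "sqint LL f" "!!ps. N < length ps ==> f ps = 0" using u by (elim fock_leE) blast
 have sq: "sqint LL (crea_fun kp g f)" by (rule sqint_crea_fun[where N = N, OF kernel_kp g(2) f(2)]) (rule f(3))
 show ?thesis unfolding f(1) g(1) creaK_mk[OF g(2) f(2)] V_P_mk(1)[OF sq] V_P_mk(1)[OF f(2)] crea_mw_def vl.mk_eq_iff_M
  using AE_nth[OF vm.repr_M(3)[OF vm.sqint_strong[OF g(2)]]] AE_rem_nth[OF vl.repr_M(3)[OF vl.sqint_strong[OF V_P_mk(2)[OF f(2)]]]] proof eventually_elim
  case (elim qs)
  let ?r = "repr (mk (%ps. f ps *c W (tot ps) \<xi>))"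
  have "repr (mk g) (qs ! k) *c W (onshell m (qs ! k)) (?r (take k qs @ drop (Suc k) qs)) = (g (qs ! k) * kp (qs ! k) (tot (rem_nth k qs)) * f (rem_nth k qs)) *c W (tot qs) \<xi>" if k: "k < length qs" for k
   using elim k by (simp add: W_scale W_mult cscale_cscale tot_rem_nth[OF k] kp_def mult_ac flip: rem_nth_def)
  then show ?case by (simp add: crea_fun_def cscale_cscale cscale_sum_left[symmetric])
 qed
qed

text \<open>\<open>ann_mw\<close> is linear in its smearing function while \<open>annK\<close>
  conjugates its own, hence \<open>aconj h\<close>. The operator \<open>W (- onshell m p)\<close>
  removes the momentum \<open>p\<close> from the Weyl factor of the state and leaves the phase
  \<open>ckp\<close>.\<close>

lemma ann_mw_V_P: assumes h: "h : hcar H1" and u: "u : cN N" shows "ann_mw m W (aconj h) (VP u) = VP (annK ckp h u)" proof -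
 obtain g where g: "h = mk g" "sqint Mu g" using h by (rule H1E)
 obtain f where f: "u = mk f" "sqint LL f" "!!ps. N < length ps ==> f ps = 0" using u by (elim fock_leE) blast
 have sq: "sqint LL (ann_fun ckp g f)" by (rule sqint_ann_fun[where N = N, OF kernel_ckp g(2) f(2)]) (rule f(3))
 note sg = vm.sqint_strong[OF sqint_cnj[OF g(2)]] and sf = vl.sqint_strong[OF V_P_mk(2)[OF f(2)]]
 let ?r = "repr (mk (%ps. f ps *c W (tot ps) \<xi>))" and ?g = "repr (mk (%p. cnj (g p)))"
 show ?thesis unfolding f(1) g(1) annK_mk[OF kernel_ckp g(2) f(2)] V_P_mk(1)[OF sq] V_P_mk(1)[OF f(2)] aconj_mk[OF g(2)] ann_mw_def vl.mk_eq_iff_M using AE_L_Cons(2)[OF vl.repr_M(3)[OF sf]] proof eventually_elim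
  case (elim ps)
  let ?s = "%p. cnj (g p) * ckp p (tot ps) * f (p # ps)" and ?F = "%p. ?g p *c W (- onshell m p) (?r (p # ps))"
  have AEF: "AE p in Mu. ?F p = ?s p *c W (tot ps) \<xi>" using elim vm.repr_M(3)[OF sg] proof eventually_elim
   case (elim p)
   \<comment> \<open>When \<open>W\<close> at \<open>-p\<close> meets \<open>W\<close> at
     \<open>p + q\<close>, the term of the phase quadratic in \<open>p\<close> vanishes by
     skewness.\<close>
   have "mink (onshell m p) (th *v onshell m p) = 0" using skew_swap[OF skew, of "onshell m p" "onshell m p"] by (simp add: mink_commute)
   then show ?case using elim by (simp add: W_scale W_mult cscale_cscale kp_def mink_simps matrix_vector_right_distrib exp_cnj mult_ac)
  qed
  have sec: "(%p. p # ps) : measurable Mu LL" by (intro measurable_Cons_L' measurable_ident_sets measurable_const) auto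
  have os: "(%p. - onshell m p) : bm Mu" unfolding measurable_mu_iff by measurable
  have Fm: "smeas Mu ?F" by (intro smeas_cscale smeas_borel[OF vm.repr_M(1)[OF sg]] smeas_W[OF os] smeas_compose[OF vl.repr_M(1)[OF sf] sec])
  have sm: "?s : bm Mu" by (rule measurable_ann_integrand[OF kernel_ckp vm.sqint_borel[OF g(2)] vl.sqint_borel[OF f(2)]])
  have "(itg Mu (%p. cinner v (?F p))) = cinner v ((itg Mu (%p. ?s p)) *c W (tot ps) \<xi>)" for v proof -
   have "(itg Mu (%p. cinner v (?F p))) = (itg Mu (%p. cinner v (?s p *c W (tot ps) \<xi>)))"
    by (rule integral_cong_AE[OF borel_measurable_cinner[OF smeas_const Fm] borel_measurable_cinner[OF smeas_const smeas_cscale[OF sm smeas_const]]]) (use AEF in eventually_elim, simp only:)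
   then show ?thesis by (simp add: cinner_cscale_right)
  qed
  \<comment> \<open>The scalar integral times the fixed vector has the required pairings with every
    \<open>v\<close>, and \<open>cinner_ext\<close> makes it the only such vector.\<close>
  then have "weak_integral Mu ?F = (itg Mu (%p. ?s p)) *c W (tot ps) \<xi>" unfolding weak_integral_def by (intro the_equality) (auto intro: cinner_ext)
  then show ?case by (simp add: ann_fun_def cscale_cscale)
 qed
qed

lemma field_mw_V_P: assumes f: "schwartz f" and u: "u : cN N" shows "field_mw m W V f (VP u) = VP (tfield f u)" proof -
 have u': "u : hcar (full_le N)" using u fock_le_full_le by blast
 show ?thesis unfolding field_mw_def tfield_def ann_mw_V_P[OF smear_H1(1)[OF f] u] crea_mw_V_P[OF smear_H1(2)[OF f] u] by (rule linear_onD(1)[OF V_P_linear, symmetric])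
   (use annK_full_le(1)[OF kernel_ckp smear_H1(1)[OF f] u'] creaK_full_le(1)[OF kernel_kp smear_H1(2)[OF f] u'] full_le_full in blast)+
qed

lemma VT_eq: "VT u = AGi (VP (G u))" by (simp add: Vtilde_def)

lemma VT_fock: "u : hcar FK ==> VT u : hcar FV" unfolding VT_eq by (intro AGi V_P_fock Gam_fock[OF V])

lemma VT_hip: assumes u: "u : hcar FK" and v: "v : hcar FK" shows "ipL (VT u) (VT v) = ipL u v" proof -
 have L: "u : cL" "v : cL" using u v fock_full by blast+
 show ?thesis unfolding VT_eq AGi(2)[OF V_P_fock[OF Gam_fock[OF V u]] V_P_fock[OF Gam_fock[OF V v]]] V_P_hip[OF Gam_full[OF V L(1)] Gam_full[OF V L(2)]] Gam_hip[OF V L] ..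
qed

lemma VT_linear: "linear_on (hcar FK) VT" proof -
 have L: "u : cL" if "u : hcar FK" for u using that fock_full by blast
 show ?thesis unfolding linear_on_def VT_eq by (auto simp: linear_onD[OF Gam_linear[OF V]] linear_onD[OF V_P_linear] linear_onD[OF AGi(3)] L Gam_full[OF V] V_P_fock Gam_fock[OF V])
qed

lemma transformed_field_VT: assumes f: "schwartz f" and u: "u : FP" shows "transformed_field m W V f (VT u) = VT (dfield f u)" proof -
 obtain N where N: "u : cN N" using u by (auto simp: finite_particle_eq)
 note g = Gam_fock_le[OF V N]
 have "VP (G u) : hcar FV" using g fock_le_fock by (intro V_P_fock) blast
 then have "transformed_field m W V f (VT u) = AGi (VP (tfield f (G u)))" unfolding transformed_field_def VT_eq by (simp add: AG_AGi field_mw_V_P[OF f g])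
 moreover have "G (dfield f u) = tfield f (G u)" unfolding dfield_def by (rule GGi) (use tfield_fock_le[OF f g] fock_le_full in blast)
 ultimately show ?thesis by (simp add: VT_eq)
qed

end

section \<open>Star algebras generated by operators with adjoints\<close>

text \<open>\<open>is_star_algebra\<close> demands for every element an adjoint that preserves the
  domain; its existence is carried as an invariant of the generation.\<close>

definition adjointable :: "'a::cvector hilb => 'a set => ('a => 'a) => bool" where "adjointable H D A \<longleftrightarrow> A : D \<rightarrow>\<^sub>E D \<and> linear_on D A \<and> (\<exists>B. is_adj H D A B)"

lemma hip_eqI_subspace: assumes H: "hspace H" and D: "csubspace D" "D <= hcar H" and xy: "x : D" "y : D" and eq: "!!w. w : D ==> hip H w x = hip H w y" shows "x = y" proof -
 interpret hspace H by fact
 have d: "x - y : D" by (rule csubspace_diff[OF D(1) xy])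
 have m: "x : hcar H" "y : hcar H" "x - y : hcar H" using d xy D(2) by auto
 have "hip H (x - y) (x - y) = 0" using hip_diff_right[OF m(3,1,2)] eq[OF d] by simp
 then show ?thesis using hip_definite[OF m(3)] by simp
qed

lemma is_adj_unique: assumes H: "hspace H" and D: "csubspace D" "D <= hcar H" and B: "is_adj H D A B" "is_adj H D A B'" shows "B = B'" proof (rule extensionalityI)
 show "B : extensional D" "B' : extensional D" using B by (auto simp: is_adj_def PiE_def)
 show "B v = B' v" if v: "v : D" for v by (rule hip_eqI_subspace[OF H D]) (use B v in "auto simp: is_adj_def")
qed

lemma is_adj_sym: assumes H: "hspace H" and D: "D <= hcar H" and A: "A : D \<rightarrow>\<^sub>E D" and adj: "is_adj H D A B" shows "is_adj H D B A" unfolding is_adj_def proof (intro conjI ballI A)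
 interpret hspace H by fact
 fix u v assume uv: "u : D" "v : D"
 then have m: "A v : hcar H" "B u : hcar H" "u : hcar H" "v : hcar H" using A adj D by (auto simp: is_adj_def)
 have "hip H (B u) v = cnj (hip H v (B u))" by (rule hip_commute[OF m(2,4)])
 also have "hip H v (B u) = hip H (A v) u" using adj uv by (simp add: is_adj_def)
 also have "cnj ... = hip H u (A v)" by (rule hip_commute[OF m(3,1), symmetric])
 finally show "hip H (B u) v = hip H u (A v)" .
qed

text \<open>Adjoints of sums, multiples and products are formed from those of the parts, with
  conjugated scalars and reversed order; for an adjoint, the original operator is its star.\<close>

lemma star_alg_facts: assumes H: "hspace H" and D: "csubspace D" "D <= hcar H" and gens: "S <= {A. adjointable H D A}" and A: "A : star_alg H D S" shows "adjointable H D A" using A unfolding adjointable_def proof induction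
 interpret hspace H by fact
 note sub = D(1)[unfolded csubspace_def]
 {
  case (gen A) then show ?case using gens by (auto simp: adjointable_def)
 next
  case one
  have "is_adj H D (\<lambda>u\<in>D. u) (\<lambda>u\<in>D. u)" by (auto simp: is_adj_def)
  moreover have "linear_on D (\<lambda>u\<in>D. u)" using sub by (auto simp: linear_on_def)
  moreover have "restrict (%u. u) D : D \<rightarrow>\<^sub>E D" by auto
  ultimately show ?case by blast
 next
  case (add A B)
  then obtain A' B' where ab: "is_adj H D A A'" "is_adj H D B B'" by blast
  have m: "A u : D" "B u : D" "A' u : D" "B' u : D" if "u : D" for u using add ab that by (auto simp: is_adj_def)
  have "is_adj H D (\<lambda>u\<in>D. A u + B u) (\<lambda>u\<in>D. A' u + B' u)" using ab m sub D(2) by (auto simp: is_adj_def hip_add_left hip_add_right subset_iff)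
  moreover have "linear_on D (\<lambda>u\<in>D. A u + B u)" using add m sub by (auto simp: linear_on_def cscale_add_right)
  moreover have "(\<lambda>u\<in>D. A u + B u) : D \<rightarrow>\<^sub>E D" using m sub by auto
  ultimately show ?case by blast
 next
  case (scale A c)
  then obtain A' where a: "is_adj H D A A'" by blast
  have m: "A u : D" "A' u : D" if "u : D" for u using scale a that by (auto simp: is_adj_def)
  have "is_adj H D (\<lambda>u\<in>D. c *c A u) (\<lambda>u\<in>D. cnj c *c A' u)" using a m sub D(2) by (auto simp: is_adj_def hip_scale_left hip_scale_right subset_iff)
  moreover have "linear_on D (\<lambda>u\<in>D. c *c A u)" using scale m sub by (auto simp: linear_on_def cscale_add_right cscale_cscale mult.commute)
  moreover have "(\<lambda>u\<in>D. c *c A u) : D \<rightarrow>\<^sub>E D" using m sub by auto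
  ultimately show ?case by blast
 next
  case (mult A B)
  then obtain A' B' where ab: "is_adj H D A A'" "is_adj H D B B'" by blast
  have m: "A u : D" "B u : D" "A' u : D" "B' u : D" if "u : D" for u using mult ab that by (auto simp: is_adj_def)
  have "is_adj H D (compose D A B) (compose D B' A')" using ab m by (auto simp: is_adj_def compose_def)
  moreover have "linear_on D (compose D A B)" using mult m sub by (auto simp: linear_on_def compose_def)
  moreover have "(compose D A B) : D \<rightarrow>\<^sub>E D" using m by (auto simp: compose_def)
  ultimately show ?case by blast
 next
  case (adj A B)
  have B: "B : D \<rightarrow>\<^sub>E D" "is_adj H D B A" using adj is_adj_sym[OF H D(2)] by (auto simp: is_adj_def)
  have BD: "B u : D" if "u : D" for u using B(1) that by auto
  have e: "hip H w (B u) = hip H (A w) u" if "u : D" "w : D" for u w using adj that by (simp add: is_adj_def)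
  have AD: "A w : D" if "w : D" for w using adj that by auto
  \<comment> \<open>Linearity of an adjoint is obtained weakly, by pairing with all vectors of the
    domain, on which the inner product is definite.\<close>
  have "linear_on D B" unfolding linear_on_def proof (intro conjI ballI allI; rule hip_eqI_subspace[OF H D])
   fix u v c assume uv: "u : D" "v : D"
   show "B (u + v) : D" "B u + B v : D" "B (c *c u) : D" "c *c B u : D" using uv sub BD by auto
   fix w assume w: "w : D"
   show "hip H w (B (u + v)) = hip H w (B u + B v)" using uv w sub BD AD D(2) by (simp add: e hip_add_right subset_iff)
   show "hip H w (B (c *c u)) = hip H w (c *c B u)" using uv w sub BD AD D(2) by (simp add: e hip_scale_right subset_iff)
  qed
  then show ?case using B by blast
 }
qed

lemma is_star_algebra_star_alg: assumes H: "hspace H" and D: "csubspace D" "D <= hcar H" and gens: "S <= {A. adjointable H D A}" shows "is_star_algebra H D (star_alg H D S)" unfolding is_star_algebra_def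
proof (intro conjI ballI allI impI)
 note f = star_alg_facts[OF assms]
 show "star_alg H D S <= {A. A : D \<rightarrow>\<^sub>E D \<and> linear_on D A}" using f by (auto simp: adjointable_def)
 show "\<exists>!B. is_adj H D A B" if "A : star_alg H D S" for A using f[OF that] is_adj_unique[OF H D] unfolding adjointable_def by blast
qed (auto intro: star_alg.intros)

text \<open>Formulated between two invariant domains because the isometry is inverted only on its
  range.\<close>

locale conjugation = fixes H :: "'a::cvector hilb" and D and K :: "'b::cvector hilb" and E U U' assumes H: "hspace H" and D: "csubspace D" "D <= hcar H" and K: "hspace K" and E: "csubspace E" "E <= hcar K"
  and U: "!!u. u : D ==> U u : E" "!!w. w : E ==> U' w : D" "!!u. u : D ==> U' (U u) = u" "!!w. w : E ==> U (U' w) = w" and lin: "linear_on D U" and iso: "!!u v. u : D ==> v : D ==> hip K (U u) (U v) = hip H u v"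
begin

definition conj_op :: "('a => 'a) => 'b => 'b" where "conj_op A = (\<lambda>w\<in>E. U (A (U' w)))"

lemma conj_op_mem: "A : D \<rightarrow>\<^sub>E D ==> conj_op A : E \<rightarrow>\<^sub>E E" using U by (auto simp: conj_op_def)

lemma conj_op_U: "u : D ==> conj_op A (U u) = U (A u)" using U by (simp add: conj_op_def)

lemma conj_op_hom: assumes "A : D \<rightarrow>\<^sub>E D" "B : D \<rightarrow>\<^sub>E D"
 shows "conj_op (\<lambda>u\<in>D. u) = (\<lambda>w\<in>E. w)" "conj_op (\<lambda>u\<in>D. A u + B u) = (\<lambda>w\<in>E. conj_op A w + conj_op B w)"
  "conj_op (\<lambda>u\<in>D. c *c A u) = (\<lambda>w\<in>E. c *c conj_op A w)" "conj_op (compose D A B) = compose E (conj_op A) (conj_op B)" proof -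
 have "A u : D" "B u : D" if "u : D" for u using assms that by auto
 then show "conj_op (\<lambda>u\<in>D. u) = (\<lambda>w\<in>E. w)" "conj_op (\<lambda>u\<in>D. A u + B u) = (\<lambda>w\<in>E. conj_op A w + conj_op B w)"
  "conj_op (\<lambda>u\<in>D. c *c A u) = (\<lambda>w\<in>E. c *c conj_op A w)" "conj_op (compose D A B) = compose E (conj_op A) (conj_op B)" using U linear_onD[OF lin] by (auto simp: conj_op_def compose_def fun_eq_iff)
qed

lemma conj_op_adj: assumes A: "A : D \<rightarrow>\<^sub>E D" and adj: "is_adj H D A B" shows "is_adj K E (conj_op A) (conj_op B)" unfolding is_adj_def proof (intro conjI ballI)
 show "conj_op B : E \<rightarrow>\<^sub>E E" using adj by (intro conj_op_mem) (simp add: is_adj_def)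
 fix w z assume wz: "w : E" "z : E"
 have "hip K (U (A (U' w))) (U (U' z)) = hip H (A (U' w)) (U' z)" using A U(2) wz by (intro iso) auto
 also have "... = hip H (U' w) (B (U' z))" using adj U(2) wz by (simp add: is_adj_def)
 also have "... = hip K (U (U' w)) (U (B (U' z)))" using adj U(2) wz by (intro iso[symmetric]) (auto simp: is_adj_def)
 finally show "hip K (conj_op A w) z = hip K w (conj_op B z)" using wz by (simp add: conj_op_def U(4))
qed

text \<open>The assumptions are symmetric in the two sides, so conjugation by \<open>U'\<close> maps
  the second algebra back into the first; this makes \<open>conj_op\<close> surjective between the
  algebras.\<close>

lemma swap: "conjugation K E H D U' U" proof (rule conjugation.intro)
 show "linear_on E U'" unfolding linear_on_def proof (intro conjI ballI allI)
  fix w z c assume wz: "w : E" "z : E"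
  have "U' (U (U' w + U' z)) = U' w + U' z" "U' (U (c *c U' w)) = c *c U' w" using wz U(2) D(1) by (auto intro!: U(3) simp: csubspace_def)
  then show "U' (w + z) = U' w + U' z" "U' (c *c w) = c *c U' w" using wz U linear_onD[OF lin] by auto
 qed
 show "hip H (U' w) (U' z) = hip K w z" if "w : E" "z : E" for w z using iso[OF U(2)[OF that(1)] U(2)[OF that(2)]] that U(4) by simp
qed (rule K E H D | erule U)+

lemma mem: "S <= {A. adjointable H D A} ==> A : star_alg H D S ==> A : D \<rightarrow>\<^sub>E D" by (drule (1) star_alg_facts[OF H D]) (simp add: adjointable_def)

lemma conj_op_star_alg: assumes gens: "S <= {A. adjointable H D A}" and A: "A : star_alg H D S" shows "conj_op A : star_alg K E (conj_op ` S)" using A proof induction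
 case (gen A) then show ?case by (intro star_alg.gen imageI)
next
 case one
 have "restrict (%u. u) D : D \<rightarrow>\<^sub>E D" by auto
 from conj_op_hom(1)[OF this this] show ?case by (simp only: star_alg.one)
next
 case (add A B)
 show ?case unfolding conj_op_hom(2)[OF mem[OF gens add.hyps(1)] mem[OF gens add.hyps(2)]] by (rule star_alg.add[OF add.IH])
next
 case (scale A c)
 show ?case unfolding conj_op_hom(3)[OF mem[OF gens scale.hyps] mem[OF gens scale.hyps]] by (rule star_alg.scale[OF scale.IH])
next
 case (mult A B)
 show ?case unfolding conj_op_hom(4)[OF mem[OF gens mult.hyps(1)] mem[OF gens mult.hyps(2)]] by (rule star_alg.mult[OF mult.IH])
next
 case (adj A B)
 show ?case by (rule star_alg.adj[OF adj.IH conj_op_adj[OF mem[OF gens adj.hyps(1)] adj.hyps(2)]])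
qed

lemma star_iso_conj_op: assumes gens: "S <= {A. adjointable H D A}" shows "star_iso H D (star_alg H D S) K E (star_alg K E (conj_op ` S)) conj_op" proof -
 interpret S: conjugation K E H D U' U by (rule swap)
 note f = mem[OF gens]
 have inv: "S.conj_op (conj_op A) = A" if "A : D \<rightarrow>\<^sub>E D" for A proof (rule extensionalityI[of _ D])
  show "S.conj_op (conj_op A) : extensional D" "A : extensional D" using that by (auto simp: S.conj_op_def PiE_def)
  show "S.conj_op (conj_op A) u = A u" if u: "u : D" for u using U u PiE_mem[OF \<open>A : D \<rightarrow>\<^sub>E D\<close> u] by (simp add: S.conj_op_def conj_op_def)
 qed
 have inv': "conj_op (S.conj_op B) = B" if "B : E \<rightarrow>\<^sub>E E" for B proof (rule extensionalityI[of _ E])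
  show "conj_op (S.conj_op B) : extensional E" "B : extensional E" using that by (auto simp: conj_op_def PiE_def)
  show "conj_op (S.conj_op B) w = B w" if w: "w : E" for w using U w PiE_mem[OF \<open>B : E \<rightarrow>\<^sub>E E\<close> w] by (simp add: S.conj_op_def conj_op_def)
 qed
 have gens': "conj_op ` S <= {B. adjointable K E B}" proof clarify
  fix A assume "A : S"
  then have g: "A : D \<rightarrow>\<^sub>E D" "linear_on D A" "\<exists>B. is_adj H D A B" using gens by (auto simp: adjointable_def)
  have AD: "A u : D" if "u : D" for u using g(1) that by auto
  have "linear_on E (conj_op A)" unfolding linear_on_def using E(1) U AD linear_onD[OF lin] linear_onD[OF S.lin] linear_onD[OF g(2)] by (auto simp: conj_op_def csubspace_def)
  then show "adjointable K E (conj_op A)" using g conj_op_mem conj_op_adj unfolding adjointable_def by blast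
 qed
 have "S.conj_op (conj_op A) = A" if "A : S" for A by (rule inv) (use gens that in "auto simp: adjointable_def")
 then have "S.conj_op ` conj_op ` S = S" by (simp add: image_image cong: image_cong)
 with S.conj_op_star_alg[OF gens'] have bwd: "S.conj_op B : star_alg H D S" if "B : star_alg K E (conj_op ` S)" for B using that by auto
 show ?thesis unfolding star_iso_def proof (intro conjI ballI allI impI)
  show "bij_betw conj_op (star_alg H D S) (star_alg K E (conj_op ` S))" by (rule bij_betw_byWitness[where f' = S.conj_op]) (use inv f inv' bwd conj_op_star_alg[OF gens] S.mem[OF gens'] in auto)
  have "restrict (%u. u) D : D \<rightarrow>\<^sub>E D" by auto
  from conj_op_hom(1)[OF this this] show "conj_op (\<lambda>u\<in>D. u) = (\<lambda>w\<in>E. w)" .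
 qed (rule is_star_algebra_star_alg[OF H D gens] is_star_algebra_star_alg[OF K E gens'] | erule (1) conj_op_hom(2,4)[OF f f] conj_op_adj[OF f] | rule conj_op_hom(3)[OF f f], assumption+)+
qed

end

section \<open>The isomorphism\<close>

text \<open>The analysis enters through \<open>deformed_field_eq\<close> and
  \<open>transformed_field_VT\<close>, which say that conjugation carries generators to generators;
  \<open>star_iso_conj_op\<close> passes from generators to algebras.\<close>

theorem proposition5p1:
  fixes m :: real
    and V :: "(real ^ 's::finite, complex) aefun \<Rightarrow> (real ^ 's, complex) aefun"
    and \<theta> :: "real ^ ('s option) ^ ('s option)"
    and \<rho> :: "'s spacetime \<times> 's spacetime \<Rightarrow> complex"
    and xh :: "'s option \<Rightarrow> ('v::chilbert \<times> 'v) set"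
    and W :: "'s spacetime \<Rightarrow> 'v \<Rightarrow> 'v"
    and \<xi> :: 'v
  assumes "m > 0"
    and "unitary_op (one_particle m) (one_particle m) V"
    and "lorentz_skew \<theta>"
    and "schwartz \<rho>" and "\<rho> (0, 0) = 1"
    and "moyal_weyl \<theta> xh W"
    and "norm \<xi> = 1"
  shows "unitary_op (fock m) ((fock m)\<lparr>hcarrier := Vtilde m V W \<xi> ` hcarrier (fock m)\<rparr>) (Vtilde m V W \<xi>) \<and>
    star_iso
      (fock m) (finite_particle m)
      (star_alg (fock m) (finite_particle m) {deformed_field m V \<theta> \<rho> f | f. schwartz f})
      (fock m) (mw_domain m V W \<xi>)
      (star_alg (fock m) (mw_domain m V W \<xi>)
        {restrict (transformed_field m W V f) (mw_domain m V W \<xi>) | f. schwartz f})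
      (\<lambda>A. \<lambda>w\<in>mw_domain m V W \<xi>.
        Vtilde m V W \<xi> (A (adjoint_op (fock m) (fock m) (Vtilde m V W \<xi>) w)))"
proof -
 interpret mw m "TYPE('s)" V \<theta> \<rho> xh W \<xi> using assms by (unfold_locales) auto
 interpret F: hspace FK by (rule hspace_fock)
 interpret FV: hspace FV by (rule hspace_fock)
 let ?E = "mw_domain m V W \<xi>" and ?U' = "adjoint_op FK FV VT"
 have inj: "inj_on VT (hcar FK)" proof (rule inj_onI)
  fix u v assume uv: "u : hcar FK" "v : hcar FK" "VT u = VT v"
  have "hip FK w u = hip FK w v" if "w : hcar FK" for w using VT_hip[OF that uv(1)] VT_hip[OF that uv(2)] uv(3) by simp
  then show "u = v" using uv by (intro F.hip_eqI) auto
 qed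
 have 1: "unitary_op FK (FV\<lparr>hcarrier := VT ` hcar FK\<rparr>) VT" unfolding unitary_op_def using inj VT_linear VT_hip by (simp add: bij_betw_def)
 \<comment> \<open>On the range the adjoint acts as the inverse: \<open>VT\<close> preserves inner
   products, and pairings with all vectors determine \<open>u\<close>.\<close>
 have U': "?U' (VT u) = u" if u: "u : hcar FK" for u unfolding adjoint_op_def proof (rule the_equality)
  show "u : hcar FK \<and> (\<forall>v\<in>hcar FK. hip FK v u = hip FV (VT v) (VT u))" using u VT_hip by simp
  show "u' = u" if "u' : hcar FK \<and> (\<forall>v\<in>hcar FK. hip FK v u' = hip FV (VT v) (VT u))" for u' using that u VT_hip by (intro F.hip_eqI) auto
 qed
 have FP: "u : hcar FK" if "u : FP" for u using that finite_particle_fock by blast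
 have lin: "linear_on FP VT" using VT_linear FP unfolding linear_on_def by blast
 interpret C: conjugation FK FP FV ?E VT ?U' proof (rule conjugation.intro)
  show "csubspace ?E" unfolding csubspace_def mw_domain_def proof (intro conjI ballI allI)
   have "VT 0 = 0" using linear_on_zero[OF VT_linear F.zero] .
   then show "0 : VT ` FP" using csubspace_finite_particle unfolding csubspace_def by (metis image_eqI)
   fix w z c assume "w : VT ` FP" "z : VT ` FP"
   then obtain u v where uv: "w = VT u" "u : FP" "z = VT v" "v : FP" by blast
   then have "w + z = VT (u + v)" "c *c w = VT (c *c u)" "u + v : FP" "c *c u : FP" using linear_onD[OF lin] csubspace_finite_particle unfolding csubspace_def by auto
   then show "w + z : VT ` FP" "c *c w : VT ` FP" by auto
  qed
 qed (use F.hspace_axioms FV.hspace_axioms csubspace_finite_particle FP VT_fock U' lin VT_hip in "auto simp: mw_domain_def")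
 have fields: "{deformed_field m V \<theta> \<rho> f | f. schwartz f} = {restrict (dfield f) FP | f. schwartz f}" using deformed_field_eq by metis
 have gens: "{restrict (dfield f) FP | f. schwartz f} <= {A. adjointable FK FP A}" proof clarify
  fix f :: "'s spacetime => complex" assume f: "schwartz f"
  let ?A = "restrict (dfield f) FP"
  have "linear_on FP ?A" using dfield_linear[OF f] csubspace_finite_particle unfolding linear_on_def csubspace_def by auto
  moreover have "is_adj FK FP ?A (restrict (dfield (%x. cnj (f x))) FP)" unfolding is_adj_def using hip_dfield[OF f] dfield_fp[OF schwartz_cnj[OF f]] by auto
  moreover have "?A : FP \<rightarrow>\<^sub>E FP" using dfield_fp[OF f] by auto
  ultimately show "adjointable FK FP ?A" unfolding adjointable_def by blast
 qed
 have "C.conj_op (restrict (dfield f) FP) = restrict (transformed_field m W V f) ?E" if f: "schwartz f" for f proof (rule extensionalityI[of _ ?E])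
  fix w assume "w : ?E"
  then obtain u where u: "w = VT u" "u : FP" by (auto simp: mw_domain_def)
  then show "C.conj_op (restrict (dfield f) FP) w = restrict (transformed_field m W V f) ?E w" using \<open>w : ?E\<close> transformed_field_VT[OF f u(2)] by (simp add: C.conj_op_U)
 qed (auto simp: C.conj_op_def)
 then have im: "C.conj_op ` {restrict (dfield f) FP | f. schwartz f} = {restrict (transformed_field m W V f) ?E | f. schwartz f}" by (auto simp: image_iff) metis+
 have "C.conj_op = (%A. \<lambda>w\<in>?E. VT (A (?U' w)))" by (rule ext) (simp add: C.conj_op_def)
 then show ?thesis using 1 C.star_iso_conj_op[OF gens] unfolding fields im by simp
qed

end
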